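(* Let $\mathcal{D}$ be a $2$-category that admits EM (Eilenberg-Moore) objects. Then the $2$-categories $\mathbf{Mnd}_{op}(\mathcal{D})$ (monads in $\mathcal{D}$ with oplax morphisms) and $\mathbf{Cmd}_{op}(\mathcal{D})$ (comonads in $\mathcal{D}$ with oplax morphisms) admit EM objects, and they are standard with respect to $\mathcal{D}$. Moreover, if $\mathcal{D}$ has finite products, then the $2$-categories $\mathbf{BMon}_{op}(\mathcal{D})$ and $\mathbf{SMon}_{op}(\mathcal{D})$ of braided, respectively symmetric, monoidal objects in $\mathcal{D}$ with oplax morphisms admit EM objects, and they are standard with respect to $\mathcal{D}$. (Standardness is with respect to the forgetful $2$-functors to $\mathcal{D}$.)
   Context: Whiskering notation: for $1$-cells $F,G$ and a $2$-cell $\sigma$, $F(\sigma)$ is $\sigma$ post-whiskered by $F$ and $\sigma_G$ is $\sigma$ pre-whiskered by $G$; $\circ$ also denotes vertical composition of $2$-cells. A $2$-category with finite products is one with finite products of $0$-cells. Monads. A monad in a $2$-category $\mathcal{E}$ is $(\mathcal{C},\mathcal{S},\eta,\mu)$ with $\mathcal{S}:\mathcal{C}\to\mathcal{C}$ a $1$-cell and $2$-cells $\eta:1_{\mathcal{C}}\to\mathcal{S}$, $\mu:\mathcal{S}^2\to\mathcal{S}$ with $\mu\circ\eta_{\mathcal{S}}=1_{\mathcal{S}}=\mu\circ\mathcal{S}(\eta)$, $\mu\circ\mu_{\mathcal{S}}=\mu\circ\mathcal{S}(\mu)$. A lax morphism of monads $(\mathcal{C},\mathcal{S},\eta,\mu)\to(\mathcal{C}',\mathcal{S}',\eta',\mu')$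 is $(F,\tau)$ with a $1$-cell $F:\mathcal{C}\to\mathcal{C}'$ and a $2$-cell $\tau:\mathcal{S}'F\to F\mathcal{S}$ such that $\tau\circ\eta'_F=F(\eta)$ and $\tau\circ\mu'_F=F(\mu)\circ\tau_{\mathcal{S}}\circ\mathcal{S}'(\tau)$; composition is $(F',\tau')\circ(F,\tau)=(F'F,F'(\tau)\circ\tau'_F)$. A transformation of lax morphisms $(F,\tau)\to(F',\tau')$ is $\sigma:F\to F'$ with $\tau'\circ\mathcal{S}'(\sigma)=\sigma_{\mathcal{S}}\circ\tau$. These form the $2$-category $\mathbf{Mnd}(\mathcal{E})$; a $2$-functor $G$ induces $\mathbf{Mnd}(G)$ in the obvious way. An oplax morphism of monads is $(F,\tau)$ with $\tau:F\mathcal{S}\to\mathcal{S}'F$ such that $\tau\circ F(\eta)=\eta'_F$ and $\tau\circ F(\mu)=\mu'_F\circ\mathcal{S}'(\tau)\circ\tau_{\mathcal{S}}$; composition is $(F'F,\tau'_F\circ F'(\tau))$. A transformation of oplax morphisms is $\sigma:F\to F'$ with $\tau'\circ\sigma_{\mathcal{S}}=\mathcal{S}'(\sigma)\circ\tau$. These form the $2$-category $\mathbf{Mnd}_{op}(\mathcal{E})$. Comonads. A comonad in $\mathcal{E}$ is $(\mathcal{C},\mathcal{G},\varepsilon,\delta)$ with $\varepsilon:\mathcal{G}\to1_{\mathcal{C}}$, $\delta:\mathcal{G}\to\mathcal{G}^2$ satisfying the counit and coassociativity laws. An oplax morphism of comonads is $(F,\tau)$ with $\tau:F\mathcal{G}\to\mathcal{G}'F$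 such that $\varepsilon'_F\circ\tau=F(\varepsilon)$ and $\delta'_F\circ\tau=\mathcal{G}'(\tau)\circ\tau_{\mathcal{G}}\circ F(\delta)$; transformations are $2$-cells $\sigma:F\to F'$ with $\tau'\circ\sigma_{\mathcal{G}}=\mathcal{G}'(\sigma)\circ\tau$. These form $\mathbf{Cmd}_{op}(\mathcal{E})$. EM objects. $\iota_{\mathcal{E}}:\mathcal{E}\to\mathbf{Mnd}(\mathcal{E})$ sends $\mathcal{C}$ to the identity monad on $\mathcal{C}$. $\mathcal{E}$ admits EM objects if $\iota_{\mathcal{E}}$ has a right $2$-adjoint $EM_{\mathcal{E}}$. For a $2$-functor $G:\mathcal{D}'\to\mathcal{E}$ between $2$-categories admitting EM objects, $\mathcal{D}'$ has standard EM objects with respect to $G$ (or with respect to $\mathcal{E}$, if $G$ is understood) if the canonical $2$-natural transformation $G\circ EM_{\mathcal{D}'}\to EM_{\mathcal{E}}\circ\mathbf{Mnd}(G)$ (the mate of $\mathbf{Mnd}(G)\circ\iota_{\mathcal{D}'}=\iota_{\mathcal{E}}\circ G$) is an isomorphism. Monoidal objects. Let $\mathcal{D}$ have finite products. A monoidal object in $\mathcal{D}$ is a $0$-cell $\mathcal{C}$ with $1$-cells $\otimes:\mathcal{C}\times\mathcal{C}\to\mathcal{C}$, $I:1\to\mathcal{C}$ and invertible $2$-cells $\alpha:\otimes\circ(1\times\otimes)\Rightarrow\otimes\circ(\otimes\times1)$, $\lambda:\otimes\circ\langle I,1_{\mathcal{C}}\rangle\Rightarrow1_{\mathcal{C}}$,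 $\varrho:\otimes\circ\langle1_{\mathcal{C}},I\rangle\Rightarrow1_{\mathcal{C}}$ (inside pairings $I$ means $\mathcal{C}\to1\to\mathcal{C}$) satisfying the pentagon $\otimes\langle\alpha,1\rangle\circ\alpha_{1\times\otimes\times1}\circ\otimes\langle1,\alpha\rangle=\alpha_{\otimes\times1\times1}\circ\alpha_{1\times1\times\otimes}$ and the triangle $\otimes\langle\varrho_{\pi_1},1_{\pi_2}\rangle\circ\alpha_{\langle\pi_1,I,\pi_2\rangle}=\otimes\langle1_{\pi_1},\lambda_{\pi_2}\rangle$. An oplax monoidal morphism $(F,\varphi,\bar\varphi)$ from $(\mathcal{C},\otimes,I,\alpha,\lambda,\varrho)$ to $(\mathcal{C}',\otimes',I',\alpha',\lambda',\varrho')$ consists of $F:\mathcal{C}\to\mathcal{C}'$, $\bar\varphi:F\circ I\Rightarrow I'$, $\varphi:F\circ\otimes\Rightarrow\otimes'\circ(F\times F)$ with $\alpha'_{F\times F\times F}\circ\otimes'(1,\varphi)\circ\varphi_{1\times\otimes}=\otimes'(\varphi,1)\circ\varphi_{\otimes\times1}\circ F(\alpha)$, $\varrho'_F\circ\otimes'(1,\bar\varphi)\circ\varphi_{\langle1,I\rangle}=F(\varrho)$, $\lambda'_F\circ\otimes'(\bar\varphi,1)\circ\varphi_{\langle I,1\rangle}=F(\lambda)$. A monoidal transformation $(F,\varphi,\bar\varphi)\Rightarrow(F',\varphi',\bar\varphi')$ is a $2$-cell $\sigma:F\to F'$ with $\varphi'\circ\sigma_\otimes=\otimes'(\sigma,\sigma)\circ\varphi$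 and $\bar\varphi'\circ\sigma_I=\bar\varphi$. A braided monoidal object is a monoidal object with an invertible $2$-cell $\beta:\otimes\Rightarrow\otimes\circ c$, where $c:\mathcal{C}\times\mathcal{C}\to\mathcal{C}\times\mathcal{C}$ is the symmetry of the product, satisfying the two usual hexagon equations (on generalized elements: $\alpha_{z,x,y}\circ\beta_{x\otimes y,z}\circ\alpha_{x,y,z}=(\beta_{x,z}\otimes y)\circ\alpha_{x,z,y}\circ(x\otimes\beta_{y,z})$ and $\alpha^{-1}_{y,z,x}\circ\beta_{x,y\otimes z}\circ\alpha^{-1}_{x,y,z}=(y\otimes\beta_{x,z})\circ\alpha^{-1}_{y,x,z}\circ(\beta_{x,y}\otimes z)$). It is symmetric if moreover $\beta_c\circ\beta=1_\otimes$. The $1$-cells of $\mathbf{BMon}_{op}(\mathcal{D})$ and $\mathbf{SMon}_{op}(\mathcal{D})$ are oplax monoidal morphisms compatible with the braidings, $\beta'_{F\times F}\circ\varphi=\varphi_c\circ F(\beta)$; the $2$-cells are monoidal transformations. The forgetful $2$-functors from $\mathbf{Mnd}_{op}(\mathcal{D})$, $\mathbf{Cmd}_{op}(\mathcal{D})$, $\mathbf{BMon}_{op}(\mathcal{D})$, $\mathbf{SMon}_{op}(\mathcal{D})$ to $\mathcal{D}$ send a structure to its underlying $0$-cell $\mathcal{C}$. *)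

theory Defs
  imports Main
begin

section \<open>Strict 2-categories\<close>

text \<open>
  The source and target of a cell are functions of the cell.  Composites are written in the usual
  (right-to-left) order; all operations are meaningful only on composable cells of the carriers.
\<close>

record ('o, 'a, 'c) two_cat =
  Obj :: "'o set"
  Arr :: "'a set"
  Cell :: "'c set"
  Dom1 :: "'a \<Rightarrow> 'o"
  Cod1 :: "'a \<Rightarrow> 'o"
  Dom2 :: "'c \<Rightarrow> 'a"
  Cod2 :: "'c \<Rightarrow> 'a"
  Id1 :: "'o \<Rightarrow> 'a"
  Id2 :: "'a \<Rightarrow> 'c"
  Comp1 :: "'a \<Rightarrow> 'a \<Rightarrow> 'a"  (infixr "\<odot>\<index>" 75)
  VComp :: "'c \<Rightarrow> 'c \<Rightarrow> 'c"  (infixr "\<bullet>\<index>" 60)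
  HComp :: "'c \<Rightarrow> 'c \<Rightarrow> 'c"  (infixr "\<star>\<index>" 70)

definition Hom1 :: "('o, 'a, 'c) two_cat \<Rightarrow> 'o \<Rightarrow> 'o \<Rightarrow> 'a set" where
  "Hom1 D A B = {f \<in> Arr D. Dom1 D f = A \<and> Cod1 D f = B}"

definition Hom2 :: "('o, 'a, 'c) two_cat \<Rightarrow> 'a \<Rightarrow> 'a \<Rightarrow> 'c set" where
  "Hom2 D f g = {\<sigma> \<in> Cell D. Dom2 D \<sigma> = f \<and> Cod2 D \<sigma> = g}"

locale two_category =
  fixes D :: "('o, 'a, 'c) two_cat" (structure)
  assumes Dom1_Obj: "f \<in> Arr D \<Longrightarrow> Dom1 D f \<in> Obj D"
    and Cod1_Obj: "f \<in> Arr D \<Longrightarrow> Cod1 D f \<in> Obj D"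
    and Dom2_Arr: "\<sigma> \<in> Cell D \<Longrightarrow> Dom2 D \<sigma> \<in> Arr D"
    and Cod2_Arr: "\<sigma> \<in> Cell D \<Longrightarrow> Cod2 D \<sigma> \<in> Arr D"
    and Dom1_parallel: "\<sigma> \<in> Cell D \<Longrightarrow> Dom1 D (Dom2 D \<sigma>) = Dom1 D (Cod2 D \<sigma>)"
    and Cod1_parallel: "\<sigma> \<in> Cell D \<Longrightarrow> Cod1 D (Dom2 D \<sigma>) = Cod1 D (Cod2 D \<sigma>)"
    and Id1_Hom: "A \<in> Obj D \<Longrightarrow> Id1 D A \<in> Hom1 D A A"
    and Comp1_Hom: "\<lbrakk>f \<in> Hom1 D A B; g \<in> Hom1 D B C\<rbrakk> \<Longrightarrow> g \<odot> f \<in> Hom1 D A C"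
    and Comp1_Id_left: "f \<in> Hom1 D A B \<Longrightarrow> Id1 D B \<odot> f = f"
    and Comp1_Id_right: "f \<in> Hom1 D A B \<Longrightarrow> f \<odot> Id1 D A = f"
    and Comp1_assoc: "\<lbrakk>f \<in> Hom1 D A B; g \<in> Hom1 D B C; h \<in> Hom1 D C E\<rbrakk>
        \<Longrightarrow> (h \<odot> g) \<odot> f = h \<odot> (g \<odot> f)"
    and Id2_Hom: "f \<in> Arr D \<Longrightarrow> Id2 D f \<in> Hom2 D f f"
    and VComp_Hom: "\<lbrakk>\<sigma> \<in> Hom2 D f g; \<tau> \<in> Hom2 D g h\<rbrakk> \<Longrightarrow> \<tau> \<bullet> \<sigma> \<in> Hom2 D f h"
    and VComp_Id_left: "\<sigma> \<in> Hom2 D f g \<Longrightarrow> Id2 D g \<bullet> \<sigma> = \<sigma>"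
    and VComp_Id_right: "\<sigma> \<in> Hom2 D f g \<Longrightarrow> \<sigma> \<bullet> Id2 D f = \<sigma>"
    and VComp_assoc: "\<lbrakk>\<rho> \<in> Hom2 D f g; \<sigma> \<in> Hom2 D g h; \<tau> \<in> Hom2 D h k\<rbrakk>
        \<Longrightarrow> (\<tau> \<bullet> \<sigma>) \<bullet> \<rho> = \<tau> \<bullet> (\<sigma> \<bullet> \<rho>)"
    and HComp_Hom: "\<lbrakk>\<sigma> \<in> Hom2 D f g; \<tau> \<in> Hom2 D h k; Cod1 D f = Dom1 D h\<rbrakk>
        \<Longrightarrow> \<tau> \<star> \<sigma> \<in> Hom2 D (h \<odot> f) (k \<odot> g)"
    and HComp_Id2: "\<lbrakk>f \<in> Hom1 D A B; g \<in> Hom1 D B C\<rbrakk>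
        \<Longrightarrow> Id2 D g \<star> Id2 D f = Id2 D (g \<odot> f)"
    and interchange: "\<lbrakk>\<sigma> \<in> Hom2 D f g; \<sigma>' \<in> Hom2 D g h; \<tau> \<in> Hom2 D f' g'; \<tau>' \<in> Hom2 D g' h';
          Cod1 D f = Dom1 D f'\<rbrakk> \<Longrightarrow> (\<tau>' \<bullet> \<tau>) \<star> (\<sigma>' \<bullet> \<sigma>) = (\<tau>' \<star> \<sigma>') \<bullet> (\<tau> \<star> \<sigma>)"
    and HComp_Id_left: "\<lbrakk>\<sigma> \<in> Hom2 D f g; f \<in> Hom1 D A B\<rbrakk> \<Longrightarrow> Id2 D (Id1 D B) \<star> \<sigma> = \<sigma>"
    and HComp_Id_right: "\<lbrakk>\<sigma> \<in> Hom2 D f g; f \<in> Hom1 D A B\<rbrakk> \<Longrightarrow> \<sigma> \<star> Id2 D (Id1 D A) = \<sigma>"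
    and HComp_assoc: "\<lbrakk>\<rho> \<in> Hom2 D f f'; \<sigma> \<in> Hom2 D g g'; \<tau> \<in> Hom2 D h h';
          Cod1 D f = Dom1 D g; Cod1 D g = Dom1 D h\<rbrakk> \<Longrightarrow> (\<tau> \<star> \<sigma>) \<star> \<rho> = \<tau> \<star> (\<sigma> \<star> \<rho>)"

text \<open>Post-whiskering \<open>F(\<sigma>)\<close> and pre-whiskering \<open>\<sigma>\<^sub>G\<close>.\<close>

definition lwhisk :: "('o, 'a, 'c) two_cat \<Rightarrow> 'a \<Rightarrow> 'c \<Rightarrow> 'c" (infixr "\<rhd>\<index>" 70) where
  "F \<rhd>\<^bsub>D\<^esub> \<sigma> = Id2 D F \<star>\<^bsub>D\<^esub> \<sigma>"

definition rwhisk :: "('o, 'a, 'c) two_cat \<Rightarrow> 'c \<Rightarrow> 'a \<Rightarrow> 'c" (infixl "\<lhd>\<index>" 71) where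
  "\<sigma> \<lhd>\<^bsub>D\<^esub> G = \<sigma> \<star>\<^bsub>D\<^esub> Id2 D G"

definition inverse2 :: "('o, 'a, 'c) two_cat \<Rightarrow> 'c \<Rightarrow> 'c \<Rightarrow> bool" where
  "inverse2 D \<sigma> \<tau> \<longleftrightarrow> \<sigma> \<in> Cell D \<and> \<tau> \<in> Hom2 D (Cod2 D \<sigma>) (Dom2 D \<sigma>) \<and>
     \<tau> \<bullet>\<^bsub>D\<^esub> \<sigma> = Id2 D (Dom2 D \<sigma>) \<and> \<sigma> \<bullet>\<^bsub>D\<^esub> \<tau> = Id2 D (Cod2 D \<sigma>)"

definition invertible2 :: "('o, 'a, 'c) two_cat \<Rightarrow> 'c \<Rightarrow> bool" where
  "invertible2 D \<sigma> \<longleftrightarrow> (\<exists>\<tau>. inverse2 D \<sigma> \<tau>)"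

definition inv2 :: "('o, 'a, 'c) two_cat \<Rightarrow> 'c \<Rightarrow> 'c" where
  "inv2 D \<sigma> = (THE \<tau>. inverse2 D \<sigma> \<tau>)"


section \<open>2-functors, 2-natural transformations and 2-adjunctions\<close>

record ('o, 'a, 'c, 'p, 'b, 'd) two_fun =
  F0 :: "'o \<Rightarrow> 'p"
  F1 :: "'a \<Rightarrow> 'b"
  F2 :: "'c \<Rightarrow> 'd"

locale two_functor = A: two_category A + B: two_category B
  for A :: "('o, 'a, 'c) two_cat" and B :: "('p, 'b, 'd) two_cat" +
  fixes G :: "('o, 'a, 'c, 'p, 'b, 'd) two_fun"
  assumes F0_Obj: "X \<in> Obj A \<Longrightarrow> F0 G X \<in> Obj B"
    and F1_Hom: "f \<in> Hom1 A X Y \<Longrightarrow> F1 G f \<in> Hom1 B (F0 G X) (F0 G Y)"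
    and F2_Hom: "\<sigma> \<in> Hom2 A f g \<Longrightarrow> F2 G \<sigma> \<in> Hom2 B (F1 G f) (F1 G g)"
    and F1_Id1: "X \<in> Obj A \<Longrightarrow> F1 G (Id1 A X) = Id1 B (F0 G X)"
    and F1_Comp1: "\<lbrakk>f \<in> Hom1 A X Y; g \<in> Hom1 A Y Z\<rbrakk>
        \<Longrightarrow> F1 G (g \<odot>\<^bsub>A\<^esub> f) = F1 G g \<odot>\<^bsub>B\<^esub> F1 G f"
    and F2_Id2: "f \<in> Arr A \<Longrightarrow> F2 G (Id2 A f) = Id2 B (F1 G f)"
    and F2_VComp: "\<lbrakk>\<sigma> \<in> Hom2 A f g; \<tau> \<in> Hom2 A g h\<rbrakk>
        \<Longrightarrow> F2 G (\<tau> \<bullet>\<^bsub>A\<^esub> \<sigma>) = F2 G \<tau> \<bullet>\<^bsub>B\<^esub> F2 G \<sigma>"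
    and F2_HComp: "\<lbrakk>\<sigma> \<in> Hom2 A f g; \<tau> \<in> Hom2 A h k; Cod1 A f = Dom1 A h\<rbrakk>
        \<Longrightarrow> F2 G (\<tau> \<star>\<^bsub>A\<^esub> \<sigma>) = F2 G \<tau> \<star>\<^bsub>B\<^esub> F2 G \<sigma>"

definition id_fun :: "('o, 'a, 'c, 'o, 'a, 'c) two_fun" where
  "id_fun = \<lparr>F0 = (\<lambda>X. X), F1 = (\<lambda>f. f), F2 = (\<lambda>\<sigma>. \<sigma>)\<rparr>"

definition comp_fun ::
  "('p, 'b, 'd, 'q, 'e, 'f) two_fun \<Rightarrow> ('o, 'a, 'c, 'p, 'b, 'd) two_fun
    \<Rightarrow> ('o, 'a, 'c, 'q, 'e, 'f) two_fun" where
  "comp_fun H G = \<lparr>F0 = F0 H \<circ> F0 G, F1 = F1 H \<circ> F1 G, F2 = F2 H \<circ> F2 G\<rparr>"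

locale two_nat = F: two_functor A B F + G: two_functor A B G
  for A :: "('o, 'a, 'c) two_cat" and B :: "('p, 'b, 'd) two_cat"
    and F :: "('o, 'a, 'c, 'p, 'b, 'd) two_fun" and G :: "('o, 'a, 'c, 'p, 'b, 'd) two_fun" +
  fixes \<theta> :: "'o \<Rightarrow> 'b"
  assumes component: "X \<in> Obj A \<Longrightarrow> \<theta> X \<in> Hom1 B (F0 F X) (F0 G X)"
    and natural1: "f \<in> Hom1 A X Y \<Longrightarrow> F1 G f \<odot>\<^bsub>B\<^esub> \<theta> X = \<theta> Y \<odot>\<^bsub>B\<^esub> F1 F f"
    and natural2: "\<lbrakk>f \<in> Hom1 A X Y; \<sigma> \<in> Hom2 A f g\<rbrakk>
        \<Longrightarrow> F2 G \<sigma> \<lhd>\<^bsub>B\<^esub> \<theta> X = \<theta> Y \<rhd>\<^bsub>B\<^esub> F2 F \<sigma>"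

definition two_nat_iso ::
  "('o, 'a, 'c) two_cat \<Rightarrow> ('p, 'b, 'd) two_cat \<Rightarrow> ('o, 'a, 'c, 'p, 'b, 'd) two_fun
    \<Rightarrow> ('o, 'a, 'c, 'p, 'b, 'd) two_fun \<Rightarrow> ('o \<Rightarrow> 'b) \<Rightarrow> bool" where
  "two_nat_iso A B F G \<theta> \<longleftrightarrow> two_nat A B F G \<theta> \<and>
     (\<exists>\<theta>'. two_nat A B G F \<theta>' \<and>
       (\<forall>X\<in>Obj A. \<theta>' X \<odot>\<^bsub>B\<^esub> \<theta> X = Id1 B (F0 F X) \<and> \<theta> X \<odot>\<^bsub>B\<^esub> \<theta>' X = Id1 B (F0 G X)))"

text \<open>\<open>L : A \<rightarrow> B\<close> is left 2-adjoint to \<open>R\<close>, with unit \<open>u\<close> and counit \<open>e\<close>.\<close>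

locale two_adjunction =
  L: two_functor A B L + R: two_functor B A R +
  unit: two_nat A A id_fun "comp_fun R L" u +
  counit: two_nat B B "comp_fun L R" id_fun e
  for A :: "('o, 'a, 'c) two_cat" and B :: "('p, 'b, 'd) two_cat"
    and L :: "('o, 'a, 'c, 'p, 'b, 'd) two_fun" and R :: "('p, 'b, 'd, 'o, 'a, 'c) two_fun"
    and u :: "'o \<Rightarrow> 'a" and e :: "'p \<Rightarrow> 'b" +
  assumes triangle_L: "X \<in> Obj A \<Longrightarrow> e (F0 L X) \<odot>\<^bsub>B\<^esub> F1 L (u X) = Id1 B (F0 L X)"
    and triangle_R: "Y \<in> Obj B \<Longrightarrow> F1 R (e Y) \<odot>\<^bsub>A\<^esub> u (F0 R Y) = Id1 A (F0 R Y)"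

text \<open>
  Given adjunctions \<open>L \<stileturn> R\<close> between \<open>A\<close> and \<open>B\<close> with counit \<open>e\<close>, and \<open>L' \<stileturn> R'\<close> between \<open>A'\<close> and
  \<open>B'\<close> with unit \<open>u'\<close>, and 2-functors \<open>G : A \<rightarrow> A'\<close>, \<open>H : B \<rightarrow> B'\<close> with \<open>H L = L' G\<close>, this is the mate
  \<open>G R \<rightarrow> R' L' G R = R' H L R \<rightarrow> R' H\<close>.
\<close>

definition mate ::
  "('p2, 'b2, 'd2, 'o2, 'a2, 'c2) two_fun \<Rightarrow> ('o2 \<Rightarrow> 'a2) \<Rightarrow> ('o2, 'a2, 'c2) two_cat
    \<Rightarrow> ('p, 'b, 'd, 'o, 'a, 'c) two_fun \<Rightarrow> ('p \<Rightarrow> 'b)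
    \<Rightarrow> ('o, 'a, 'c, 'o2, 'a2, 'c2) two_fun \<Rightarrow> ('p, 'b, 'd, 'p2, 'b2, 'd2) two_fun
    \<Rightarrow> 'p \<Rightarrow> 'a2" where
  "mate R' u' A' R e G H Y = F1 R' (F1 H (e Y)) \<odot>\<^bsub>A'\<^esub> u' (F0 G (F0 R Y))"


section \<open>2-categories of structured objects\<close>

text \<open>
  All 2-categories below have as 0-cells some 0-cells of \<open>D\<close> with structure, as 1-cells the 1-cells
  of \<open>D\<close> with extra 2-cells, and as 2-cells certain 2-cells of \<open>D\<close>.  Since source and target have
  to be functions of a cell, 1-cells and 2-cells carry them along.
\<close>

datatype ('s, 'a, 't) mor = Mor (mdom: 's) (mcod: 's) (mfun: 'a) (mstr: 't)

datatype ('m, 'c) trf = Trf (tdom: 'm) (tcod: 'm) (tcell: 'c)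

definition structured ::
  "('o, 'a, 'c) two_cat \<Rightarrow> 's set \<Rightarrow> ('s \<Rightarrow> 'o)
    \<Rightarrow> (('s, 'a, 't) mor \<Rightarrow> bool) \<Rightarrow> (('s, 'a, 't) mor \<Rightarrow> ('s, 'a, 't) mor \<Rightarrow> 'c \<Rightarrow> bool)
    \<Rightarrow> ('s \<Rightarrow> 't) \<Rightarrow> (('s, 'a, 't) mor \<Rightarrow> ('s, 'a, 't) mor \<Rightarrow> 't)
    \<Rightarrow> ('s, ('s, 'a, 't) mor, (('s, 'a, 't) mor, 'c) trf) two_cat" where
  "structured D obs und is_mor is_trf id_str comp_str =
    (let arrs = {f. mdom f \<in> obs \<and> mcod f \<in> obs \<and>
                    mfun f \<in> Hom1 D (und (mdom f)) (und (mcod f)) \<and> is_mor f};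
         cmp = (\<lambda>g f. Mor (mdom f) (mcod g) (mfun g \<odot>\<^bsub>D\<^esub> mfun f) (comp_str g f))
     in \<lparr>Obj = obs,
         Arr = arrs,
         Cell = {t. tdom t \<in> arrs \<and> tcod t \<in> arrs \<and>
                    mdom (tdom t) = mdom (tcod t) \<and> mcod (tdom t) = mcod (tcod t) \<and>
                    tcell t \<in> Hom2 D (mfun (tdom t)) (mfun (tcod t)) \<and>
                    is_trf (tdom t) (tcod t) (tcell t)},
         Dom1 = mdom, Cod1 = mcod, Dom2 = tdom, Cod2 = tcod,
         Id1 = (\<lambda>X. Mor X X (Id1 D (und X)) (id_str X)),
         Id2 = (\<lambda>f. Trf f f (Id2 D (mfun f))),
         Comp1 = cmp,
         VComp = (\<lambda>t s. Trf (tdom s) (tcod t) (tcell t \<bullet>\<^bsub>D\<^esub> tcell s)),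
         HComp = (\<lambda>t s. Trf (cmp (tdom t) (tdom s)) (cmp (tcod t) (tcod s))
                            (tcell t \<star>\<^bsub>D\<^esub> tcell s))\<rparr>)"

definition forgetful ::
  "('s \<Rightarrow> 'o) \<Rightarrow> ('s, ('s, 'a, 't) mor, (('s, 'a, 't) mor, 'c) trf, 'o, 'a, 'c) two_fun" where
  "forgetful und = \<lparr>F0 = und, F1 = mfun, F2 = tcell\<rparr>"


section \<open>Monads and comonads\<close>

datatype ('o, 'a, 'c) monad = Monad (mob: 'o) (mend: 'a) (munit: 'c) (mmult: 'c)

datatype ('o, 'a, 'c) comonad = Comonad (cob: 'o) (cend: 'a) (ccounit: 'c) (ccomult: 'c)

context
  fixes D :: "('o, 'a, 'c) two_cat" (structure)
begin

definition is_monad :: "('o, 'a, 'c) monad \<Rightarrow> bool" where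
  "is_monad M \<longleftrightarrow> (case M of Monad C S \<eta> \<mu> \<Rightarrow>
     C \<in> Obj D \<and> S \<in> Hom1 D C C \<and> \<eta> \<in> Hom2 D (Id1 D C) S \<and> \<mu> \<in> Hom2 D (S \<odot> S) S \<and>
     \<mu> \<bullet> (\<eta> \<lhd> S) = Id2 D S \<and> \<mu> \<bullet> (S \<rhd> \<eta>) = Id2 D S \<and>
     \<mu> \<bullet> (\<mu> \<lhd> S) = \<mu> \<bullet> (S \<rhd> \<mu>))"

definition is_comonad :: "('o, 'a, 'c) comonad \<Rightarrow> bool" where
  "is_comonad M \<longleftrightarrow> (case M of Comonad C K \<epsilon> \<delta> \<Rightarrow>
     C \<in> Obj D \<and> K \<in> Hom1 D C C \<and> \<epsilon> \<in> Hom2 D K (Id1 D C) \<and> \<delta> \<in> Hom2 D K (K \<odot> K) \<and>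
     (\<epsilon> \<lhd> K) \<bullet> \<delta> = Id2 D K \<and> (K \<rhd> \<epsilon>) \<bullet> \<delta> = Id2 D K \<and>
     (\<delta> \<lhd> K) \<bullet> \<delta> = (K \<rhd> \<delta>) \<bullet> \<delta>)"

definition lax_monad_mor :: "(('o, 'a, 'c) monad, 'a, 'c) mor \<Rightarrow> bool" where
  "lax_monad_mor f \<longleftrightarrow> (case f of Mor (Monad C S \<eta> \<mu>) (Monad C' S' \<eta>' \<mu>') F \<tau> \<Rightarrow>
     \<tau> \<in> Hom2 D (S' \<odot> F) (F \<odot> S) \<and>
     \<tau> \<bullet> (\<eta>' \<lhd> F) = F \<rhd> \<eta> \<and>
     \<tau> \<bullet> (\<mu>' \<lhd> F) = (F \<rhd> \<mu>) \<bullet> (\<tau> \<lhd> S) \<bullet> (S' \<rhd> \<tau>))"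

definition lax_monad_trf ::
  "(('o, 'a, 'c) monad, 'a, 'c) mor \<Rightarrow> (('o, 'a, 'c) monad, 'a, 'c) mor \<Rightarrow> 'c \<Rightarrow> bool" where
  "lax_monad_trf f f' \<sigma> \<longleftrightarrow>
     mstr f' \<bullet> (mend (mcod f) \<rhd> \<sigma>) = (\<sigma> \<lhd> mend (mdom f)) \<bullet> mstr f"

definition oplax_monad_mor :: "(('o, 'a, 'c) monad, 'a, 'c) mor \<Rightarrow> bool" where
  "oplax_monad_mor f \<longleftrightarrow> (case f of Mor (Monad C S \<eta> \<mu>) (Monad C' S' \<eta>' \<mu>') F \<tau> \<Rightarrow>
     \<tau> \<in> Hom2 D (F \<odot> S) (S' \<odot> F) \<and>
     \<tau> \<bullet> (F \<rhd> \<eta>) = \<eta>' \<lhd> F \<and>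
     \<tau> \<bullet> (F \<rhd> \<mu>) = (\<mu>' \<lhd> F) \<bullet> (S' \<rhd> \<tau>) \<bullet> (\<tau> \<lhd> S))"

definition oplax_monad_trf ::
  "(('o, 'a, 'c) monad, 'a, 'c) mor \<Rightarrow> (('o, 'a, 'c) monad, 'a, 'c) mor \<Rightarrow> 'c \<Rightarrow> bool" where
  "oplax_monad_trf f f' \<sigma> \<longleftrightarrow>
     mstr f' \<bullet> (\<sigma> \<lhd> mend (mdom f)) = (mend (mcod f) \<rhd> \<sigma>) \<bullet> mstr f"

definition oplax_comonad_mor :: "(('o, 'a, 'c) comonad, 'a, 'c) mor \<Rightarrow> bool" where
  "oplax_comonad_mor f \<longleftrightarrow> (case f of Mor (Comonad C K \<epsilon> \<delta>) (Comonad C' K' \<epsilon>' \<delta>') F \<tau> \<Rightarrow>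
     \<tau> \<in> Hom2 D (F \<odot> K) (K' \<odot> F) \<and>
     (\<epsilon>' \<lhd> F) \<bullet> \<tau> = F \<rhd> \<epsilon> \<and>
     (\<delta>' \<lhd> F) \<bullet> \<tau> = (K' \<rhd> \<tau>) \<bullet> (\<tau> \<lhd> K) \<bullet> (F \<rhd> \<delta>))"

definition oplax_comonad_trf ::
  "(('o, 'a, 'c) comonad, 'a, 'c) mor \<Rightarrow> (('o, 'a, 'c) comonad, 'a, 'c) mor \<Rightarrow> 'c \<Rightarrow> bool" where
  "oplax_comonad_trf f f' \<sigma> \<longleftrightarrow>
     mstr f' \<bullet> (\<sigma> \<lhd> cend (mdom f)) = (cend (mcod f) \<rhd> \<sigma>) \<bullet> mstr f"

definition lax_comp_str :: "('s, 'a, 'c) mor \<Rightarrow> ('s, 'a, 'c) mor \<Rightarrow> 'c" where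
  "lax_comp_str f' f = (mfun f' \<rhd> mstr f) \<bullet> (mstr f' \<lhd> mfun f)"

definition oplax_comp_str :: "('s, 'a, 'c) mor \<Rightarrow> ('s, 'a, 'c) mor \<Rightarrow> 'c" where
  "oplax_comp_str f' f = (mstr f' \<lhd> mfun f) \<bullet> (mfun f' \<rhd> mstr f)"

definition Mnd where
  "Mnd = structured D {M. is_monad M} mob lax_monad_mor lax_monad_trf
     (\<lambda>M. Id2 D (mend M)) lax_comp_str"

definition Mnd_op where
  "Mnd_op = structured D {M. is_monad M} mob oplax_monad_mor oplax_monad_trf
     (\<lambda>M. Id2 D (mend M)) oplax_comp_str"

definition Cmd_op where
  "Cmd_op = structured D {M. is_comonad M} cob oplax_comonad_mor oplax_comonad_trf
     (\<lambda>M. Id2 D (cend M)) oplax_comp_str"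


section \<open>Eilenberg-Moore objects\<close>

definition id_monad :: "'o \<Rightarrow> ('o, 'a, 'c) monad" where
  "id_monad C = Monad C (Id1 D C) (Id2 D (Id1 D C)) (Id2 D (Id1 D C))"

definition id_monad_mor :: "'a \<Rightarrow> (('o, 'a, 'c) monad, 'a, 'c) mor" where
  "id_monad_mor F = Mor (id_monad (Dom1 D F)) (id_monad (Cod1 D F)) F (Id2 D F)"

definition iota where
  "iota = \<lparr>F0 = id_monad, F1 = id_monad_mor,
     F2 = (\<lambda>\<sigma>. Trf (id_monad_mor (Dom2 D \<sigma>)) (id_monad_mor (Cod2 D \<sigma>)) \<sigma>)\<rparr>"

definition EM_adjunction where
  "EM_adjunction EM u e \<longleftrightarrow> two_adjunction D Mnd iota EM u e"

definition admits_EM :: bool where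
  "admits_EM \<longleftrightarrow> two_category D \<and> (\<exists>EM u e. EM_adjunction EM u e)"

end

definition Mnd_obj_map ::
  "('o, 'a, 'c, 'p, 'b, 'd) two_fun \<Rightarrow> ('o, 'a, 'c) monad \<Rightarrow> ('p, 'b, 'd) monad" where
  "Mnd_obj_map G M = Monad (F0 G (mob M)) (F1 G (mend M)) (F2 G (munit M)) (F2 G (mmult M))"

definition Mnd_mor_map ::
  "('o, 'a, 'c, 'p, 'b, 'd) two_fun \<Rightarrow> (('o, 'a, 'c) monad, 'a, 'c) mor
    \<Rightarrow> (('p, 'b, 'd) monad, 'b, 'd) mor" where
  "Mnd_mor_map G f =
     Mor (Mnd_obj_map G (mdom f)) (Mnd_obj_map G (mcod f)) (F1 G (mfun f)) (F2 G (mstr f))"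

definition Mnd_map where
  "Mnd_map G = \<lparr>F0 = Mnd_obj_map G, F1 = Mnd_mor_map G,
     F2 = (\<lambda>t. Trf (Mnd_mor_map G (tdom t)) (Mnd_mor_map G (tcod t)) (F2 G (tcell t)))\<rparr>"

text \<open>
  Right 2-adjoints of \<open>iota\<close> are unique up to isomorphism only; the canonical comparison is required
  to be invertible for every choice of them.
\<close>

definition standard_EM ::
  "('o, 'a, 'c) two_cat \<Rightarrow> ('p, 'b, 'd) two_cat \<Rightarrow> ('o, 'a, 'c, 'p, 'b, 'd) two_fun \<Rightarrow> bool" where
  "standard_EM D' E G \<longleftrightarrow> admits_EM D' \<and> admits_EM E \<and> two_functor D' E G \<and>
     (\<forall>EM' u' e' EM u e. EM_adjunction D' EM' u' e' \<longrightarrow> EM_adjunction E EM u e \<longrightarrow>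
        two_nat_iso (Mnd D') E (comp_fun G EM') (comp_fun EM (Mnd_map G))
          (mate EM u E EM' e' G (Mnd_map G)))"


section \<open>Finite products of 0-cells\<close>

record ('o, 'a) prods =
  One :: 'o
  Prod :: "'o \<Rightarrow> 'o \<Rightarrow> 'o"
  Pr1 :: "'o \<Rightarrow> 'o \<Rightarrow> 'a"
  Pr2 :: "'o \<Rightarrow> 'o \<Rightarrow> 'a"

text \<open>
  A choice of finite products.  As usual for 2-categories, the universal properties are
  isomorphisms of hom-categories, that is, they concern 1-cells as well as 2-cells.
\<close>

locale finite_products = two_category D
  for D :: "('o, 'a, 'c) two_cat" (structure) and P :: "('o, 'a) prods" +
  assumes One_Obj: "One P \<in> Obj D"
    and One_1: "X \<in> Obj D \<Longrightarrow> \<exists>!f. f \<in> Hom1 D X (One P)"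
    and One_2: "\<lbrakk>f \<in> Hom1 D X (One P); g \<in> Hom1 D X (One P)\<rbrakk> \<Longrightarrow> \<exists>!\<sigma>. \<sigma> \<in> Hom2 D f g"
    and Prod_Obj: "\<lbrakk>A \<in> Obj D; B \<in> Obj D\<rbrakk> \<Longrightarrow> Prod P A B \<in> Obj D"
    and Pr1_Hom: "\<lbrakk>A \<in> Obj D; B \<in> Obj D\<rbrakk> \<Longrightarrow> Pr1 P A B \<in> Hom1 D (Prod P A B) A"
    and Pr2_Hom: "\<lbrakk>A \<in> Obj D; B \<in> Obj D\<rbrakk> \<Longrightarrow> Pr2 P A B \<in> Hom1 D (Prod P A B) B"
    and Prod_1: "\<lbrakk>f \<in> Hom1 D X A; g \<in> Hom1 D X B\<rbrakk>
        \<Longrightarrow> \<exists>!h. h \<in> Hom1 D X (Prod P A B) \<and> Pr1 P A B \<odot> h = f \<and> Pr2 P A B \<odot> h = g"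
    and Prod_2: "\<lbrakk>A \<in> Obj D; B \<in> Obj D; h \<in> Hom1 D X (Prod P A B); k \<in> Hom1 D X (Prod P A B);
          \<sigma> \<in> Hom2 D (Pr1 P A B \<odot> h) (Pr1 P A B \<odot> k);
          \<tau> \<in> Hom2 D (Pr2 P A B \<odot> h) (Pr2 P A B \<odot> k)\<rbrakk>
        \<Longrightarrow> \<exists>!\<rho>. \<rho> \<in> Hom2 D h k \<and> Pr1 P A B \<rhd> \<rho> = \<sigma> \<and> Pr2 P A B \<rhd> \<rho> = \<tau>"


section \<open>Braided and symmetric monoidal objects\<close>

datatype ('o, 'a, 'c) monoidal =
  Monoidal (ob: 'o) (ten: 'a) (unt: 'a) (asc: 'c) (lun: 'c) (run: 'c)

datatype ('o, 'a, 'c) braided = Braided (mon: "('o, 'a, 'c) monoidal") (brd: 'c)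

context
  fixes D :: "('o, 'a, 'c) two_cat" (structure) and P :: "('o, 'a) prods"
begin

definition pair1 :: "'a \<Rightarrow> 'a \<Rightarrow> 'a" where
  "pair1 f g = (THE h. h \<in> Hom1 D (Dom1 D f) (Prod P (Cod1 D f) (Cod1 D g)) \<and>
     Pr1 P (Cod1 D f) (Cod1 D g) \<odot> h = f \<and> Pr2 P (Cod1 D f) (Cod1 D g) \<odot> h = g)"

definition pair2 :: "'c \<Rightarrow> 'c \<Rightarrow> 'c" where
  "pair2 \<sigma> \<tau> = (let A = Cod1 D (Dom2 D \<sigma>); B = Cod1 D (Dom2 D \<tau>) in
     THE \<rho>. \<rho> \<in> Hom2 D (pair1 (Dom2 D \<sigma>) (Dom2 D \<tau>)) (pair1 (Cod2 D \<sigma>) (Cod2 D \<tau>)) \<and>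
       Pr1 P A B \<rhd> \<rho> = \<sigma> \<and> Pr2 P A B \<rhd> \<rho> = \<tau>)"

definition bang :: "'o \<Rightarrow> 'a" where
  "bang X = (THE f. f \<in> Hom1 D X (One P))"

text \<open>
  Throughout, an \<open>n\<close>-fold product is bracketed to the right, and products and permutations of 1-cells
  are written as pairings of (composites with) the projections.  For instance \<open>1 \<times> \<otimes>\<close> is
  \<open>\<langle>p\<^sub>1, \<otimes> \<langle>p\<^sub>2, p\<^sub>3\<rangle>\<rangle>\<close>, and \<open>\<otimes>\<close>, \<open>\<alpha>\<close>, \<open>\<beta>\<close>, \<open>\<phi>\<close> are evaluated at 1-cells \<open>x, y, z : X \<rightarrow> C\<close> by composition or
  whiskering with \<open>\<langle>x, y\<rangle>\<close> or \<open>\<langle>x, \<langle>y, z\<rangle>\<rangle>\<close>.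
\<close>

definition p1of3 where "p1of3 C = Pr1 P C (Prod P C C)"
definition p2of3 where "p2of3 C = Pr1 P C C \<odot> Pr2 P C (Prod P C C)"
definition p3of3 where "p3of3 C = Pr2 P C C \<odot> Pr2 P C (Prod P C C)"

definition p1of4 where "p1of4 C = Pr1 P C (Prod P C (Prod P C C))"
definition p2of4 where "p2of4 C = p1of3 C \<odot> Pr2 P C (Prod P C (Prod P C C))"
definition p3of4 where "p3of4 C = p2of3 C \<odot> Pr2 P C (Prod P C (Prod P C C))"
definition p4of4 where "p4of4 C = p3of3 C \<odot> Pr2 P C (Prod P C (Prod P C C))"

definition tensor1 :: "('o, 'a, 'c) monoidal \<Rightarrow> 'a \<Rightarrow> 'a \<Rightarrow> 'a" where
  "tensor1 M x y = ten M \<odot> pair1 x y"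

definition tensor2 :: "('o, 'a, 'c) monoidal \<Rightarrow> 'c \<Rightarrow> 'c \<Rightarrow> 'c" where
  "tensor2 M \<sigma> \<tau> = ten M \<rhd> pair2 \<sigma> \<tau>"

definition unit_at :: "('o, 'a, 'c) monoidal \<Rightarrow> 'o \<Rightarrow> 'a" where
  "unit_at M X = unt M \<odot> bang X"

definition at2 :: "'c \<Rightarrow> 'a \<Rightarrow> 'a \<Rightarrow> 'c" where
  "at2 \<sigma> x y = \<sigma> \<lhd> pair1 x y"

definition at3 :: "'c \<Rightarrow> 'a \<Rightarrow> 'a \<Rightarrow> 'a \<Rightarrow> 'c" where
  "at3 \<sigma> x y z = \<sigma> \<lhd> pair1 x (pair1 y z)"

definition is_monoidal :: "('o, 'a, 'c) monoidal \<Rightarrow> bool" where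
  "is_monoidal M \<longleftrightarrow>
    (let C = ob M; \<alpha> = asc M; ten1 = tensor1 M; ten2 = tensor2 M in
      C \<in> Obj D \<and> ten M \<in> Hom1 D (Prod P C C) C \<and> unt M \<in> Hom1 D (One P) C \<and>
      (let x = p1of3 C; y = p2of3 C; z = p3of3 C in
        \<alpha> \<in> Hom2 D (ten1 x (ten1 y z)) (ten1 (ten1 x y) z)) \<and>
      lun M \<in> Hom2 D (ten1 (unit_at M C) (Id1 D C)) (Id1 D C) \<and>
      run M \<in> Hom2 D (ten1 (Id1 D C) (unit_at M C)) (Id1 D C) \<and>
      invertible2 D \<alpha> \<and> invertible2 D (lun M) \<and> invertible2 D (run M) \<and>
      (let x = p1of4 C; y = p2of4 C; z = p3of4 C; w = p4of4 C in
        ten2 (at3 \<alpha> x y z) (Id2 D w) \<bullet> at3 \<alpha> x (ten1 y z) w \<bullet> ten2 (Id2 D x) (at3 \<alpha> y z w)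
        = at3 \<alpha> (ten1 x y) z w \<bullet> at3 \<alpha> x y (ten1 z w)) \<and>
      (let x = Pr1 P C C; y = Pr2 P C C in
        ten2 (run M \<lhd> x) (Id2 D y) \<bullet> at3 \<alpha> x (unit_at M (Prod P C C)) y
        = ten2 (Id2 D x) (lun M \<lhd> y)))"

definition is_braided :: "('o, 'a, 'c) braided \<Rightarrow> bool" where
  "is_braided B \<longleftrightarrow>
    (let M = mon B; C = ob M; \<alpha> = asc M; \<alpha>' = inv2 D \<alpha>; \<beta> = brd B;
         ten1 = tensor1 M; ten2 = tensor2 M in
      is_monoidal M \<and>
      \<beta> \<in> Hom2 D (ten M) (ten M \<odot> pair1 (Pr2 P C C) (Pr1 P C C)) \<and> invertible2 D \<beta> \<and>
      (let x = p1of3 C; y = p2of3 C; z = p3of3 C in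
        at3 \<alpha> z x y \<bullet> at2 \<beta> (ten1 x y) z \<bullet> at3 \<alpha> x y z
          = ten2 (at2 \<beta> x z) (Id2 D y) \<bullet> at3 \<alpha> x z y \<bullet> ten2 (Id2 D x) (at2 \<beta> y z) \<and>
        at3 \<alpha>' y z x \<bullet> at2 \<beta> x (ten1 y z) \<bullet> at3 \<alpha>' x y z
          = ten2 (Id2 D y) (at2 \<beta> x z) \<bullet> at3 \<alpha>' y x z \<bullet> ten2 (at2 \<beta> x y) (Id2 D z)))"

definition is_symmetric :: "('o, 'a, 'c) braided \<Rightarrow> bool" where
  "is_symmetric B \<longleftrightarrow> is_braided B \<and>
    (let C = ob (mon B) in at2 (brd B) (Pr2 P C C) (Pr1 P C C) \<bullet> brd B = Id2 D (ten (mon B)))"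

text \<open>The structure of a 1-cell is the pair of \<open>\<phi>\<close> and \<open>\<phi>\<close>-bar.\<close>

definition oplax_monoidal ::
  "('o, 'a, 'c) monoidal \<Rightarrow> ('o, 'a, 'c) monoidal \<Rightarrow> 'a \<Rightarrow> 'c \<times> 'c \<Rightarrow> bool" where
  "oplax_monoidal M M' F s \<longleftrightarrow>
    (let C = ob M; \<phi> = fst s; \<phi>' = snd s in
      \<phi> \<in> Hom2 D (F \<odot> ten M) (tensor1 M' (F \<odot> Pr1 P C C) (F \<odot> Pr2 P C C)) \<and>
      \<phi>' \<in> Hom2 D (F \<odot> unt M) (unt M') \<and>
      (let x = p1of3 C; y = p2of3 C; z = p3of3 C in
        at3 (asc M') (F \<odot> x) (F \<odot> y) (F \<odot> z) \<bullet> tensor2 M' (Id2 D (F \<odot> x)) (at2 \<phi> y z)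
          \<bullet> at2 \<phi> x (tensor1 M y z)
        = tensor2 M' (at2 \<phi> x y) (Id2 D (F \<odot> z)) \<bullet> at2 \<phi> (tensor1 M x y) z \<bullet> (F \<rhd> asc M)) \<and>
      (run M' \<lhd> F) \<bullet> tensor2 M' (Id2 D F) (\<phi>' \<lhd> bang C) \<bullet> at2 \<phi> (Id1 D C) (unit_at M C)
        = F \<rhd> run M \<and>
      (lun M' \<lhd> F) \<bullet> tensor2 M' (\<phi>' \<lhd> bang C) (Id2 D F) \<bullet> at2 \<phi> (unit_at M C) (Id1 D C)
        = F \<rhd> lun M)"

definition braided_mor :: "(('o, 'a, 'c) braided, 'a, 'c \<times> 'c) mor \<Rightarrow> bool" where
  "braided_mor f \<longleftrightarrow>
    (let B = mdom f; B' = mcod f; F = mfun f; \<phi> = fst (mstr f);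
         x = Pr1 P (ob (mon B)) (ob (mon B)); y = Pr2 P (ob (mon B)) (ob (mon B)) in
      oplax_monoidal (mon B) (mon B') F (mstr f) \<and>
      at2 (brd B') (F \<odot> x) (F \<odot> y) \<bullet> \<phi> = at2 \<phi> y x \<bullet> (F \<rhd> brd B))"

definition monoidal_trf ::
  "(('o, 'a, 'c) braided, 'a, 'c \<times> 'c) mor \<Rightarrow> (('o, 'a, 'c) braided, 'a, 'c \<times> 'c) mor
    \<Rightarrow> 'c \<Rightarrow> bool" where
  "monoidal_trf f f' \<sigma> \<longleftrightarrow>
    (let M = mon (mdom f); M' = mon (mcod f); C = ob M in
      fst (mstr f') \<bullet> (\<sigma> \<lhd> ten M)
        = tensor2 M' (\<sigma> \<lhd> Pr1 P C C) (\<sigma> \<lhd> Pr2 P C C) \<bullet> fst (mstr f) \<and>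
      snd (mstr f') \<bullet> (\<sigma> \<lhd> unt M) = snd (mstr f))"

definition monoidal_id_str :: "('o, 'a, 'c) braided \<Rightarrow> 'c \<times> 'c" where
  "monoidal_id_str B = (Id2 D (ten (mon B)), Id2 D (unt (mon B)))"

definition monoidal_comp_str ::
  "(('o, 'a, 'c) braided, 'a, 'c \<times> 'c) mor \<Rightarrow> (('o, 'a, 'c) braided, 'a, 'c \<times> 'c) mor
    \<Rightarrow> 'c \<times> 'c" where
  "monoidal_comp_str f' f =
    (let C = ob (mon (mdom f)); F = mfun f; F' = mfun f' in
      (at2 (fst (mstr f')) (F \<odot> Pr1 P C C) (F \<odot> Pr2 P C C) \<bullet> (F' \<rhd> fst (mstr f)),
       snd (mstr f') \<bullet> (F' \<rhd> snd (mstr f))))"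

definition BMon_op where
  "BMon_op = structured D {B. is_braided B} (\<lambda>B. ob (mon B)) braided_mor monoidal_trf
     monoidal_id_str monoidal_comp_str"

definition SMon_op where
  "SMon_op = structured D {B. is_symmetric B} (\<lambda>B. ob (mon B)) braided_mor monoidal_trf
     monoidal_id_str monoidal_comp_str"

end

end

theory Submission
  imports Defs
begin

text \<open>
  A right 2-adjoint of \<open>\<iota>\<close> amounts to a universal algebra \<open>(U, \<chi>)\<close> for every monad, and the comparison of EM
  objects along \<open>G\<close> is invertible as soon as \<open>G\<close> preserves one such universal algebra for every monad.
  It therefore suffices to lift the universal algebra \<open>(U : C\<^sup>T \<rightarrow> C, \<chi>)\<close> of the underlying monad along the
  forgetful 2-functor.  That \<open>T\<close> is an oplax morphism says that every operation of \<open>C\<close>, applied to algebras,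
  is an algebra again; so the operations lift strictly along \<open>U\<close>, and with them all structure
  2-cells, which are morphisms of algebras because the unit, the multiplication and the structure of \<open>T\<close> are
  compatible with them.  Since \<open>U\<close> is faithful on 2-cells, equations in \<open>C\<^sup>T\<close> can be checked in \<open>C\<close>, and \<open>U\<close>
  with the identity structure is universal among structured morphisms.
\<close>

section \<open>Whiskering calculus\<close>

text \<open>The oplax direction is what makes lifting possible: a structure cell
  \<open>T S -> S T\<close> turns an action \<open>T U -> U\<close> into
  \<open>T S U -> S T U -> S U\<close>, so \<open>S U\<close> is again an algebra, whereas a cell in
  the other direction yields no such action. The universal property of \<open>(U, \<chi>)\<close> is
  an isomorphism of hom-categories, not merely an equivalence. Hence \<open>S U\<close> equals
  \<open>U R\<close> on the nose, the structure of \<open>U\<close> is an identity cell, and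
  uniqueness of structured factorisations can be stated as equality. Two obstacles shape the rest.
  Standardness quantifies over all right 2-adjoints, whereas the construction yields one universal
  algebra per monad; uniqueness of universal arrows bridges the gap. And the operations of a
  monoidal object live on products, while a universal property is available for \<open>U\<close>
  only. It suffices because every operation and every structure cell ends in \<open>X\<close>:
  coherence equations are evaluated at generalized elements, and only their target matters.\<close>

context two_category
begin

text \<open>Sources and targets are given as equations rather than through \<open>Hom1\<close>, so
  that the typing of long composites is computed by rewriting.\<close>

lemma Comp1_typ [simp]:
  assumes "f \<in> Arr D" "g \<in> Arr D" "Cod1 D f = Dom1 D g"
  shows "g \<odot> f \<in> Arr D" "Dom1 D (g \<odot> f) = Dom1 D f" "Cod1 D (g \<odot> f) = Cod1 D g"
  using Comp1_Hom[of f "Dom1 D f" "Cod1 D f" g "Cod1 D g"] assms by (auto simp: Hom1_def)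

lemma Id1_typ [simp]:
  assumes "A \<in> Obj D"
  shows "Id1 D A \<in> Arr D" "Dom1 D (Id1 D A) = A" "Cod1 D (Id1 D A) = A"
  using Id1_Hom[OF assms] by (auto simp: Hom1_def)

lemma Id2_typ [simp]:
  assumes "f \<in> Arr D"
  shows "Id2 D f \<in> Cell D" "Dom2 D (Id2 D f) = f" "Cod2 D (Id2 D f) = f"
  using Id2_Hom[OF assms] by (auto simp: Hom2_def)

lemma VComp_typ [simp]:
  assumes "\<sigma> \<in> Cell D" "\<tau> \<in> Cell D" "Cod2 D \<sigma> = Dom2 D \<tau>"
  shows "\<tau> \<bullet> \<sigma> \<in> Cell D" "Dom2 D (\<tau> \<bullet> \<sigma>) = Dom2 D \<sigma>" "Cod2 D (\<tau> \<bullet> \<sigma>) = Cod2 D \<tau>"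
  using VComp_Hom[of \<sigma> "Dom2 D \<sigma>" "Cod2 D \<sigma>" \<tau> "Cod2 D \<tau>"] assms by (auto simp: Hom2_def)

declare Dom1_Obj [simp] Cod1_Obj [simp] Dom2_Arr [simp] Cod2_Arr [simp]

text \<open>Oriented towards the source: the 0-cells bounding a 2-cell are always read off
  \<open>Dom2\<close>, and later typing hypotheses mention only these.\<close>

lemma parallel [simp]:
  assumes "\<sigma> \<in> Cell D"
  shows "Dom1 D (Cod2 D \<sigma>) = Dom1 D (Dom2 D \<sigma>)" "Cod1 D (Cod2 D \<sigma>) = Cod1 D (Dom2 D \<sigma>)"
  using Dom1_parallel Cod1_parallel assms by auto

text \<open>The 0-cell is a variable tied to \<open>f\<close> by a premise, so the unit law also
  applies when that 0-cell is written in another, provably equal way.\<close>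

lemma Comp1_unit [simp]:
  assumes "f \<in> Arr D"
  shows "Cod1 D f = B \<Longrightarrow> Id1 D B \<odot> f = f" "Dom1 D f = A \<Longrightarrow> f \<odot> Id1 D A = f"
  using Comp1_Id_left Comp1_Id_right assms by (auto simp: Hom1_def)

lemma Comp1_ac [simp]:
  assumes "f \<in> Arr D" "g \<in> Arr D" "h \<in> Arr D" "Cod1 D f = Dom1 D g" "Cod1 D g = Dom1 D h"
  shows "(h \<odot> g) \<odot> f = h \<odot> (g \<odot> f)"
  using Comp1_assoc assms by (auto simp: Hom1_def)

lemma VComp_unit [simp]:
  assumes "\<sigma> \<in> Cell D"
  shows "Cod2 D \<sigma> = g \<Longrightarrow> Id2 D g \<bullet> \<sigma> = \<sigma>" "Dom2 D \<sigma> = f \<Longrightarrow> \<sigma> \<bullet> Id2 D f = \<sigma>"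
  using VComp_Id_left VComp_Id_right assms by (auto simp: Hom2_def)

lemma VComp_ac [simp]:
  assumes "\<rho> \<in> Cell D" "\<sigma> \<in> Cell D" "\<tau> \<in> Cell D" "Cod2 D \<rho> = Dom2 D \<sigma>" "Cod2 D \<sigma> = Dom2 D \<tau>"
  shows "(\<tau> \<bullet> \<sigma>) \<bullet> \<rho> = \<tau> \<bullet> (\<sigma> \<bullet> \<rho>)"
  using VComp_assoc assms by (auto simp: Hom2_def)

lemma HComp_typ:
  assumes "\<sigma> \<in> Cell D" "\<tau> \<in> Cell D" "Cod1 D (Dom2 D \<sigma>) = Dom1 D (Dom2 D \<tau>)"
  shows "\<tau> \<star> \<sigma> \<in> Cell D" "Dom2 D (\<tau> \<star> \<sigma>) = Dom2 D \<tau> \<odot> Dom2 D \<sigma>"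
    "Cod2 D (\<tau> \<star> \<sigma>) = Cod2 D \<tau> \<odot> Cod2 D \<sigma>"
  using HComp_Hom[of \<sigma> _ _ \<tau>] assms by (auto simp: Hom2_def)

lemma lwhisk_typ [simp]:
  assumes "\<sigma> \<in> Cell D" "F \<in> Arr D" "Cod1 D (Dom2 D \<sigma>) = Dom1 D F"
  shows "F \<rhd> \<sigma> \<in> Cell D" "Dom2 D (F \<rhd> \<sigma>) = F \<odot> Dom2 D \<sigma>" "Cod2 D (F \<rhd> \<sigma>) = F \<odot> Cod2 D \<sigma>"
  using HComp_typ[of \<sigma> "Id2 D F"] assms by (auto simp: lwhisk_def)

lemma rwhisk_typ [simp]:
  assumes "\<sigma> \<in> Cell D" "G \<in> Arr D" "Cod1 D G = Dom1 D (Dom2 D \<sigma>)"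
  shows "\<sigma> \<lhd> G \<in> Cell D" "Dom2 D (\<sigma> \<lhd> G) = Dom2 D \<sigma> \<odot> G" "Cod2 D (\<sigma> \<lhd> G) = Cod2 D \<sigma> \<odot> G"
  using HComp_typ[of "Id2 D G" \<sigma>] assms by (auto simp: rwhisk_def)

lemma lwhisk_VComp [simp]:
  assumes "\<sigma> \<in> Cell D" "\<tau> \<in> Cell D" "Cod2 D \<sigma> = Dom2 D \<tau>" "F \<in> Arr D"
    "Cod1 D (Dom2 D \<sigma>) = Dom1 D F"
  shows "F \<rhd> (\<tau> \<bullet> \<sigma>) = (F \<rhd> \<tau>) \<bullet> (F \<rhd> \<sigma>)"
  using interchange[of \<sigma> "Dom2 D \<sigma>" "Cod2 D \<sigma>" \<tau> "Cod2 D \<tau>" "Id2 D F" F F "Id2 D F" F] assms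
  by (auto simp: Hom2_def lwhisk_def)

lemma rwhisk_VComp [simp]:
  assumes "\<sigma> \<in> Cell D" "\<tau> \<in> Cell D" "Cod2 D \<sigma> = Dom2 D \<tau>" "G \<in> Arr D"
    "Cod1 D G = Dom1 D (Dom2 D \<sigma>)"
  shows "(\<tau> \<bullet> \<sigma>) \<lhd> G = (\<tau> \<lhd> G) \<bullet> (\<sigma> \<lhd> G)"
  using interchange[of "Id2 D G" G G "Id2 D G" G \<sigma> "Dom2 D \<sigma>" "Cod2 D \<sigma>" \<tau> "Cod2 D \<tau>"] assms
  by (auto simp: Hom2_def rwhisk_def)

lemma whisk_Id2 [simp]:
  assumes "f \<in> Arr D" "g \<in> Arr D" "Cod1 D f = Dom1 D g"
  shows "g \<rhd> Id2 D f = Id2 D (g \<odot> f)" "Id2 D g \<lhd> f = Id2 D (g \<odot> f)"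
  using HComp_Id2[of f "Dom1 D f" "Cod1 D f" g "Cod1 D g"] assms
  by (auto simp: Hom1_def lwhisk_def rwhisk_def)

lemma HComp_Id2_Id2 [simp]:
  assumes "f \<in> Arr D" "g \<in> Arr D" "Cod1 D f = Dom1 D g"
  shows "Id2 D g \<star> Id2 D f = Id2 D (g \<odot> f)"
  using whisk_Id2[OF assms] by (simp add: lwhisk_def)

lemma lwhisk_lwhisk [simp]:
  assumes "\<sigma> \<in> Cell D" "F \<in> Arr D" "G \<in> Arr D" "Cod1 D (Dom2 D \<sigma>) = Dom1 D G" "Cod1 D G = Dom1 D F"
  shows "F \<rhd> (G \<rhd> \<sigma>) = (F \<odot> G) \<rhd> \<sigma>"
  using HComp_assoc[of \<sigma> "Dom2 D \<sigma>" "Cod2 D \<sigma>" "Id2 D G" G G "Id2 D F" F F] assms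
    whisk_Id2[of G F]
  by (auto simp: Hom2_def lwhisk_def)

lemma rwhisk_rwhisk [simp]:
  assumes "\<sigma> \<in> Cell D" "F \<in> Arr D" "G \<in> Arr D" "Cod1 D F = Dom1 D (Dom2 D \<sigma>)" "Cod1 D G = Dom1 D F"
  shows "(\<sigma> \<lhd> F) \<lhd> G = \<sigma> \<lhd> (F \<odot> G)"
  using HComp_assoc[of "Id2 D G" G G "Id2 D F" F F \<sigma> "Dom2 D \<sigma>" "Cod2 D \<sigma>"] assms
    whisk_Id2[of G F]
  by (auto simp: Hom2_def rwhisk_def lwhisk_def)

text \<open>Fixes the order \<open>F \<rhd> (\<sigma> \<lhd> G)\<close>. With the rules that merge
  whiskers and distribute them, a simplified 2-cell is a right-nested vertical composite of such
  terms.\<close>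

lemma lwhisk_rwhisk [simp]:
  assumes "\<sigma> \<in> Cell D" "F \<in> Arr D" "G \<in> Arr D" "Cod1 D (Dom2 D \<sigma>) = Dom1 D F"
    "Cod1 D G = Dom1 D (Dom2 D \<sigma>)"
  shows "(F \<rhd> \<sigma>) \<lhd> G = F \<rhd> (\<sigma> \<lhd> G)"
  using HComp_assoc[of "Id2 D G" G G \<sigma> "Dom2 D \<sigma>" "Cod2 D \<sigma>" "Id2 D F" F F] assms
  by (auto simp: Hom2_def rwhisk_def lwhisk_def)

lemma whisk_Id1 [simp]:
  assumes "\<sigma> \<in> Cell D"
  shows "Cod1 D (Dom2 D \<sigma>) = B \<Longrightarrow> Id1 D B \<rhd> \<sigma> = \<sigma>" "Dom1 D (Dom2 D \<sigma>) = A \<Longrightarrow> \<sigma> \<lhd> Id1 D A = \<sigma>"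
  using HComp_Id_left[of \<sigma> "Dom2 D \<sigma>" "Cod2 D \<sigma>" A B] HComp_Id_right[of \<sigma> "Dom2 D \<sigma>" "Cod2 D \<sigma>" A B] assms
    HComp_Id_left[of \<sigma> "Dom2 D \<sigma>" "Cod2 D \<sigma>" "Dom1 D (Dom2 D \<sigma>)" B]
    HComp_Id_right[of \<sigma> "Dom2 D \<sigma>" "Cod2 D \<sigma>" A "Cod1 D (Dom2 D \<sigma>)"]
  by (auto simp: Hom2_def Hom1_def lwhisk_def rwhisk_def)

text \<open>Interchange with an identity inserted next to each factor; this reduces horizontal
  composites to whiskerings.\<close>

lemma HComp_whisk:
  assumes "\<sigma> \<in> Cell D" "\<tau> \<in> Cell D" "Cod1 D (Dom2 D \<sigma>) = Dom1 D (Dom2 D \<tau>)"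
  shows "\<tau> \<star> \<sigma> = (\<tau> \<lhd> Cod2 D \<sigma>) \<bullet> (Dom2 D \<tau> \<rhd> \<sigma>)" "\<tau> \<star> \<sigma> = (Cod2 D \<tau> \<rhd> \<sigma>) \<bullet> (\<tau> \<lhd> Dom2 D \<sigma>)"
  using interchange[of \<sigma> "Dom2 D \<sigma>" "Cod2 D \<sigma>" "Id2 D (Cod2 D \<sigma>)" "Cod2 D \<sigma>"
      "Id2 D (Dom2 D \<tau>)" "Dom2 D \<tau>" "Dom2 D \<tau>" \<tau> "Cod2 D \<tau>"]
    interchange[of "Id2 D (Dom2 D \<sigma>)" "Dom2 D \<sigma>" "Dom2 D \<sigma>" \<sigma> "Cod2 D \<sigma>"
      \<tau> "Dom2 D \<tau>" "Cod2 D \<tau>" "Id2 D (Cod2 D \<tau>)" "Cod2 D \<tau>"]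
    assms
  by (auto simp: Hom2_def lwhisk_def rwhisk_def)

text \<open>The remaining law of the calculus. Neither side is simpler than the other, so it is no
  rewrite rule and every proof applies it explicitly in the direction it needs.\<close>

lemma whisk_swap:
  assumes "\<sigma> \<in> Hom2 D f g" "\<tau> \<in> Hom2 D h k" "Cod1 D f = Dom1 D h"
  shows "(\<tau> \<lhd> g) \<bullet> (h \<rhd> \<sigma>) = (k \<rhd> \<sigma>) \<bullet> (\<tau> \<lhd> f)"
  using HComp_whisk[of \<sigma> \<tau>] assms by (auto simp: Hom2_def)

section \<open>Invertible 2-cells\<close>

lemma inverse2_unique:
  assumes "inverse2 D \<sigma> \<tau>" "inverse2 D \<sigma> \<tau>'" shows "\<tau> = \<tau>'"
proof -
  have "(\<tau>' \<bullet> \<sigma>) \<bullet> \<tau> = \<tau>' \<bullet> (\<sigma> \<bullet> \<tau>)"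
    by (rule VComp_ac) (use assms in \<open>auto simp: inverse2_def Hom2_def\<close>)
  moreover have "(\<tau>' \<bullet> \<sigma>) \<bullet> \<tau> = \<tau>" "\<tau>' \<bullet> (\<sigma> \<bullet> \<tau>) = \<tau>'"
    using assms by (simp_all add: inverse2_def Hom2_def)
  ultimately show ?thesis by simp
qed

lemma inv2_eqI: "inverse2 D \<sigma> \<tau> \<Longrightarrow> inv2 D \<sigma> = \<tau>"
  unfolding inv2_def using inverse2_unique by blast

lemma inverse2_inv2: "invertible2 D \<sigma> \<Longrightarrow> inverse2 D \<sigma> (inv2 D \<sigma>)"
  unfolding invertible2_def using inv2_eqI by auto

lemma inverse2_rwhisk:
  assumes "inverse2 D \<sigma> \<tau>" "G \<in> Arr D" "Cod1 D G = Dom1 D (Dom2 D \<sigma>)"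
  shows "inverse2 D (\<sigma> \<lhd> G) (\<tau> \<lhd> G)"
  \<comment> \<open>As a rewrite rule \<open>rwhisk_VComp\<close> would turn its own two instances
    into trivialities; as plain facts they carry the inverse laws across the whiskering.\<close>
  using assms rwhisk_VComp[of \<sigma> \<tau> G] rwhisk_VComp[of \<tau> \<sigma> G]
  by (simp add: inverse2_def Hom2_def del: rwhisk_VComp)

end

section \<open>2-categories of structured objects\<close>

text \<open>Membership in the set of 1-cells of \<open>structured\<close>, with \<open>Hom1\<close>
  resolved into equations on source and target.\<close>

definition str_arr ::
  "('o, 'a, 'c) two_cat \<Rightarrow> 's set \<Rightarrow> ('s \<Rightarrow> 'o) \<Rightarrow> (('s, 'a, 't) mor \<Rightarrow> bool) \<Rightarrow> ('s, 'a, 't) mor \<Rightarrow> bool" where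
  "str_arr D obs und is_mor f \<longleftrightarrow> mdom f \<in> obs \<and> mcod f \<in> obs \<and> mfun f \<in> Arr D \<and>
     Dom1 D (mfun f) = und (mdom f) \<and> Cod1 D (mfun f) = und (mcod f) \<and> is_mor f"

definition str_comp ::
  "('o, 'a, 'c) two_cat \<Rightarrow> (('s, 'a, 't) mor \<Rightarrow> ('s, 'a, 't) mor \<Rightarrow> 't)
    \<Rightarrow> ('s, 'a, 't) mor \<Rightarrow> ('s, 'a, 't) mor \<Rightarrow> ('s, 'a, 't) mor" where
  "str_comp D comp_str g f = Mor (mdom f) (mcod g) (mfun g \<odot>\<^bsub>D\<^esub> mfun f) (comp_str g f)"

lemma str_comp_sel [simp]:
  "mdom (str_comp D cs g f) = mdom f" "mcod (str_comp D cs g f) = mcod g"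
  "mfun (str_comp D cs g f) = mfun g \<odot>\<^bsub>D\<^esub> mfun f" "mstr (str_comp D cs g f) = cs g f"
  by (simp_all add: str_comp_def)

lemma str_arr_sel:
  assumes "str_arr D obs und is_mor f"
  shows "mdom f \<in> obs" "mcod f \<in> obs" "mfun f \<in> Arr D" "Dom1 D (mfun f) = und (mdom f)"
    "Cod1 D (mfun f) = und (mcod f)" "is_mor f"
  using assms by (simp_all add: str_arr_def)

definition str_id :: "('o, 'a, 'c) two_cat \<Rightarrow> ('s \<Rightarrow> 'o) \<Rightarrow> ('s \<Rightarrow> 't) \<Rightarrow> 's \<Rightarrow> ('s, 'a, 't) mor" where
  "str_id D und id_str X = Mor X X (Id1 D (und X)) (id_str X)"

lemma str_id_sel [simp]:
  "mdom (str_id D und ids X) = X" "mcod (str_id D und ids X) = X"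
  "mfun (str_id D und ids X) = Id1 D (und X)" "mstr (str_id D und ids X) = ids X"
  by (simp_all add: str_id_def)

lemma structured_sel:
  "Obj (structured D obs und is_mor is_trf id_str comp_str) = obs"
  "f \<in> Arr (structured D obs und is_mor is_trf id_str comp_str) \<longleftrightarrow> str_arr D obs und is_mor f"
  "t \<in> Cell (structured D obs und is_mor is_trf id_str comp_str) \<longleftrightarrow>
     str_arr D obs und is_mor (tdom t) \<and> str_arr D obs und is_mor (tcod t) \<and>
     mdom (tdom t) = mdom (tcod t) \<and> mcod (tdom t) = mcod (tcod t) \<and>
     tcell t \<in> Cell D \<and> Dom2 D (tcell t) = mfun (tdom t) \<and> Cod2 D (tcell t) = mfun (tcod t) \<and>
     is_trf (tdom t) (tcod t) (tcell t)"
  "Dom1 (structured D obs und is_mor is_trf id_str comp_str) = mdom"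
  "Cod1 (structured D obs und is_mor is_trf id_str comp_str) = mcod"
  "Dom2 (structured D obs und is_mor is_trf id_str comp_str) = tdom"
  "Cod2 (structured D obs und is_mor is_trf id_str comp_str) = tcod"
  "Id1 (structured D obs und is_mor is_trf id_str comp_str) X = str_id D und id_str X"
  "Id2 (structured D obs und is_mor is_trf id_str comp_str) f = Trf f f (Id2 D (mfun f))"
  "Comp1 (structured D obs und is_mor is_trf id_str comp_str) g f = str_comp D comp_str g f"
  "VComp (structured D obs und is_mor is_trf id_str comp_str) t s =
     Trf (tdom s) (tcod t) (tcell t \<bullet>\<^bsub>D\<^esub> tcell s)"
  "HComp (structured D obs und is_mor is_trf id_str comp_str) t s =
     Trf (str_comp D comp_str (tdom t) (tdom s)) (str_comp D comp_str (tcod t) (tcod s))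
       (tcell t \<star>\<^bsub>D\<^esub> tcell s)"
  by (auto simp: structured_def Let_def str_comp_def str_id_def str_arr_def Hom1_def Hom2_def)

lemma structured_whisk:
  "F \<rhd>\<^bsub>structured D obs und is_mor is_trf id_str comp_str\<^esub> t =
     Trf (str_comp D comp_str F (tdom t)) (str_comp D comp_str F (tcod t)) (mfun F \<rhd>\<^bsub>D\<^esub> tcell t)"
  "t \<lhd>\<^bsub>structured D obs und is_mor is_trf id_str comp_str\<^esub> F =
     Trf (str_comp D comp_str (tdom t) F) (str_comp D comp_str (tcod t) F) (tcell t \<lhd>\<^bsub>D\<^esub> mfun F)"
  by (simp_all add: lwhisk_def rwhisk_def structured_sel)

text \<open>What a notion of structure must supply for \<open>structured\<close> to form a
  2-category. Closure under horizontal composition is asked for whiskerings only, and the equational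
  laws of 2-cells need no axiom, since these cells are compared in \<open>D\<close>.\<close>

locale structured_data = two_category D
  for D :: "('o, 'a, 'c) two_cat" (structure)
    and obs :: "'s set" and und :: "'s \<Rightarrow> 'o"
    and is_mor :: "('s, 'a, 't) mor \<Rightarrow> bool"
    and is_trf :: "('s, 'a, 't) mor \<Rightarrow> ('s, 'a, 't) mor \<Rightarrow> 'c \<Rightarrow> bool"
    and id_str :: "'s \<Rightarrow> 't" and comp_str :: "('s, 'a, 't) mor \<Rightarrow> ('s, 'a, 't) mor \<Rightarrow> 't" +
  assumes und_Obj: "X \<in> obs \<Longrightarrow> und X \<in> Obj D"
    and id_mor: "X \<in> obs \<Longrightarrow> is_mor (Mor X X (Id1 D (und X)) (id_str X))"
    and comp_mor: "\<lbrakk>str_arr D obs und is_mor f; str_arr D obs und is_mor g; mcod f = mdom g\<rbrakk>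
      \<Longrightarrow> is_mor (Mor (mdom f) (mcod g) (mfun g \<odot> mfun f) (comp_str g f))"
    and comp_id_right: "str_arr D obs und is_mor f
      \<Longrightarrow> comp_str f (Mor (mdom f) (mdom f) (Id1 D (und (mdom f))) (id_str (mdom f))) = mstr f"
    and comp_id_left: "str_arr D obs und is_mor f
      \<Longrightarrow> comp_str (Mor (mcod f) (mcod f) (Id1 D (und (mcod f))) (id_str (mcod f))) f = mstr f"
    and comp_assoc: "\<lbrakk>str_arr D obs und is_mor f; str_arr D obs und is_mor g; str_arr D obs und is_mor h;
        mcod f = mdom g; mcod g = mdom h\<rbrakk>
      \<Longrightarrow> comp_str (Mor (mdom g) (mcod h) (mfun h \<odot> mfun g) (comp_str h g)) f
        = comp_str h (Mor (mdom f) (mcod g) (mfun g \<odot> mfun f) (comp_str g f))"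
    and id_trf: "str_arr D obs und is_mor f \<Longrightarrow> is_trf f f (Id2 D (mfun f))"
    and vcomp_trf: "\<lbrakk>str_arr D obs und is_mor f; str_arr D obs und is_mor g; str_arr D obs und is_mor h;
        mdom g = mdom f; mcod g = mcod f; mdom h = mdom f; mcod h = mcod f;
        \<sigma> \<in> Hom2 D (mfun f) (mfun g); \<tau> \<in> Hom2 D (mfun g) (mfun h); is_trf f g \<sigma>; is_trf g h \<tau>\<rbrakk>
      \<Longrightarrow> is_trf f h (\<tau> \<bullet> \<sigma>)"
    and lwhisk_trf: "\<lbrakk>str_arr D obs und is_mor f; str_arr D obs und is_mor f'; str_arr D obs und is_mor g;
        mdom f' = mdom f; mcod f' = mcod f; mcod f = mdom g; \<sigma> \<in> Hom2 D (mfun f) (mfun f'); is_trf f f' \<sigma>\<rbrakk>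
      \<Longrightarrow> is_trf (Mor (mdom f) (mcod g) (mfun g \<odot> mfun f) (comp_str g f))
            (Mor (mdom f) (mcod g) (mfun g \<odot> mfun f') (comp_str g f')) (mfun g \<rhd> \<sigma>)"
    and rwhisk_trf: "\<lbrakk>str_arr D obs und is_mor f; str_arr D obs und is_mor g; str_arr D obs und is_mor g';
        mdom g' = mdom g; mcod g' = mcod g; mcod f = mdom g; \<sigma> \<in> Hom2 D (mfun g) (mfun g'); is_trf g g' \<sigma>\<rbrakk>
      \<Longrightarrow> is_trf (Mor (mdom f) (mcod g) (mfun g \<odot> mfun f) (comp_str g f))
            (Mor (mdom f) (mcod g) (mfun g' \<odot> mfun f) (comp_str g' f)) (\<sigma> \<lhd> mfun f)"
begin

abbreviation S where "S \<equiv> structured D obs und is_mor is_trf id_str comp_str"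
abbreviation arr where "arr \<equiv> str_arr D obs und is_mor"
abbreviation cmp where "cmp \<equiv> str_comp D comp_str"
abbreviation idt where "idt \<equiv> str_id D und id_str"

lemmas arr_sel = str_arr_sel[where D = D and obs = obs and und = und and is_mor = is_mor]

lemma arr_id: "X \<in> obs \<Longrightarrow> arr (idt X)"
  using id_mor und_Obj by (simp add: str_arr_def str_id_def)

lemma arr_cmp: "\<lbrakk>arr f; arr g; mcod f = mdom g\<rbrakk> \<Longrightarrow> arr (cmp g f)"
  using comp_mor[of f g] by (simp add: str_arr_def str_comp_def)

lemma cmp_id: "arr f \<Longrightarrow> mdom f = X \<Longrightarrow> cmp f (idt X) = f" "arr f \<Longrightarrow> mcod f = X \<Longrightarrow> cmp (idt X) f = f"
  using comp_id_right[of f] comp_id_left[of f]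
  by (auto simp: str_comp_def str_id_def str_arr_def intro: mor.expand)

lemma cmp_assoc:
  "\<lbrakk>arr f; arr g; arr h; mcod f = mdom g; mcod g = mdom h\<rbrakk> \<Longrightarrow> cmp (cmp h g) f = cmp h (cmp g f)"
  using comp_assoc[of f g h] by (auto simp: str_comp_def str_arr_def)

text \<open>Factor through the middle 1-cell \<open>cmp g f'\<close>: whisker
  \<open>\<sigma>\<close> by \<open>g\<close>, then \<open>\<tau>\<close> by \<open>f'\<close>, and
  compose vertically.\<close>

lemma hcomp_trf:
  assumes "arr f" "arr f'" "arr g" "arr g'" "mdom f' = mdom f" "mcod f' = mcod f" "mcod f = mdom g"
    "mdom g' = mdom g" "mcod g' = mcod g" "\<sigma> \<in> Hom2 D (mfun f) (mfun f')" "is_trf f f' \<sigma>"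
    "\<tau> \<in> Hom2 D (mfun g) (mfun g')" "is_trf g g' \<tau>"
  shows "is_trf (cmp g f) (cmp g' f') (\<tau> \<star> \<sigma>)"
proof -
  have 1: "is_trf (cmp g f) (cmp g f') (mfun g \<rhd> \<sigma>)"
    using lwhisk_trf[of f f' g \<sigma>] assms by (simp add: str_comp_def)
  have 2: "is_trf (cmp g f') (cmp g' f') (\<tau> \<lhd> mfun f')"
    using rwhisk_trf[of f' g g' \<tau>] assms by (simp add: str_comp_def)
  note sel = assms(1-4)[THEN arr_sel(3)] assms(1-4)[THEN arr_sel(4)]
    assms(1-4)[THEN arr_sel(5)] assms(5-9)
  have cells: "\<sigma> \<in> Cell D" "Dom2 D \<sigma> = mfun f" "Cod2 D \<sigma> = mfun f'"
    "\<tau> \<in> Cell D" "Dom2 D \<tau> = mfun g" "Cod2 D \<tau> = mfun g'"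
    using assms(10,12) by (simp_all add: Hom2_def)
  have "is_trf (cmp g f) (cmp g' f') ((\<tau> \<lhd> mfun f') \<bullet> (mfun g \<rhd> \<sigma>))"
    by (rule vcomp_trf[of "cmp g f" "cmp g f'" "cmp g' f'", OF _ _ _ _ _ _ _ _ _ 1 2])
      (simp_all add: arr_cmp assms(1-9) Hom2_def sel cells)
  moreover have "(\<tau> \<lhd> mfun f') \<bullet> (mfun g \<rhd> \<sigma>) = \<tau> \<star> \<sigma>"
    using HComp_whisk(1)[of \<sigma> \<tau>] by (simp add: cells sel)
  ultimately show ?thesis by simp
qed

text \<open>The laws of 1-cells are the axioms of the locale. The laws of 2-cells are inherited from
  \<open>D\<close>, because a \<open>Trf\<close> is determined by its two boundary 1-cells and its
  underlying cell.\<close>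

lemma structured_two_category: "two_category S"
proof (unfold_locales, goal_cases)
  case 8 then show ?case
    by (auto simp: structured_sel Hom1_def arr_cmp)
next
  case 11 then show ?case
    by (auto simp: structured_sel Hom1_def cmp_assoc)
next
  case 13 then show ?case
    by (auto simp: structured_sel Hom2_def arr_sel intro: vcomp_trf)
next
  case 14 then show ?case
    by (auto simp: structured_sel Hom2_def arr_sel intro!: trf.expand)
next
  case 15 then show ?case
    by (auto simp: structured_sel Hom2_def arr_sel intro!: trf.expand)
next
  case 17 then show ?case
    by (auto simp: structured_sel Hom1_def Hom2_def arr_sel arr_cmp HComp_typ intro!: hcomp_trf)
next
  case 18 then show ?case
    by (simp add: structured_sel Hom1_def arr_sel)
next
  case 19
  then show ?case
    by (simp add: structured_sel Hom1_def Hom2_def) (rule interchange, auto simp: Hom2_def arr_sel)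
next
  case 20 then show ?case
    by (auto simp: structured_sel Hom1_def Hom2_def cmp_id arr_sel lwhisk_def[symmetric] intro!: trf.expand)
next
  case 21 then show ?case
    by (auto simp: structured_sel Hom1_def Hom2_def cmp_id arr_sel rwhisk_def[symmetric] intro!: trf.expand)
next
  case 22 then show ?case
    by (auto simp: structured_sel Hom1_def Hom2_def cmp_assoc arr_sel intro!: HComp_assoc)
qed (simp_all add: structured_sel Hom1_def Hom2_def arr_sel arr_id cmp_id id_trf)

lemma forgetful_two_functor: "two_functor S D (forgetful und)"
  by (intro two_functor.intro two_functor_axioms.intro structured_two_category two_category_axioms)
    (auto simp: structured_sel forgetful_def Hom1_def Hom2_def arr_sel und_Obj)

end

section \<open>Universal arrows and 2-adjunctions\<close>

context two_functor
begin

lemma F0_typ [simp]: "X \<in> Obj A \<Longrightarrow> F0 G X \<in> Obj B"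
  by (rule F0_Obj)

lemma F1_typ [simp]:
  assumes "f \<in> Arr A"
  shows "F1 G f \<in> Arr B" "Dom1 B (F1 G f) = F0 G (Dom1 A f)" "Cod1 B (F1 G f) = F0 G (Cod1 A f)"
  using F1_Hom[of f "Dom1 A f" "Cod1 A f"] assms by (auto simp: Hom1_def)

lemma F2_typ [simp]:
  assumes "\<sigma> \<in> Cell A"
  shows "F2 G \<sigma> \<in> Cell B" "Dom2 B (F2 G \<sigma>) = F1 G (Dom2 A \<sigma>)" "Cod2 B (F2 G \<sigma>) = F1 G (Cod2 A \<sigma>)"
  using F2_Hom[of \<sigma> "Dom2 A \<sigma>" "Cod2 A \<sigma>"] assms by (auto simp: Hom2_def)

declare F1_Id1 [simp] F2_Id2 [simp]

lemma F1_cmp [simp]: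
  assumes "f \<in> Arr A" "g \<in> Arr A" "Cod1 A f = Dom1 A g"
  shows "F1 G (g \<odot>\<^bsub>A\<^esub> f) = F1 G g \<odot>\<^bsub>B\<^esub> F1 G f"
  using F1_Comp1 assms by (auto simp: Hom1_def)

lemma F2_vcmp [simp]:
  assumes "\<sigma> \<in> Cell A" "\<tau> \<in> Cell A" "Cod2 A \<sigma> = Dom2 A \<tau>"
  shows "F2 G (\<tau> \<bullet>\<^bsub>A\<^esub> \<sigma>) = F2 G \<tau> \<bullet>\<^bsub>B\<^esub> F2 G \<sigma>"
  using F2_VComp assms by (auto simp: Hom2_def)

lemma F2_whisk [simp]:
  assumes "\<sigma> \<in> Cell A" "f \<in> Arr A"
  shows "Cod1 A (Dom2 A \<sigma>) = Dom1 A f \<Longrightarrow> F2 G (f \<rhd>\<^bsub>A\<^esub> \<sigma>) = F1 G f \<rhd>\<^bsub>B\<^esub> F2 G \<sigma>"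
    "Cod1 A f = Dom1 A (Dom2 A \<sigma>) \<Longrightarrow> F2 G (\<sigma> \<lhd>\<^bsub>A\<^esub> f) = F2 G \<sigma> \<lhd>\<^bsub>B\<^esub> F1 G f"
  using F2_HComp[of \<sigma> "Dom2 A \<sigma>" "Cod2 A \<sigma>" "Id2 A f" f f] F2_HComp[of "Id2 A f" f f \<sigma> "Dom2 A \<sigma>" "Cod2 A \<sigma>"] assms
  by (auto simp: Hom2_def lwhisk_def rwhisk_def)

end

lemma two_functor_comp:
  assumes "two_functor A B F" "two_functor B C G"
  shows "two_functor A C (comp_fun G F)"
proof -
  interpret F: two_functor A B F by fact
  interpret G: two_functor B C G by fact
  show ?thesis
    by unfold_locales (auto simp: comp_fun_def Hom1_def Hom2_def F.F2_HComp G.F2_HComp)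
qed

lemma two_functor_id: "two_category A \<Longrightarrow> two_functor A A id_fun"
  by (intro two_functor.intro two_functor_axioms.intro) (auto simp: id_fun_def)

text \<open>\<open>(R, e)\<close> represents \<open>B(L -, Y)\<close>: composition with
  \<open>e\<close> is bijective on 1-cells and fully faithful on 2-cells, an isomorphism of
  hom-categories. Uniqueness is strict, as a strict 2-adjunction demands.\<close>

definition univ_arrow ::
  "('o, 'a, 'c) two_cat \<Rightarrow> ('p, 'b, 'd) two_cat \<Rightarrow> ('o, 'a, 'c, 'p, 'b, 'd) two_fun \<Rightarrow> 'p \<Rightarrow> 'o \<Rightarrow> 'b \<Rightarrow> bool"
  where
  "univ_arrow A B L Y R e \<longleftrightarrow> R \<in> Obj A \<and> e \<in> Hom1 B (F0 L R) Y \<and>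
    (\<forall>X\<in>Obj A. \<forall>f\<in>Hom1 B (F0 L X) Y. \<exists>!g. g \<in> Hom1 A X R \<and> e \<odot>\<^bsub>B\<^esub> F1 L g = f) \<and>
    (\<forall>X g h \<sigma>. g \<in> Hom1 A X R \<longrightarrow> h \<in> Hom1 A X R \<longrightarrow> \<sigma> \<in> Hom2 B (e \<odot>\<^bsub>B\<^esub> F1 L g) (e \<odot>\<^bsub>B\<^esub> F1 L h) \<longrightarrow>
      (\<exists>!\<rho>. \<rho> \<in> Hom2 A g h \<and> e \<rhd>\<^bsub>B\<^esub> F2 L \<rho> = \<sigma>))"

lemma univ_arrowD:
  assumes "univ_arrow A B L Y R e"
  shows "R \<in> Obj A" "e \<in> Arr B" "Dom1 B e = F0 L R" "Cod1 B e = Y"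
  using assms by (auto simp: univ_arrow_def Hom1_def)

context two_functor
begin

lemma univ_ex1:
  assumes "univ_arrow A B G Y R e" "X \<in> Obj A" "f \<in> Hom1 B (F0 G X) Y"
  shows "\<exists>!g. g \<in> Hom1 A X R \<and> e \<odot>\<^bsub>B\<^esub> F1 G g = f"
  using assms unfolding univ_arrow_def by blast

lemma univ_ex2:
  assumes "univ_arrow A B G Y R e" "g \<in> Hom1 A X R" "h \<in> Hom1 A X R"
    "\<sigma> \<in> Hom2 B (e \<odot>\<^bsub>B\<^esub> F1 G g) (e \<odot>\<^bsub>B\<^esub> F1 G h)"
  shows "\<exists>!\<rho>. \<rho> \<in> Hom2 A g h \<and> e \<rhd>\<^bsub>B\<^esub> F2 G \<rho> = \<sigma>"
  using assms unfolding univ_arrow_def by blast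

text \<open>The uniqueness half as a cancellation law; equations between 1-cells into
  \<open>R\<close> are proved with it by composing with \<open>e\<close>.\<close>

lemma univ_eq1:
  assumes "univ_arrow A B G Y R e" "g \<in> Arr A" "h \<in> Arr A" "Dom1 A g = Dom1 A h"
    "Cod1 A g = R" "Cod1 A h = R" "e \<odot>\<^bsub>B\<^esub> F1 G g = e \<odot>\<^bsub>B\<^esub> F1 G h"
  shows "g = h"
proof -
  have "e \<odot>\<^bsub>B\<^esub> F1 G g \<in> Hom1 B (F0 G (Dom1 A g)) Y"
    using assms univ_arrowD[OF assms(1)] by (simp add: Hom1_def)
  from univ_ex1[OF assms(1) _ this] assms show ?thesis by (auto simp: Hom1_def)
qed

lemma univ_eq2:
  assumes "univ_arrow A B G Y R e" "\<rho> \<in> Cell A" "\<rho>' \<in> Cell A" "Dom2 A \<rho> = Dom2 A \<rho>'" "Cod2 A \<rho> = Cod2 A \<rho>'"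
    "Cod1 A (Dom2 A \<rho>) = R" "e \<rhd>\<^bsub>B\<^esub> F2 G \<rho> = e \<rhd>\<^bsub>B\<^esub> F2 G \<rho>'"
  shows "\<rho> = \<rho>'"
proof -
  have "\<exists>!\<rho>''. \<rho>'' \<in> Hom2 A (Dom2 A \<rho>) (Cod2 A \<rho>) \<and> e \<rhd>\<^bsub>B\<^esub> F2 G \<rho>'' = e \<rhd>\<^bsub>B\<^esub> F2 G \<rho>"
    by (rule univ_ex2[OF assms(1), where X = "Dom1 A (Dom2 A \<rho>)"])
      (use assms univ_arrowD[OF assms(1)] in \<open>auto simp: Hom1_def Hom2_def\<close>)
  then show ?thesis using assms by (auto simp: Hom2_def)
qed

end

text \<open>One chosen universal arrow over each 0-cell of \<open>B\<close>. From this a right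
  2-adjoint is rebuilt: its values on 1-cells and 2-cells are forced by the naturality of
  \<open>e\<close> as a counit.\<close>

locale univ_family = L: two_functor A B L
  for A :: "('o, 'a, 'c) two_cat" and B :: "('p, 'b, 'd) two_cat" and L :: "('o, 'a, 'c, 'p, 'b, 'd) two_fun" +
  fixes R :: "'p \<Rightarrow> 'o" and e :: "'p \<Rightarrow> 'b"
  assumes univ: "Y \<in> Obj B \<Longrightarrow> univ_arrow A B L Y (R Y) (e Y)"
begin

definition R1 where
  "R1 f = (THE g. g \<in> Hom1 A (R (Dom1 B f)) (R (Cod1 B f)) \<and> e (Cod1 B f) \<odot>\<^bsub>B\<^esub> F1 L g = f \<odot>\<^bsub>B\<^esub> e (Dom1 B f))"

definition R2 where
  "R2 \<sigma> = (THE \<rho>. \<rho> \<in> Hom2 A (R1 (Dom2 B \<sigma>)) (R1 (Cod2 B \<sigma>)) \<and>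
     e (Cod1 B (Dom2 B \<sigma>)) \<rhd>\<^bsub>B\<^esub> F2 L \<rho> = \<sigma> \<lhd>\<^bsub>B\<^esub> e (Dom1 B (Dom2 B \<sigma>)))"

definition RF where "RF = \<lparr>F0 = R, F1 = R1, F2 = R2\<rparr>"

text \<open>The transpose of the identity of \<open>F0 L X\<close>, that is, the only unit
  compatible with \<open>triangle_L\<close>.\<close>

definition un where
  "un X = (THE g. g \<in> Hom1 A X (R (F0 L X)) \<and> e (F0 L X) \<odot>\<^bsub>B\<^esub> F1 L g = Id1 B (F0 L X))"

lemma e_typ [simp]:
  assumes "Y \<in> Obj B"
  shows "R Y \<in> Obj A" "e Y \<in> Arr B" "Dom1 B (e Y) = F0 L (R Y)" "Cod1 B (e Y) = Y"
  using univ_arrowD[OF univ[OF assms]] by auto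

lemma R1:
  assumes "f \<in> Arr B"
  shows "R1 f \<in> Arr A" "Dom1 A (R1 f) = R (Dom1 B f)" "Cod1 A (R1 f) = R (Cod1 B f)"
    "Cod1 B f = Y \<Longrightarrow> e Y \<odot>\<^bsub>B\<^esub> F1 L (R1 f) = f \<odot>\<^bsub>B\<^esub> e (Dom1 B f)"
proof -
  have "\<exists>!g. g \<in> Hom1 A (R (Dom1 B f)) (R (Cod1 B f)) \<and> e (Cod1 B f) \<odot>\<^bsub>B\<^esub> F1 L g = f \<odot>\<^bsub>B\<^esub> e (Dom1 B f)"
    by (rule L.univ_ex1[OF univ]) (use assms in \<open>auto simp: Hom1_def\<close>)
  from theI'[OF this, folded R1_def]
  show "R1 f \<in> Arr A" "Dom1 A (R1 f) = R (Dom1 B f)" "Cod1 A (R1 f) = R (Cod1 B f)"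
    "Cod1 B f = Y \<Longrightarrow> e Y \<odot>\<^bsub>B\<^esub> F1 L (R1 f) = f \<odot>\<^bsub>B\<^esub> e (Dom1 B f)"
    by (auto simp: Hom1_def)
qed

declare R1(1-3) [simp]

lemma R2:
  assumes "\<sigma> \<in> Cell B"
  shows "R2 \<sigma> \<in> Cell A" "Dom2 A (R2 \<sigma>) = R1 (Dom2 B \<sigma>)" "Cod2 A (R2 \<sigma>) = R1 (Cod2 B \<sigma>)"
    "Cod1 B (Dom2 B \<sigma>) = Y \<Longrightarrow> e Y \<rhd>\<^bsub>B\<^esub> F2 L (R2 \<sigma>) = \<sigma> \<lhd>\<^bsub>B\<^esub> e (Dom1 B (Dom2 B \<sigma>))"
proof -
  have "\<exists>!\<rho>. \<rho> \<in> Hom2 A (R1 (Dom2 B \<sigma>)) (R1 (Cod2 B \<sigma>)) \<and>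
     e (Cod1 B (Dom2 B \<sigma>)) \<rhd>\<^bsub>B\<^esub> F2 L \<rho> = \<sigma> \<lhd>\<^bsub>B\<^esub> e (Dom1 B (Dom2 B \<sigma>))"
    by (rule L.univ_ex2[OF univ, where X = "R (Dom1 B (Dom2 B \<sigma>))"]) (use assms in \<open>auto simp: Hom1_def Hom2_def R1(4)\<close>)
  from theI'[OF this, folded R2_def]
  show "R2 \<sigma> \<in> Cell A" "Dom2 A (R2 \<sigma>) = R1 (Dom2 B \<sigma>)" "Cod2 A (R2 \<sigma>) = R1 (Cod2 B \<sigma>)"
    "Cod1 B (Dom2 B \<sigma>) = Y \<Longrightarrow> e Y \<rhd>\<^bsub>B\<^esub> F2 L (R2 \<sigma>) = \<sigma> \<lhd>\<^bsub>B\<^esub> e (Dom1 B (Dom2 B \<sigma>))"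
    by (auto simp: Hom2_def)
qed

declare R2(1-3) [simp]

lemma un:
  assumes "X \<in> Obj A"
  shows "un X \<in> Arr A" "Dom1 A (un X) = X" "Cod1 A (un X) = R (F0 L X)"
    "e (F0 L X) \<odot>\<^bsub>B\<^esub> F1 L (un X) = Id1 B (F0 L X)"
proof -
  have "\<exists>!g. g \<in> Hom1 A X (R (F0 L X)) \<and> e (F0 L X) \<odot>\<^bsub>B\<^esub> F1 L g = Id1 B (F0 L X)"
    by (rule L.univ_ex1[OF univ]) (use assms in \<open>auto simp: Hom1_def\<close>)
  from theI'[OF this, folded un_def]
  show "un X \<in> Arr A" "Dom1 A (un X) = X" "Cod1 A (un X) = R (F0 L X)"
    "e (F0 L X) \<odot>\<^bsub>B\<^esub> F1 L (un X) = Id1 B (F0 L X)"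
    by (auto simp: Hom1_def)
qed

declare un(1-3) [simp]

text \<open>The defining property of \<open>R1\<close> for right-nested composites, where
  \<open>e Y\<close> and \<open>F1 L (R1 f)\<close> no longer form a subterm of their own.\<close>

lemma e_R1:
  assumes "f \<in> Arr B" "Cod1 B f = Y" "g \<in> Arr B" "Cod1 B g = F0 L (R (Dom1 B f))"
  shows "e Y \<odot>\<^bsub>B\<^esub> (F1 L (R1 f) \<odot>\<^bsub>B\<^esub> g) = f \<odot>\<^bsub>B\<^esub> (e (Dom1 B f) \<odot>\<^bsub>B\<^esub> g)"
proof -
  have "e Y \<odot>\<^bsub>B\<^esub> (F1 L (R1 f) \<odot>\<^bsub>B\<^esub> g) = (e Y \<odot>\<^bsub>B\<^esub> F1 L (R1 f)) \<odot>\<^bsub>B\<^esub> g"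
    using assms by (subst L.B.Comp1_ac) auto
  then show ?thesis using assms R1(4)[of f] by simp
qed

lemma e_un:
  assumes "X \<in> Obj A" "g \<in> Arr B" "Cod1 B g = F0 L X"
  shows "e (F0 L X) \<odot>\<^bsub>B\<^esub> (F1 L (un X) \<odot>\<^bsub>B\<^esub> g) = g"
proof -
  have "e (F0 L X) \<odot>\<^bsub>B\<^esub> (F1 L (un X) \<odot>\<^bsub>B\<^esub> g) = (e (F0 L X) \<odot>\<^bsub>B\<^esub> F1 L (un X)) \<odot>\<^bsub>B\<^esub> g"
    using assms by (subst L.B.Comp1_ac) auto
  then show ?thesis using assms un(4)[of X] by simp
qed

lemma R1_eqI:
  assumes "f \<in> Arr B" "g \<in> Arr A" "Dom1 A g = R (Dom1 B f)" "Cod1 A g = R (Cod1 B f)"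
    "e (Cod1 B f) \<odot>\<^bsub>B\<^esub> F1 L g = f \<odot>\<^bsub>B\<^esub> e (Dom1 B f)"
  shows "R1 f = g"
  by (rule L.univ_eq1[OF univ]) (use assms R1(4) in auto)

lemma R2_eqI:
  assumes "\<sigma> \<in> Cell B" "\<rho> \<in> Cell A" "Dom2 A \<rho> = R1 (Dom2 B \<sigma>)" "Cod2 A \<rho> = R1 (Cod2 B \<sigma>)"
    "e (Cod1 B (Dom2 B \<sigma>)) \<rhd>\<^bsub>B\<^esub> F2 L \<rho> = \<sigma> \<lhd>\<^bsub>B\<^esub> e (Dom1 B (Dom2 B \<sigma>))"
  shows "R2 \<sigma> = \<rho>"
  by (rule L.univ_eq2[OF univ]) (use assms R2(4) in auto)

lemma R1_cmp [simp]:
  assumes "f \<in> Arr B" "g \<in> Arr B" "Cod1 B f = Dom1 B g"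
  shows "R1 (g \<odot>\<^bsub>B\<^esub> f) = R1 g \<odot>\<^bsub>A\<^esub> R1 f"
  by (rule R1_eqI) (use assms in \<open>auto simp: e_R1 R1(4)\<close>)

lemma R1_Id [simp]: "Y \<in> Obj B \<Longrightarrow> R1 (Id1 B Y) = Id1 A (R Y)"
  by (rule R1_eqI) auto

lemma R2_whisk [simp]:
  assumes "\<sigma> \<in> Cell B" "f \<in> Arr B"
  shows "Cod1 B (Dom2 B \<sigma>) = Dom1 B f \<Longrightarrow> R2 (f \<rhd>\<^bsub>B\<^esub> \<sigma>) = R1 f \<rhd>\<^bsub>A\<^esub> R2 \<sigma>"
    "Cod1 B f = Dom1 B (Dom2 B \<sigma>) \<Longrightarrow> R2 (\<sigma> \<lhd>\<^bsub>B\<^esub> f) = R2 \<sigma> \<lhd>\<^bsub>A\<^esub> R1 f"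
proof -
  assume t: "Cod1 B (Dom2 B \<sigma>) = Dom1 B f"
  have "e (Cod1 B f) \<rhd>\<^bsub>B\<^esub> (F1 L (R1 f) \<rhd>\<^bsub>B\<^esub> F2 L (R2 \<sigma>)) = f \<rhd>\<^bsub>B\<^esub> (e (Dom1 B f) \<rhd>\<^bsub>B\<^esub> F2 L (R2 \<sigma>))"
    using assms t by (simp add: R1(4))
  also have "\<dots> = f \<rhd>\<^bsub>B\<^esub> (\<sigma> \<lhd>\<^bsub>B\<^esub> e (Dom1 B (Dom2 B \<sigma>)))" using assms t by (subst R2(4)) auto
  finally show "R2 (f \<rhd>\<^bsub>B\<^esub> \<sigma>) = R1 f \<rhd>\<^bsub>A\<^esub> R2 \<sigma>" using assms t by (intro R2_eqI) auto
next
  assume t: "Cod1 B f = Dom1 B (Dom2 B \<sigma>)"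
  have "e (Cod1 B (Dom2 B \<sigma>)) \<rhd>\<^bsub>B\<^esub> (F2 L (R2 \<sigma>) \<lhd>\<^bsub>B\<^esub> F1 L (R1 f)) =
      (e (Cod1 B (Dom2 B \<sigma>)) \<rhd>\<^bsub>B\<^esub> F2 L (R2 \<sigma>)) \<lhd>\<^bsub>B\<^esub> F1 L (R1 f)" using assms t by simp
  also have "\<dots> = \<sigma> \<lhd>\<^bsub>B\<^esub> (f \<odot>\<^bsub>B\<^esub> e (Dom1 B f))" using assms t by (subst R2(4)) (auto simp: R1(4))
  finally show "R2 (\<sigma> \<lhd>\<^bsub>B\<^esub> f) = R2 \<sigma> \<lhd>\<^bsub>A\<^esub> R1 f" using assms t by (intro R2_eqI) auto
qed

lemma R2_vcmp [simp]:
  assumes "\<sigma> \<in> Cell B" "\<tau> \<in> Cell B" "Cod2 B \<sigma> = Dom2 B \<tau>"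
  shows "R2 (\<tau> \<bullet>\<^bsub>B\<^esub> \<sigma>) = R2 \<tau> \<bullet>\<^bsub>A\<^esub> R2 \<sigma>"
proof -
  \<comment> \<open>The assumption replaces \<open>Cod2 B \<sigma>\<close> by
    \<open>Dom2 B \<tau>\<close>, so \<open>parallel\<close> for \<open>\<sigma>\<close> has to be
    brought in by hand.\<close>
  have *: "Cod1 B (Dom2 B \<tau>) = Cod1 B (Dom2 B \<sigma>)" "Dom1 B (Dom2 B \<tau>) = Dom1 B (Dom2 B \<sigma>)"
    using assms by (metis L.B.parallel)+
  show ?thesis by (rule R2_eqI) (use assms * in \<open>auto simp: R2(4)\<close>)
qed

lemma R2_Id [simp]: "f \<in> Arr B \<Longrightarrow> R2 (Id2 B f) = Id2 A (R1 f)"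
  by (rule R2_eqI) (auto simp: R1(4))

lemma R2_HComp:
  assumes "\<sigma> \<in> Cell B" "\<tau> \<in> Cell B" "Cod1 B (Dom2 B \<sigma>) = Dom1 B (Dom2 B \<tau>)"
  shows "R2 (\<tau> \<star>\<^bsub>B\<^esub> \<sigma>) = R2 \<tau> \<star>\<^bsub>A\<^esub> R2 \<sigma>"
  using assms by (simp add: L.B.HComp_whisk(1) L.A.HComp_whisk(1))

lemma RF_two_functor: "two_functor B A RF"
  by unfold_locales (auto simp: RF_def Hom1_def Hom2_def R2_HComp)

text \<open>After applying \<open>L\<close> and composing with the universal arrow, both sides
  become \<open>F1 L f\<close>.\<close>

lemma un_natural:
  assumes "f \<in> Arr A"
  shows "R1 (F1 L f) \<odot>\<^bsub>A\<^esub> un (Dom1 A f) = un (Cod1 A f) \<odot>\<^bsub>A\<^esub> f"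
  by (rule L.univ_eq1[OF univ[of "F0 L (Cod1 A f)"]]) (use assms in \<open>auto simp: e_R1 e_un un(4)\<close>)

lemma un_natural2:
  assumes "\<sigma> \<in> Cell A"
  shows "R2 (F2 L \<sigma>) \<lhd>\<^bsub>A\<^esub> un (Dom1 A (Dom2 A \<sigma>)) = un (Cod1 A (Dom2 A \<sigma>)) \<rhd>\<^bsub>A\<^esub> \<sigma>"
proof (rule L.univ_eq2[OF univ[of "F0 L (Cod1 A (Dom2 A \<sigma>))"]])
  let ?e = "e (F0 L (Cod1 A (Dom2 A \<sigma>)))" and ?u = "F1 L (un (Dom1 A (Dom2 A \<sigma>)))"
  have "?e \<rhd>\<^bsub>B\<^esub> F2 L (R2 (F2 L \<sigma>) \<lhd>\<^bsub>A\<^esub> un (Dom1 A (Dom2 A \<sigma>))) = (?e \<rhd>\<^bsub>B\<^esub> F2 L (R2 (F2 L \<sigma>))) \<lhd>\<^bsub>B\<^esub> ?u"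
    using assms by simp
  also have "\<dots> = F2 L \<sigma>" using assms by (subst R2(4)) (auto simp: un(4))
  also have "\<dots> = ?e \<rhd>\<^bsub>B\<^esub> F2 L (un (Cod1 A (Dom2 A \<sigma>)) \<rhd>\<^bsub>A\<^esub> \<sigma>)" using assms by (simp add: un(4))
  finally show "?e \<rhd>\<^bsub>B\<^esub> F2 L (R2 (F2 L \<sigma>) \<lhd>\<^bsub>A\<^esub> un (Dom1 A (Dom2 A \<sigma>))) = ?e \<rhd>\<^bsub>B\<^esub> F2 L (un (Cod1 A (Dom2 A \<sigma>)) \<rhd>\<^bsub>A\<^esub> \<sigma>)" .
qed (use assms un_natural[of "Dom2 A \<sigma>"] un_natural[of "Cod2 A \<sigma>"] in auto)

lemma adjunction: "two_adjunction A B L RF un e"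
proof -
  interpret R: two_functor B A RF by (rule RF_two_functor)
  interpret RL: two_functor A A "comp_fun RF L" by (rule two_functor_comp[OF L.two_functor_axioms RF_two_functor])
  interpret LR: two_functor B B "comp_fun L RF" by (rule two_functor_comp[OF RF_two_functor L.two_functor_axioms])
  interpret IA: two_functor A A id_fun by (rule two_functor_id[OF L.A.two_category_axioms])
  interpret IB: two_functor B B id_fun by (rule two_functor_id[OF L.B.two_category_axioms])
  \<comment> \<open>This triangle is cancelled against \<open>e Y\<close>; the other one is the
    defining equation of \<open>un\<close>.\<close>
  have "R1 (e Y) \<odot>\<^bsub>A\<^esub> un (R Y) = Id1 A (R Y)" if "Y \<in> Obj B" for Y
    by (rule L.univ_eq1[OF univ[OF that]]) (use that in \<open>auto simp: e_R1 un(4)\<close>)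
  then show ?thesis
    by unfold_locales
      (auto simp: RF_def id_fun_def comp_fun_def Hom1_def Hom2_def un_natural un_natural2 R1(4) R2(4) un(4))
qed

end

context two_category
begin

lemma Comp1_cancel:
  assumes "g \<odot> f = Id1 D A" "h \<in> Arr D" "f \<in> Arr D" "g \<in> Arr D" "Cod1 D h = A" "Dom1 D f = A" "Cod1 D f = Dom1 D g"
  shows "g \<odot> (f \<odot> h) = h"
  using Comp1_ac[of h f g] assms by simp

end

section \<open>The counit of a 2-adjunction as a universal arrow\<close>

context two_adjunction
begin

lemma u_typ [simp]:
  assumes "X \<in> Obj A"
  shows "u X \<in> Arr A" "Dom1 A (u X) = X" "Cod1 A (u X) = F0 R (F0 L X)"
  using unit.component[OF assms] by (auto simp: Hom1_def id_fun_def comp_fun_def)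

lemma e_typ [simp]:
  assumes "Y \<in> Obj B"
  shows "e Y \<in> Arr B" "Dom1 B (e Y) = F0 L (F0 R Y)" "Cod1 B (e Y) = Y"
  using counit.component[OF assms] by (auto simp: Hom1_def id_fun_def comp_fun_def)

lemma u_nat: "f \<in> Arr A \<Longrightarrow> F1 R (F1 L f) \<odot>\<^bsub>A\<^esub> u (Dom1 A f) = u (Cod1 A f) \<odot>\<^bsub>A\<^esub> f"
  using unit.natural1[of f] by (auto simp: Hom1_def id_fun_def comp_fun_def)

lemma e_nat: "f \<in> Arr B \<Longrightarrow> e (Cod1 B f) \<odot>\<^bsub>B\<^esub> F1 L (F1 R f) = f \<odot>\<^bsub>B\<^esub> e (Dom1 B f)"
  using counit.natural1[of f] by (auto simp: Hom1_def id_fun_def comp_fun_def)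

lemma u_nat2:
  "\<sigma> \<in> Cell A \<Longrightarrow> F2 R (F2 L \<sigma>) \<lhd>\<^bsub>A\<^esub> u (Dom1 A (Dom2 A \<sigma>)) = u (Cod1 A (Dom2 A \<sigma>)) \<rhd>\<^bsub>A\<^esub> \<sigma>"
  using unit.natural2[of "Dom2 A \<sigma>" _ _ \<sigma>] by (auto simp: Hom1_def Hom2_def id_fun_def comp_fun_def)

lemma e_nat2:
  "\<sigma> \<in> Cell B \<Longrightarrow> e (Cod1 B (Dom2 B \<sigma>)) \<rhd>\<^bsub>B\<^esub> F2 L (F2 R \<sigma>) = \<sigma> \<lhd>\<^bsub>B\<^esub> e (Dom1 B (Dom2 B \<sigma>))"
  using counit.natural2[of "Dom2 B \<sigma>" _ _ \<sigma>] by (auto simp: Hom1_def Hom2_def id_fun_def comp_fun_def)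

text \<open>One half of the bijection on 1-cells: naturality of the counit and the triangle on
  \<open>L\<close>. The other half, \<open>transpose_e\<close>, uses the unit and the triangle on
  \<open>R\<close>.\<close>

lemma e_transpose:
  assumes "f \<in> Arr B" "Dom1 B f = F0 L X" "X \<in> Obj A" "Cod1 B f = Y"
  shows "e Y \<odot>\<^bsub>B\<^esub> F1 L (F1 R f \<odot>\<^bsub>A\<^esub> u X) = f"
proof -
  have "e Y \<odot>\<^bsub>B\<^esub> F1 L (F1 R f \<odot>\<^bsub>A\<^esub> u X) = (e Y \<odot>\<^bsub>B\<^esub> F1 L (F1 R f)) \<odot>\<^bsub>B\<^esub> F1 L (u X)" using assms by auto
  also have "\<dots> = f" using assms e_nat[of f] by (simp add: triangle_L)
  finally show ?thesis .
qed

lemma transpose_e: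
  assumes "g \<in> Arr A" "Dom1 A g = X" "Cod1 A g = F0 R Y" "Y \<in> Obj B"
  shows "F1 R (e Y \<odot>\<^bsub>B\<^esub> F1 L g) \<odot>\<^bsub>A\<^esub> u X = g"
proof -
  have "F1 R (e Y \<odot>\<^bsub>B\<^esub> F1 L g) \<odot>\<^bsub>A\<^esub> u X = F1 R (e Y) \<odot>\<^bsub>A\<^esub> (F1 R (F1 L g) \<odot>\<^bsub>A\<^esub> u X)" using assms by auto
  also have "\<dots> = F1 R (e Y) \<odot>\<^bsub>A\<^esub> (u (F0 R Y) \<odot>\<^bsub>A\<^esub> g)" using assms u_nat[of g] by simp
  also have "\<dots> = g" using assms by (intro L.A.Comp1_cancel[OF triangle_R]) auto
  finally show ?thesis .
qed

lemma counit_univ: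
  assumes Y: "Y \<in> Obj B"
  shows "univ_arrow A B L Y (F0 R Y) (e Y)"
proof -
  have 1: "\<exists>!g. g \<in> Hom1 A X (F0 R Y) \<and> e Y \<odot>\<^bsub>B\<^esub> F1 L g = f"
    if "X \<in> Obj A" "f \<in> Hom1 B (F0 L X) Y" for X f
  proof (rule ex1I[of _ "F1 R f \<odot>\<^bsub>A\<^esub> u X"])
    show "F1 R f \<odot>\<^bsub>A\<^esub> u X \<in> Hom1 A X (F0 R Y) \<and> e Y \<odot>\<^bsub>B\<^esub> F1 L (F1 R f \<odot>\<^bsub>A\<^esub> u X) = f"
      using that Y e_transpose[of f X Y] by (auto simp: Hom1_def)
    fix g assume "g \<in> Hom1 A X (F0 R Y) \<and> e Y \<odot>\<^bsub>B\<^esub> F1 L g = f"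
    then show "g = F1 R f \<odot>\<^bsub>A\<^esub> u X" using transpose_e[of g X Y] Y by (auto simp: Hom1_def)
  qed
  have 2: "\<exists>!\<rho>. \<rho> \<in> Hom2 A g h \<and> e Y \<rhd>\<^bsub>B\<^esub> F2 L \<rho> = \<sigma>"
    if g: "g \<in> Hom1 A X (F0 R Y)" and h: "h \<in> Hom1 A X (F0 R Y)"
      and \<sigma>: "\<sigma> \<in> Hom2 B (e Y \<odot>\<^bsub>B\<^esub> F1 L g) (e Y \<odot>\<^bsub>B\<^esub> F1 L h)" for X g h \<sigma>
  \<comment> \<open>The transpose of \<open>\<sigma>\<close>, built like the transpose
    \<open>F1 R f \<odot> u X\<close> of a 1-cell.\<close>
  proof (rule ex1I[of _ "F2 R \<sigma> \<lhd>\<^bsub>A\<^esub> u X"])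
    have X: "X \<in> Obj A" "g \<in> Arr A" "h \<in> Arr A" "Dom1 A g = X" "Cod1 A g = F0 R Y" "Dom1 A h = X" "Cod1 A h = F0 R Y"
      using g h by (auto simp: Hom1_def)
    have \<sigma>': "\<sigma> \<in> Cell B" "Dom2 B \<sigma> = e Y \<odot>\<^bsub>B\<^esub> F1 L g" "Cod2 B \<sigma> = e Y \<odot>\<^bsub>B\<^esub> F1 L h"
      using \<sigma> by (auto simp: Hom2_def)
    have "F2 R \<sigma> \<lhd>\<^bsub>A\<^esub> u X \<in> Hom2 A g h"
      using X Y \<sigma>' transpose_e[of g X Y] transpose_e[of h X Y] by (auto simp: Hom2_def)
    moreover have "e Y \<rhd>\<^bsub>B\<^esub> F2 L (F2 R \<sigma> \<lhd>\<^bsub>A\<^esub> u X) = (e Y \<rhd>\<^bsub>B\<^esub> F2 L (F2 R \<sigma>)) \<lhd>\<^bsub>B\<^esub> F1 L (u X)"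
      using X Y \<sigma>' by simp
    moreover have "\<dots> = \<sigma>" using e_nat2[of \<sigma>] X Y \<sigma>' triangle_L[of X] by (simp)
    ultimately show "F2 R \<sigma> \<lhd>\<^bsub>A\<^esub> u X \<in> Hom2 A g h \<and> e Y \<rhd>\<^bsub>B\<^esub> F2 L (F2 R \<sigma> \<lhd>\<^bsub>A\<^esub> u X) = \<sigma>" by simp
    fix \<rho> assume \<rho>: "\<rho> \<in> Hom2 A g h \<and> e Y \<rhd>\<^bsub>B\<^esub> F2 L \<rho> = \<sigma>"
    then have \<rho>': "\<rho> \<in> Cell A" "Dom2 A \<rho> = g" "Cod2 A \<rho> = h" by (auto simp: Hom2_def)
    have "F2 R (e Y \<rhd>\<^bsub>B\<^esub> F2 L \<rho>) \<lhd>\<^bsub>A\<^esub> u X = F1 R (e Y) \<rhd>\<^bsub>A\<^esub> (F2 R (F2 L \<rho>) \<lhd>\<^bsub>A\<^esub> u X)"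
      using X Y \<rho>' by simp
    also have "\<dots> = (F1 R (e Y) \<odot>\<^bsub>A\<^esub> u (F0 R Y)) \<rhd>\<^bsub>A\<^esub> \<rho>" using X Y \<rho>' u_nat2[of \<rho>] by simp
    also have "\<dots> = \<rho>" using X Y \<rho>' by (simp add: triangle_R)
    finally show "\<rho> = F2 R \<sigma> \<lhd>\<^bsub>A\<^esub> u X" using \<rho> by simp
  qed
  show ?thesis
    using Y 1 2 unfolding univ_arrow_def by (auto simp: Hom1_def)
qed

end

text \<open>Precomposing with an isomorphism of 0-cells changes nothing in a universal property.
  This is how a conveniently constructed universal arrow and the counit of an arbitrary adjunction
  are compared.\<close>

lemma (in two_functor) univ_iso:
  assumes e: "univ_arrow A B G Y R e" and "i \<in> Arr A" "j \<in> Arr A" "Cod1 A i = R" "Dom1 A i = R'" "Cod1 A j = R'" "Dom1 A j = R"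
    "i \<odot>\<^bsub>A\<^esub> j = Id1 A R" "j \<odot>\<^bsub>A\<^esub> i = Id1 A R'"
  shows "univ_arrow A B G Y R' (e \<odot>\<^bsub>B\<^esub> F1 G i)"
proof -
  note t = assms(2-) univ_arrowD[OF e]
  have c: "i \<odot>\<^bsub>A\<^esub> (j \<odot>\<^bsub>A\<^esub> g) = g" if "g \<in> Arr A" "Cod1 A g = R" for g
    using A.Comp1_cancel[of i j R g] that t by simp
  have c': "j \<odot>\<^bsub>A\<^esub> (i \<odot>\<^bsub>A\<^esub> g) = g" if "g \<in> Arr A" "Cod1 A g = R'" for g
    using A.Comp1_cancel[of j i R' g] that t by simp
  have 1: "\<exists>!g. g \<in> Hom1 A X R' \<and> (e \<odot>\<^bsub>B\<^esub> F1 G i) \<odot>\<^bsub>B\<^esub> F1 G g = f"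
    if Xf: "X \<in> Obj A" "f \<in> Hom1 B (F0 G X) Y" for X f
  proof -
    obtain g where g: "g \<in> Arr A" "Dom1 A g = X" "Cod1 A g = R" "e \<odot>\<^bsub>B\<^esub> F1 G g = f"
      using univ_ex1[OF e Xf] by (auto simp: Hom1_def)
    show ?thesis
    proof (rule ex1I[of _ "j \<odot>\<^bsub>A\<^esub> g"])
      show "j \<odot>\<^bsub>A\<^esub> g \<in> Hom1 A X R' \<and> (e \<odot>\<^bsub>B\<^esub> F1 G i) \<odot>\<^bsub>B\<^esub> F1 G (j \<odot>\<^bsub>A\<^esub> g) = f"
        using g t F1_cmp[of "j \<odot>\<^bsub>A\<^esub> g" i] c[of g] by (auto simp: Hom1_def)
    next
      fix h assume h: "h \<in> Hom1 A X R' \<and> (e \<odot>\<^bsub>B\<^esub> F1 G i) \<odot>\<^bsub>B\<^esub> F1 G h = f"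
      have "i \<odot>\<^bsub>A\<^esub> h = g" by (rule univ_eq1[OF e]) (use h g t in \<open>auto simp: Hom1_def\<close>)
      then show "h = j \<odot>\<^bsub>A\<^esub> g" using c'[of h] h by (auto simp: Hom1_def)
    qed
  qed
  have 2: "\<exists>!\<rho>. \<rho> \<in> Hom2 A g h \<and> (e \<odot>\<^bsub>B\<^esub> F1 G i) \<rhd>\<^bsub>B\<^esub> F2 G \<rho> = \<sigma>"
    if g: "g \<in> Hom1 A X R'" and h: "h \<in> Hom1 A X R'"
      and \<sigma>: "\<sigma> \<in> Hom2 B ((e \<odot>\<^bsub>B\<^esub> F1 G i) \<odot>\<^bsub>B\<^esub> F1 G g) ((e \<odot>\<^bsub>B\<^esub> F1 G i) \<odot>\<^bsub>B\<^esub> F1 G h)" for X g h \<sigma>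
  proof -
    have gh: "g \<in> Arr A" "h \<in> Arr A" "Dom1 A g = X" "Cod1 A g = R'" "Dom1 A h = X" "Cod1 A h = R'"
      using g h by (auto simp: Hom1_def)
    have "\<exists>!\<rho>. \<rho> \<in> Hom2 A (i \<odot>\<^bsub>A\<^esub> g) (i \<odot>\<^bsub>A\<^esub> h) \<and> e \<rhd>\<^bsub>B\<^esub> F2 G \<rho> = \<sigma>"
      by (rule univ_ex2[OF e, where X = X]) (use gh \<sigma> t in \<open>auto simp: Hom1_def Hom2_def\<close>)
    then obtain \<rho> where \<rho>: "\<rho> \<in> Cell A" "Dom2 A \<rho> = i \<odot>\<^bsub>A\<^esub> g" "Cod2 A \<rho> = i \<odot>\<^bsub>A\<^esub> h" "e \<rhd>\<^bsub>B\<^esub> F2 G \<rho> = \<sigma>"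
      by (auto simp: Hom2_def)
    have "e \<odot>\<^bsub>B\<^esub> (F1 G i \<odot>\<^bsub>B\<^esub> F1 G j) = e" using t F1_cmp[of j i, symmetric] by (simp del: F1_cmp)
    then have "(e \<odot>\<^bsub>B\<^esub> F1 G i) \<rhd>\<^bsub>B\<^esub> F2 G (j \<rhd>\<^bsub>A\<^esub> \<rho>) = \<sigma>" using \<rho> t gh by simp
    moreover have "j \<rhd>\<^bsub>A\<^esub> \<rho> \<in> Hom2 A g h" using \<rho> t gh c' by (simp add: Hom2_def)
    moreover have "\<rho>' = j \<rhd>\<^bsub>A\<^esub> \<rho>" if \<rho>': "\<rho>' \<in> Hom2 A g h" "(e \<odot>\<^bsub>B\<^esub> F1 G i) \<rhd>\<^bsub>B\<^esub> F2 G \<rho>' = \<sigma>" for \<rho>'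
    proof -
      have "i \<rhd>\<^bsub>A\<^esub> \<rho>' = \<rho>" by (rule univ_eq2[OF e]) (use \<rho>' \<rho> t gh in \<open>auto simp: Hom2_def\<close>)
      moreover have "j \<rhd>\<^bsub>A\<^esub> (i \<rhd>\<^bsub>A\<^esub> \<rho>') = \<rho>'" using \<rho>' t gh by (simp add: Hom2_def)
      ultimately show ?thesis by simp
    qed
    ultimately show ?thesis by blast
  qed
  show ?thesis unfolding univ_arrow_def using t 1 2 by (auto simp: Hom1_def)
qed

lemma (in two_functor) univ_unique:
  assumes e: "univ_arrow A B G Y R e" and e': "univ_arrow A B G Y R' e'"
  obtains i j where "i \<in> Arr A" "j \<in> Arr A" "Cod1 A i = R" "Dom1 A i = R'" "Cod1 A j = R'" "Dom1 A j = R"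
    "i \<odot>\<^bsub>A\<^esub> j = Id1 A R" "j \<odot>\<^bsub>A\<^esub> i = Id1 A R'" "e \<odot>\<^bsub>B\<^esub> F1 G i = e'"
proof -
  note t = univ_arrowD[OF e] univ_arrowD[OF e']
  obtain i where i: "i \<in> Arr A" "Cod1 A i = R" "Dom1 A i = R'" "e \<odot>\<^bsub>B\<^esub> F1 G i = e'"
    using univ_ex1[OF e, of R' e'] t by (auto simp: Hom1_def)
  obtain j where j: "j \<in> Arr A" "Cod1 A j = R'" "Dom1 A j = R" "e' \<odot>\<^bsub>B\<^esub> F1 G j = e"
    using univ_ex1[OF e', of R e] t by (auto simp: Hom1_def)
  have "e \<odot>\<^bsub>B\<^esub> (F1 G i \<odot>\<^bsub>B\<^esub> F1 G j) = e" using B.Comp1_ac[of "F1 G j" "F1 G i" e] i j t by simp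
  then have 1: "i \<odot>\<^bsub>A\<^esub> j = Id1 A R" by (intro univ_eq1[OF e]) (use i j t in auto)
  have "e' \<odot>\<^bsub>B\<^esub> (F1 G j \<odot>\<^bsub>B\<^esub> F1 G i) = e'" using B.Comp1_ac[of "F1 G i" "F1 G j" e'] i j t by simp
  then have 2: "j \<odot>\<^bsub>A\<^esub> i = Id1 A R'" by (intro univ_eq1[OF e']) (use i j t in auto)
  show ?thesis using that i j 1 2 by blast
qed

text \<open>Pointwise inverses suffice: conjugating the naturality squares of
  \<open>\<theta>\<close> by \<open>\<theta>'\<close> gives those of \<open>\<theta>'\<close>, on
  1-cells as well as on 2-cells.\<close>

lemma two_nat_isoI:
  assumes \<theta>: "two_nat A B F G \<theta>" and
    inv: "\<And>X. X \<in> Obj A \<Longrightarrow> \<theta>' X \<in> Hom1 B (F0 G X) (F0 F X)"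
      "\<And>X. X \<in> Obj A \<Longrightarrow> \<theta>' X \<odot>\<^bsub>B\<^esub> \<theta> X = Id1 B (F0 F X)"
      "\<And>X. X \<in> Obj A \<Longrightarrow> \<theta> X \<odot>\<^bsub>B\<^esub> \<theta>' X = Id1 B (F0 G X)"
  shows "two_nat_iso A B F G \<theta>"
proof -
  interpret two_nat A B F G \<theta> by fact
  have t [simp]: "\<theta> X \<in> Arr B" "Dom1 B (\<theta> X) = F0 F X" "Cod1 B (\<theta> X) = F0 G X"
    "\<theta>' X \<in> Arr B" "Dom1 B (\<theta>' X) = F0 G X" "Cod1 B (\<theta>' X) = F0 F X" if "X \<in> Obj A" for X
    using component[OF that] inv(1)[OF that] by (auto simp: Hom1_def)
  have n1: "F1 F f \<odot>\<^bsub>B\<^esub> \<theta>' (Dom1 A f) = \<theta>' (Cod1 A f) \<odot>\<^bsub>B\<^esub> F1 G f" if "f \<in> Arr A" for f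
  proof -
    have "F1 F f \<odot>\<^bsub>B\<^esub> \<theta>' (Dom1 A f) = \<theta>' (Cod1 A f) \<odot>\<^bsub>B\<^esub> (\<theta> (Cod1 A f) \<odot>\<^bsub>B\<^esub> (F1 F f \<odot>\<^bsub>B\<^esub> \<theta>' (Dom1 A f)))"
      using that F.B.Comp1_cancel[OF inv(2)[of "Cod1 A f"], of "F1 F f \<odot>\<^bsub>B\<^esub> \<theta>' (Dom1 A f)"] by simp
    also have "\<dots> = \<theta>' (Cod1 A f) \<odot>\<^bsub>B\<^esub> ((F1 G f \<odot>\<^bsub>B\<^esub> \<theta> (Dom1 A f)) \<odot>\<^bsub>B\<^esub> \<theta>' (Dom1 A f))"
      using that natural1[of f] by (simp add: Hom1_def)
    also have "\<dots> = \<theta>' (Cod1 A f) \<odot>\<^bsub>B\<^esub> F1 G f" using that inv(3) by simp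
    finally show ?thesis .
  qed
  have n2: "F2 F \<sigma> \<lhd>\<^bsub>B\<^esub> \<theta>' (Dom1 A (Dom2 A \<sigma>)) = \<theta>' (Cod1 A (Dom2 A \<sigma>)) \<rhd>\<^bsub>B\<^esub> F2 G \<sigma>" if "\<sigma> \<in> Cell A" for \<sigma>
  proof -
    let ?X = "Dom1 A (Dom2 A \<sigma>)" and ?Y = "Cod1 A (Dom2 A \<sigma>)"
    have "F2 F \<sigma> \<lhd>\<^bsub>B\<^esub> \<theta>' ?X = (\<theta>' ?Y \<odot>\<^bsub>B\<^esub> \<theta> ?Y) \<rhd>\<^bsub>B\<^esub> (F2 F \<sigma> \<lhd>\<^bsub>B\<^esub> \<theta>' ?X)" using that inv(2) by simp
    also have "\<dots> = \<theta>' ?Y \<rhd>\<^bsub>B\<^esub> ((\<theta> ?Y \<rhd>\<^bsub>B\<^esub> F2 F \<sigma>) \<lhd>\<^bsub>B\<^esub> \<theta>' ?X)"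
      using that by (simp del: inv(2))
    also have "\<theta> ?Y \<rhd>\<^bsub>B\<^esub> F2 F \<sigma> = F2 G \<sigma> \<lhd>\<^bsub>B\<^esub> \<theta> ?X"
      using that natural2[of "Dom2 A \<sigma>" _ _ \<sigma>] by (simp add: Hom1_def Hom2_def)
    also have "\<theta>' ?Y \<rhd>\<^bsub>B\<^esub> ((F2 G \<sigma> \<lhd>\<^bsub>B\<^esub> \<theta> ?X) \<lhd>\<^bsub>B\<^esub> \<theta>' ?X) = \<theta>' ?Y \<rhd>\<^bsub>B\<^esub> F2 G \<sigma>"
      using that inv(3) by simp
    finally show ?thesis .
  qed
  have "two_nat A B G F \<theta>'"
    by unfold_locales (auto simp: inv(1) n1 n2 Hom1_def Hom2_def)
  then show ?thesis unfolding two_nat_iso_def using \<theta> inv by blast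
qed

text \<open>Both adjunctions are arbitrary, whereas \<open>preserved\<close> speaks of some
  universal arrow over \<open>Y\<close>. So it can be verified on a specific construction that has
  nothing to do with the given counit.\<close>

locale adjunction_square =
  X: two_adjunction A B L R u e + X': two_adjunction A' B' L' R' u' e' +
  G: two_functor A A' G + H: two_functor B B' H
  for A :: "('o, 'a, 'c) two_cat" and B :: "('p, 'b, 'd) two_cat" and L R u e
    and A' :: "('o2, 'a2, 'c2) two_cat" and B' :: "('p2, 'b2, 'd2) two_cat" and L' R' u' e' G H +
  assumes comm0: "X \<in> Obj A \<Longrightarrow> F0 H (F0 L X) = F0 L' (F0 G X)"
    and comm1: "f \<in> Arr A \<Longrightarrow> F1 H (F1 L f) = F1 L' (F1 G f)"
    and comm2: "\<sigma> \<in> Cell A \<Longrightarrow> F2 H (F2 L \<sigma>) = F2 L' (F2 G \<sigma>)"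
    and preserved: "Y \<in> Obj B \<Longrightarrow> \<exists>R0 e0. univ_arrow A B L Y R0 e0 \<and> univ_arrow A' B' L' (F0 H Y) (F0 G R0) (F1 H e0)"
begin

abbreviation m where "m \<equiv> mate R' u' A' R e G H"

text \<open>The preserved arrow and the counit differ by an isomorphism \<open>i\<close> of
  \<open>A\<close>; its image under \<open>G\<close> is an isomorphism too, and universality is
  transported along it.\<close>

lemma counit_preserved:
  assumes Y: "Y \<in> Obj B"
  shows "univ_arrow A' B' L' (F0 H Y) (F0 G (F0 R Y)) (F1 H (e Y))"
proof -
  obtain R0 e0 where u: "univ_arrow A B L Y R0 e0" "univ_arrow A' B' L' (F0 H Y) (F0 G R0) (F1 H e0)"
    using preserved[OF Y] by blast
  obtain i j where ij: "i \<in> Arr A" "j \<in> Arr A" "Cod1 A i = R0" "Dom1 A i = F0 R Y" "Cod1 A j = F0 R Y" "Dom1 A j = R0"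
    "i \<odot>\<^bsub>A\<^esub> j = Id1 A R0" "j \<odot>\<^bsub>A\<^esub> i = Id1 A (F0 R Y)" "e0 \<odot>\<^bsub>B\<^esub> F1 L i = e Y"
    using X.L.univ_unique[OF u(1) X.counit_univ[OF Y]] by blast
  have "univ_arrow A' B' L' (F0 H Y) (F0 G (F0 R Y)) (F1 H e0 \<odot>\<^bsub>B'\<^esub> F1 L' (F1 G i))"
    by (rule X'.L.univ_iso[OF u(2), where j = "F1 G j"])
      (use ij Y G.F1_cmp[of i j] G.F1_cmp[of j i] univ_arrowD[OF u(1)] in auto)
  moreover have "F1 H e0 \<odot>\<^bsub>B'\<^esub> F1 L' (F1 G i) = F1 H (e Y)"
    using ij H.F1_cmp[of "F1 L i" e0] comm1[of i] univ_arrowD[OF u(1)] by simp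
  ultimately show ?thesis by simp
qed

lemma m_typ [simp]:
  assumes "Y \<in> Obj B"
  shows "m Y \<in> Arr A'" "Dom1 A' (m Y) = F0 G (F0 R Y)" "Cod1 A' (m Y) = F0 R' (F0 H Y)"
  using assms by (simp_all add: mate_def comm0)

text \<open>The mate is the transpose of \<open>F1 H (e Y)\<close>. Beyond typing, this equation is
  all that naturality and invertibility of the mate rest on.\<close>

lemma e_m: "Y \<in> Obj B \<Longrightarrow> e' (F0 H Y) \<odot>\<^bsub>B'\<^esub> F1 L' (m Y) = F1 H (e Y)"
  unfolding mate_def by (rule X'.e_transpose) (auto simp: comm0)

lemma m_natural1:
  assumes f: "f \<in> Arr B"
  shows "F1 R' (F1 H f) \<odot>\<^bsub>A'\<^esub> m (Dom1 B f) = m (Cod1 B f) \<odot>\<^bsub>A'\<^esub> F1 G (F1 R f)"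
proof (rule X'.L.univ_eq1[OF X'.counit_univ[of "F0 H (Cod1 B f)"]])
  let ?e = "e' (F0 H (Cod1 B f))"
  have "?e \<odot>\<^bsub>B'\<^esub> F1 L' (F1 R' (F1 H f) \<odot>\<^bsub>A'\<^esub> m (Dom1 B f)) = (?e \<odot>\<^bsub>B'\<^esub> F1 L' (F1 R' (F1 H f))) \<odot>\<^bsub>B'\<^esub> F1 L' (m (Dom1 B f))"
    using f by simp
  also have "\<dots> = F1 H f \<odot>\<^bsub>B'\<^esub> F1 H (e (Dom1 B f))"
    using f X'.e_nat[of "F1 H f"] by (simp add: e_m)
  also have "\<dots> = F1 H (f \<odot>\<^bsub>B\<^esub> e (Dom1 B f))" using f by simp
  also have "\<dots> = F1 H (e (Cod1 B f) \<odot>\<^bsub>B\<^esub> F1 L (F1 R f))" using f X.e_nat[of f] by simp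
  also have "\<dots> = (?e \<odot>\<^bsub>B'\<^esub> F1 L' (m (Cod1 B f))) \<odot>\<^bsub>B'\<^esub> F1 L' (F1 G (F1 R f))"
    using f comm1 by (simp add: e_m)
  also have "\<dots> = ?e \<odot>\<^bsub>B'\<^esub> F1 L' (m (Cod1 B f) \<odot>\<^bsub>A'\<^esub> F1 G (F1 R f))" using f by simp
  finally show "?e \<odot>\<^bsub>B'\<^esub> F1 L' (F1 R' (F1 H f) \<odot>\<^bsub>A'\<^esub> m (Dom1 B f)) = \<dots>" .
qed (use f in auto)

lemma m_natural2:
  assumes f: "\<sigma> \<in> Cell B"
  shows "F2 R' (F2 H \<sigma>) \<lhd>\<^bsub>A'\<^esub> m (Dom1 B (Dom2 B \<sigma>)) = m (Cod1 B (Dom2 B \<sigma>)) \<rhd>\<^bsub>A'\<^esub> F2 G (F2 R \<sigma>)"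
proof (rule X'.L.univ_eq2[OF X'.counit_univ[of "F0 H (Cod1 B (Dom2 B \<sigma>))"]])
  let ?X = "Dom1 B (Dom2 B \<sigma>)" and ?Y = "Cod1 B (Dom2 B \<sigma>)"
  let ?e = "e' (F0 H ?Y)"
  have "?e \<rhd>\<^bsub>B'\<^esub> F2 L' (F2 R' (F2 H \<sigma>) \<lhd>\<^bsub>A'\<^esub> m ?X) = (?e \<rhd>\<^bsub>B'\<^esub> F2 L' (F2 R' (F2 H \<sigma>))) \<lhd>\<^bsub>B'\<^esub> F1 L' (m ?X)"
    using f by simp
  also have "\<dots> = F2 H \<sigma> \<lhd>\<^bsub>B'\<^esub> F1 H (e ?X)"
    using f X'.e_nat2[of "F2 H \<sigma>"] by (simp add: e_m)
  also have "\<dots> = F2 H (\<sigma> \<lhd>\<^bsub>B\<^esub> e ?X)" using f by simp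
  also have "\<dots> = F2 H (e ?Y \<rhd>\<^bsub>B\<^esub> F2 L (F2 R \<sigma>))" using f X.e_nat2[of \<sigma>] by simp
  also have "\<dots> = (?e \<odot>\<^bsub>B'\<^esub> F1 L' (m ?Y)) \<rhd>\<^bsub>B'\<^esub> F2 L' (F2 G (F2 R \<sigma>))"
    using f comm2 by (simp add: e_m)
  also have "\<dots> = ?e \<rhd>\<^bsub>B'\<^esub> F2 L' (m ?Y \<rhd>\<^bsub>A'\<^esub> F2 G (F2 R \<sigma>))" using f by simp
  finally show "?e \<rhd>\<^bsub>B'\<^esub> F2 L' (F2 R' (F2 H \<sigma>) \<lhd>\<^bsub>A'\<^esub> m ?X) = \<dots>" .
qed (use f m_natural1[of "Dom2 B \<sigma>"] m_natural1[of "Cod2 B \<sigma>"] in auto)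

lemma mate_iso: "two_nat_iso B A' (comp_fun G R) (comp_fun R' H) m"
proof -
  \<comment> \<open>Both \<open>e' (F0 H Y)\<close> and \<open>F1 H (e Y)\<close> are universal over
    \<open>F0 H Y\<close>; the candidate inverse factors the former through the latter.\<close>
  define n where "n Y = (THE n. n \<in> Hom1 A' (F0 R' (F0 H Y)) (F0 G (F0 R Y)) \<and> F1 H (e Y) \<odot>\<^bsub>B'\<^esub> F1 L' n = e' (F0 H Y))" for Y
  have n: "n Y \<in> Hom1 A' (F0 R' (F0 H Y)) (F0 G (F0 R Y)) \<and> F1 H (e Y) \<odot>\<^bsub>B'\<^esub> F1 L' (n Y) = e' (F0 H Y)"
    if "Y \<in> Obj B" for Y
    unfolding n_def by (rule theI', rule X'.L.univ_ex1[OF counit_preserved]) (use that in \<open>auto simp: Hom1_def\<close>)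
  then have n' [simp]: "n Y \<in> Arr A'" "Dom1 A' (n Y) = F0 R' (F0 H Y)" "Cod1 A' (n Y) = F0 G (F0 R Y)"
    if "Y \<in> Obj B" for Y using that by (auto simp: Hom1_def)
  have t: "F0 L' (F0 G (F0 R Y)) = F0 H (F0 L (F0 R Y))" if "Y \<in> Obj B" for Y using comm0 that by simp
  show ?thesis
  proof (rule two_nat_isoI[where \<theta>' = n])
    interpret GR: two_functor B A' "comp_fun G R" by (rule two_functor_comp[OF X.R.two_functor_axioms G.two_functor_axioms])
    interpret RH: two_functor B A' "comp_fun R' H" by (rule two_functor_comp[OF H.two_functor_axioms X'.R.two_functor_axioms])
    show "two_nat B A' (comp_fun G R) (comp_fun R' H) m"
      by unfold_locales (auto simp: comp_fun_def Hom1_def Hom2_def m_natural1 m_natural2)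
    fix Y assume Y: "Y \<in> Obj B"
    show "n Y \<in> Hom1 A' (F0 (comp_fun R' H) Y) (F0 (comp_fun G R) Y)" using n[OF Y] by (simp add: comp_fun_def)
    have "n Y \<odot>\<^bsub>A'\<^esub> m Y = Id1 A' (F0 G (F0 R Y))"
    proof (rule X'.L.univ_eq1[OF counit_preserved[OF Y]])
      have "F1 H (e Y) \<odot>\<^bsub>B'\<^esub> F1 L' (n Y \<odot>\<^bsub>A'\<^esub> m Y) = (F1 H (e Y) \<odot>\<^bsub>B'\<^esub> F1 L' (n Y)) \<odot>\<^bsub>B'\<^esub> F1 L' (m Y)"
        using Y t by simp
      also have "\<dots> = F1 H (e Y) \<odot>\<^bsub>B'\<^esub> F1 L' (Id1 A' (F0 G (F0 R Y)))" using Y n e_m t by simp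
      finally show "F1 H (e Y) \<odot>\<^bsub>B'\<^esub> F1 L' (n Y \<odot>\<^bsub>A'\<^esub> m Y) = \<dots>" .
    qed (use Y in auto)
    then show "n Y \<odot>\<^bsub>A'\<^esub> m Y = Id1 A' (F0 (comp_fun G R) Y)" by (simp add: comp_fun_def)
    have "m Y \<odot>\<^bsub>A'\<^esub> n Y = Id1 A' (F0 R' (F0 H Y))"
    proof (rule X'.L.univ_eq1[OF X'.counit_univ[of "F0 H Y"]])
      have "e' (F0 H Y) \<odot>\<^bsub>B'\<^esub> F1 L' (m Y \<odot>\<^bsub>A'\<^esub> n Y) = (e' (F0 H Y) \<odot>\<^bsub>B'\<^esub> F1 L' (m Y)) \<odot>\<^bsub>B'\<^esub> F1 L' (n Y)"
        using Y by simp
      also have "\<dots> = e' (F0 H Y) \<odot>\<^bsub>B'\<^esub> F1 L' (Id1 A' (F0 R' (F0 H Y)))" using Y n e_m by simp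
      finally show "e' (F0 H Y) \<odot>\<^bsub>B'\<^esub> F1 L' (m Y \<odot>\<^bsub>A'\<^esub> n Y) = \<dots>" .
    qed (use Y in auto)
    then show "m Y \<odot>\<^bsub>A'\<^esub> n Y = Id1 A' (F0 (comp_fun R' H) Y)" by (simp add: comp_fun_def)
  qed
qed

end

section \<open>Monads, algebras and EM objects\<close>

text \<open>Selectors in place of a case distinction, so that the laws apply to a morphism that is
  not displayed as a constructor term.\<close>

lemma lax_monad_mor_sel:
  "lax_monad_mor D f \<longleftrightarrow>
     mstr f \<in> Hom2 D (mend (mcod f) \<odot>\<^bsub>D\<^esub> mfun f) (mfun f \<odot>\<^bsub>D\<^esub> mend (mdom f)) \<and>
     mstr f \<bullet>\<^bsub>D\<^esub> (munit (mcod f) \<lhd>\<^bsub>D\<^esub> mfun f) = mfun f \<rhd>\<^bsub>D\<^esub> munit (mdom f) \<and>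
     mstr f \<bullet>\<^bsub>D\<^esub> (mmult (mcod f) \<lhd>\<^bsub>D\<^esub> mfun f) =
       (mfun f \<rhd>\<^bsub>D\<^esub> mmult (mdom f)) \<bullet>\<^bsub>D\<^esub> (mstr f \<lhd>\<^bsub>D\<^esub> mend (mdom f)) \<bullet>\<^bsub>D\<^esub> (mend (mcod f) \<rhd>\<^bsub>D\<^esub> mstr f)"
  by (auto simp: lax_monad_mor_def split: mor.split monad.split)

lemma is_monad_sel:
  "is_monad D M \<longleftrightarrow> mob M \<in> Obj D \<and> mend M \<in> Arr D \<and> Dom1 D (mend M) = mob M \<and> Cod1 D (mend M) = mob M \<and>
     munit M \<in> Cell D \<and> Dom2 D (munit M) = Id1 D (mob M) \<and> Cod2 D (munit M) = mend M \<and>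
     mmult M \<in> Cell D \<and> Dom2 D (mmult M) = mend M \<odot>\<^bsub>D\<^esub> mend M \<and> Cod2 D (mmult M) = mend M \<and>
     mmult M \<bullet>\<^bsub>D\<^esub> (munit M \<lhd>\<^bsub>D\<^esub> mend M) = Id2 D (mend M) \<and>
     mmult M \<bullet>\<^bsub>D\<^esub> (mend M \<rhd>\<^bsub>D\<^esub> munit M) = Id2 D (mend M) \<and>
     mmult M \<bullet>\<^bsub>D\<^esub> (mmult M \<lhd>\<^bsub>D\<^esub> mend M) = mmult M \<bullet>\<^bsub>D\<^esub> (mend M \<rhd>\<^bsub>D\<^esub> mmult M)"
  by (auto simp: is_monad_def Hom1_def Hom2_def split: monad.split)

section \<open>The 2-category of monads and lax morphisms\<close>

context two_category
begin

text \<open>Use the law of \<open>\<tau>'\<close> whiskered by \<open>F\<close>, then the law of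
  \<open>\<tau>\<close> under \<open>G\<close>. For the multiplications one interchange
  (\<open>sw\<close>) is left, which reorders the two middle cells.\<close>

lemma lax_comp_eqs:
  assumes ty: "F \<in> Arr D" "G \<in> Arr D" "S \<in> Arr D" "S' \<in> Arr D" "S'' \<in> Arr D"
    "Dom1 D F = C" "Cod1 D F = C'" "Dom1 D G = C'" "Cod1 D G = C''"
    "Dom1 D S = C" "Cod1 D S = C" "Dom1 D S' = C'" "Cod1 D S' = C'" "Dom1 D S'' = C''" "Cod1 D S'' = C''"
    "\<tau> \<in> Cell D" "Dom2 D \<tau> = S' \<odot> F" "Cod2 D \<tau> = F \<odot> S"
    "\<tau>' \<in> Cell D" "Dom2 D \<tau>' = S'' \<odot> G" "Cod2 D \<tau>' = G \<odot> S'"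
    "\<eta> \<in> Cell D" "Dom2 D \<eta> = Id1 D C" "Cod2 D \<eta> = S" "\<mu> \<in> Cell D" "Dom2 D \<mu> = S \<odot> S" "Cod2 D \<mu> = S"
    "\<eta>' \<in> Cell D" "Dom2 D \<eta>' = Id1 D C'" "Cod2 D \<eta>' = S'" "\<mu>' \<in> Cell D" "Dom2 D \<mu>' = S' \<odot> S'" "Cod2 D \<mu>' = S'"
    "\<eta>'' \<in> Cell D" "Dom2 D \<eta>'' = Id1 D C''" "Cod2 D \<eta>'' = S''" "\<mu>'' \<in> Cell D" "Dom2 D \<mu>'' = S'' \<odot> S''" "Cod2 D \<mu>'' = S''"
  and obj: "C \<in> Obj D" "C' \<in> Obj D" "C'' \<in> Obj D"
  and u: "\<tau> \<bullet> (\<eta>' \<lhd> F) = F \<rhd> \<eta>" and u': "\<tau>' \<bullet> (\<eta>'' \<lhd> G) = G \<rhd> \<eta>'"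
  and mu: "\<tau> \<bullet> (\<mu>' \<lhd> F) = (F \<rhd> \<mu>) \<bullet> (\<tau> \<lhd> S) \<bullet> (S' \<rhd> \<tau>)"
  and mu': "\<tau>' \<bullet> (\<mu>'' \<lhd> G) = (G \<rhd> \<mu>') \<bullet> (\<tau>' \<lhd> S') \<bullet> (S'' \<rhd> \<tau>')"
  shows "((G \<rhd> \<tau>) \<bullet> (\<tau>' \<lhd> F)) \<bullet> (\<eta>'' \<lhd> (G \<odot> F)) = (G \<odot> F) \<rhd> \<eta>"
    "((G \<rhd> \<tau>) \<bullet> (\<tau>' \<lhd> F)) \<bullet> (\<mu>'' \<lhd> (G \<odot> F)) =
       ((G \<odot> F) \<rhd> \<mu>) \<bullet> (((G \<rhd> \<tau>) \<bullet> (\<tau>' \<lhd> F)) \<lhd> S) \<bullet> (S'' \<rhd> ((G \<rhd> \<tau>) \<bullet> (\<tau>' \<lhd> F)))"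
proof -
  have "((G \<rhd> \<tau>) \<bullet> (\<tau>' \<lhd> F)) \<bullet> (\<eta>'' \<lhd> (G \<odot> F)) = (G \<rhd> \<tau>) \<bullet> ((\<tau>' \<bullet> (\<eta>'' \<lhd> G)) \<lhd> F)"
    using ty obj by simp
  also have "\<dots> = (G \<rhd> \<tau>) \<bullet> ((G \<rhd> \<eta>') \<lhd> F)" by (simp only: u')
  also have "\<dots> = G \<rhd> (\<tau> \<bullet> (\<eta>' \<lhd> F))" using ty obj by simp
  also have "\<dots> = G \<rhd> (F \<rhd> \<eta>)" by (simp only: u)
  also have "\<dots> = (G \<odot> F) \<rhd> \<eta>" using ty obj by simp
  finally show "((G \<rhd> \<tau>) \<bullet> (\<tau>' \<lhd> F)) \<bullet> (\<eta>'' \<lhd> (G \<odot> F)) = (G \<odot> F) \<rhd> \<eta>" .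
  have sw: "(\<tau>' \<lhd> (F \<odot> S)) \<bullet> ((S'' \<odot> G) \<rhd> \<tau>) = ((G \<odot> S') \<rhd> \<tau>) \<bullet> (\<tau>' \<lhd> (S' \<odot> F))"
    by (rule whisk_swap) (use ty in \<open>simp_all add: Hom2_def\<close>)
  have "((G \<rhd> \<tau>) \<bullet> (\<tau>' \<lhd> F)) \<bullet> (\<mu>'' \<lhd> (G \<odot> F)) = (G \<rhd> \<tau>) \<bullet> ((\<tau>' \<bullet> (\<mu>'' \<lhd> G)) \<lhd> F)"
    using ty obj by simp
  also have "\<dots> = (G \<rhd> \<tau>) \<bullet> (((G \<rhd> \<mu>') \<bullet> (\<tau>' \<lhd> S') \<bullet> (S'' \<rhd> \<tau>')) \<lhd> F)" by (simp only: mu')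
  also have "\<dots> = (G \<rhd> (\<tau> \<bullet> (\<mu>' \<lhd> F))) \<bullet> (\<tau>' \<lhd> (S' \<odot> F)) \<bullet> (S'' \<rhd> (\<tau>' \<lhd> F))" using ty obj by simp
  also have "\<dots> = (G \<rhd> ((F \<rhd> \<mu>) \<bullet> (\<tau> \<lhd> S) \<bullet> (S' \<rhd> \<tau>))) \<bullet> (\<tau>' \<lhd> (S' \<odot> F)) \<bullet> (S'' \<rhd> (\<tau>' \<lhd> F))" by (simp only: mu)
  also have "\<dots> = ((G \<odot> F) \<rhd> \<mu>) \<bullet> (G \<rhd> (\<tau> \<lhd> S)) \<bullet> (((G \<odot> S') \<rhd> \<tau>) \<bullet> (\<tau>' \<lhd> (S' \<odot> F))) \<bullet> (S'' \<rhd> (\<tau>' \<lhd> F))"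
    using ty obj by simp
  also have "\<dots> = ((G \<odot> F) \<rhd> \<mu>) \<bullet> (G \<rhd> (\<tau> \<lhd> S)) \<bullet> ((\<tau>' \<lhd> (F \<odot> S)) \<bullet> ((S'' \<odot> G) \<rhd> \<tau>)) \<bullet> (S'' \<rhd> (\<tau>' \<lhd> F))"
    by (simp only: sw)
  also have "\<dots> = ((G \<odot> F) \<rhd> \<mu>) \<bullet> (((G \<rhd> \<tau>) \<bullet> (\<tau>' \<lhd> F)) \<lhd> S) \<bullet> (S'' \<rhd> ((G \<rhd> \<tau>) \<bullet> (\<tau>' \<lhd> F)))"
    using ty obj by simp
  finally show "((G \<rhd> \<tau>) \<bullet> (\<tau>' \<lhd> F)) \<bullet> (\<mu>'' \<lhd> (G \<odot> F)) =
       ((G \<odot> F) \<rhd> \<mu>) \<bullet> (((G \<rhd> \<tau>) \<bullet> (\<tau>' \<lhd> F)) \<lhd> S) \<bullet> (S'' \<rhd> ((G \<rhd> \<tau>) \<bullet> (\<tau>' \<lhd> F)))" .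
qed

text \<open>\<open>\<kappa>\<close> slides past \<open>\<sigma>\<close> by interchange, and the
  hypothesis then applies under \<open>G\<close>.\<close>

lemma lax_lwhisk:
  assumes ty: "F \<in> Arr D" "F' \<in> Arr D" "G \<in> Arr D" "S \<in> Arr D" "S' \<in> Arr D" "S'' \<in> Arr D"
    "Dom1 D F = C" "Cod1 D F = C'" "Dom1 D F' = C" "Cod1 D F' = C'" "Dom1 D G = C'" "Cod1 D G = C''"
    "Dom1 D S = C" "Cod1 D S = C" "Dom1 D S' = C'" "Cod1 D S' = C'" "Dom1 D S'' = C''" "Cod1 D S'' = C''"
    "\<tau> \<in> Cell D" "Dom2 D \<tau> = S' \<odot> F" "Cod2 D \<tau> = F \<odot> S"
    "\<tau>' \<in> Cell D" "Dom2 D \<tau>' = S' \<odot> F'" "Cod2 D \<tau>' = F' \<odot> S"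
    "\<kappa> \<in> Cell D" "Dom2 D \<kappa> = S'' \<odot> G" "Cod2 D \<kappa> = G \<odot> S'"
    "\<sigma> \<in> Cell D" "Dom2 D \<sigma> = F" "Cod2 D \<sigma> = F'"
  and t: "\<tau>' \<bullet> (S' \<rhd> \<sigma>) = (\<sigma> \<lhd> S) \<bullet> \<tau>"
  shows "((G \<rhd> \<tau>') \<bullet> (\<kappa> \<lhd> F')) \<bullet> (S'' \<rhd> (G \<rhd> \<sigma>)) = ((G \<rhd> \<sigma>) \<lhd> S) \<bullet> ((G \<rhd> \<tau>) \<bullet> (\<kappa> \<lhd> F))"
proof -
  have sw: "(\<kappa> \<lhd> F') \<bullet> ((S'' \<odot> G) \<rhd> \<sigma>) = ((G \<odot> S') \<rhd> \<sigma>) \<bullet> (\<kappa> \<lhd> F)"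
    by (rule whisk_swap) (use ty in \<open>simp_all add: Hom2_def\<close>)
  have "((G \<rhd> \<tau>') \<bullet> (\<kappa> \<lhd> F')) \<bullet> (S'' \<rhd> (G \<rhd> \<sigma>)) = (G \<rhd> \<tau>') \<bullet> ((\<kappa> \<lhd> F') \<bullet> ((S'' \<odot> G) \<rhd> \<sigma>))"
    using ty by simp
  also have "\<dots> = (G \<rhd> \<tau>') \<bullet> (((G \<odot> S') \<rhd> \<sigma>) \<bullet> (\<kappa> \<lhd> F))" by (simp only: sw)
  also have "\<dots> = (G \<rhd> (\<tau>' \<bullet> (S' \<rhd> \<sigma>))) \<bullet> (\<kappa> \<lhd> F)" using ty by simp
  also have "\<dots> = (G \<rhd> ((\<sigma> \<lhd> S) \<bullet> \<tau>)) \<bullet> (\<kappa> \<lhd> F)" by (simp only: t)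
  also have "\<dots> = ((G \<rhd> \<sigma>) \<lhd> S) \<bullet> ((G \<rhd> \<tau>) \<bullet> (\<kappa> \<lhd> F))" using ty by simp
  finally show ?thesis .
qed

text \<open>Here the hypothesis applies first, whiskered by \<open>F\<close>, and then
  \<open>\<sigma>\<close> slides past \<open>\<tau>\<close>.\<close>

lemma lax_rwhisk:
  assumes ty: "F \<in> Arr D" "G' \<in> Arr D" "G \<in> Arr D" "S \<in> Arr D" "S' \<in> Arr D" "S'' \<in> Arr D"
    "Dom1 D F = C" "Cod1 D F = C'" "Dom1 D G = C'" "Cod1 D G = C''" "Dom1 D G' = C'" "Cod1 D G' = C''"
    "Dom1 D S = C" "Cod1 D S = C" "Dom1 D S' = C'" "Cod1 D S' = C'" "Dom1 D S'' = C''" "Cod1 D S'' = C''"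
    "\<tau> \<in> Cell D" "Dom2 D \<tau> = S' \<odot> F" "Cod2 D \<tau> = F \<odot> S"
    "\<kappa> \<in> Cell D" "Dom2 D \<kappa> = S'' \<odot> G" "Cod2 D \<kappa> = G \<odot> S'"
    "\<kappa>' \<in> Cell D" "Dom2 D \<kappa>' = S'' \<odot> G'" "Cod2 D \<kappa>' = G' \<odot> S'"
    "\<sigma> \<in> Cell D" "Dom2 D \<sigma> = G" "Cod2 D \<sigma> = G'"
  and t: "\<kappa>' \<bullet> (S'' \<rhd> \<sigma>) = (\<sigma> \<lhd> S') \<bullet> \<kappa>"
  shows "((G' \<rhd> \<tau>) \<bullet> (\<kappa>' \<lhd> F)) \<bullet> (S'' \<rhd> (\<sigma> \<lhd> F)) = ((\<sigma> \<lhd> F) \<lhd> S) \<bullet> ((G \<rhd> \<tau>) \<bullet> (\<kappa> \<lhd> F))"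
proof -
  have sw: "(\<sigma> \<lhd> (F \<odot> S)) \<bullet> (G \<rhd> \<tau>) = (G' \<rhd> \<tau>) \<bullet> (\<sigma> \<lhd> (S' \<odot> F))"
    by (rule whisk_swap) (use ty in \<open>simp_all add: Hom2_def\<close>)
  have "((G' \<rhd> \<tau>) \<bullet> (\<kappa>' \<lhd> F)) \<bullet> (S'' \<rhd> (\<sigma> \<lhd> F)) = (G' \<rhd> \<tau>) \<bullet> ((\<kappa>' \<bullet> (S'' \<rhd> \<sigma>)) \<lhd> F)"
    using ty by simp
  also have "\<dots> = (G' \<rhd> \<tau>) \<bullet> (((\<sigma> \<lhd> S') \<bullet> \<kappa>) \<lhd> F)" by (simp only: t)
  also have "\<dots> = ((G' \<rhd> \<tau>) \<bullet> (\<sigma> \<lhd> (S' \<odot> F))) \<bullet> (\<kappa> \<lhd> F)" using ty by simp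
  also have "\<dots> = ((\<sigma> \<lhd> (F \<odot> S)) \<bullet> (G \<rhd> \<tau>)) \<bullet> (\<kappa> \<lhd> F)" by (simp only: sw)
  also have "\<dots> = ((\<sigma> \<lhd> F) \<lhd> S) \<bullet> ((G \<rhd> \<tau>) \<bullet> (\<kappa> \<lhd> F))" using ty by simp
  finally show ?thesis .
qed

lemma Mnd_data:
  "structured_data D {M. is_monad D M} mob (lax_monad_mor D) (lax_monad_trf D) (\<lambda>M. Id2 D (mend M)) (lax_comp_str D)"
proof (unfold_locales, goal_cases)
  case 1 then show ?case by (simp add: is_monad_sel)
next
  case 2 then show ?case by (simp add: is_monad_sel lax_monad_mor_sel Hom2_def)
next
  case (3 f g)
  then have "mstr f \<in> Cell D" "mstr g \<in> Cell D"
    by (auto simp: str_arr_def lax_monad_mor_sel Hom2_def)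
  with 3 show ?case
    unfolding lax_monad_mor_sel str_arr_def lax_comp_str_def mor.sel mem_Collect_eq
    by (intro conjI lax_comp_eqs[where F = "mfun f" and G = "mfun g" and S = "mend (mdom f)" and S' = "mend (mcod f)" and S'' = "mend (mcod g)"
    and C = "mob (mdom f)" and C' = "mob (mcod f)" and C'' = "mob (mcod g)" and \<tau> = "mstr f" and \<tau>' = "mstr g"
    and \<eta> = "munit (mdom f)" and \<eta>' = "munit (mcod f)" and \<eta>'' = "munit (mcod g)"
    and \<mu> = "mmult (mdom f)" and \<mu>' = "mmult (mcod f)" and \<mu>'' = "mmult (mcod g)"]; simp add: is_monad_sel Hom2_def)
next
  case 4 then show ?case by (simp add: str_arr_def is_monad_sel lax_monad_mor_sel lax_comp_str_def Hom2_def)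
next
  case 5 then show ?case by (simp add: str_arr_def is_monad_sel lax_monad_mor_sel lax_comp_str_def Hom2_def)
next
  case 6 then show ?case by (simp add: str_arr_def is_monad_sel lax_monad_mor_sel lax_comp_str_def Hom2_def)
next
  case 7 then show ?case by (simp add: str_arr_def is_monad_sel lax_monad_mor_sel lax_monad_trf_def Hom2_def)
next
  case (8 f g h \<sigma> \<tau>)
  let ?S = "mend (mdom f)" and ?S' = "mend (mcod f)"
  have t: "?S \<in> Arr D" "?S' \<in> Arr D" "Dom1 D ?S = mob (mdom f)" "Cod1 D ?S = mob (mdom f)"
    "Dom1 D ?S' = mob (mcod f)" "Cod1 D ?S' = mob (mcod f)"
    "mstr f \<in> Cell D" "mstr g \<in> Cell D" "mstr h \<in> Cell D"
    "Dom2 D (mstr f) = ?S' \<odot> mfun f" "Cod2 D (mstr f) = mfun f \<odot> ?S"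
    "Dom2 D (mstr g) = ?S' \<odot> mfun g" "Cod2 D (mstr g) = mfun g \<odot> ?S"
    "Dom2 D (mstr h) = ?S' \<odot> mfun h" "Cod2 D (mstr h) = mfun h \<odot> ?S"
    "mfun f \<in> Arr D" "Dom1 D (mfun f) = mob (mdom f)" "Cod1 D (mfun f) = mob (mcod f)"
    "mfun g \<in> Arr D" "Dom1 D (mfun g) = mob (mdom f)" "Cod1 D (mfun g) = mob (mcod f)"
    "mfun h \<in> Arr D" "Dom1 D (mfun h) = mob (mdom f)" "Cod1 D (mfun h) = mob (mcod f)"
    "\<sigma> \<in> Cell D" "Dom2 D \<sigma> = mfun f" "Cod2 D \<sigma> = mfun g" "\<tau> \<in> Cell D" "Dom2 D \<tau> = mfun g" "Cod2 D \<tau> = mfun h"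
    using 8 by (simp_all add: str_arr_def is_monad_sel lax_monad_mor_sel Hom2_def)
  have s: "mstr g \<bullet> (?S' \<rhd> \<sigma>) = (\<sigma> \<lhd> ?S) \<bullet> mstr f" "mstr h \<bullet> (?S' \<rhd> \<tau>) = (\<tau> \<lhd> ?S) \<bullet> mstr g"
    using 8 by (simp_all add: lax_monad_trf_def)
  have "mstr h \<bullet> (?S' \<rhd> (\<tau> \<bullet> \<sigma>)) = (mstr h \<bullet> (?S' \<rhd> \<tau>)) \<bullet> (?S' \<rhd> \<sigma>)" using t by simp
  also have "\<dots> = ((\<tau> \<lhd> ?S) \<bullet> mstr g) \<bullet> (?S' \<rhd> \<sigma>)" by (simp only: s)
  also have "\<dots> = (\<tau> \<lhd> ?S) \<bullet> (mstr g \<bullet> (?S' \<rhd> \<sigma>))" using t by simp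
  also have "\<dots> = (\<tau> \<lhd> ?S) \<bullet> ((\<sigma> \<lhd> ?S) \<bullet> mstr f)" by (simp only: s)
  also have "\<dots> = ((\<tau> \<bullet> \<sigma>) \<lhd> ?S) \<bullet> mstr f" using t by simp
  finally show ?case by (simp add: lax_monad_trf_def)
next
  case (9 f f' g \<sigma>)
  then show ?case
    unfolding lax_monad_trf_def lax_comp_str_def mor.sel
    by (intro lax_lwhisk; simp add: str_arr_def is_monad_sel lax_monad_mor_sel Hom2_def)
next
  case (10 f g g' \<sigma>)
  then show ?case
    unfolding lax_monad_trf_def lax_comp_str_def mor.sel
    by (intro lax_rwhisk; simp add: str_arr_def is_monad_sel lax_monad_mor_sel Hom2_def)
qed

end

lemma is_monadD:
  assumes "is_monad D M"
  shows "mob M \<in> Obj D" "mend M \<in> Arr D" "Dom1 D (mend M) = mob M" "Cod1 D (mend M) = mob M"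
     "munit M \<in> Cell D" "Dom2 D (munit M) = Id1 D (mob M)" "Cod2 D (munit M) = mend M"
     "mmult M \<in> Cell D" "Dom2 D (mmult M) = mend M \<odot>\<^bsub>D\<^esub> mend M" "Cod2 D (mmult M) = mend M"
  using assms by (simp_all add: is_monad_sel)

lemma is_monad_eqs:
  assumes "is_monad D M"
  shows "mmult M \<bullet>\<^bsub>D\<^esub> (munit M \<lhd>\<^bsub>D\<^esub> mend M) = Id2 D (mend M)"
     "mmult M \<bullet>\<^bsub>D\<^esub> (mend M \<rhd>\<^bsub>D\<^esub> munit M) = Id2 D (mend M)"
     "mmult M \<bullet>\<^bsub>D\<^esub> (mmult M \<lhd>\<^bsub>D\<^esub> mend M) = mmult M \<bullet>\<^bsub>D\<^esub> (mend M \<rhd>\<^bsub>D\<^esub> mmult M)"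
  using assms by (simp_all add: is_monad_sel)

text \<open>A generalized algebra with domain \<open>Z\<close>; for categories with \<open>Z\<close>
  terminal these are the usual Eilenberg-Moore algebras.\<close>

definition is_alg ::
  "('o, 'a, 'c) two_cat \<Rightarrow> ('o, 'a, 'c) monad \<Rightarrow> 'o \<Rightarrow> 'a \<Rightarrow> 'c \<Rightarrow> bool" where
  "is_alg D M Z f a \<longleftrightarrow> f \<in> Hom1 D Z (mob M) \<and> a \<in> Hom2 D (mend M \<odot>\<^bsub>D\<^esub> f) f \<and>
     a \<bullet>\<^bsub>D\<^esub> (munit M \<lhd>\<^bsub>D\<^esub> f) = Id2 D f \<and> a \<bullet>\<^bsub>D\<^esub> (mmult M \<lhd>\<^bsub>D\<^esub> f) = a \<bullet>\<^bsub>D\<^esub> (mend M \<rhd>\<^bsub>D\<^esub> a)"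

text \<open>\<open>(U, \<chi>)\<close> exhibits \<open>X\<close> as the object of algebras of \<open>M\<close>: the isomorphism of categories
  \<open>D(Z, X) \<cong> M-Alg(Z)\<close> on objects and on morphisms.\<close>

definition em_universal ::
  "('o, 'a, 'c) two_cat \<Rightarrow> ('o, 'a, 'c) monad \<Rightarrow> 'o \<Rightarrow> 'a \<Rightarrow> 'c \<Rightarrow> bool" where
  "em_universal D M X U \<chi> \<longleftrightarrow> X \<in> Obj D \<and> is_alg D M X U \<chi> \<and>
     (\<forall>Z f a. is_alg D M Z f a \<longrightarrow> (\<exists>!g. g \<in> Hom1 D Z X \<and> U \<odot>\<^bsub>D\<^esub> g = f \<and> \<chi> \<lhd>\<^bsub>D\<^esub> g = a)) \<and>
     (\<forall>Z g h \<sigma>. g \<in> Hom1 D Z X \<longrightarrow> h \<in> Hom1 D Z X \<longrightarrow> \<sigma> \<in> Hom2 D (U \<odot>\<^bsub>D\<^esub> g) (U \<odot>\<^bsub>D\<^esub> h) \<longrightarrow>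
        \<sigma> \<bullet>\<^bsub>D\<^esub> (\<chi> \<lhd>\<^bsub>D\<^esub> g) = (\<chi> \<lhd>\<^bsub>D\<^esub> h) \<bullet>\<^bsub>D\<^esub> (mend M \<rhd>\<^bsub>D\<^esub> \<sigma>) \<longrightarrow>
        (\<exists>!\<rho>. \<rho> \<in> Hom2 D g h \<and> U \<rhd>\<^bsub>D\<^esub> \<rho> = \<sigma>))"

lemma id_monad_sel [simp]:
  "mob (id_monad D C) = C" "mend (id_monad D C) = Id1 D C"
  "munit (id_monad D C) = Id2 D (Id1 D C)" "mmult (id_monad D C) = Id2 D (Id1 D C)"
  by (simp_all add: id_monad_def)

lemma id_monad_mor_sel [simp]:
  "mdom (id_monad_mor D F) = id_monad D (Dom1 D F)" "mcod (id_monad_mor D F) = id_monad D (Cod1 D F)"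
  "mfun (id_monad_mor D F) = F" "mstr (id_monad_mor D F) = Id2 D F"
  by (simp_all add: id_monad_mor_def)

lemmas Mnd_sel = structured_sel[where obs = "{M. is_monad D M}" and und = mob and is_mor = "lax_monad_mor D"
    and is_trf = "lax_monad_trf D" and id_str = "\<lambda>M. Id2 D (mend M)" and comp_str = "lax_comp_str D" and D = D for D,
    folded Mnd_def]

lemmas Mnd_whisk = structured_whisk[where obs = "{M. is_monad D M}" and und = mob and is_mor = "lax_monad_mor D"
    and is_trf = "lax_monad_trf D" and id_str = "\<lambda>M. Id2 D (mend M)" and comp_str = "lax_comp_str D" and D = D for D,
    folded Mnd_def]

context two_category
begin

lemma Mnd_two_category: "two_category (Mnd D)"
  using structured_data.structured_two_category[OF Mnd_data] by (simp add: Mnd_def)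

lemma id_monad_is_monad [simp]: "C \<in> Obj D \<Longrightarrow> is_monad D (id_monad D C)"
  by (simp add: is_monad_sel)

lemma id_monad_mor_arr [simp]:
  "F \<in> Arr D \<Longrightarrow> str_arr D {M. is_monad D M} mob (lax_monad_mor D) (id_monad_mor D F)"
  by (simp add: str_arr_def lax_monad_mor_sel Hom2_def)

lemma id_monad_mor_arr' [simp]:
  "F \<in> Arr D \<Longrightarrow> Dom1 D F = A \<Longrightarrow> Cod1 D F = B \<Longrightarrow>
    str_arr D {M. is_monad D M} mob (lax_monad_mor D) (Mor (id_monad D A) (id_monad D B) F (Id2 D F))"
  using id_monad_mor_arr[of F] by (simp add: id_monad_mor_def)

lemma iota_two_functor: "two_functor D (Mnd D) (iota D)"
proof -
  interpret M: two_category "Mnd D" by (rule Mnd_two_category)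
  show ?thesis
  proof (unfold_locales, goal_cases)
    case 5 then show ?case
      by (auto simp: iota_def Mnd_sel Hom1_def str_comp_def id_monad_mor_def lax_comp_str_def)
  next
    case 8 then show ?case
      by (auto simp: iota_def Mnd_sel Hom2_def HComp_typ str_comp_def id_monad_mor_def lax_comp_str_def)
  qed (auto simp: iota_def Mnd_sel Hom1_def Hom2_def lax_monad_trf_def str_id_def id_monad_mor_def)
qed

text \<open>For a lax morphism out of an identity monad all whiskerings by the source endomorphism
  disappear, and the unit and multiplication laws become those of an action.\<close>

lemma alg_iff:
  assumes "is_monad D M" "Z \<in> Obj D"
  shows "Mor (id_monad D Z) M f a \<in> Arr (Mnd D) \<longleftrightarrow> is_alg D M Z f a"
\<comment> \<open>This typing is implied by either side, and the identity laws rewrite only in its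
  presence.\<close>
proof (cases "f \<in> Arr D \<and> Dom1 D f = Z \<and> Cod1 D f = mob M \<and> a \<in> Cell D \<and> Dom2 D a = mend M \<odot> f \<and> Cod2 D a = f")
  case True
  with assms show ?thesis by (simp add: Mnd_sel str_arr_def lax_monad_mor_sel is_alg_def is_monad_sel Hom1_def Hom2_def)
next
  case False
  with assms show ?thesis by (auto simp add: Mnd_sel str_arr_def lax_monad_mor_sel is_alg_def Hom1_def Hom2_def)
qed

lemma iota_hom_iff:
  assumes "is_monad D M" "Z \<in> Obj D"
  shows "F \<in> Hom1 (Mnd D) (F0 (iota D) Z) M \<longleftrightarrow> (\<exists>f a. F = Mor (id_monad D Z) M f a \<and> is_alg D M Z f a)"
  using assms alg_iff[OF assms] by (cases F) (auto simp: Hom1_def Mnd_sel(4,5) iota_def)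

lemma alg_comp_iota:
  assumes "is_alg D M X U \<chi>" "is_monad D M" "g \<in> Hom1 D Z X"
  shows "Mor (id_monad D X) M U \<chi> \<odot>\<^bsub>Mnd D\<^esub> F1 (iota D) g = Mor (id_monad D Z) M (U \<odot> g) (\<chi> \<lhd> g)"
  using assms by (auto simp: iota_def Mnd_sel str_comp_def lax_comp_str_def is_alg_def is_monad_sel Hom1_def Hom2_def)

text \<open>Restricting an algebra along \<open>g\<close> is composing in \<open>Mnd D\<close> with
  the image of \<open>g\<close> under \<open>iota\<close>, so the closure of 1-cells under
  composition does the work.\<close>

lemma alg_comp:
  assumes "is_alg D M X U \<chi>" "is_monad D M" "g \<in> Hom1 D Z X" "X \<in> Obj D"
  shows "is_alg D M Z (U \<odot> g) (\<chi> \<lhd> g)"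
proof -
  interpret M: two_category "Mnd D" by (rule Mnd_two_category)
  interpret I: two_functor D "Mnd D" "iota D" by (rule iota_two_functor)
  have Z: "Z \<in> Obj D" using assms by (auto simp: Hom1_def)
  have "Mor (id_monad D X) M U \<chi> \<in> Arr (Mnd D)" using assms alg_iff[of M X U \<chi>] by simp
  then have "Mor (id_monad D X) M U \<chi> \<odot>\<^bsub>Mnd D\<^esub> F1 (iota D) g \<in> Arr (Mnd D)"
    using assms by (intro M.Comp1_typ) (auto simp: Hom1_def iota_def Mnd_sel(2,4,5))
  then show ?thesis using alg_comp_iota[OF assms(1-3)] alg_iff[OF assms(2) Z] by simp
qed

text \<open>A dictionary: 1-cells from \<open>iota Z\<close> to \<open>M\<close> are algebras with
  domain \<open>Z\<close>, 2-cells between them are morphisms of algebras. Both clauses of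
  \<open>univ_arrow\<close> are translated separately, in \<open>A\<close> and
  \<open>B\<close>.\<close>

lemma univ_arrow_iff:
  assumes M: "is_monad D M"
  shows "univ_arrow D (Mnd D) (iota D) M X (Mor (id_monad D X) M U \<chi>) \<longleftrightarrow> em_universal D M X U \<chi>" (is "univ_arrow _ _ _ _ _ ?E \<longleftrightarrow> _")
proof (cases "X \<in> Obj D \<and> is_alg D M X U \<chi>")
  case False
  then show ?thesis using iota_hom_iff[OF M, of X ?E] by (auto simp: univ_arrow_def em_universal_def)
next
  case X: True
  have c: "?E \<odot>\<^bsub>Mnd D\<^esub> F1 (iota D) g = Mor (id_monad D Z) M (U \<odot> g) (\<chi> \<lhd> g)" if "g \<in> Hom1 D Z X" for g Z
    using alg_comp_iota[of M X U \<chi> g Z] X M that by simp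
  have 1: "(\<exists>!g. g \<in> Hom1 D Z X \<and> ?E \<odot>\<^bsub>Mnd D\<^esub> F1 (iota D) g = Mor (id_monad D Z) M f a) \<longleftrightarrow>
      (\<exists>!g. g \<in> Hom1 D Z X \<and> U \<odot> g = f \<and> \<chi> \<lhd> g = a)" for Z f a
  proof -
    have "(g \<in> Hom1 D Z X \<and> ?E \<odot>\<^bsub>Mnd D\<^esub> F1 (iota D) g = Mor (id_monad D Z) M f a) \<longleftrightarrow>
        (g \<in> Hom1 D Z X \<and> U \<odot> g = f \<and> \<chi> \<lhd> g = a)" for g
      using c[of g Z] by (cases "g \<in> Hom1 D Z X") simp_all
    then show ?thesis by simp
  qed
  \<comment> \<open>The source is an identity monad, so the condition on a 2-cell of
    \<open>Mnd D\<close> reduces to commuting with the two actions.\<close>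
  have h: "\<sigma> \<in> Hom2 (Mnd D) (Mor (id_monad D Z) M (U \<odot> g) (\<chi> \<lhd> g)) (Mor (id_monad D Z) M (U \<odot> h) (\<chi> \<lhd> h)) \<longleftrightarrow>
      (\<exists>s. \<sigma> = Trf (Mor (id_monad D Z) M (U \<odot> g) (\<chi> \<lhd> g)) (Mor (id_monad D Z) M (U \<odot> h) (\<chi> \<lhd> h)) s \<and>
        s \<in> Hom2 D (U \<odot> g) (U \<odot> h) \<and> s \<bullet> (\<chi> \<lhd> g) = (\<chi> \<lhd> h) \<bullet> (mend M \<rhd> s))"
    if gh: "g \<in> Hom1 D Z X" "h \<in> Hom1 D Z X" for Z g h \<sigma>
  proof -
    have Z: "Z \<in> Obj D" using gh by (auto simp: Hom1_def)
    have a: "Mor (id_monad D Z) M (U \<odot> g) (\<chi> \<lhd> g) \<in> Arr (Mnd D)" "Mor (id_monad D Z) M (U \<odot> h) (\<chi> \<lhd> h) \<in> Arr (Mnd D)"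
      using alg_iff[OF M Z] alg_comp[of M X U \<chi>] X M gh by auto
    have d: "Dom1 D (U \<odot> g) = Z" "g \<in> Arr D" "Dom1 D U = X" "Cod1 D g = X" "U \<in> Arr D" using gh X by (auto simp: Hom1_def is_alg_def)
    show ?thesis using a d by (cases \<sigma>) (auto simp: Hom2_def Mnd_sel lax_monad_trf_def)
  qed
  have w: "?E \<rhd>\<^bsub>Mnd D\<^esub> F2 (iota D) \<rho> = Trf (Mor (id_monad D Z) M (U \<odot> g) (\<chi> \<lhd> g)) (Mor (id_monad D Z) M (U \<odot> h) (\<chi> \<lhd> h)) (U \<rhd> \<rho>)"
    if "g \<in> Hom1 D Z X" "h \<in> Hom1 D Z X" "\<rho> \<in> Hom2 D g h" for Z g h \<rho>
    using c[OF that(1)] c[OF that(2)] that(3) by (auto simp: Mnd_whisk Mnd_sel(10) iota_def Hom2_def)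
  have 2: "(\<exists>!\<rho>. \<rho> \<in> Hom2 D g h \<and> ?E \<rhd>\<^bsub>Mnd D\<^esub> F2 (iota D) \<rho> =
         Trf (Mor (id_monad D Z) M (U \<odot> g) (\<chi> \<lhd> g)) (Mor (id_monad D Z) M (U \<odot> h) (\<chi> \<lhd> h)) s) \<longleftrightarrow>
      (\<exists>!\<rho>. \<rho> \<in> Hom2 D g h \<and> U \<rhd> \<rho> = s)" if "g \<in> Hom1 D Z X" "h \<in> Hom1 D Z X" for Z g h s
  proof -
    have "(\<rho> \<in> Hom2 D g h \<and> ?E \<rhd>\<^bsub>Mnd D\<^esub> F2 (iota D) \<rho> =
         Trf (Mor (id_monad D Z) M (U \<odot> g) (\<chi> \<lhd> g)) (Mor (id_monad D Z) M (U \<odot> h) (\<chi> \<lhd> h)) s) \<longleftrightarrow>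
      (\<rho> \<in> Hom2 D g h \<and> U \<rhd> \<rho> = s)" for \<rho>
      using w[OF that, of \<rho>] by (cases "\<rho> \<in> Hom2 D g h") simp_all
    then show ?thesis by simp
  qed
  have O: "Z \<in> Obj D" if "is_alg D M Z f a" for Z f a using that by (auto simp: is_alg_def Hom1_def)
  have A: "(\<forall>Z\<in>Obj D. \<forall>f\<in>Hom1 (Mnd D) (F0 (iota D) Z) M. \<exists>!g. g \<in> Hom1 D Z X \<and> ?E \<odot>\<^bsub>Mnd D\<^esub> F1 (iota D) g = f) \<longleftrightarrow>
      (\<forall>Z f a. is_alg D M Z f a \<longrightarrow> (\<exists>!g. g \<in> Hom1 D Z X \<and> U \<odot> g = f \<and> \<chi> \<lhd> g = a))" (is "?l \<longleftrightarrow> ?r")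
  proof
    assume l: ?l show ?r
    proof (intro allI impI)
      fix Z f a assume a: "is_alg D M Z f a"
      then have "Mor (id_monad D Z) M f a \<in> Hom1 (Mnd D) (F0 (iota D) Z) M" using iota_hom_iff[OF M O[OF a]] by blast
      then have "\<exists>!g. g \<in> Hom1 D Z X \<and> ?E \<odot>\<^bsub>Mnd D\<^esub> F1 (iota D) g = Mor (id_monad D Z) M f a"
        using l O[OF a] by blast
      then show "\<exists>!g. g \<in> Hom1 D Z X \<and> U \<odot> g = f \<and> \<chi> \<lhd> g = a" by (simp only: 1)
    qed
  next
    assume r: ?r show ?l
    proof (intro ballI)
      fix Z F assume Z: "Z \<in> Obj D" and "F \<in> Hom1 (Mnd D) (F0 (iota D) Z) M"
      then obtain f a where "F = Mor (id_monad D Z) M f a" "is_alg D M Z f a" using iota_hom_iff[OF M Z] by blast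
      then show "\<exists>!g. g \<in> Hom1 D Z X \<and> ?E \<odot>\<^bsub>Mnd D\<^esub> F1 (iota D) g = F" using r by (simp only: 1)
    qed
  qed
  have B: "(\<forall>Z g h \<sigma>. g \<in> Hom1 D Z X \<longrightarrow> h \<in> Hom1 D Z X \<longrightarrow>
        \<sigma> \<in> Hom2 (Mnd D) (?E \<odot>\<^bsub>Mnd D\<^esub> F1 (iota D) g) (?E \<odot>\<^bsub>Mnd D\<^esub> F1 (iota D) h) \<longrightarrow>
        (\<exists>!\<rho>. \<rho> \<in> Hom2 D g h \<and> ?E \<rhd>\<^bsub>Mnd D\<^esub> F2 (iota D) \<rho> = \<sigma>)) \<longleftrightarrow>
      (\<forall>Z g h s. g \<in> Hom1 D Z X \<longrightarrow> h \<in> Hom1 D Z X \<longrightarrow> s \<in> Hom2 D (U \<odot> g) (U \<odot> h) \<longrightarrow>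
        s \<bullet> (\<chi> \<lhd> g) = (\<chi> \<lhd> h) \<bullet> (mend M \<rhd> s) \<longrightarrow> (\<exists>!\<rho>. \<rho> \<in> Hom2 D g h \<and> U \<rhd> \<rho> = s))" (is "?l \<longleftrightarrow> ?r")
  proof
    assume l: ?l show ?r
    proof (intro allI impI)
      fix Z g h s assume a: "g \<in> Hom1 D Z X" "h \<in> Hom1 D Z X" "s \<in> Hom2 D (U \<odot> g) (U \<odot> h)"
         "s \<bullet> (\<chi> \<lhd> g) = (\<chi> \<lhd> h) \<bullet> (mend M \<rhd> s)"
      let ?\<sigma> = "Trf (Mor (id_monad D Z) M (U \<odot> g) (\<chi> \<lhd> g)) (Mor (id_monad D Z) M (U \<odot> h) (\<chi> \<lhd> h)) s"
      have "?\<sigma> \<in> Hom2 (Mnd D) (?E \<odot>\<^bsub>Mnd D\<^esub> F1 (iota D) g) (?E \<odot>\<^bsub>Mnd D\<^esub> F1 (iota D) h)"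
        unfolding c[OF a(1)] c[OF a(2)] h[OF a(1,2)] using a by blast
      then have "\<exists>!\<rho>. \<rho> \<in> Hom2 D g h \<and> ?E \<rhd>\<^bsub>Mnd D\<^esub> F2 (iota D) \<rho> = ?\<sigma>" using l a(1,2) by blast
      then show "\<exists>!\<rho>. \<rho> \<in> Hom2 D g h \<and> U \<rhd> \<rho> = s" by (simp only: 2[OF a(1,2)])
    qed
  next
    assume r: ?r show ?l
    proof (intro allI impI)
      fix Z g k \<sigma> assume a: "g \<in> Hom1 D Z X" "k \<in> Hom1 D Z X"
         "\<sigma> \<in> Hom2 (Mnd D) (?E \<odot>\<^bsub>Mnd D\<^esub> F1 (iota D) g) (?E \<odot>\<^bsub>Mnd D\<^esub> F1 (iota D) k)"
      then obtain s where s: "\<sigma> = Trf (Mor (id_monad D Z) M (U \<odot> g) (\<chi> \<lhd> g)) (Mor (id_monad D Z) M (U \<odot> k) (\<chi> \<lhd> k)) s"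
        "s \<in> Hom2 D (U \<odot> g) (U \<odot> k)" "s \<bullet> (\<chi> \<lhd> g) = (\<chi> \<lhd> k) \<bullet> (mend M \<rhd> s)"
        using a(3)[unfolded c[OF a(1)] c[OF a(2)] h[OF a(1,2)]] by blast
      then have "\<exists>!\<rho>. \<rho> \<in> Hom2 D g k \<and> U \<rhd> \<rho> = s" using r a(1,2) by blast
      then show "\<exists>!\<rho>. \<rho> \<in> Hom2 D g k \<and> ?E \<rhd>\<^bsub>Mnd D\<^esub> F2 (iota D) \<rho> = \<sigma>" by (simp only: 2[OF a(1,2)] s(1))
    qed
  qed
  have E: "?E \<in> Hom1 (Mnd D) (F0 (iota D) X) M" using X iota_hom_iff[OF M] by blast
  show ?thesis unfolding univ_arrow_def em_universal_def A B using X E by simp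
qed

text \<open>Existence may be checked monad by monad: choosing one universal algebra for each gives a
  \<open>univ_family\<close>, hence an adjunction, and conversely every counit is universal.\<close>

lemma admits_EM_iff: "admits_EM D \<longleftrightarrow> (\<forall>M. is_monad D M \<longrightarrow> (\<exists>X U \<chi>. em_universal D M X U \<chi>))"
proof
  assume "admits_EM D"
  then obtain EM u e where "EM_adjunction D EM u e" by (auto simp: admits_EM_def)
  then interpret two_adjunction D "Mnd D" "iota D" EM u e by (simp add: EM_adjunction_def)
  show "\<forall>M. is_monad D M \<longrightarrow> (\<exists>X U \<chi>. em_universal D M X U \<chi>)"
  proof (intro allI impI)
    fix M assume M: "is_monad D M"
    then have u: "univ_arrow D (Mnd D) (iota D) M (F0 EM M) (e M)" by (intro counit_univ) (simp add: Mnd_sel)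
    then obtain f a where "e M = Mor (id_monad D (F0 EM M)) M f a"
      using iota_hom_iff[OF M, of "F0 EM M" "e M"] by (auto simp: univ_arrow_def)
    then show "\<exists>X U \<chi>. em_universal D M X U \<chi>" using u univ_arrow_iff[OF M] by auto
  qed
next
  assume *: "\<forall>M. is_monad D M \<longrightarrow> (\<exists>X U \<chi>. em_universal D M X U \<chi>)"
  interpret I: two_functor D "Mnd D" "iota D" by (rule iota_two_functor)
  have "\<forall>M. \<exists>X e. M \<in> Obj (Mnd D) \<longrightarrow> univ_arrow D (Mnd D) (iota D) M X e"
    using * univ_arrow_iff by (auto simp: Mnd_sel(1)) blast
  then obtain R e where "\<And>M. M \<in> Obj (Mnd D) \<Longrightarrow> univ_arrow D (Mnd D) (iota D) M (R M) (e M)" by metis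
  then interpret univ_family D "Mnd D" "iota D" R e by unfold_locales
  show "admits_EM D" using adjunction two_category_axioms by (auto simp: admits_EM_def EM_adjunction_def)
qed

end

section \<open>The action of a 2-functor on monads\<close>

context two_functor
begin

lemma Mnd_obj_map_sel [simp]:
  "mob (Mnd_obj_map G M) = F0 G (mob M)" "mend (Mnd_obj_map G M) = F1 G (mend M)"
  "munit (Mnd_obj_map G M) = F2 G (munit M)" "mmult (Mnd_obj_map G M) = F2 G (mmult M)"
  by (simp_all add: Mnd_obj_map_def)

lemma Mnd_mor_map_sel [simp]:
  "mdom (Mnd_mor_map G f) = Mnd_obj_map G (mdom f)" "mcod (Mnd_mor_map G f) = Mnd_obj_map G (mcod f)"
  "mfun (Mnd_mor_map G f) = F1 G (mfun f)" "mstr (Mnd_mor_map G f) = F2 G (mstr f)"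
  by (simp_all add: Mnd_mor_map_def)

text \<open>The image of each of the three laws under \<open>F2 G\<close>; typing lets
  \<open>F2 G\<close> pass through composites and whiskerings.\<close>

lemma Mnd_obj_map_monad:
  assumes M: "is_monad A M" shows "is_monad B (Mnd_obj_map G M)"
  using is_monad_eqs[OF M, THEN arg_cong[where f = "F2 G"]]
  by (simp add: is_monadD[OF M] is_monad_sel)

lemma Mnd_mor_map_lax:
  assumes M: "is_monad A (mdom f)" "is_monad A (mcod f)" and f: "mfun f \<in> Hom1 A (mob (mdom f)) (mob (mcod f))" "lax_monad_mor A f"
  shows "lax_monad_mor B (Mnd_mor_map G f)"
proof -
  note t = M[THEN is_monadD(1)] M[THEN is_monadD(2)] M[THEN is_monadD(3)] M[THEN is_monadD(4)]
    M[THEN is_monadD(5)] M[THEN is_monadD(6)] M[THEN is_monadD(7)] M[THEN is_monadD(8)] M[THEN is_monadD(9)] M[THEN is_monadD(10)]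
  have f': "mfun f \<in> Arr A" "Dom1 A (mfun f) = mob (mdom f)" "Cod1 A (mfun f) = mob (mcod f)"
    "mstr f \<in> Cell A" "Dom2 A (mstr f) = mend (mcod f) \<odot>\<^bsub>A\<^esub> mfun f" "Cod2 A (mstr f) = mfun f \<odot>\<^bsub>A\<^esub> mend (mdom f)"
    using f by (auto simp: lax_monad_mor_sel Hom1_def Hom2_def)
  have "F2 G (mstr f \<bullet>\<^bsub>A\<^esub> (munit (mcod f) \<lhd>\<^bsub>A\<^esub> mfun f)) = F2 G (mfun f \<rhd>\<^bsub>A\<^esub> munit (mdom f))"
    "F2 G (mstr f \<bullet>\<^bsub>A\<^esub> (mmult (mcod f) \<lhd>\<^bsub>A\<^esub> mfun f)) =
      F2 G ((mfun f \<rhd>\<^bsub>A\<^esub> mmult (mdom f)) \<bullet>\<^bsub>A\<^esub> (mstr f \<lhd>\<^bsub>A\<^esub> mend (mdom f)) \<bullet>\<^bsub>A\<^esub> (mend (mcod f) \<rhd>\<^bsub>A\<^esub> mstr f))"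
    using f(2) by (simp_all add: lax_monad_mor_sel)
  then show ?thesis by (simp add: t f' lax_monad_mor_sel Hom2_def)
qed

lemma Mnd_mor_map_arr:
  assumes "str_arr A {M. is_monad A M} mob (lax_monad_mor A) f"
  shows "str_arr B {M. is_monad B M} mob (lax_monad_mor B) (Mnd_mor_map G f)"
  using assms Mnd_obj_map_monad Mnd_mor_map_lax by (simp add: str_arr_def Hom1_def)

lemma Mnd_mor_map_trf:
  assumes "str_arr A {M. is_monad A M} mob (lax_monad_mor A) f" "str_arr A {M. is_monad A M} mob (lax_monad_mor A) g"
    "mdom f = mdom g" "mcod f = mcod g" "\<sigma> \<in> Hom2 A (mfun f) (mfun g)" "lax_monad_trf A f g \<sigma>"
  shows "lax_monad_trf B (Mnd_mor_map G f) (Mnd_mor_map G g) (F2 G \<sigma>)"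
proof -
  have t: "mend (mdom f) \<in> Arr A" "mend (mcod f) \<in> Arr A" "mfun f \<in> Arr A" "mfun g \<in> Arr A"
    "Dom1 A (mfun f) = mob (mdom f)" "Cod1 A (mfun f) = mob (mcod f)"
    "Dom1 A (mfun g) = mob (mdom f)" "Cod1 A (mfun g) = mob (mcod f)"
    "Dom1 A (mend (mdom f)) = mob (mdom f)" "Cod1 A (mend (mdom f)) = mob (mdom f)"
    "Dom1 A (mend (mcod f)) = mob (mcod f)" "Cod1 A (mend (mcod f)) = mob (mcod f)"
    "mstr f \<in> Cell A" "Dom2 A (mstr f) = mend (mcod f) \<odot>\<^bsub>A\<^esub> mfun f" "Cod2 A (mstr f) = mfun f \<odot>\<^bsub>A\<^esub> mend (mdom f)"
    "mstr g \<in> Cell A" "Dom2 A (mstr g) = mend (mcod f) \<odot>\<^bsub>A\<^esub> mfun g" "Cod2 A (mstr g) = mfun g \<odot>\<^bsub>A\<^esub> mend (mdom f)"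
    "\<sigma> \<in> Cell A" "Dom2 A \<sigma> = mfun f" "Cod2 A \<sigma> = mfun g"
    using assms by (auto simp: str_arr_def lax_monad_mor_sel Hom2_def is_monad_sel)
  have "F2 G (mstr g \<bullet>\<^bsub>A\<^esub> (mend (mcod f) \<rhd>\<^bsub>A\<^esub> \<sigma>)) = F2 G ((\<sigma> \<lhd>\<^bsub>A\<^esub> mend (mdom f)) \<bullet>\<^bsub>A\<^esub> mstr f)"
    using assms(6) by (simp add: lax_monad_trf_def)
  then show ?thesis by (simp add: t lax_monad_trf_def)
qed

lemma Mnd_map_two_functor: "two_functor (Mnd A) (Mnd B) (Mnd_map G)"
proof -
  interpret MA: two_category "Mnd A" by (rule A.Mnd_two_category)
  interpret MB: two_category "Mnd B" by (rule B.Mnd_two_category)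
  show ?thesis
  proof (unfold_locales, goal_cases)
    case 3 then show ?case
      by (auto simp: Mnd_map_def Mnd_sel Hom2_def Mnd_mor_map_arr intro!: Mnd_mor_map_trf)
  next
    case 4 then show ?case
      by (auto simp: Mnd_map_def Mnd_sel is_monad_sel str_id_def Mnd_mor_map_def)
  next
    case (5 f X Y g Z) then show ?case
      by (auto simp: Mnd_map_def Mnd_sel Hom1_def Hom2_def str_comp_def Mnd_mor_map_def lax_comp_str_def
          str_arr_def lax_monad_mor_sel is_monad_sel)
  next
    case 8 then show ?case
      by (auto simp: Mnd_map_def Mnd_sel Hom1_def Hom2_def str_comp_def Mnd_mor_map_def lax_comp_str_def
          str_arr_def lax_monad_mor_sel is_monad_sel F2_HComp)
  qed (auto simp: Mnd_map_def Mnd_sel Hom1_def Hom2_def Mnd_obj_map_monad Mnd_mor_map_arr str_arr_sel(3))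
qed

text \<open>The criterion behind all four results. A single preserved universal algebra per monad
  controls the comparison for every choice of the two right 2-adjoints.\<close>

lemma standard_EM_I:
  assumes EM: "\<And>M. is_monad A M \<Longrightarrow> \<exists>X U \<chi>. em_universal A M X U \<chi> \<and>
      em_universal B (Mnd_obj_map G M) (F0 G X) (F1 G U) (F2 G \<chi>)"
    and B: "admits_EM B"
  shows "admits_EM A \<and> standard_EM A B G"
proof -
  have A: "admits_EM A" using EM A.admits_EM_iff by blast
  have "two_nat_iso (Mnd A) B (comp_fun G EM') (comp_fun EM (Mnd_map G)) (mate EM u B EM' e' G (Mnd_map G))"
    if 1: "EM_adjunction A EM' u' e'" and 2: "EM_adjunction B EM u e" for EM' u' e' EM u e
  proof -
    interpret X: two_adjunction A "Mnd A" "iota A" EM' u' e' using 1 by (simp add: EM_adjunction_def)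
    interpret X': two_adjunction B "Mnd B" "iota B" EM u e using 2 by (simp add: EM_adjunction_def)
    interpret H: two_functor "Mnd A" "Mnd B" "Mnd_map G" by (rule Mnd_map_two_functor)
    have c0: "Mnd_obj_map G (id_monad A X) = id_monad B (F0 G X)" if "X \<in> Obj A" for X
      using that by (simp add: Mnd_obj_map_def id_monad_def)
    have c1: "Mnd_mor_map G (id_monad_mor A f) = id_monad_mor B (F1 G f)" if "f \<in> Arr A" for f
      using that by (simp add: Mnd_mor_map_def id_monad_mor_def c0)
    interpret adjunction_square A "Mnd A" "iota A" EM' u' e' B "Mnd B" "iota B" EM u e G "Mnd_map G"
    proof (unfold_locales, goal_cases)
      \<comment> \<open>The condition \<open>preserved\<close>; by \<open>univ_arrow_iff\<close> the
        two universal algebras are universal arrows for the two versions of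
        \<open>iota\<close>.\<close>
      case (4 M)
      then have M: "is_monad A M" by (simp add: Mnd_sel)
      then obtain X U \<chi> where u: "em_universal A M X U \<chi>" "em_universal B (Mnd_obj_map G M) (F0 G X) (F1 G U) (F2 G \<chi>)"
        using EM by blast
      have X: "X \<in> Obj A" using u by (simp add: em_universal_def)
      have "F1 (Mnd_map G) (Mor (id_monad A X) M U \<chi>) = Mor (id_monad B (F0 G X)) (Mnd_obj_map G M) (F1 G U) (F2 G \<chi>)"
        by (simp add: Mnd_map_def Mnd_mor_map_def c0[OF X])
      then show ?case using u A.univ_arrow_iff[OF M] B.univ_arrow_iff[OF Mnd_obj_map_monad[OF M]]
        by (intro exI[of _ X] exI[of _ "Mor (id_monad A X) M U \<chi>"]) (simp add: Mnd_map_def)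
    qed (simp_all add: Mnd_map_def iota_def c0 c1)
    show ?thesis by (rule mate_iso)
  qed
  then show ?thesis using A B two_functor_axioms by (simp add: standard_EM_def)
qed

end

section \<open>Lifting EM objects along the forgetful 2-functor\<close>

lemma forgetful_sel [simp]:
  "F0 (forgetful und) = und" "F1 (forgetful und) = mfun" "F2 (forgetful und) = tcell"
  by (simp_all add: forgetful_def)

section \<open>Monads and algebras of structured objects\<close>

context structured_data
begin

text \<open>The clauses with \<open>is_trf\<close> are the substance: they say that unit and
  multiplication respect the structure carried by the endomorphism \<open>mend M\<close>.\<close>

lemma S_monadD:
  assumes "is_monad S M"
  shows "mob M \<in> obs" "arr (mend M)" "mdom (mend M) = mob M" "mcod (mend M) = mob M"
    "tdom (munit M) = idt (mob M)" "tcod (munit M) = mend M" "tcell (munit M) \<in> Cell D"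
    "Dom2 D (tcell (munit M)) = Id1 D (und (mob M))" "Cod2 D (tcell (munit M)) = mfun (mend M)"
    "is_trf (idt (mob M)) (mend M) (tcell (munit M))"
    "tdom (mmult M) = cmp (mend M) (mend M)" "tcod (mmult M) = mend M" "tcell (mmult M) \<in> Cell D"
    "Dom2 D (tcell (mmult M)) = mfun (mend M) \<odot> mfun (mend M)" "Cod2 D (tcell (mmult M)) = mfun (mend M)"
    "is_trf (cmp (mend M) (mend M)) (mend M) (tcell (mmult M))"
  using assms by (auto simp: is_monad_sel structured_sel)

abbreviation under where "under M \<equiv> Mnd_obj_map (forgetful und) M"

lemma under_sel [simp]:
  "mob (under M) = und (mob M)" "mend (under M) = mfun (mend M)"
  "munit (under M) = tcell (munit M)" "mmult (under M) = tcell (mmult M)"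
  by (simp_all add: Mnd_obj_map_def)

text \<open>Equations between 2-cells are compared on underlying cells, so the algebra laws are
  those below. The only additional demands are that \<open>f\<close> is structured and that the
  action is a structured transformation.\<close>

lemma is_alg_S_iff:
  assumes M: "is_monad S M"
  shows "is_alg S M Z f a \<longleftrightarrow> arr f \<and> mdom f = Z \<and> mcod f = mob M \<and>
     a = Trf (cmp (mend M) f) f (tcell a) \<and> is_trf (cmp (mend M) f) f (tcell a) \<and>
     is_alg D (under M) (und Z) (mfun f) (tcell a)"
proof (cases "arr f \<and> mdom f = Z \<and> mcod f = mob M \<and> a = Trf (cmp (mend M) f) f (tcell a)")
  case True
  note m = S_monadD[OF M]
  have "cmp (idt (mob M)) f = f" "cmp (cmp (mend M) (mend M)) f = cmp (mend M) (cmp (mend M) f)" "arr (cmp (mend M) f)"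
    using True m by (simp_all add: cmp_id cmp_assoc arr_cmp)
  then show ?thesis using True m
    by (cases a) (auto simp: is_alg_def structured_sel structured_whisk Hom1_def Hom2_def arr_sel)
next
  case False
  then show ?thesis
    by (cases a) (auto simp: is_alg_def structured_sel structured_whisk Hom1_def Hom2_def)
qed

text \<open>Isolates what depends on the kind of structure. The underlying factorisations come from
  \<open>em\<close>; \<open>lift1\<close> puts a unique structure on a factorising 1-cell, and
  \<open>lift2\<close> says that whiskering by \<open>U\<close> reflects structured
  transformations.\<close>

lemma lift_em:
  assumes M: "is_monad S M" and em: "em_universal D (under M) (und X) U \<chi>"
    and X: "X \<in> obs" and U: "is_mor (Mor X (mob M) U s)"
    and \<chi>: "is_trf (cmp (mend M) (Mor X (mob M) U s)) (Mor X (mob M) U s) \<chi>"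
    and lift1: "\<And>f g. \<lbrakk>arr f; mcod f = mob M; g \<in> Hom1 D (und (mdom f)) (und X); U \<odot> g = mfun f;
        is_trf (cmp (mend M) f) f (\<chi> \<lhd> g)\<rbrakk>
      \<Longrightarrow> \<exists>!t. is_mor (Mor (mdom f) X g t) \<and> comp_str (Mor X (mob M) U s) (Mor (mdom f) X g t) = mstr f"
    and lift2: "\<And>g h \<rho>. \<lbrakk>arr g; arr h; mdom g = mdom h; mcod g = X; mcod h = X; \<rho> \<in> Hom2 D (mfun g) (mfun h);
        is_trf (cmp (Mor X (mob M) U s) g) (cmp (Mor X (mob M) U s) h) (U \<rhd> \<rho>)\<rbrakk> \<Longrightarrow> is_trf g h \<rho>"
  shows "\<exists>X' U' \<chi>'. em_universal S M X' U' \<chi>' \<and> em_universal D (under M) (und X') (mfun U') (tcell \<chi>')"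
proof -
  let ?U = "Mor X (mob M) U s" and ?T = "mend M"
  let ?\<chi> = "Trf (cmp ?T ?U) ?U \<chi>"
  note m = S_monadD[OF M]
  have algU: "is_alg D (under M) (und X) U \<chi>" using em by (simp add: em_universal_def)
  then have ty: "U \<in> Arr D" "Dom1 D U = und X" "Cod1 D U = und (mob M)" "\<chi> \<in> Cell D" "Dom2 D \<chi> = mfun ?T \<odot> U" "Cod2 D \<chi> = U"
    by (auto simp: is_alg_def Hom1_def Hom2_def)
  have aU: "arr ?U" using ty X U m by (simp add: str_arr_def)
  have A: "is_alg S M X ?U ?\<chi>" using is_alg_S_iff[OF M, of X ?U ?\<chi>] aU \<chi> algU by simp
  \<comment> \<open>Restriction of \<open>?\<chi>\<close> along \<open>G\<close>; reassociating its
    boundary brings it into the form that \<open>is_alg_S_iff\<close> expects.\<close>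
  have w: "?\<chi> \<lhd>\<^bsub>S\<^esub> G = Trf (cmp ?T (cmp ?U G)) (cmp ?U G) (\<chi> \<lhd> mfun G)" if "arr G" "mcod G = X" for G
    using that m aU by (simp add: structured_whisk cmp_assoc)
  have E1: "\<exists>!G. G \<in> Hom1 S Z X \<and> ?U \<odot>\<^bsub>S\<^esub> G = F \<and> ?\<chi> \<lhd>\<^bsub>S\<^esub> G = a" if a: "is_alg S M Z F a" for Z F a
  proof -
    from a[unfolded is_alg_S_iff[OF M]] have F: "arr F" "mdom F = Z" "mcod F = mob M" "a = Trf (cmp ?T F) F (tcell a)"
      "is_trf (cmp ?T F) F (tcell a)" "is_alg D (under M) (und Z) (mfun F) (tcell a)" by auto
    then obtain g where g: "g \<in> Hom1 D (und Z) (und X)" "U \<odot> g = mfun F" "\<chi> \<lhd> g = tcell a"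
      and gu: "\<And>g'. g' \<in> Hom1 D (und Z) (und X) \<Longrightarrow> U \<odot> g' = mfun F \<Longrightarrow> \<chi> \<lhd> g' = tcell a \<Longrightarrow> g' = g"
      using em unfolding em_universal_def by metis
    obtain t where t: "is_mor (Mor Z X g t)" "comp_str ?U (Mor Z X g t) = mstr F"
      and tu: "\<And>t'. is_mor (Mor Z X g t') \<Longrightarrow> comp_str ?U (Mor Z X g t') = mstr F \<Longrightarrow> t' = t"
      using lift1[of F g] F g by (metis)
    have G: "arr (Mor Z X g t)" using t F X g by (auto simp: str_arr_def Hom1_def)
    show ?thesis
    proof (rule ex1I[of _ "Mor Z X g t"])
      have "cmp ?U (Mor Z X g t) = F" using t F g by (cases F) (simp add: str_comp_def)
      then show "Mor Z X g t \<in> Hom1 S Z X \<and> ?U \<odot>\<^bsub>S\<^esub> Mor Z X g t = F \<and> ?\<chi> \<lhd>\<^bsub>S\<^esub> Mor Z X g t = a"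
        using w[OF G] G F g by (simp add: structured_sel Hom1_def)
    next
      fix G' assume G': "G' \<in> Hom1 S Z X \<and> ?U \<odot>\<^bsub>S\<^esub> G' = F \<and> ?\<chi> \<lhd>\<^bsub>S\<^esub> G' = a"
      then have 1: "arr G'" "mdom G' = Z" "mcod G' = X" "cmp ?U G' = F" by (auto simp: structured_sel Hom1_def)
      have "tcell (?\<chi> \<lhd>\<^bsub>S\<^esub> G') = tcell a" using G' by simp
      then have "\<chi> \<lhd> mfun G' = tcell a" by (simp add: structured_whisk)
      moreover have "U \<odot> mfun G' = mfun F" using 1(4) by (auto simp: str_comp_def)
      moreover have "mfun G' \<in> Hom1 D (und Z) (und X)" using 1 by (auto simp: str_arr_def Hom1_def)
      ultimately have g': "mfun G' = g" by (intro gu)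
      moreover have "mstr G' = t" using 1 g' by (intro tu; cases G') (auto simp: str_arr_def str_comp_def)
      ultimately show "G' = Mor Z X g t" using 1 by (cases G') auto
    qed
  qed
  have E2: "\<exists>!\<rho>. \<rho> \<in> Hom2 S G H \<and> ?U \<rhd>\<^bsub>S\<^esub> \<rho> = \<sigma>"
    if h: "G \<in> Hom1 S Z X" "H \<in> Hom1 S Z X" "\<sigma> \<in> Hom2 S (?U \<odot>\<^bsub>S\<^esub> G) (?U \<odot>\<^bsub>S\<^esub> H)"
      "\<sigma> \<bullet>\<^bsub>S\<^esub> (?\<chi> \<lhd>\<^bsub>S\<^esub> G) = (?\<chi> \<lhd>\<^bsub>S\<^esub> H) \<bullet>\<^bsub>S\<^esub> (?T \<rhd>\<^bsub>S\<^esub> \<sigma>)" for Z G H \<sigma>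
  proof -
    have GH: "arr G" "arr H" "mdom G = Z" "mdom H = Z" "mcod G = X" "mcod H = X"
      using h by (auto simp: structured_sel Hom1_def)
    have \<sigma>: "\<sigma> = Trf (cmp ?U G) (cmp ?U H) (tcell \<sigma>)" "is_trf (cmp ?U G) (cmp ?U H) (tcell \<sigma>)"
      "tcell \<sigma> \<in> Hom2 D (U \<odot> mfun G) (U \<odot> mfun H)"
      using h(3) by (cases \<sigma>, auto simp: structured_sel Hom2_def)+
    have eq: "tcell \<sigma> \<bullet> (\<chi> \<lhd> mfun G) = (\<chi> \<lhd> mfun H) \<bullet> (mfun ?T \<rhd> tcell \<sigma>)"
      using arg_cong[OF h(4), of tcell] by (simp add: structured_sel structured_whisk)
    have gh: "mfun G \<in> Hom1 D (und Z) (und X)" "mfun H \<in> Hom1 D (und Z) (und X)" using GH by (auto simp: str_arr_def Hom1_def)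
    have "\<exists>!\<rho>. \<rho> \<in> Hom2 D (mfun G) (mfun H) \<and> U \<rhd> \<rho> = tcell \<sigma>"
      using em gh \<sigma>(3) eq unfolding em_universal_def by simp
    then obtain \<rho> where \<rho>: "\<rho> \<in> Hom2 D (mfun G) (mfun H)" "U \<rhd> \<rho> = tcell \<sigma>"
      and \<rho>u: "\<And>\<rho>'. \<rho>' \<in> Hom2 D (mfun G) (mfun H) \<Longrightarrow> U \<rhd> \<rho>' = tcell \<sigma> \<Longrightarrow> \<rho>' = \<rho>" by metis
    have t: "is_trf G H \<rho>" using lift2[of G H \<rho>] GH \<rho> \<sigma> by simp
    show ?thesis
    proof (rule ex1I[of _ "Trf G H \<rho>"])
      show "Trf G H \<rho> \<in> Hom2 S G H \<and> ?U \<rhd>\<^bsub>S\<^esub> Trf G H \<rho> = \<sigma>"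
        using GH \<rho> t \<sigma>(1) by (simp add: structured_sel structured_whisk Hom2_def)
    next
      fix \<rho>' assume \<rho>': "\<rho>' \<in> Hom2 S G H \<and> ?U \<rhd>\<^bsub>S\<^esub> \<rho>' = \<sigma>"
      have "tcell (?U \<rhd>\<^bsub>S\<^esub> \<rho>') = tcell \<sigma>" using \<rho>' by simp
      then have "tcell \<rho>' = \<rho>" using \<rho>' by (intro \<rho>u) (auto simp: structured_sel structured_whisk Hom2_def)
      then show "\<rho>' = Trf G H \<rho>" using \<rho>' by (cases \<rho>') (auto simp: structured_sel Hom2_def)
    qed
  qed
  have "em_universal S M X ?U ?\<chi>"
    unfolding em_universal_def using X A E1 E2 by (simp add: structured_sel(1))
  then show ?thesis using em by (intro exI[of _ X] exI[of _ ?U] exI[of _ ?\<chi>]) simp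
qed

text \<open>\<open>lift\<close> starts from an arbitrary universal algebra of the underlying monad,
  since \<open>admits_EM D\<close> only guarantees that there is one.\<close>

lemma structured_standard:
  assumes D: "admits_EM D"
    and lift: "\<And>M X U \<chi>. \<lbrakk>is_monad S M; is_monad D (under M); em_universal D (under M) X U \<chi>\<rbrakk> \<Longrightarrow>
      \<exists>X' U' \<chi>'. em_universal S M X' U' \<chi>' \<and> em_universal D (under M) (und X') (mfun U') (tcell \<chi>')"
  shows "admits_EM S \<and> standard_EM S D (forgetful und)"
proof -
  interpret G: two_functor S D "forgetful und" by (rule forgetful_two_functor)
  show ?thesis
  proof (rule G.standard_EM_I[OF _ D])
    fix M assume M: "is_monad S M"
    have M': "is_monad D (under M)" using G.Mnd_obj_map_monad[OF M] .
    then obtain X U \<chi> where "em_universal D (under M) X U \<chi>" using D admits_EM_iff by blast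
    from lift[OF M M' this] show "\<exists>X U \<chi>. em_universal S M X U \<chi> \<and>
      em_universal D (under M) (F0 (forgetful und) X) (F1 (forgetful und) U) (F2 (forgetful und) \<chi>)" by simp
  qed
qed

end

lemma em_universalD:
  assumes "em_universal D M X U \<chi>"
  shows "X \<in> Obj D" "is_alg D M X U \<chi>"
    "is_alg D M Z f a \<Longrightarrow> \<exists>!g. g \<in> Hom1 D Z X \<and> U \<odot>\<^bsub>D\<^esub> g = f \<and> \<chi> \<lhd>\<^bsub>D\<^esub> g = a"
    "\<lbrakk>g \<in> Hom1 D Z X; h \<in> Hom1 D Z X; \<sigma> \<in> Hom2 D (U \<odot>\<^bsub>D\<^esub> g) (U \<odot>\<^bsub>D\<^esub> h);
      \<sigma> \<bullet>\<^bsub>D\<^esub> (\<chi> \<lhd>\<^bsub>D\<^esub> g) = (\<chi> \<lhd>\<^bsub>D\<^esub> h) \<bullet>\<^bsub>D\<^esub> (mend M \<rhd>\<^bsub>D\<^esub> \<sigma>)\<rbrakk>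
      \<Longrightarrow> \<exists>!\<rho>. \<rho> \<in> Hom2 D g h \<and> U \<rhd>\<^bsub>D\<^esub> \<rho> = \<sigma>"
  using assms unfolding em_universal_def by blast+

section \<open>The universal algebra of a fixed monad\<close>

locale em_object = two_category D
  for D :: "('o, 'a, 'c) two_cat" (structure) and M :: "('o, 'a, 'c) monad" and X U \<chi> +
  assumes monad: "is_monad D M" and em: "em_universal D M X U \<chi>"
begin

abbreviation "C \<equiv> mob M"
abbreviation "T \<equiv> mend M"
abbreviation "\<eta> \<equiv> munit M"
abbreviation "\<mu> \<equiv> mmult M"

declare is_monadD[OF monad, simp]

lemma em_typ [simp]:
  "X \<in> Obj D" "U \<in> Arr D" "Dom1 D U = X" "Cod1 D U = C" "\<chi> \<in> Cell D" "Dom2 D \<chi> = T \<odot> U" "Cod2 D \<chi> = U"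
  using em_universalD(1,2)[OF em] by (auto simp: is_alg_def Hom1_def Hom2_def)

lemmas em_alg = em_universalD(2)[OF em]

lemma em_lift:
  assumes "is_alg D M Z f a"
  obtains g where "g \<in> Arr D" "Dom1 D g = Z" "Cod1 D g = X" "U \<odot> g = f" "\<chi> \<lhd> g = a"
  using em_universalD(3)[OF em assms] unfolding Hom1_def by blast

lemma em_lift2:
  assumes "g \<in> Arr D" "h \<in> Arr D" "Dom1 D g = Dom1 D h" "Cod1 D g = X" "Cod1 D h = X"
    "\<sigma> \<in> Cell D" "Dom2 D \<sigma> = U \<odot> g" "Cod2 D \<sigma> = U \<odot> h" "\<sigma> \<bullet> (\<chi> \<lhd> g) = (\<chi> \<lhd> h) \<bullet> (T \<rhd> \<sigma>)"
  obtains \<rho> where "\<rho> \<in> Cell D" "Dom2 D \<rho> = g" "Cod2 D \<rho> = h" "U \<rhd> \<rho> = \<sigma>"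
proof -
  have "\<exists>!\<rho>. \<rho> \<in> Hom2 D g h \<and> U \<rhd> \<rho> = \<sigma>"
    by (rule em_universalD(4)[OF em, of g "Dom1 D g"]) (use assms in \<open>simp_all add: Hom1_def Hom2_def\<close>)
  then show ?thesis using that by (auto simp: Hom2_def)
qed

text \<open>Interchange of \<open>\<rho>\<close> with \<open>\<chi>\<close>: whatever has been
  whiskered by \<open>U\<close> is a morphism of algebras. This is why \<open>em_faithful\<close>
  holds without a condition on the two cells beyond typing.\<close>

lemma chi_natural:
  assumes "\<rho> \<in> Cell D" "Cod1 D (Dom2 D \<rho>) = X"
  shows "(U \<rhd> \<rho>) \<bullet> (\<chi> \<lhd> Dom2 D \<rho>) = (\<chi> \<lhd> Cod2 D \<rho>) \<bullet> (T \<rhd> (U \<rhd> \<rho>))"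
  using whisk_swap[of \<rho> "Dom2 D \<rho>" "Cod2 D \<rho>" \<chi> "T \<odot> U" U] assms by (simp add: Hom2_def)

lemma em_faithful:
  assumes "\<rho> \<in> Cell D" "\<rho>' \<in> Cell D" "Dom2 D \<rho> = Dom2 D \<rho>'" "Cod2 D \<rho> = Cod2 D \<rho>'" "Cod1 D (Dom2 D \<rho>) = X" "U \<rhd> \<rho> = U \<rhd> \<rho>'"
  shows "\<rho> = \<rho>'"
proof -
  have "\<exists>!\<rho>''. \<rho>'' \<in> Hom2 D (Dom2 D \<rho>) (Cod2 D \<rho>) \<and> U \<rhd> \<rho>'' = U \<rhd> \<rho>"
    by (rule em_universalD(4)[OF em, of _ "Dom1 D (Dom2 D \<rho>)"])
      (use assms(1,5) chi_natural[of \<rho>] in \<open>simp_all add: Hom1_def Hom2_def\<close>)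
  then show ?thesis using assms by (auto simp: Hom2_def)
qed

end

section \<open>Oplax morphisms of endomorphisms\<close>

context two_category
begin

text \<open>Hypotheses \<open>1\<close> and \<open>2\<close> say that \<open>\<theta>\<close> commutes with the structure 2-cells of \<open>F\<close> and \<open>G\<close>: every axiom of
  an oplax morphism of monads or comonads has this form, with identities or composites for \<open>a\<close> and \<open>b\<close>.\<close>

lemma compat_comp:
  assumes ty: "F \<in> Arr D" "G \<in> Arr D" "Dom1 D F = C" "Cod1 D F = C'" "Dom1 D G = C'" "Cod1 D G = C''"
    "\<theta> \<in> Cell D" "Dom2 D \<theta> = A" "Cod2 D \<theta> = B" "\<theta>' \<in> Cell D" "Dom2 D \<theta>' = A'" "Cod2 D \<theta>' = B'"
    "\<theta>'' \<in> Cell D" "Dom2 D \<theta>'' = A''" "Cod2 D \<theta>'' = B''"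
    "Dom1 D A = C" "Cod1 D A = C" "Dom1 D A' = C'" "Cod1 D A' = C'" "Dom1 D A'' = C''" "Cod1 D A'' = C''"
    "a \<in> Cell D" "Dom2 D a = F \<odot> A" "Cod2 D a = A' \<odot> F" "b \<in> Cell D" "Dom2 D b = F \<odot> B" "Cod2 D b = B' \<odot> F"
    "a' \<in> Cell D" "Dom2 D a' = G \<odot> A'" "Cod2 D a' = A'' \<odot> G" "b' \<in> Cell D" "Dom2 D b' = G \<odot> B'" "Cod2 D b' = B'' \<odot> G"
  and 1: "b \<bullet> (F \<rhd> \<theta>) = (\<theta>' \<lhd> F) \<bullet> a" and 2: "b' \<bullet> (G \<rhd> \<theta>') = (\<theta>'' \<lhd> G) \<bullet> a'"
  shows "((b' \<lhd> F) \<bullet> (G \<rhd> b)) \<bullet> ((G \<odot> F) \<rhd> \<theta>) = (\<theta>'' \<lhd> (G \<odot> F)) \<bullet> ((a' \<lhd> F) \<bullet> (G \<rhd> a))"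
proof -
  have t: "A \<in> Arr D" "B \<in> Arr D" "A' \<in> Arr D" "B' \<in> Arr D" "A'' \<in> Arr D" "B'' \<in> Arr D"
    "Dom1 D B = C" "Cod1 D B = C" "Dom1 D B' = C'" "Cod1 D B' = C'" "Dom1 D B'' = C''" "Cod1 D B'' = C''"
    using ty Dom2_Arr[of \<theta>] Cod2_Arr[of \<theta>] Dom2_Arr[of \<theta>'] Cod2_Arr[of \<theta>'] Dom2_Arr[of \<theta>''] Cod2_Arr[of \<theta>'']
      parallel[of \<theta>] parallel[of \<theta>'] parallel[of \<theta>''] by simp_all
  have "((b' \<lhd> F) \<bullet> (G \<rhd> b)) \<bullet> ((G \<odot> F) \<rhd> \<theta>) = (b' \<lhd> F) \<bullet> (G \<rhd> (b \<bullet> (F \<rhd> \<theta>)))" using ty t by simp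
  also have "\<dots> = (b' \<lhd> F) \<bullet> (G \<rhd> ((\<theta>' \<lhd> F) \<bullet> a))" by (simp only: 1)
  also have "\<dots> = ((b' \<bullet> (G \<rhd> \<theta>')) \<lhd> F) \<bullet> (G \<rhd> a)" using ty t by simp
  also have "\<dots> = (((\<theta>'' \<lhd> G) \<bullet> a') \<lhd> F) \<bullet> (G \<rhd> a)" by (simp only: 2)
  also have "\<dots> = (\<theta>'' \<lhd> (G \<odot> F)) \<bullet> ((a' \<lhd> F) \<bullet> (G \<rhd> a))" using ty t by simp
  finally show ?thesis .
qed

text \<open>Doubling the structure cell of a composite agrees with composing the doubled structure
  cells. Hence the law for a multiplication or comultiplication of a composite is a case of
  \<open>compat_comp\<close>.\<close>

lemma oplax_square_comp:
  assumes ty: "F \<in> Arr D" "G \<in> Arr D" "Dom1 D F = C" "Cod1 D F = C'" "Dom1 D G = C'" "Cod1 D G = C''"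
    "S \<in> Arr D" "S' \<in> Arr D" "S'' \<in> Arr D"
    "Dom1 D S = C" "Cod1 D S = C" "Dom1 D S' = C'" "Cod1 D S' = C'" "Dom1 D S'' = C''" "Cod1 D S'' = C''"
    "\<tau> \<in> Cell D" "Dom2 D \<tau> = F \<odot> S" "Cod2 D \<tau> = S' \<odot> F"
    "\<tau>' \<in> Cell D" "Dom2 D \<tau>' = G \<odot> S'" "Cod2 D \<tau>' = S'' \<odot> G"
  shows "(S'' \<rhd> ((\<tau>' \<lhd> F) \<bullet> (G \<rhd> \<tau>))) \<bullet> (((\<tau>' \<lhd> F) \<bullet> (G \<rhd> \<tau>)) \<lhd> S) =
    (((S'' \<rhd> \<tau>') \<bullet> (\<tau>' \<lhd> S')) \<lhd> F) \<bullet> (G \<rhd> ((S' \<rhd> \<tau>) \<bullet> (\<tau> \<lhd> S)))"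
proof -
  have sw: "(\<tau>' \<lhd> (S' \<odot> F)) \<bullet> ((G \<odot> S') \<rhd> \<tau>) = ((S'' \<odot> G) \<rhd> \<tau>) \<bullet> (\<tau>' \<lhd> (F \<odot> S))"
    by (rule whisk_swap) (use ty in \<open>simp_all add: Hom2_def\<close>)
  have "(S'' \<rhd> ((\<tau>' \<lhd> F) \<bullet> (G \<rhd> \<tau>))) \<bullet> (((\<tau>' \<lhd> F) \<bullet> (G \<rhd> \<tau>)) \<lhd> S) =
      (S'' \<rhd> (\<tau>' \<lhd> F)) \<bullet> (((S'' \<odot> G) \<rhd> \<tau>) \<bullet> (\<tau>' \<lhd> (F \<odot> S))) \<bullet> (G \<rhd> (\<tau> \<lhd> S))"
    using ty by simp
  also have "\<dots> = (S'' \<rhd> (\<tau>' \<lhd> F)) \<bullet> ((\<tau>' \<lhd> (S' \<odot> F)) \<bullet> ((G \<odot> S') \<rhd> \<tau>)) \<bullet> (G \<rhd> (\<tau> \<lhd> S))"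
    by (simp only: sw)
  also have "\<dots> = (((S'' \<rhd> \<tau>') \<bullet> (\<tau>' \<lhd> S')) \<lhd> F) \<bullet> (G \<rhd> ((S' \<rhd> \<tau>) \<bullet> (\<tau> \<lhd> S)))"
    using ty by simp
  finally show ?thesis .
qed

text \<open>As for lax morphisms with the structure cells reversed: the hypothesis applies under
  \<open>G\<close>, then \<open>\<kappa>\<close> slides past \<open>\<sigma>\<close>.\<close>

lemma oplax_lwhisk:
  assumes ty: "F \<in> Arr D" "F' \<in> Arr D" "G \<in> Arr D" "S \<in> Arr D" "S' \<in> Arr D" "S'' \<in> Arr D"
    "Dom1 D F = C" "Cod1 D F = C'" "Dom1 D F' = C" "Cod1 D F' = C'" "Dom1 D G = C'" "Cod1 D G = C''"
    "Dom1 D S = C" "Cod1 D S = C" "Dom1 D S' = C'" "Cod1 D S' = C'" "Dom1 D S'' = C''" "Cod1 D S'' = C''"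
    "\<tau> \<in> Cell D" "Dom2 D \<tau> = F \<odot> S" "Cod2 D \<tau> = S' \<odot> F"
    "\<tau>' \<in> Cell D" "Dom2 D \<tau>' = F' \<odot> S" "Cod2 D \<tau>' = S' \<odot> F'"
    "\<kappa> \<in> Cell D" "Dom2 D \<kappa> = G \<odot> S'" "Cod2 D \<kappa> = S'' \<odot> G"
    "\<sigma> \<in> Cell D" "Dom2 D \<sigma> = F" "Cod2 D \<sigma> = F'"
  and t: "\<tau>' \<bullet> (\<sigma> \<lhd> S) = (S' \<rhd> \<sigma>) \<bullet> \<tau>"
  shows "((\<kappa> \<lhd> F') \<bullet> (G \<rhd> \<tau>')) \<bullet> ((G \<rhd> \<sigma>) \<lhd> S) = (S'' \<rhd> (G \<rhd> \<sigma>)) \<bullet> ((\<kappa> \<lhd> F) \<bullet> (G \<rhd> \<tau>))"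
proof -
  have sw: "(\<kappa> \<lhd> F') \<bullet> ((G \<odot> S') \<rhd> \<sigma>) = ((S'' \<odot> G) \<rhd> \<sigma>) \<bullet> (\<kappa> \<lhd> F)"
    by (rule whisk_swap) (use ty in \<open>simp_all add: Hom2_def\<close>)
  have "((\<kappa> \<lhd> F') \<bullet> (G \<rhd> \<tau>')) \<bullet> ((G \<rhd> \<sigma>) \<lhd> S) = (\<kappa> \<lhd> F') \<bullet> (G \<rhd> (\<tau>' \<bullet> (\<sigma> \<lhd> S)))" using ty by simp
  also have "\<dots> = (\<kappa> \<lhd> F') \<bullet> (G \<rhd> ((S' \<rhd> \<sigma>) \<bullet> \<tau>))" by (simp only: t)
  also have "\<dots> = ((\<kappa> \<lhd> F') \<bullet> ((G \<odot> S') \<rhd> \<sigma>)) \<bullet> (G \<rhd> \<tau>)" using ty by simp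
  also have "\<dots> = (((S'' \<odot> G) \<rhd> \<sigma>) \<bullet> (\<kappa> \<lhd> F)) \<bullet> (G \<rhd> \<tau>)" by (simp only: sw)
  also have "\<dots> = (S'' \<rhd> (G \<rhd> \<sigma>)) \<bullet> ((\<kappa> \<lhd> F) \<bullet> (G \<rhd> \<tau>))" using ty by simp
  finally show ?thesis .
qed

text \<open>First \<open>\<sigma>\<close> slides past \<open>\<tau>\<close>, then the hypothesis
  applies whiskered by \<open>F\<close>.\<close>

lemma oplax_rwhisk:
  assumes ty: "F \<in> Arr D" "G' \<in> Arr D" "G \<in> Arr D" "S \<in> Arr D" "S' \<in> Arr D" "S'' \<in> Arr D"
    "Dom1 D F = C" "Cod1 D F = C'" "Dom1 D G = C'" "Cod1 D G = C''" "Dom1 D G' = C'" "Cod1 D G' = C''"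
    "Dom1 D S = C" "Cod1 D S = C" "Dom1 D S' = C'" "Cod1 D S' = C'" "Dom1 D S'' = C''" "Cod1 D S'' = C''"
    "\<tau> \<in> Cell D" "Dom2 D \<tau> = F \<odot> S" "Cod2 D \<tau> = S' \<odot> F"
    "\<kappa> \<in> Cell D" "Dom2 D \<kappa> = G \<odot> S'" "Cod2 D \<kappa> = S'' \<odot> G"
    "\<kappa>' \<in> Cell D" "Dom2 D \<kappa>' = G' \<odot> S'" "Cod2 D \<kappa>' = S'' \<odot> G'"
    "\<sigma> \<in> Cell D" "Dom2 D \<sigma> = G" "Cod2 D \<sigma> = G'"
  and t: "\<kappa>' \<bullet> (\<sigma> \<lhd> S') = (S'' \<rhd> \<sigma>) \<bullet> \<kappa>"
  shows "((\<kappa>' \<lhd> F) \<bullet> (G' \<rhd> \<tau>)) \<bullet> ((\<sigma> \<lhd> F) \<lhd> S) = (S'' \<rhd> (\<sigma> \<lhd> F)) \<bullet> ((\<kappa> \<lhd> F) \<bullet> (G \<rhd> \<tau>))"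
proof -
  have sw: "(\<sigma> \<lhd> (S' \<odot> F)) \<bullet> (G \<rhd> \<tau>) = (G' \<rhd> \<tau>) \<bullet> (\<sigma> \<lhd> (F \<odot> S))"
    by (rule whisk_swap) (use ty in \<open>simp_all add: Hom2_def\<close>)
  have "((\<kappa>' \<lhd> F) \<bullet> (G' \<rhd> \<tau>)) \<bullet> ((\<sigma> \<lhd> F) \<lhd> S) = (\<kappa>' \<lhd> F) \<bullet> ((G' \<rhd> \<tau>) \<bullet> (\<sigma> \<lhd> (F \<odot> S)))" using ty by simp
  also have "\<dots> = (\<kappa>' \<lhd> F) \<bullet> ((\<sigma> \<lhd> (S' \<odot> F)) \<bullet> (G \<rhd> \<tau>))" by (simp only: sw)
  also have "\<dots> = ((\<kappa>' \<bullet> (\<sigma> \<lhd> S')) \<lhd> F) \<bullet> (G \<rhd> \<tau>)" using ty by simp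
  also have "\<dots> = (((S'' \<rhd> \<sigma>) \<bullet> \<kappa>) \<lhd> F) \<bullet> (G \<rhd> \<tau>)" by (simp only: t)
  also have "\<dots> = (S'' \<rhd> (\<sigma> \<lhd> F)) \<bullet> ((\<kappa> \<lhd> F) \<bullet> (G \<rhd> \<tau>))" using ty by simp
  finally show ?thesis .
qed

end

text \<open>The common part of monads and comonads: an endomorphism \<open>en\<close> and an oplax
  structure cell on morphisms. Transformations refer to these data alone; what distinguishes the two
  kinds of object is hidden in \<open>obs\<close> and \<open>is_mor\<close>.\<close>

locale oplax_endo = two_category D
  for D :: "('o, 'a, 'c) two_cat" (structure)
    and obs :: "'s set" and ob :: "'s \<Rightarrow> 'o" and en :: "'s \<Rightarrow> 'a" and is_mor :: "('s, 'a, 'c) mor \<Rightarrow> bool" +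
  assumes ob_Obj: "X \<in> obs \<Longrightarrow> ob X \<in> Obj D"
    and en_typ: "X \<in> obs \<Longrightarrow> en X \<in> Arr D \<and> Dom1 D (en X) = ob X \<and> Cod1 D (en X) = ob X"
    and mor_typ: "is_mor f \<Longrightarrow> mstr f \<in> Cell D \<and>
       Dom2 D (mstr f) = mfun f \<odot> en (mdom f) \<and> Cod2 D (mstr f) = en (mcod f) \<odot> mfun f"
    and id_mor_ax: "X \<in> obs \<Longrightarrow> is_mor (Mor X X (Id1 D (ob X)) (Id2 D (en X)))"
    and comp_mor_ax: "\<lbrakk>str_arr D obs ob is_mor f; str_arr D obs ob is_mor g; mcod f = mdom g\<rbrakk>
      \<Longrightarrow> is_mor (Mor (mdom f) (mcod g) (mfun g \<odot> mfun f) ((mstr g \<lhd> mfun f) \<bullet> (mfun g \<rhd> mstr f)))"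
begin

definition endo_trf :: "('s, 'a, 'c) mor \<Rightarrow> ('s, 'a, 'c) mor \<Rightarrow> 'c \<Rightarrow> bool" where
  "endo_trf f f' \<sigma> \<longleftrightarrow> mstr f' \<bullet> (\<sigma> \<lhd> en (mdom f)) = (en (mcod f) \<rhd> \<sigma>) \<bullet> mstr f"

lemma endo_arrD:
  assumes "str_arr D obs ob is_mor f"
  shows "en (mdom f) \<in> Arr D" "Dom1 D (en (mdom f)) = ob (mdom f)" "Cod1 D (en (mdom f)) = ob (mdom f)"
    "en (mcod f) \<in> Arr D" "Dom1 D (en (mcod f)) = ob (mcod f)" "Cod1 D (en (mcod f)) = ob (mcod f)"
    "mfun f \<in> Arr D" "Dom1 D (mfun f) = ob (mdom f)" "Cod1 D (mfun f) = ob (mcod f)"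
    "mstr f \<in> Cell D" "Dom2 D (mstr f) = mfun f \<odot> en (mdom f)" "Cod2 D (mstr f) = en (mcod f) \<odot> mfun f"
  using assms en_typ mor_typ unfolding str_arr_def by blast+

lemma endo_data: "structured_data D obs ob is_mor endo_trf (\<lambda>M. Id2 D (en M)) (oplax_comp_str D)"
proof (unfold_locales, goal_cases)
  case 1 then show ?case by (rule ob_Obj)
next
  case 2 then show ?case by (rule id_mor_ax)
next
  case (3 f g) then show ?case unfolding oplax_comp_str_def by (rule comp_mor_ax)
next
  case (4 f) show ?case by (simp add: oplax_comp_str_def endo_arrD[OF 4])
next
  case (5 f) show ?case by (simp add: oplax_comp_str_def endo_arrD[OF 5])
next
  case (6 f g h)
  note t = endo_arrD[OF 6(1)] endo_arrD[OF 6(2)] endo_arrD[OF 6(3)]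
  show ?case using 6(4,5) by (simp add: oplax_comp_str_def t)
next
  case (7 f) show ?case by (simp add: endo_trf_def endo_arrD[OF 7])
next
  case (8 f g h \<sigma> \<tau>)
  let ?S = "en (mdom f)" and ?S' = "en (mcod f)"
  have t: "\<sigma> \<in> Cell D" "Dom2 D \<sigma> = mfun f" "Cod2 D \<sigma> = mfun g" "\<tau> \<in> Cell D" "Dom2 D \<tau> = mfun g" "Cod2 D \<tau> = mfun h"
    using 8 by (simp_all add: Hom2_def)
  note t = t 8(4-7) endo_arrD[OF 8(1)] endo_arrD[OF 8(2), unfolded 8(4,5)] endo_arrD[OF 8(3), unfolded 8(6,7)]
  have s: "mstr g \<bullet> (\<sigma> \<lhd> ?S) = (?S' \<rhd> \<sigma>) \<bullet> mstr f" "mstr h \<bullet> (\<tau> \<lhd> ?S) = (?S' \<rhd> \<tau>) \<bullet> mstr g"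
    using 8 by (simp_all add: endo_trf_def)
  have "mstr h \<bullet> ((\<tau> \<bullet> \<sigma>) \<lhd> ?S) = (mstr h \<bullet> (\<tau> \<lhd> ?S)) \<bullet> (\<sigma> \<lhd> ?S)" by (simp add: t)
  also have "\<dots> = ((?S' \<rhd> \<tau>) \<bullet> mstr g) \<bullet> (\<sigma> \<lhd> ?S)" by (simp only: s)
  also have "\<dots> = (?S' \<rhd> \<tau>) \<bullet> (mstr g \<bullet> (\<sigma> \<lhd> ?S))" by (simp add: t)
  also have "\<dots> = (?S' \<rhd> \<tau>) \<bullet> ((?S' \<rhd> \<sigma>) \<bullet> mstr f)" by (simp only: s)
  also have "\<dots> = (?S' \<rhd> (\<tau> \<bullet> \<sigma>)) \<bullet> mstr f" by (simp add: t)
  finally show ?case by (simp add: endo_trf_def)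
next
  case (9 f f' g \<sigma>)
  note t = endo_arrD[OF 9(1)] endo_arrD[OF 9(2), unfolded 9(4,5)] endo_arrD[OF 9(3)] 9(4-6)
  show ?case
    unfolding endo_trf_def oplax_comp_str_def mor.sel
    by (rule oplax_lwhisk[where S' = "en (mcod f)" and C' = "ob (mcod f)" and C = "ob (mdom f)" and C'' = "ob (mcod g)"])
      (use 9(7,8) t in \<open>simp_all add: endo_trf_def Hom2_def\<close>)
next
  case (10 f g g' \<sigma>)
  note t = endo_arrD[OF 10(1)] endo_arrD[OF 10(2)] endo_arrD[OF 10(3), unfolded 10(4,5)] 10(4-6)
  show ?case
    unfolding endo_trf_def oplax_comp_str_def mor.sel
    by (rule oplax_rwhisk[where S' = "en (mcod f)" and C' = "ob (mcod f)" and C = "ob (mdom f)" and C'' = "ob (mcod g)"])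
      (use 10(7,8) t in \<open>simp_all add: endo_trf_def Hom2_def\<close>)
qed

sublocale structured_data D obs ob is_mor endo_trf "\<lambda>M. Id2 D (en M)" "oplax_comp_str D"
  by (rule endo_data)

text \<open>\<open>R\<close> is the endomorphism of \<open>X\<close> that classifies the algebra
  \<open>S U\<close>. It remains to equip \<open>R\<close> with a structure for which
  \<open>U\<close> with an identity cell is a morphism, and for which every cell lying over the
  structure of a morphism is a structure itself; this is \<open>lift\<close>.\<close>

lemma endo_standard:
  assumes D: "admits_EM D"
    and lift: "\<And>M X U \<chi> R. \<lbrakk>is_monad S M; em_object D (under M) X U \<chi>;
        R \<in> Arr D; Dom1 D R = X; Cod1 D R = X; U \<odot> R = en (mob M) \<odot> U;
        \<chi> \<lhd> R = (en (mob M) \<rhd> \<chi>) \<bullet> (mstr (mend M) \<lhd> U)\<rbrakk> \<Longrightarrow>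
      \<exists>X'\<in>obs. ob X' = X \<and> en X' = R \<and> is_mor (Mor X' (mob M) U (Id2 D (U \<odot> R))) \<and>
        (\<forall>f g t. arr f \<longrightarrow> mcod f = mob M \<longrightarrow> g \<in> Hom1 D (ob (mdom f)) X \<longrightarrow> U \<odot> g = mfun f \<longrightarrow>
          t \<in> Hom2 D (g \<odot> en (mdom f)) (R \<odot> g) \<longrightarrow> U \<rhd> t = mstr f \<longrightarrow> is_mor (Mor (mdom f) X' g t))"
  shows "admits_EM S \<and> standard_EM S D (forgetful ob)"
proof (rule structured_standard[OF D])
  fix M X U \<chi> assume M: "is_monad S M" and M': "is_monad D (under M)" and em: "em_universal D (under M) X U \<chi>"
  interpret em_object D "under M" X U \<chi> using M' em by unfold_locales
  let ?S = "en (mob M)" and ?T = "mend M" and ?\<tau> = "mstr (mend M)"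
  note m = S_monadD[OF M]
  note T = endo_arrD[OF m(2), unfolded m(3,4)]
  \<comment> \<open>\<open>u\<close> and \<open>mu\<close> express that unit and multiplication of
    \<open>M\<close> are transformations; they become the two algebra laws of
    \<open>S U\<close>.\<close>
  have u: "?\<tau> \<bullet> (tcell (munit M) \<lhd> ?S) = ?S \<rhd> tcell (munit M)"
    using m(10) ob_Obj[OF m(1)] by (simp add: endo_trf_def m T)
  have mu: "?\<tau> \<bullet> (tcell (mmult M) \<lhd> ?S) = (?S \<rhd> tcell (mmult M)) \<bullet> ((?\<tau> \<lhd> mfun ?T) \<bullet> (mfun ?T \<rhd> ?\<tau>))"
    using m(16) m(1) by (simp add: endo_trf_def m(1-4) oplax_comp_str_def)
  have Xtyp: "Dom1 D U = X" "U \<in> Arr D" "Cod1 D U = ob (mob M)" using em_typ by simp_all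
  have \<chi>typ: "\<chi> \<in> Cell D" "Dom2 D \<chi> = mfun ?T \<odot> U" "Cod2 D \<chi> = U" using em_typ by simp_all
  have \<chi>1: "\<chi> \<bullet> (tcell (munit M) \<lhd> U) = Id2 D U" and \<chi>2: "\<chi> \<bullet> (tcell (mmult M) \<lhd> U) = \<chi> \<bullet> (mfun ?T \<rhd> \<chi>)"
    using em_alg by (simp_all add: is_alg_def)
  note ty = Xtyp \<chi>typ T m(1,7-9,13-15) ob_Obj[OF m(1)]
  have "is_alg D (under M) X (?S \<odot> U) ((?S \<rhd> \<chi>) \<bullet> (?\<tau> \<lhd> U))"
  proof -
    let ?a = "(?S \<rhd> \<chi>) \<bullet> (?\<tau> \<lhd> U)"
    have "?a \<bullet> (tcell (munit M) \<lhd> (?S \<odot> U)) = (?S \<rhd> \<chi>) \<bullet> ((?\<tau> \<bullet> (tcell (munit M) \<lhd> ?S)) \<lhd> U)"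
      by (simp add: ty)
    also have "\<dots> = ?S \<rhd> (\<chi> \<bullet> (tcell (munit M) \<lhd> U))" by (simp only: u) (simp add: ty)
    also have "\<dots> = Id2 D (?S \<odot> U)" by (simp only: \<chi>1) (simp add: ty)
    finally have 1: "?a \<bullet> (tcell (munit M) \<lhd> (?S \<odot> U)) = Id2 D (?S \<odot> U)" .
    have sw: "(?\<tau> \<lhd> U) \<bullet> ((mfun ?T \<odot> ?S) \<rhd> \<chi>) = ((?S \<odot> mfun ?T) \<rhd> \<chi>) \<bullet> (?\<tau> \<lhd> (mfun ?T \<odot> U))"
      by (rule whisk_swap) (simp_all add: Hom2_def ty)
    have "?a \<bullet> (tcell (mmult M) \<lhd> (?S \<odot> U)) = (?S \<rhd> \<chi>) \<bullet> ((?\<tau> \<bullet> (tcell (mmult M) \<lhd> ?S)) \<lhd> U)"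
      by (simp add: ty)
    also have "\<dots> = (?S \<rhd> (\<chi> \<bullet> (tcell (mmult M) \<lhd> U))) \<bullet> (?\<tau> \<lhd> (mfun ?T \<odot> U)) \<bullet> (mfun ?T \<rhd> (?\<tau> \<lhd> U))"
      by (simp only: mu) (simp add: ty)
    also have "\<dots> = (?S \<rhd> \<chi>) \<bullet> (((?S \<odot> mfun ?T) \<rhd> \<chi>) \<bullet> (?\<tau> \<lhd> (mfun ?T \<odot> U))) \<bullet> (mfun ?T \<rhd> (?\<tau> \<lhd> U))"
      by (simp only: \<chi>2) (simp add: ty)
    also have "\<dots> = ?a \<bullet> (mfun ?T \<rhd> ?a)" by (simp only: sw[symmetric]) (simp add: ty)
    finally have "?a \<bullet> (tcell (mmult M) \<lhd> (?S \<odot> U)) = ?a \<bullet> (mfun ?T \<rhd> ?a)" .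
    with 1 show ?thesis by (simp add: is_alg_def Hom1_def Hom2_def ty)
  qed
  then obtain R where R: "R \<in> Arr D" "Dom1 D R = X" "Cod1 D R = X" "U \<odot> R = ?S \<odot> U" "\<chi> \<lhd> R = (?S \<rhd> \<chi>) \<bullet> (?\<tau> \<lhd> U)"
    by (rule em_lift)
  obtain X' where X': "X' \<in> obs" "ob X' = X" "en X' = R" "is_mor (Mor X' (mob M) U (Id2 D (U \<odot> R)))"
    and mor: "\<And>f g t. \<lbrakk>arr f; mcod f = mob M; g \<in> Hom1 D (ob (mdom f)) X; U \<odot> g = mfun f;
        t \<in> Hom2 D (g \<odot> en (mdom f)) (R \<odot> g); U \<rhd> t = mstr f\<rbrakk> \<Longrightarrow> is_mor (Mor (mdom f) X' g t)"
    using lift[OF M em_object_axioms R] by blast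
  have RU: "?S \<odot> (U \<odot> g) = U \<odot> (R \<odot> g)" if "g \<in> Arr D" "Cod1 D g = X" for g
    using Comp1_ac[of g R U] Comp1_ac[of g U ?S] R that ty by simp
  have U\<rho>: "?S \<rhd> (U \<rhd> \<rho>) = U \<rhd> (R \<rhd> \<rho>)" if "\<rho> \<in> Cell D" "Cod1 D (Dom2 D \<rho>) = X" for \<rho>
    using that R ty by simp
  have \<chi>R: "\<chi> \<lhd> (R \<odot> g) = (?S \<rhd> (\<chi> \<lhd> g)) \<bullet> (?\<tau> \<lhd> (U \<odot> g))" if "g \<in> Arr D" "Cod1 D g = X" for g
    using arg_cong[OF R(5), of "\<lambda>x. x \<lhd> g"] that R(1-3) ty by simp
  show "\<exists>X' U' \<chi>'. em_universal S M X' U' \<chi>' \<and> em_universal D (under M) (ob X') (mfun U') (tcell \<chi>')"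
  proof (rule lift_em[OF M _ X'(1,4)])
    show "em_universal D (under M) (ob X') U \<chi>" using em X' by simp
    show "endo_trf (cmp ?T (Mor X' (mob M) U (Id2 D (U \<odot> R)))) (Mor X' (mob M) U (Id2 D (U \<odot> R))) \<chi>"
    proof -
      have "(?\<tau> \<lhd> U) \<bullet> (mfun ?T \<rhd> Id2 D (U \<odot> R)) = ?\<tau> \<lhd> U" using R by (simp add: ty)
      then show ?thesis using R(1-3,5) R(4)[symmetric] by (simp add: endo_trf_def oplax_comp_str_def X' m ty)
    qed
  next
    fix f g assume f: "arr f" "mcod f = mob M" and g: "g \<in> Hom1 D (ob (mdom f)) (ob X')" and Ug: "U \<odot> g = mfun f"
      and trf: "endo_trf (cmp ?T f) f (\<chi> \<lhd> g)"
    have g': "g \<in> Arr D" "Dom1 D g = ob (mdom f)" "Cod1 D g = X" using g X' by (auto simp: Hom1_def)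
    note ft = endo_arrD[OF f(1), unfolded f(2)]
    have UgS: "U \<odot> (g \<odot> en (mdom f)) = mfun f \<odot> en (mdom f)"
      using Comp1_ac[of "en (mdom f)" g U] g' ft Ug ty by simp
    \<comment> \<open>That \<open>\<chi> \<lhd> g\<close> is a transformation says precisely that
      \<open>mstr f\<close> is a morphism of algebras, so it lifts to a structure cell for
      \<open>g\<close>.\<close>
    have "\<exists>t. t \<in> Cell D \<and> Dom2 D t = g \<odot> en (mdom f) \<and> Cod2 D t = R \<odot> g \<and> U \<rhd> t = mstr f"
    proof (rule em_lift2[of "g \<odot> en (mdom f)" "R \<odot> g" "mstr f"])
      show "mstr f \<bullet> (\<chi> \<lhd> (g \<odot> en (mdom f))) = (\<chi> \<lhd> (R \<odot> g)) \<bullet> (mend (under M) \<rhd> mstr f)"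
        using trf g' R(1-3) by (simp add: endo_trf_def oplax_comp_str_def \<chi>R Ug UgS ft ty f m)
    qed (use g' ft R(1-3) Ug UgS RU[OF g'(1,3)] ty in auto)
    then obtain t where t: "t \<in> Hom2 D (g \<odot> en (mdom f)) (R \<odot> g)" "U \<rhd> t = mstr f" by (auto simp: Hom2_def)
    \<comment> \<open>Because the structure of \<open>U\<close> is an identity, composing with
      \<open>U\<close> only whiskers the structure of \<open>g\<close>. Uniqueness of that structure
      is then faithfulness of \<open>U\<close>.\<close>
    have cs: "oplax_comp_str D (Mor X' (mob M) U (Id2 D (U \<odot> R))) (Mor (mdom f) X' g t') = U \<rhd> t'"
      if "t' \<in> Hom2 D (g \<odot> en (mdom f)) (R \<odot> g)" for t'
      using that g' R(1-3) ty ft by (simp add: oplax_comp_str_def Hom2_def)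
    show "\<exists>!t. is_mor (Mor (mdom f) X' g t) \<and> oplax_comp_str D (Mor X' (mob M) U (Id2 D (U \<odot> R))) (Mor (mdom f) X' g t) = mstr f"
    proof (rule ex1I[of _ t])
      show "is_mor (Mor (mdom f) X' g t) \<and> oplax_comp_str D (Mor X' (mob M) U (Id2 D (U \<odot> R))) (Mor (mdom f) X' g t) = mstr f"
        using mor[OF f _ Ug t] g X' cs t by simp
      fix t' assume t': "is_mor (Mor (mdom f) X' g t') \<and> oplax_comp_str D (Mor X' (mob M) U (Id2 D (U \<odot> R))) (Mor (mdom f) X' g t') = mstr f"
      have tt: "t' \<in> Cell D" "Dom2 D t' = g \<odot> en (mdom f)" "Cod2 D t' = R \<odot> g"
        using mor_typ[OF conjunct1[OF t']] by (simp_all add: X')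
      have "t' \<in> Hom2 D (g \<odot> en (mdom f)) (R \<odot> g)" by (simp add: Hom2_def tt)
      from cs[OF this] conjunct2[OF t'] t(2) have eq: "U \<rhd> t' = U \<rhd> t" by simp
      have "t \<in> Cell D" "Dom2 D t = g \<odot> en (mdom f)" "Cod2 D t = R \<odot> g" using t(1) by (simp_all add: Hom2_def)
      with tt eq show "t' = t" by - (rule em_faithful, simp_all add: g' ft R(1-3))
    qed
  next
    fix g h \<rho> assume g: "arr g" "arr h" "mdom g = mdom h" "mcod g = X'" "mcod h = X'" and \<rho>: "\<rho> \<in> Hom2 D (mfun g) (mfun h)"
      and trf: "endo_trf (cmp (Mor X' (mob M) U (Id2 D (U \<odot> R))) g) (cmp (Mor X' (mob M) U (Id2 D (U \<odot> R))) h) (U \<rhd> \<rho>)"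
    note gt = endo_arrD[OF g(1), unfolded g(3,4) X'(2,3)] endo_arrD[OF g(2), unfolded g(5) X'(2,3)]
    have \<rho>t: "\<rho> \<in> Cell D" "Dom2 D \<rho> = mfun g" "Cod2 D \<rho> = mfun h" using \<rho> by (auto simp: Hom2_def)
    have "U \<rhd> (mstr h \<bullet> (\<rho> \<lhd> en (mdom g))) = U \<rhd> ((R \<rhd> \<rho>) \<bullet> mstr g)"
      using trf R(1-3) U\<rho>[OF \<rho>t(1)] by (simp add: endo_trf_def oplax_comp_str_def g gt \<rho>t ty)
    then have "mstr h \<bullet> (\<rho> \<lhd> en (mdom g)) = (R \<rhd> \<rho>) \<bullet> mstr g"
      by (rule em_faithful[rotated -1]) (use R(1-3) in \<open>simp_all add: gt g \<rho>t ty\<close>)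
    then show "endo_trf g h \<rho>" by (simp add: endo_trf_def g X')
  qed
qed

end

text \<open>\<open>UR\<close> and \<open>chi_R\<close> together say that \<open>R\<close> is the
  factorisation through \<open>U\<close> of the algebra \<open>S \<odot> U\<close> whose action
  comes from \<open>\<tau>\<close>.\<close>

locale em_endo = em_object +
  fixes S \<tau> R
  assumes S_typ [simp]: "S \<in> Arr D" "Dom1 D S = C" "Cod1 D S = C"
    and tau_typ [simp]: "\<tau> \<in> Cell D" "Dom2 D \<tau> = T \<odot> S" "Cod2 D \<tau> = S \<odot> T"
    and R_typ [simp]: "R \<in> Arr D" "Dom1 D R = X" "Cod1 D R = X"
    and UR: "U \<odot> R = S \<odot> U" and chi_R: "\<chi> \<lhd> R = (S \<rhd> \<chi>) \<bullet> (\<tau> \<lhd> U)"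
begin

lemma UR_comp: "g \<in> Arr D \<Longrightarrow> Cod1 D g = X \<Longrightarrow> U \<odot> (R \<odot> g) = S \<odot> (U \<odot> g)"
  using Comp1_ac[of g R U] Comp1_ac[of g U S] UR by simp

lemma U_lwhisk: "\<rho> \<in> Cell D \<Longrightarrow> Cod1 D (Dom2 D \<rho>) = X \<Longrightarrow> U \<rhd> (R \<rhd> \<rho>) = S \<rhd> (U \<rhd> \<rho>)"
  using UR by simp

text \<open>\<open>R \<odot> R\<close> lifts \<open>S \<odot> S\<close> with the doubled structure
  cell, which makes \<open>lift_cell\<close> available for multiplications and
  comultiplications.\<close>

lemma chi_RR: "\<chi> \<lhd> (R \<odot> R) = ((S \<odot> S) \<rhd> \<chi>) \<bullet> (((S \<rhd> \<tau>) \<bullet> (\<tau> \<lhd> S)) \<lhd> U)"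
proof -
  have "\<chi> \<lhd> (R \<odot> R) = (\<chi> \<lhd> R) \<lhd> R" by simp
  also have "\<dots> = (S \<rhd> (\<chi> \<lhd> R)) \<bullet> (\<tau> \<lhd> (S \<odot> U))" by (simp only: chi_R) (simp add: UR chi_R)
  also have "\<dots> = ((S \<odot> S) \<rhd> \<chi>) \<bullet> (((S \<rhd> \<tau>) \<bullet> (\<tau> \<lhd> S)) \<lhd> U)" by (simp only: chi_R) simp
  finally show ?thesis .
qed

text \<open>By interchange with \<open>\<chi>\<close>, the hypothesis on \<open>\<theta>\<close>
  says that \<open>\<theta> \<lhd> U\<close> is a morphism of algebras. In the uses \<open>a\<close>
  and \<open>b\<close> are an identity, \<open>\<tau>\<close> or the doubled cell, according to
  whether the endomorphism is the identity, \<open>S\<close> or its square.\<close>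

lemma lift_cell:
  assumes ty: "A \<in> Arr D" "B \<in> Arr D" "Dom1 D A = C" "Cod1 D A = C" "Dom1 D B = C" "Cod1 D B = C"
    "A' \<in> Arr D" "B' \<in> Arr D" "Dom1 D A' = X" "Cod1 D A' = X" "Dom1 D B' = X" "Cod1 D B' = X"
    "U \<odot> A' = A \<odot> U" "U \<odot> B' = B \<odot> U"
    "a \<in> Cell D" "Dom2 D a = T \<odot> A" "Cod2 D a = A \<odot> T" "b \<in> Cell D" "Dom2 D b = T \<odot> B" "Cod2 D b = B \<odot> T"
    "\<theta> \<in> Cell D" "Dom2 D \<theta> = A" "Cod2 D \<theta> = B"
  and A: "\<chi> \<lhd> A' = (A \<rhd> \<chi>) \<bullet> (a \<lhd> U)" and B: "\<chi> \<lhd> B' = (B \<rhd> \<chi>) \<bullet> (b \<lhd> U)"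
  and \<theta>: "b \<bullet> (T \<rhd> \<theta>) = (\<theta> \<lhd> T) \<bullet> a"
  obtains \<theta>' where "\<theta>' \<in> Cell D" "Dom2 D \<theta>' = A'" "Cod2 D \<theta>' = B'" "U \<rhd> \<theta>' = \<theta> \<lhd> U"
proof (rule em_lift2[of A' B' "\<theta> \<lhd> U"])
  have sw: "(\<theta> \<lhd> U) \<bullet> (A \<rhd> \<chi>) = (B \<rhd> \<chi>) \<bullet> (\<theta> \<lhd> (T \<odot> U))"
    by (rule whisk_swap) (simp_all add: Hom2_def ty)
  have "(\<theta> \<lhd> U) \<bullet> (\<chi> \<lhd> A') = ((\<theta> \<lhd> U) \<bullet> (A \<rhd> \<chi>)) \<bullet> (a \<lhd> U)" by (simp only: A) (simp add: ty)
  also have "\<dots> = (B \<rhd> \<chi>) \<bullet> (((\<theta> \<lhd> T) \<bullet> a) \<lhd> U)" by (simp only: sw) (simp add: ty)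
  also have "\<dots> = ((B \<rhd> \<chi>) \<bullet> (b \<lhd> U)) \<bullet> (T \<rhd> (\<theta> \<lhd> U))" by (simp only: \<theta>[symmetric]) (simp add: ty)
  finally show "(\<theta> \<lhd> U) \<bullet> (\<chi> \<lhd> A') = (\<chi> \<lhd> B') \<bullet> (T \<rhd> (\<theta> \<lhd> U))" by (simp only: B)
qed (use ty that in simp_all)

lemma Id_square: "U \<odot> Id1 D X = Id1 D C \<odot> U" "\<chi> \<lhd> Id1 D X = (Id1 D C \<rhd> \<chi>) \<bullet> (Id2 D T \<lhd> U)"
  by simp_all

lemma RR_square: "U \<odot> (R \<odot> R) = (S \<odot> S) \<odot> U"
  using UR UR_comp[of R] by simp

lemmas R_eqs = UR chi_R Id_square RR_square chi_RR

end

section \<open>Laws of monads, comonads and their oplax morphisms\<close>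

lemma oplax_monad_mor_sel:
  "oplax_monad_mor D f \<longleftrightarrow>
     mstr f \<in> Hom2 D (mfun f \<odot>\<^bsub>D\<^esub> mend (mdom f)) (mend (mcod f) \<odot>\<^bsub>D\<^esub> mfun f) \<and>
     mstr f \<bullet>\<^bsub>D\<^esub> (mfun f \<rhd>\<^bsub>D\<^esub> munit (mdom f)) = munit (mcod f) \<lhd>\<^bsub>D\<^esub> mfun f \<and>
     mstr f \<bullet>\<^bsub>D\<^esub> (mfun f \<rhd>\<^bsub>D\<^esub> mmult (mdom f)) =
       (mmult (mcod f) \<lhd>\<^bsub>D\<^esub> mfun f) \<bullet>\<^bsub>D\<^esub> (mend (mcod f) \<rhd>\<^bsub>D\<^esub> mstr f) \<bullet>\<^bsub>D\<^esub> (mstr f \<lhd>\<^bsub>D\<^esub> mend (mdom f))"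
  by (auto simp: oplax_monad_mor_def split: mor.split monad.split)

lemma oplax_comonad_mor_sel:
  "oplax_comonad_mor D f \<longleftrightarrow>
     mstr f \<in> Hom2 D (mfun f \<odot>\<^bsub>D\<^esub> cend (mdom f)) (cend (mcod f) \<odot>\<^bsub>D\<^esub> mfun f) \<and>
     (ccounit (mcod f) \<lhd>\<^bsub>D\<^esub> mfun f) \<bullet>\<^bsub>D\<^esub> mstr f = mfun f \<rhd>\<^bsub>D\<^esub> ccounit (mdom f) \<and>
     (ccomult (mcod f) \<lhd>\<^bsub>D\<^esub> mfun f) \<bullet>\<^bsub>D\<^esub> mstr f =
       (cend (mcod f) \<rhd>\<^bsub>D\<^esub> mstr f) \<bullet>\<^bsub>D\<^esub> (mstr f \<lhd>\<^bsub>D\<^esub> cend (mdom f)) \<bullet>\<^bsub>D\<^esub> (mfun f \<rhd>\<^bsub>D\<^esub> ccomult (mdom f))"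
  by (auto simp: oplax_comonad_mor_def split: mor.split comonad.split)

lemma is_comonad_sel:
  "is_comonad D M \<longleftrightarrow> cob M \<in> Obj D \<and> cend M \<in> Arr D \<and> Dom1 D (cend M) = cob M \<and> Cod1 D (cend M) = cob M \<and>
     ccounit M \<in> Cell D \<and> Dom2 D (ccounit M) = cend M \<and> Cod2 D (ccounit M) = Id1 D (cob M) \<and>
     ccomult M \<in> Cell D \<and> Dom2 D (ccomult M) = cend M \<and> Cod2 D (ccomult M) = cend M \<odot>\<^bsub>D\<^esub> cend M \<and>
     (ccounit M \<lhd>\<^bsub>D\<^esub> cend M) \<bullet>\<^bsub>D\<^esub> ccomult M = Id2 D (cend M) \<and>
     (cend M \<rhd>\<^bsub>D\<^esub> ccounit M) \<bullet>\<^bsub>D\<^esub> ccomult M = Id2 D (cend M) \<and>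
     (ccomult M \<lhd>\<^bsub>D\<^esub> cend M) \<bullet>\<^bsub>D\<^esub> ccomult M = (cend M \<rhd>\<^bsub>D\<^esub> ccomult M) \<bullet>\<^bsub>D\<^esub> ccomult M"
  by (auto simp: is_comonad_def Hom1_def Hom2_def split: comonad.split)

lemma is_comonadD:
  assumes "is_comonad D M"
  shows "cob M \<in> Obj D" "cend M \<in> Arr D" "Dom1 D (cend M) = cob M" "Cod1 D (cend M) = cob M"
     "ccounit M \<in> Cell D" "Dom2 D (ccounit M) = cend M" "Cod2 D (ccounit M) = Id1 D (cob M)"
     "ccomult M \<in> Cell D" "Dom2 D (ccomult M) = cend M" "Cod2 D (ccomult M) = cend M \<odot>\<^bsub>D\<^esub> cend M"
  using assms by (simp_all add: is_comonad_sel)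

lemma is_comonad_eqs:
  assumes "is_comonad D M"
  shows "(ccounit M \<lhd>\<^bsub>D\<^esub> cend M) \<bullet>\<^bsub>D\<^esub> ccomult M = Id2 D (cend M)"
     "(cend M \<rhd>\<^bsub>D\<^esub> ccounit M) \<bullet>\<^bsub>D\<^esub> ccomult M = Id2 D (cend M)"
     "(ccomult M \<lhd>\<^bsub>D\<^esub> cend M) \<bullet>\<^bsub>D\<^esub> ccomult M = (cend M \<rhd>\<^bsub>D\<^esub> ccomult M) \<bullet>\<^bsub>D\<^esub> ccomult M"
  using assms by (simp_all add: is_comonad_sel)

context two_category
begin

lemma oplax_monad_arrD:
  assumes "str_arr D {M. is_monad D M} mob (oplax_monad_mor D) f"
  shows "is_monad D (mdom f)" "is_monad D (mcod f)" "mfun f \<in> Arr D"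
    "Dom1 D (mfun f) = mob (mdom f)" "Cod1 D (mfun f) = mob (mcod f)"
    "mstr f \<in> Cell D" "Dom2 D (mstr f) = mfun f \<odot> mend (mdom f)" "Cod2 D (mstr f) = mend (mcod f) \<odot> mfun f"
    "mstr f \<bullet> (mfun f \<rhd> munit (mdom f)) = munit (mcod f) \<lhd> mfun f"
    "mstr f \<bullet> (mfun f \<rhd> mmult (mdom f)) = (mmult (mcod f) \<lhd> mfun f) \<bullet> ((mend (mcod f) \<rhd> mstr f) \<bullet> (mstr f \<lhd> mend (mdom f)))"
  using assms by (auto simp: str_arr_def oplax_monad_mor_sel Hom2_def)

text \<open>The last two laws are oriented and bracketed as in \<open>compat_comp\<close> and
  \<open>lift_comonad\<close>, with the structure 2-cell of the source on the left.\<close>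

lemma oplax_comonad_arrD:
  assumes "str_arr D {M. is_comonad D M} cob (oplax_comonad_mor D) f"
  shows "is_comonad D (mdom f)" "is_comonad D (mcod f)" "mfun f \<in> Arr D"
    "Dom1 D (mfun f) = cob (mdom f)" "Cod1 D (mfun f) = cob (mcod f)"
    "mstr f \<in> Cell D" "Dom2 D (mstr f) = mfun f \<odot> cend (mdom f)" "Cod2 D (mstr f) = cend (mcod f) \<odot> mfun f"
    "mfun f \<rhd> ccounit (mdom f) = (ccounit (mcod f) \<lhd> mfun f) \<bullet> mstr f"
    "((cend (mcod f) \<rhd> mstr f) \<bullet> (mstr f \<lhd> cend (mdom f))) \<bullet> (mfun f \<rhd> ccomult (mdom f)) = (ccomult (mcod f) \<lhd> mfun f) \<bullet> mstr f"
  using assms by (auto simp: str_arr_def oplax_comonad_mor_sel Hom2_def is_comonadD)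

lemma Mnd_op_endo: "oplax_endo D {M. is_monad D M} mob mend (oplax_monad_mor D)"
proof (unfold_locales, goal_cases)
  case (5 f g)
  note f = oplax_monad_arrD[OF 5(1)] and g = oplax_monad_arrD[OF 5(2)]
  note t = is_monadD[OF f(1)] is_monadD[OF g(1)] is_monadD[OF g(2)] f(3-8) g(3-8) 5(3)
  \<comment> \<open>The unit starts at an identity endomorphism, whose structure cells are
    identities; the last factor is their composite.\<close>
  have 1: "((mstr g \<lhd> mfun f) \<bullet> (mfun g \<rhd> mstr f)) \<bullet> ((mfun g \<odot> mfun f) \<rhd> munit (mdom f)) =
    (munit (mcod g) \<lhd> (mfun g \<odot> mfun f)) \<bullet> ((Id2 D (mfun g) \<lhd> mfun f) \<bullet> (mfun g \<rhd> Id2 D (mfun f)))"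
    by (rule compat_comp[where \<theta>' = "munit (mdom g)"]) (simp add: t f(9)[unfolded 5(3)] g(9))+
  have 2: "((mstr g \<lhd> mfun f) \<bullet> (mfun g \<rhd> mstr f)) \<bullet> ((mfun g \<odot> mfun f) \<rhd> mmult (mdom f)) =
    (mmult (mcod g) \<lhd> (mfun g \<odot> mfun f)) \<bullet>
      ((((mend (mcod g) \<rhd> mstr g) \<bullet> (mstr g \<lhd> mend (mdom g))) \<lhd> mfun f) \<bullet>
       (mfun g \<rhd> ((mend (mcod f) \<rhd> mstr f) \<bullet> (mstr f \<lhd> mend (mdom f)))))"
    by (rule compat_comp[where \<theta>' = "mmult (mdom g)"]) (simp add: t f(10)[unfolded 5(3)] g(10))+
  \<comment> \<open>Turns the composite of doubled cells in \<open>2\<close> into the doubled cell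
    of the composite, the form required of a morphism.\<close>
  have 3: "(mend (mcod g) \<rhd> ((mstr g \<lhd> mfun f) \<bullet> (mfun g \<rhd> mstr f))) \<bullet> (((mstr g \<lhd> mfun f) \<bullet> (mfun g \<rhd> mstr f)) \<lhd> mend (mdom f)) =
    (((mend (mcod g) \<rhd> mstr g) \<bullet> (mstr g \<lhd> mend (mcod f))) \<lhd> mfun f) \<bullet> (mfun g \<rhd> ((mend (mcod f) \<rhd> mstr f) \<bullet> (mstr f \<lhd> mend (mdom f))))"
    by (rule oplax_square_comp) (simp_all add: t)
  show ?case
    unfolding oplax_monad_mor_sel mor.sel 2[folded 5(3), folded 3]
    using 1 by (simp add: t Hom2_def)
qed (auto simp: is_monad_sel oplax_monad_mor_sel Hom2_def)

lemma Cmd_op_endo: "oplax_endo D {M. is_comonad D M} cob cend (oplax_comonad_mor D)"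
proof (unfold_locales, goal_cases)
  case (5 f g)
  note f = oplax_comonad_arrD[OF 5(1)] and g = oplax_comonad_arrD[OF 5(2)]
  note t = is_comonadD[OF f(1)] is_comonadD[OF g(1)] is_comonadD[OF g(2)] f(3-8) g(3-8) 5(3)
  have 1: "((Id2 D (mfun g) \<lhd> mfun f) \<bullet> (mfun g \<rhd> Id2 D (mfun f))) \<bullet> ((mfun g \<odot> mfun f) \<rhd> ccounit (mdom f)) =
    (ccounit (mcod g) \<lhd> (mfun g \<odot> mfun f)) \<bullet> ((mstr g \<lhd> mfun f) \<bullet> (mfun g \<rhd> mstr f))"
    by (rule compat_comp[where \<theta>' = "ccounit (mdom g)"]) (simp add: t f(9)[unfolded 5(3)] g(9))+
  have 2: "((((cend (mcod g) \<rhd> mstr g) \<bullet> (mstr g \<lhd> cend (mdom g))) \<lhd> mfun f) \<bullet>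
       (mfun g \<rhd> ((cend (mcod f) \<rhd> mstr f) \<bullet> (mstr f \<lhd> cend (mdom f))))) \<bullet> ((mfun g \<odot> mfun f) \<rhd> ccomult (mdom f)) =
    (ccomult (mcod g) \<lhd> (mfun g \<odot> mfun f)) \<bullet> ((mstr g \<lhd> mfun f) \<bullet> (mfun g \<rhd> mstr f))"
    by (rule compat_comp[where \<theta>' = "ccomult (mdom g)"])
      (simp add: t f(10)[unfolded 5(3), simplified t VComp_ac] g(10)[simplified t VComp_ac])+
  have 3: "(cend (mcod g) \<rhd> ((mstr g \<lhd> mfun f) \<bullet> (mfun g \<rhd> mstr f))) \<bullet> (((mstr g \<lhd> mfun f) \<bullet> (mfun g \<rhd> mstr f)) \<lhd> cend (mdom f)) =
    (((cend (mcod g) \<rhd> mstr g) \<bullet> (mstr g \<lhd> cend (mcod f))) \<lhd> mfun f) \<bullet> (mfun g \<rhd> ((cend (mcod f) \<rhd> mstr f) \<bullet> (mstr f \<lhd> cend (mdom f))))"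
    by (rule oplax_square_comp) (simp_all add: t)
  show ?case
    unfolding oplax_comonad_mor_sel mor.sel 2[folded 5(3), folded 3, symmetric]
    using 1 by (simp add: t Hom2_def)
qed (auto simp: is_comonad_sel oplax_comonad_mor_sel Hom2_def)

end

context em_endo
begin

text \<open>Both sides of an equation between 2-cells into \<open>X\<close> are compared after applying \<open>U\<close>; the left-hand
  sides below are kept in the form \<open>U(\<dots>)\<close> so that the lifted structure can be replaced by the given one.\<close>

lemma lift_monad:
  assumes B: "is_monad D B" "mob B = C" "mend B = S"
    and \<eta>: "\<tau> \<bullet> (T \<rhd> munit B) = munit B \<lhd> T"
    and \<mu>: "\<tau> \<bullet> (T \<rhd> mmult B) = (mmult B \<lhd> T) \<bullet> ((S \<rhd> \<tau>) \<bullet> (\<tau> \<lhd> S))"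
  obtains \<eta>' \<mu>' where "is_monad D (Monad X R \<eta>' \<mu>')" "U \<rhd> \<eta>' = munit B \<lhd> U" "U \<rhd> \<mu>' = mmult B \<lhd> U"
proof -
  note b = is_monadD[OF B(1), unfolded B(2,3)] and e = is_monad_eqs[OF B(1), unfolded B(3)]
  obtain \<eta>' where e': "\<eta>' \<in> Cell D" "Dom2 D \<eta>' = Id1 D X" "Cod2 D \<eta>' = R" "U \<rhd> \<eta>' = munit B \<lhd> U"
    by (rule lift_cell[of "Id1 D C" S "Id1 D X" R "Id2 D T" \<tau> "munit B"]) (simp_all add: R_eqs b \<eta>)
  \<comment> \<open>The source is the square of \<open>S\<close>, so its structure cell is the
    doubled one, and the required compatibility is the hypothesis \<open>\<mu>\<close>.\<close>
  obtain \<mu>' where m': "\<mu>' \<in> Cell D" "Dom2 D \<mu>' = R \<odot> R" "Cod2 D \<mu>' = R" "U \<rhd> \<mu>' = mmult B \<lhd> U"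
    by (rule lift_cell[of "S \<odot> S" S "R \<odot> R" R "(S \<rhd> \<tau>) \<bullet> (\<tau> \<lhd> S)" \<tau> "mmult B"])
      (use \<mu> in \<open>simp_all add: R_eqs b UR_comp\<close>)
  note t = e'(1-3) m'(1-3) b
  have U: "U \<rhd> (\<mu>' \<lhd> R) = mmult B \<lhd> (S \<odot> U)" "U \<rhd> (\<eta>' \<lhd> R) = munit B \<lhd> (S \<odot> U)"
    "U \<rhd> (R \<rhd> \<mu>') = S \<rhd> (mmult B \<lhd> U)" "U \<rhd> (R \<rhd> \<eta>') = S \<rhd> (munit B \<lhd> U)"
    using lwhisk_rwhisk[of \<mu>' U R] lwhisk_rwhisk[of \<eta>' U R] U_lwhisk[of \<mu>'] U_lwhisk[of \<eta>'] e'(4) m'(4)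
    by (simp_all add: t UR)
  have "U \<rhd> (\<mu>' \<bullet> (\<eta>' \<lhd> R)) = (mmult B \<bullet> (munit B \<lhd> S)) \<lhd> U"
    by (subst lwhisk_VComp) (simp_all add: t UR U m'(4) del: lwhisk_lwhisk)
  then have 1: "U \<rhd> (\<mu>' \<bullet> (\<eta>' \<lhd> R)) = U \<rhd> Id2 D R" by (simp add: e(1) UR)
  have "U \<rhd> (\<mu>' \<bullet> (R \<rhd> \<eta>')) = (mmult B \<bullet> (S \<rhd> munit B)) \<lhd> U"
    by (subst lwhisk_VComp) (simp_all add: t UR U m'(4) del: lwhisk_lwhisk)
  then have 2: "U \<rhd> (\<mu>' \<bullet> (R \<rhd> \<eta>')) = U \<rhd> Id2 D R" by (simp add: e(2) UR)
  have "U \<rhd> (\<mu>' \<bullet> (\<mu>' \<lhd> R)) = (mmult B \<bullet> (mmult B \<lhd> S)) \<lhd> U"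
    by (subst lwhisk_VComp) (simp_all add: t UR U m'(4) del: lwhisk_lwhisk)
  moreover have "U \<rhd> (\<mu>' \<bullet> (R \<rhd> \<mu>')) = (mmult B \<bullet> (S \<rhd> mmult B)) \<lhd> U"
    by (subst lwhisk_VComp) (simp_all add: t UR U m'(4) del: lwhisk_lwhisk)
  ultimately have 3: "U \<rhd> (\<mu>' \<bullet> (\<mu>' \<lhd> R)) = U \<rhd> (\<mu>' \<bullet> (R \<rhd> \<mu>'))" by (simp only: e(3))
  have "is_monad D (Monad X R \<eta>' \<mu>')"
    using em_faithful[OF _ _ _ _ _ 1] em_faithful[OF _ _ _ _ _ 2] em_faithful[OF _ _ _ _ _ 3]
    by (simp add: is_monad_sel t)
  then show ?thesis using that e' m' by blast
qed

lemma lift_comonad: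
  assumes B: "is_comonad D B" "cob B = C" "cend B = S"
    and \<epsilon>: "T \<rhd> ccounit B = (ccounit B \<lhd> T) \<bullet> \<tau>"
    and \<delta>: "((S \<rhd> \<tau>) \<bullet> (\<tau> \<lhd> S)) \<bullet> (T \<rhd> ccomult B) = (ccomult B \<lhd> T) \<bullet> \<tau>"
  obtains \<epsilon>' \<delta>' where "is_comonad D (Comonad X R \<epsilon>' \<delta>')" "U \<rhd> \<epsilon>' = ccounit B \<lhd> U" "U \<rhd> \<delta>' = ccomult B \<lhd> U"
proof -
  note b = is_comonadD[OF B(1), unfolded B(2,3)] and e = is_comonad_eqs[OF B(1), unfolded B(3)]
  obtain \<epsilon>' where e': "\<epsilon>' \<in> Cell D" "Dom2 D \<epsilon>' = R" "Cod2 D \<epsilon>' = Id1 D X" "U \<rhd> \<epsilon>' = ccounit B \<lhd> U"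
    by (rule lift_cell[of S "Id1 D C" R "Id1 D X" \<tau> "Id2 D T" "ccounit B"]) (simp_all add: R_eqs b \<epsilon>[symmetric])
  obtain \<delta>' where m': "\<delta>' \<in> Cell D" "Dom2 D \<delta>' = R" "Cod2 D \<delta>' = R \<odot> R" "U \<rhd> \<delta>' = ccomult B \<lhd> U"
    by (rule lift_cell[of S "S \<odot> S" R "R \<odot> R" \<tau> "(S \<rhd> \<tau>) \<bullet> (\<tau> \<lhd> S)" "ccomult B"])
      (use \<delta> in \<open>simp_all add: R_eqs b UR_comp\<close>)
  note t = e'(1-3) m'(1-3) b
  have U: "U \<rhd> (\<delta>' \<lhd> R) = ccomult B \<lhd> (S \<odot> U)" "U \<rhd> (\<epsilon>' \<lhd> R) = ccounit B \<lhd> (S \<odot> U)"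
    "U \<rhd> (R \<rhd> \<delta>') = S \<rhd> (ccomult B \<lhd> U)" "U \<rhd> (R \<rhd> \<epsilon>') = S \<rhd> (ccounit B \<lhd> U)"
    using lwhisk_rwhisk[of \<delta>' U R] lwhisk_rwhisk[of \<epsilon>' U R] U_lwhisk[of \<delta>'] U_lwhisk[of \<epsilon>'] e'(4) m'(4)
    by (simp_all add: t UR)
  have "U \<rhd> ((\<epsilon>' \<lhd> R) \<bullet> \<delta>') = ((ccounit B \<lhd> S) \<bullet> ccomult B) \<lhd> U"
    by (subst lwhisk_VComp) (simp_all add: t UR U m'(4) del: lwhisk_lwhisk)
  then have 1: "U \<rhd> ((\<epsilon>' \<lhd> R) \<bullet> \<delta>') = U \<rhd> Id2 D R" by (simp add: e(1) UR)
  have "U \<rhd> ((R \<rhd> \<epsilon>') \<bullet> \<delta>') = ((S \<rhd> ccounit B) \<bullet> ccomult B) \<lhd> U"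
    by (subst lwhisk_VComp) (simp_all add: t UR U m'(4) del: lwhisk_lwhisk)
  then have 2: "U \<rhd> ((R \<rhd> \<epsilon>') \<bullet> \<delta>') = U \<rhd> Id2 D R" by (simp add: e(2) UR)
  have "U \<rhd> ((\<delta>' \<lhd> R) \<bullet> \<delta>') = ((ccomult B \<lhd> S) \<bullet> ccomult B) \<lhd> U"
    by (subst lwhisk_VComp) (simp_all add: t UR U m'(4) del: lwhisk_lwhisk)
  moreover have "U \<rhd> ((R \<rhd> \<delta>') \<bullet> \<delta>') = ((S \<rhd> ccomult B) \<bullet> ccomult B) \<lhd> U"
    by (subst lwhisk_VComp) (simp_all add: t UR U m'(4) del: lwhisk_lwhisk)
  ultimately have 3: "U \<rhd> ((\<delta>' \<lhd> R) \<bullet> \<delta>') = U \<rhd> ((R \<rhd> \<delta>') \<bullet> \<delta>')" by (simp only: e(3))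
  have "is_comonad D (Comonad X R \<epsilon>' \<delta>')"
    using em_faithful[OF _ _ _ _ _ 1] em_faithful[OF _ _ _ _ _ 2] em_faithful[OF _ _ _ _ _ 3]
    by (simp add: is_comonad_sel t)
  then show ?thesis using that e' m' by blast
qed

end

section \<open>EM objects of monads and comonads with oplax morphisms\<close>

context two_category
begin

lemma Mnd_op_standard:
  assumes D: "admits_EM D"
  shows "admits_EM (Mnd_op D) \<and> standard_EM (Mnd_op D) D (forgetful mob)"
proof -
  interpret E: oplax_endo D "{M. is_monad D M}" mob mend "oplax_monad_mor D" by (rule Mnd_op_endo)
  \<comment> \<open>The two conditions on 2-cells are literally equal, so \<open>Mnd_op D\<close> is
    an instance of the general construction.\<close>
  have "oplax_monad_trf D = E.endo_trf"
    by (intro ext) (simp add: oplax_monad_trf_def E.endo_trf_def)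
  then have S: "Mnd_op D = E.S" by (simp add: Mnd_op_def)
  show ?thesis unfolding S
  proof (rule E.endo_standard[OF D])
    fix M X U \<chi> R
    assume M: "is_monad E.S M" and em: "em_object D (E.under M) X U \<chi>"
      and R: "R \<in> Arr D" "Dom1 D R = X" "Cod1 D R = X" "U \<odot> R = mend (mob M) \<odot> U"
        "\<chi> \<lhd> R = (mend (mob M) \<rhd> \<chi>) \<bullet> (mstr (mend M) \<lhd> U)"
    note m = E.S_monadD[OF M]
    note T = oplax_monad_arrD[OF m(2), unfolded m(3,4)]
    note b = is_monadD[OF T(1)]
    interpret em_object D "E.under M" X U \<chi> by (rule em)
    interpret em_endo D "E.under M" X U \<chi> "mend (mob M)" "mstr (mend M)" R
      by unfold_locales (simp_all add: b T R)
    obtain \<eta>' \<mu>' where X': "is_monad D (Monad X R \<eta>' \<mu>')" "U \<rhd> \<eta>' = munit (mob M) \<lhd> U" "U \<rhd> \<mu>' = mmult (mob M) \<lhd> U"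
      by (rule lift_monad[OF T(1)]) (simp_all add: T)
    note x = is_monadD[OF X'(1), simplified]
    \<comment> \<open>Under \<open>U\<close> the laws of \<open>g\<close> turn into those of
      \<open>f\<close>, because \<open>t\<close> lies over \<open>mstr f\<close> and the structure
      of \<open>R\<close> over that of \<open>mob M\<close>.\<close>
    have mor: "oplax_monad_mor D (Mor (mdom f) (Monad X R \<eta>' \<mu>') g t)"
      if f: "E.arr f" "mcod f = mob M" and g: "g \<in> Hom1 D (mob (mdom f)) X" "U \<odot> g = mfun f"
        and t: "t \<in> Hom2 D (g \<odot> mend (mdom f)) (R \<odot> g)" "U \<rhd> t = mstr f" for f g t
    proof -
      note ft = oplax_monad_arrD[OF f(1), unfolded f(2)] and fb = is_monadD[OF oplax_monad_arrD(1)[OF f(1)]]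
      have g': "g \<in> Arr D" "Dom1 D g = mob (mdom f)" "Cod1 D g = X"
        "t \<in> Cell D" "Dom2 D t = g \<odot> mend (mdom f)" "Cod2 D t = R \<odot> g"
        using g t by (simp_all add: Hom1_def Hom2_def)
      have "U \<rhd> (t \<bullet> (g \<rhd> munit (mdom f))) = (U \<rhd> t) \<bullet> ((U \<odot> g) \<rhd> munit (mdom f))"
        by (simp add: g' ft(3-8) fb x)
      also have "\<dots> = munit (mob M) \<lhd> (U \<odot> g)" by (simp only: t(2) g(2) ft(9))
      also have "\<dots> = (U \<rhd> \<eta>') \<lhd> g" by (simp only: X'(2)) (simp add: g' b)
      also have "\<dots> = U \<rhd> (\<eta>' \<lhd> g)" by (simp add: g' x)
      finally have 1: "t \<bullet> (g \<rhd> munit (mdom f)) = \<eta>' \<lhd> g"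
        by (rule em_faithful[rotated -1]) (simp_all add: g' x fb)
      have "U \<rhd> (t \<bullet> (g \<rhd> mmult (mdom f))) = (U \<rhd> t) \<bullet> ((U \<odot> g) \<rhd> mmult (mdom f))"
        by (simp add: g' ft(3-8) fb x)
      also have "\<dots> = (mmult (mob M) \<lhd> (U \<odot> g)) \<bullet> (mend (mob M) \<rhd> (U \<rhd> t)) \<bullet> ((U \<rhd> t) \<lhd> mend (mdom f))"
        by (simp only: t(2) g(2) ft(10))
      also have "\<dots> = ((U \<rhd> \<mu>') \<lhd> g) \<bullet> (mend (mob M) \<rhd> (U \<rhd> t)) \<bullet> ((U \<rhd> t) \<lhd> mend (mdom f))"
        by (simp only: X'(3)) (simp add: g' b)
      also have "\<dots> = U \<rhd> ((\<mu>' \<lhd> g) \<bullet> (R \<rhd> t) \<bullet> (t \<lhd> mend (mdom f)))"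
        using U_lwhisk[of t] by (simp add: g' x fb UR UR_comp)
      finally have 2: "t \<bullet> (g \<rhd> mmult (mdom f)) = (\<mu>' \<lhd> g) \<bullet> (R \<rhd> t) \<bullet> (t \<lhd> mend (mdom f))"
        by (rule em_faithful[rotated -1]) (simp_all add: g' x fb)
      show ?thesis using 1 2 t(1) by (simp add: oplax_monad_mor_sel)
    qed
    \<comment> \<open>With an identity structure cell the laws of \<open>U\<close> reduce to the
      equations by which the unit and multiplication of \<open>R\<close> were lifted.\<close>
    have "oplax_monad_mor D (Mor (Monad X R \<eta>' \<mu>') (mob M) U (Id2 D (U \<odot> R)))"
      by (simp add: oplax_monad_mor_sel Hom2_def X' x b UR UR_comp)
    then show "\<exists>X'\<in>{M. is_monad D M}. mob X' = X \<and> mend X' = R \<and> oplax_monad_mor D (Mor X' (mob M) U (Id2 D (U \<odot> R))) \<and>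
        (\<forall>f g t. E.arr f \<longrightarrow> mcod f = mob M \<longrightarrow> g \<in> Hom1 D (mob (mdom f)) X \<longrightarrow> U \<odot> g = mfun f \<longrightarrow>
          t \<in> Hom2 D (g \<odot> mend (mdom f)) (R \<odot> g) \<longrightarrow> U \<rhd> t = mstr f \<longrightarrow> oplax_monad_mor D (Mor (mdom f) X' g t))"
      using X'(1) mor by (intro bexI[of _ "Monad X R \<eta>' \<mu>'"]) simp_all
  qed
qed

lemma Cmd_op_standard:
  assumes D: "admits_EM D"
  shows "admits_EM (Cmd_op D) \<and> standard_EM (Cmd_op D) D (forgetful cob)"
proof -
  interpret E: oplax_endo D "{M. is_comonad D M}" cob cend "oplax_comonad_mor D" by (rule Cmd_op_endo)
  have "oplax_comonad_trf D = E.endo_trf"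
    by (intro ext) (simp add: oplax_comonad_trf_def E.endo_trf_def)
  then have S: "Cmd_op D = E.S" by (simp add: Cmd_op_def)
  show ?thesis unfolding S
  proof (rule E.endo_standard[OF D])
    fix M X U \<chi> R
    assume M: "is_monad E.S M" and em: "em_object D (E.under M) X U \<chi>"
      and R: "R \<in> Arr D" "Dom1 D R = X" "Cod1 D R = X" "U \<odot> R = cend (mob M) \<odot> U"
        "\<chi> \<lhd> R = (cend (mob M) \<rhd> \<chi>) \<bullet> (mstr (mend M) \<lhd> U)"
    note m = E.S_monadD[OF M]
    note T = oplax_comonad_arrD[OF m(2), unfolded m(3,4)]
    note b = is_comonadD[OF T(1)]
    interpret em_object D "E.under M" X U \<chi> by (rule em)
    interpret em_endo D "E.under M" X U \<chi> "cend (mob M)" "mstr (mend M)" R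
      by unfold_locales (simp_all add: b T R)
    obtain \<epsilon>' \<delta>' where X': "is_comonad D (Comonad X R \<epsilon>' \<delta>')" "U \<rhd> \<epsilon>' = ccounit (mob M) \<lhd> U" "U \<rhd> \<delta>' = ccomult (mob M) \<lhd> U"
      \<comment> \<open>Folding restores \<open>mend (E.under M)\<close> for
        \<open>mfun (mend M)\<close>, the form in which the rule names the endomorphism.\<close>
      by (rule lift_comonad[OF T(1) _ _ T(9,10)[folded E.under_sel(2)]]) simp_all
    note x = is_comonadD[OF X'(1), simplified]
    have mor: "oplax_comonad_mor D (Mor (mdom f) (Comonad X R \<epsilon>' \<delta>') g t)"
      if f: "E.arr f" "mcod f = mob M" and g: "g \<in> Hom1 D (cob (mdom f)) X" "U \<odot> g = mfun f"
        and t: "t \<in> Hom2 D (g \<odot> cend (mdom f)) (R \<odot> g)" "U \<rhd> t = mstr f" for f g t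
    proof -
      note ft = oplax_comonad_arrD[OF f(1), unfolded f(2)] and fb = is_comonadD[OF oplax_comonad_arrD(1)[OF f(1)]]
      have g': "g \<in> Arr D" "Dom1 D g = cob (mdom f)" "Cod1 D g = X"
        "t \<in> Cell D" "Dom2 D t = g \<odot> cend (mdom f)" "Cod2 D t = R \<odot> g"
        using g t by (simp_all add: Hom1_def Hom2_def)
      have "U \<rhd> (g \<rhd> ccounit (mdom f)) = (U \<odot> g) \<rhd> ccounit (mdom f)" by (simp add: g' fb)
      also have "\<dots> = (ccounit (mob M) \<lhd> (U \<odot> g)) \<bullet> (U \<rhd> t)" by (simp only: t(2) g(2) ft(9))
      also have "\<dots> = ((U \<rhd> \<epsilon>') \<lhd> g) \<bullet> (U \<rhd> t)" by (simp only: X'(2)) (simp add: g' b)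
      also have "\<dots> = U \<rhd> ((\<epsilon>' \<lhd> g) \<bullet> t)" by (simp add: g' x fb)
      finally have 1: "g \<rhd> ccounit (mdom f) = (\<epsilon>' \<lhd> g) \<bullet> t"
        by (rule em_faithful[rotated -1]) (simp_all add: g' x fb)
      \<comment> \<open>Bracketed to the left so that the comultiplication law of \<open>f\<close>
        matches the result; the definition's bracketing is restored at the end.\<close>
      have "U \<rhd> (((R \<rhd> t) \<bullet> (t \<lhd> cend (mdom f))) \<bullet> (g \<rhd> ccomult (mdom f))) =
          ((cend (mob M) \<rhd> (U \<rhd> t)) \<bullet> ((U \<rhd> t) \<lhd> cend (mdom f))) \<bullet> ((U \<odot> g) \<rhd> ccomult (mdom f))"
        using U_lwhisk[of t] by (simp add: g' x fb UR UR_comp)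
      also have "\<dots> = (ccomult (mob M) \<lhd> (U \<odot> g)) \<bullet> (U \<rhd> t)" by (simp only: t(2) g(2) ft(10))
      also have "\<dots> = ((U \<rhd> \<delta>') \<lhd> g) \<bullet> (U \<rhd> t)" by (simp only: X'(3)) (simp add: g' b)
      also have "\<dots> = U \<rhd> ((\<delta>' \<lhd> g) \<bullet> t)" by (simp add: g' x fb)
      finally have 2: "((R \<rhd> t) \<bullet> (t \<lhd> cend (mdom f))) \<bullet> (g \<rhd> ccomult (mdom f)) = (\<delta>' \<lhd> g) \<bullet> t"
        by (rule em_faithful[rotated -1]) (simp_all add: g' x fb)
      have "((R \<rhd> t) \<bullet> (t \<lhd> cend (mdom f))) \<bullet> (g \<rhd> ccomult (mdom f)) = (R \<rhd> t) \<bullet> (t \<lhd> cend (mdom f)) \<bullet> (g \<rhd> ccomult (mdom f))"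
        by (simp add: g' x fb)
      then show ?thesis using 1 2 t(1) by (simp add: oplax_comonad_mor_sel)
    qed
    have "oplax_comonad_mor D (Mor (Comonad X R \<epsilon>' \<delta>') (mob M) U (Id2 D (U \<odot> R)))"
      by (simp add: oplax_comonad_mor_sel Hom2_def X' x b UR UR_comp)
    then show "\<exists>X'\<in>{M. is_comonad D M}. cob X' = X \<and> cend X' = R \<and> oplax_comonad_mor D (Mor X' (mob M) U (Id2 D (U \<odot> R))) \<and>
        (\<forall>f g t. E.arr f \<longrightarrow> mcod f = mob M \<longrightarrow> g \<in> Hom1 D (cob (mdom f)) X \<longrightarrow> U \<odot> g = mfun f \<longrightarrow>
          t \<in> Hom2 D (g \<odot> cend (mdom f)) (R \<odot> g) \<longrightarrow> U \<rhd> t = mstr f \<longrightarrow> oplax_comonad_mor D (Mor (mdom f) X' g t))"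
      using X'(1) mor by (intro bexI[of _ "Comonad X R \<epsilon>' \<delta>'"]) simp_all
  qed
qed

end

section \<open>Generalized elements of monoidal objects\<close>

context finite_products
begin

abbreviation pr where "pr \<equiv> pair1 D P"
abbreviation pr2 where "pr2 \<equiv> pair2 D P"

declare One_Obj [simp] Prod_Obj [simp]

lemma Pr_typ [simp]:
  assumes "A \<in> Obj D" "B \<in> Obj D"
  shows "Pr1 P A B \<in> Arr D" "Dom1 D (Pr1 P A B) = Prod P A B" "Cod1 D (Pr1 P A B) = A"
    "Pr2 P A B \<in> Arr D" "Dom1 D (Pr2 P A B) = Prod P A B" "Cod1 D (Pr2 P A B) = B"
  using Pr1_Hom[OF assms] Pr2_Hom[OF assms] by (simp_all add: Hom1_def)

lemma pr_props:
  assumes "f \<in> Arr D" "g \<in> Arr D" "Dom1 D f = Dom1 D g"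
  shows "pr f g \<in> Hom1 D (Dom1 D f) (Prod P (Cod1 D f) (Cod1 D g)) \<and>
    Pr1 P (Cod1 D f) (Cod1 D g) \<odot> pr f g = f \<and> Pr2 P (Cod1 D f) (Cod1 D g) \<odot> pr f g = g"
  unfolding pair1_def by (rule theI', rule Prod_1) (use assms in \<open>simp_all add: Hom1_def\<close>)

lemma pr_typ [simp]:
  assumes "f \<in> Arr D" "g \<in> Arr D" "Dom1 D f = Dom1 D g"
  shows "pr f g \<in> Arr D" "Dom1 D (pr f g) = Dom1 D f" "Cod1 D (pr f g) = Prod P (Cod1 D f) (Cod1 D g)"
    "Cod1 D f = A \<Longrightarrow> Cod1 D g = B \<Longrightarrow> Pr1 P A B \<odot> pr f g = f"
    "Cod1 D f = A \<Longrightarrow> Cod1 D g = B \<Longrightarrow> Pr2 P A B \<odot> pr f g = g"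
  using pr_props[OF assms] by (auto simp: Hom1_def)

lemma pr_eqI:
  assumes "h \<in> Arr D" "k \<in> Arr D" "Dom1 D h = Dom1 D k" "Cod1 D h = Prod P A B" "Cod1 D k = Prod P A B"
    "A \<in> Obj D" "B \<in> Obj D" "Pr1 P A B \<odot> h = Pr1 P A B \<odot> k" "Pr2 P A B \<odot> h = Pr2 P A B \<odot> k"
  shows "h = k"
proof -
  have "\<exists>!h'. h' \<in> Hom1 D (Dom1 D h) (Prod P A B) \<and> Pr1 P A B \<odot> h' = Pr1 P A B \<odot> h \<and> Pr2 P A B \<odot> h' = Pr2 P A B \<odot> h"
    by (rule Prod_1) (use assms in \<open>simp_all add: Hom1_def\<close>)
  then show ?thesis using assms unfolding Hom1_def by (metis (mono_tags, lifting) mem_Collect_eq)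
qed

text \<open>Composition moves into pairings. Together with the same rule for tensors, units and
  evaluations, whiskering an equation by a pairing becomes substitution of generalized
  elements.\<close>

lemma pr_comp [simp]:
  assumes "f \<in> Arr D" "g \<in> Arr D" "Dom1 D f = Dom1 D g" "h \<in> Arr D" "Cod1 D h = Dom1 D f"
  shows "pr f g \<odot> h = pr (f \<odot> h) (g \<odot> h)"
proof (rule pr_eqI[where A = "Cod1 D f" and B = "Cod1 D g"])
  show "Pr1 P (Cod1 D f) (Cod1 D g) \<odot> pr f g \<odot> h = Pr1 P (Cod1 D f) (Cod1 D g) \<odot> pr (f \<odot> h) (g \<odot> h)"
    using assms Comp1_ac[of h "pr f g" "Pr1 P (Cod1 D f) (Cod1 D g)"] by simp
  show "Pr2 P (Cod1 D f) (Cod1 D g) \<odot> pr f g \<odot> h = Pr2 P (Cod1 D f) (Cod1 D g) \<odot> pr (f \<odot> h) (g \<odot> h)"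
    using assms Comp1_ac[of h "pr f g" "Pr2 P (Cod1 D f) (Cod1 D g)"] by simp
qed (use assms in simp_all)

lemma pr_eta [simp]:
  assumes "h \<in> Arr D" "Cod1 D h = Prod P A B" "A \<in> Obj D" "B \<in> Obj D"
  shows "pr (Pr1 P A B \<odot> h) (Pr2 P A B \<odot> h) = h"
  by (rule pr_eqI[where A = A and B = B]) (use assms in simp_all)

lemma pr_Pr [simp]: "A \<in> Obj D \<Longrightarrow> B \<in> Obj D \<Longrightarrow> pr (Pr1 P A B) (Pr2 P A B) = Id1 D (Prod P A B)"
  using pr_eta[of "Id1 D (Prod P A B)" A B] by simp

lemma pr2_props:
  assumes "\<sigma> \<in> Cell D" "\<tau> \<in> Cell D" "Dom1 D (Dom2 D \<sigma>) = Dom1 D (Dom2 D \<tau>)"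
  shows "pr2 \<sigma> \<tau> \<in> Hom2 D (pr (Dom2 D \<sigma>) (Dom2 D \<tau>)) (pr (Cod2 D \<sigma>) (Cod2 D \<tau>)) \<and>
    Pr1 P (Cod1 D (Dom2 D \<sigma>)) (Cod1 D (Dom2 D \<tau>)) \<rhd> pr2 \<sigma> \<tau> = \<sigma> \<and>
    Pr2 P (Cod1 D (Dom2 D \<sigma>)) (Cod1 D (Dom2 D \<tau>)) \<rhd> pr2 \<sigma> \<tau> = \<tau>"
  unfolding pair2_def Let_def
  by (rule theI', rule Prod_2[where X = "Dom1 D (Dom2 D \<sigma>)"]) (use assms in \<open>simp_all add: Hom1_def Hom2_def\<close>)

lemma pr2_typ [simp]:
  assumes "\<sigma> \<in> Cell D" "\<tau> \<in> Cell D" "Dom1 D (Dom2 D \<sigma>) = Dom1 D (Dom2 D \<tau>)"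
  shows "pr2 \<sigma> \<tau> \<in> Cell D" "Dom2 D (pr2 \<sigma> \<tau>) = pr (Dom2 D \<sigma>) (Dom2 D \<tau>)" "Cod2 D (pr2 \<sigma> \<tau>) = pr (Cod2 D \<sigma>) (Cod2 D \<tau>)"
    "Cod1 D (Dom2 D \<sigma>) = A \<Longrightarrow> Cod1 D (Dom2 D \<tau>) = B \<Longrightarrow> Pr1 P A B \<rhd> pr2 \<sigma> \<tau> = \<sigma>"
    "Cod1 D (Dom2 D \<sigma>) = A \<Longrightarrow> Cod1 D (Dom2 D \<tau>) = B \<Longrightarrow> Pr2 P A B \<rhd> pr2 \<sigma> \<tau> = \<tau>"
  using pr2_props[OF assms] by (auto simp: Hom2_def)

lemma pr2_eqI:
  assumes "\<rho> \<in> Cell D" "\<rho>' \<in> Cell D" "Dom2 D \<rho> = Dom2 D \<rho>'" "Cod2 D \<rho> = Cod2 D \<rho>'" "Cod1 D (Dom2 D \<rho>) = Prod P A B"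
    "A \<in> Obj D" "B \<in> Obj D" "Pr1 P A B \<rhd> \<rho> = Pr1 P A B \<rhd> \<rho>'" "Pr2 P A B \<rhd> \<rho> = Pr2 P A B \<rhd> \<rho>'"
  shows "\<rho> = \<rho>'"
proof -
  have "\<exists>!\<rho>''. \<rho>'' \<in> Hom2 D (Dom2 D \<rho>) (Cod2 D \<rho>) \<and> Pr1 P A B \<rhd> \<rho>'' = Pr1 P A B \<rhd> \<rho> \<and> Pr2 P A B \<rhd> \<rho>'' = Pr2 P A B \<rhd> \<rho>"
    by (rule Prod_2[where X = "Dom1 D (Dom2 D \<rho>)"]) (use assms in \<open>simp_all add: Hom1_def Hom2_def\<close>)
  moreover have "\<rho> \<in> Hom2 D (Dom2 D \<rho>) (Cod2 D \<rho>)" "\<rho>' \<in> Hom2 D (Dom2 D \<rho>) (Cod2 D \<rho>)"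
    using assms by (simp_all add: Hom2_def)
  ultimately show ?thesis using assms(8,9) by metis
qed

lemma pr2_VComp:
  assumes "\<sigma> \<in> Cell D" "\<tau> \<in> Cell D" "\<sigma>' \<in> Cell D" "\<tau>' \<in> Cell D" "Dom1 D (Dom2 D \<sigma>) = Dom1 D (Dom2 D \<tau>)"
    "Cod2 D \<sigma> = Dom2 D \<sigma>'" "Cod2 D \<tau> = Dom2 D \<tau>'"
  shows "pr2 (\<sigma>' \<bullet> \<sigma>) (\<tau>' \<bullet> \<tau>) = pr2 \<sigma>' \<tau>' \<bullet> pr2 \<sigma> \<tau>"
proof -
  have p: "Dom1 D (Dom2 D \<sigma>') = Dom1 D (Dom2 D \<tau>)" "Dom1 D (Dom2 D \<tau>') = Dom1 D (Dom2 D \<tau>)"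
    "Cod1 D (Dom2 D \<sigma>') = Cod1 D (Dom2 D \<sigma>)" "Cod1 D (Dom2 D \<tau>') = Cod1 D (Dom2 D \<tau>)"
    using assms parallel[of \<sigma>] parallel[of \<tau>] by simp_all
  show ?thesis
    by (rule pr2_eqI[where A = "Cod1 D (Dom2 D \<sigma>)" and B = "Cod1 D (Dom2 D \<tau>)"]) (use assms p in simp_all)
qed

lemma pr2_rwhisk [simp]:
  assumes "\<sigma> \<in> Cell D" "\<tau> \<in> Cell D" "Dom1 D (Dom2 D \<sigma>) = Dom1 D (Dom2 D \<tau>)" "h \<in> Arr D" "Cod1 D h = Dom1 D (Dom2 D \<sigma>)"
  shows "pr2 \<sigma> \<tau> \<lhd> h = pr2 (\<sigma> \<lhd> h) (\<tau> \<lhd> h)"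
proof (rule pr2_eqI[where A = "Cod1 D (Dom2 D \<sigma>)" and B = "Cod1 D (Dom2 D \<tau>)"])
  let ?A = "Cod1 D (Dom2 D \<sigma>)" and ?B = "Cod1 D (Dom2 D \<tau>)"
  show "Pr1 P ?A ?B \<rhd> (pr2 \<sigma> \<tau> \<lhd> h) = Pr1 P ?A ?B \<rhd> pr2 (\<sigma> \<lhd> h) (\<tau> \<lhd> h)"
    "Pr2 P ?A ?B \<rhd> (pr2 \<sigma> \<tau> \<lhd> h) = Pr2 P ?A ?B \<rhd> pr2 (\<sigma> \<lhd> h) (\<tau> \<lhd> h)"
    using assms lwhisk_rwhisk[of "pr2 \<sigma> \<tau>" "Pr1 P ?A ?B" h] lwhisk_rwhisk[of "pr2 \<sigma> \<tau>" "Pr2 P ?A ?B" h] by simp_all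
qed (use assms in simp_all)

lemma pr_lwhisk [simp]:
  assumes "\<rho> \<in> Cell D" "f \<in> Arr D" "g \<in> Arr D" "Dom1 D f = Dom1 D g" "Cod1 D (Dom2 D \<rho>) = Dom1 D f"
  shows "pr f g \<rhd> \<rho> = pr2 (f \<rhd> \<rho>) (g \<rhd> \<rho>)"
  by (rule pr2_eqI[where A = "Cod1 D f" and B = "Cod1 D g"]) (use assms in simp_all)

lemma pr2_Id [simp]:
  assumes "f \<in> Arr D" "g \<in> Arr D" "Dom1 D f = Dom1 D g"
  shows "pr2 (Id2 D f) (Id2 D g) = Id2 D (pr f g)"
  by (rule pr2_eqI[where A = "Cod1 D f" and B = "Cod1 D g"]) (use assms in simp_all)

lemma bang_typ [simp]:
  assumes "X \<in> Obj D"
  shows "bang D P X \<in> Arr D" "Dom1 D (bang D P X) = X" "Cod1 D (bang D P X) = One P"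
  using theI'[OF One_1[OF assms]] by (simp_all add: bang_def Hom1_def)

lemma bang_unique: "f \<in> Arr D \<Longrightarrow> Cod1 D f = One P \<Longrightarrow> f = bang D P (Dom1 D f)"
  using One_1[of "Dom1 D f"] bang_typ[of "Dom1 D f"] by (auto simp: Hom1_def)

lemma bang_comp [simp]:
  "h \<in> Arr D \<Longrightarrow> Cod1 D h = Y \<Longrightarrow> bang D P Y \<odot> h = bang D P (Dom1 D h)"
  using bang_unique[of "bang D P Y \<odot> h"] by auto

section \<open>Tensors and structure cells at generalized elements\<close>

abbreviation ten1 where "ten1 \<equiv> tensor1 D P"
abbreviation ten2 where "ten2 \<equiv> tensor2 D P"
abbreviation e2 where "e2 \<equiv> at2 D P"
abbreviation e3 where "e3 \<equiv> at3 D P"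
abbreviation un where "un \<equiv> unit_at D P"

text \<open>Typing of tensor and unit alone, since lifted operations are computed with before any
  structure cell exists on the EM object.\<close>

definition mon_typ :: "('o, 'a, 'c) monoidal \<Rightarrow> bool" where
  "mon_typ M \<longleftrightarrow> ob M \<in> Obj D \<and> ten M \<in> Arr D \<and> Dom1 D (ten M) = Prod P (ob M) (ob M) \<and> Cod1 D (ten M) = ob M \<and>
     unt M \<in> Arr D \<and> Dom1 D (unt M) = One P \<and> Cod1 D (unt M) = ob M"

lemma mon_typD [simp]:
  assumes "mon_typ M"
  shows "ob M \<in> Obj D" "ten M \<in> Arr D" "Dom1 D (ten M) = Prod P (ob M) (ob M)" "Cod1 D (ten M) = ob M"
     "unt M \<in> Arr D" "Dom1 D (unt M) = One P" "Cod1 D (unt M) = ob M"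
  using assms by (simp_all add: mon_typ_def)

text \<open>Reverses the definitions, which makes tensors of generalized elements the normal
  form.\<close>

lemma ten_pr [simp]: "ten M \<odot> pr x y = ten1 M x y" "ten M \<rhd> pr2 \<sigma> \<tau> = ten2 M \<sigma> \<tau>"
  by (simp_all add: tensor1_def tensor2_def)

lemma ten_Pr [simp]: "mon_typ M \<Longrightarrow> A = ob M \<Longrightarrow> ten1 M (Pr1 P A A) (Pr2 P A A) = ten M"
  by (simp add: tensor1_def)

lemma ten1_typ [simp]:
  assumes "mon_typ M" "x \<in> Arr D" "y \<in> Arr D" "Dom1 D x = Dom1 D y" "Cod1 D x = ob M" "Cod1 D y = ob M"
  shows "ten1 M x y \<in> Arr D" "Dom1 D (ten1 M x y) = Dom1 D x" "Cod1 D (ten1 M x y) = ob M"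
  using assms by (simp_all add: tensor1_def del: ten_pr)

lemma ten1_comp [simp]:
  assumes "mon_typ M" "x \<in> Arr D" "y \<in> Arr D" "Dom1 D x = Dom1 D y" "Cod1 D x = ob M" "Cod1 D y = ob M"
    "h \<in> Arr D" "Cod1 D h = Dom1 D x"
  shows "ten1 M x y \<odot> h = ten1 M (x \<odot> h) (y \<odot> h)"
  using assms by (simp add: tensor1_def del: ten_pr)

lemma ten2_typ [simp]:
  assumes "mon_typ M" "\<sigma> \<in> Cell D" "\<tau> \<in> Cell D" "Dom1 D (Dom2 D \<sigma>) = Dom1 D (Dom2 D \<tau>)"
    "Cod1 D (Dom2 D \<sigma>) = ob M" "Cod1 D (Dom2 D \<tau>) = ob M"
  shows "ten2 M \<sigma> \<tau> \<in> Cell D" "Dom2 D (ten2 M \<sigma> \<tau>) = ten1 M (Dom2 D \<sigma>) (Dom2 D \<tau>)"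
    "Cod2 D (ten2 M \<sigma> \<tau>) = ten1 M (Cod2 D \<sigma>) (Cod2 D \<tau>)"
  using assms by (simp_all add: tensor1_def tensor2_def del: ten_pr)

lemma ten2_rwhisk [simp]:
  assumes "mon_typ M" "\<sigma> \<in> Cell D" "\<tau> \<in> Cell D" "Dom1 D (Dom2 D \<sigma>) = Dom1 D (Dom2 D \<tau>)"
    "Cod1 D (Dom2 D \<sigma>) = ob M" "Cod1 D (Dom2 D \<tau>) = ob M" "h \<in> Arr D" "Cod1 D h = Dom1 D (Dom2 D \<sigma>)"
  shows "ten2 M \<sigma> \<tau> \<lhd> h = ten2 M (\<sigma> \<lhd> h) (\<tau> \<lhd> h)"
  using assms by (simp add: tensor2_def del: ten_pr)

lemma ten2_VComp:
  assumes "mon_typ M" "\<sigma> \<in> Cell D" "\<tau> \<in> Cell D" "\<sigma>' \<in> Cell D" "\<tau>' \<in> Cell D" "Dom1 D (Dom2 D \<sigma>) = Dom1 D (Dom2 D \<tau>)"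
    "Cod2 D \<sigma> = Dom2 D \<sigma>'" "Cod2 D \<tau> = Dom2 D \<tau>'" "Cod1 D (Dom2 D \<sigma>) = ob M" "Cod1 D (Dom2 D \<tau>) = ob M"
  shows "ten2 M (\<sigma>' \<bullet> \<sigma>) (\<tau>' \<bullet> \<tau>) = ten2 M \<sigma>' \<tau>' \<bullet> ten2 M \<sigma> \<tau>"
proof -
  have p: "Dom1 D (Dom2 D \<sigma>') = Dom1 D (Dom2 D \<tau>)" "Dom1 D (Dom2 D \<tau>') = Dom1 D (Dom2 D \<tau>)"
    "Cod1 D (Dom2 D \<sigma>') = Cod1 D (Dom2 D \<sigma>)" "Cod1 D (Dom2 D \<tau>') = Cod1 D (Dom2 D \<tau>)"
    using assms parallel[of \<sigma>] parallel[of \<tau>] by simp_all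
  show ?thesis using assms p by (simp add: tensor2_def pr2_VComp del: ten_pr)
qed

lemma ten2_Id [simp]:
  assumes "mon_typ M" "f \<in> Arr D" "g \<in> Arr D" "Dom1 D f = Dom1 D g" "Cod1 D f = ob M" "Cod1 D g = ob M"
  shows "ten2 M (Id2 D f) (Id2 D g) = Id2 D (ten1 M f g)"
  using assms by (simp add: tensor1_def tensor2_def del: ten_pr)

lemma un_typ [simp]:
  assumes "mon_typ M" "X \<in> Obj D"
  shows "un M X \<in> Arr D" "Dom1 D (un M X) = X" "Cod1 D (un M X) = ob M"
  using assms by (simp_all add: unit_at_def)

lemma unt_bang [simp]: "unt M \<odot> bang D P X = un M X"
  by (simp add: unit_at_def)

lemma un_comp [simp]: "mon_typ M \<Longrightarrow> h \<in> Arr D \<Longrightarrow> Cod1 D h = Y \<Longrightarrow> un M Y \<odot> h = un M (Dom1 D h)"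
  by (auto simp: unit_at_def simp del: unt_bang)

lemma e2_typ [simp]:
  assumes "\<sigma> \<in> Cell D" "x \<in> Arr D" "y \<in> Arr D" "Dom1 D x = Dom1 D y" "Dom1 D (Dom2 D \<sigma>) = Prod P (Cod1 D x) (Cod1 D y)"
  shows "e2 \<sigma> x y \<in> Cell D" "Dom2 D (e2 \<sigma> x y) = Dom2 D \<sigma> \<odot> pr x y" "Cod2 D (e2 \<sigma> x y) = Cod2 D \<sigma> \<odot> pr x y"
  using assms by (simp_all add: at2_def)

lemma e2_rwhisk [simp]:
  assumes "\<sigma> \<in> Cell D" "x \<in> Arr D" "y \<in> Arr D" "Dom1 D x = Dom1 D y" "Dom1 D (Dom2 D \<sigma>) = Prod P (Cod1 D x) (Cod1 D y)"
    "h \<in> Arr D" "Cod1 D h = Dom1 D x"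
  shows "e2 \<sigma> x y \<lhd> h = e2 \<sigma> (x \<odot> h) (y \<odot> h)"
  using assms by (simp add: at2_def)

text \<open>Evaluation is the normal form of whiskering by a pairing. The rule is suspended in
  \<open>pentagon\<close> and similar proofs, where the pairing must first descend to the tensor
  factors.\<close>

lemma rwhisk_pr [simp]: "\<sigma> \<lhd> pr x y = e2 \<sigma> x y"
  by (simp add: at2_def)

lemma e3_def': "e3 \<sigma> x y z = e2 \<sigma> x (pr y z)"
  by (simp add: at3_def)

lemma e3_typ [simp]:
  assumes "\<sigma> \<in> Cell D" "x \<in> Arr D" "y \<in> Arr D" "z \<in> Arr D" "Dom1 D x = Dom1 D z" "Dom1 D y = Dom1 D z"
    "Dom1 D (Dom2 D \<sigma>) = Prod P (Cod1 D x) (Prod P (Cod1 D y) (Cod1 D z))"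
  shows "e3 \<sigma> x y z \<in> Cell D" "Dom2 D (e3 \<sigma> x y z) = Dom2 D \<sigma> \<odot> pr x (pr y z)" "Cod2 D (e3 \<sigma> x y z) = Cod2 D \<sigma> \<odot> pr x (pr y z)"
  using assms by (simp_all add: e3_def')

lemma e3_rwhisk [simp]:
  assumes "\<sigma> \<in> Cell D" "x \<in> Arr D" "y \<in> Arr D" "z \<in> Arr D" "Dom1 D x = Dom1 D z" "Dom1 D y = Dom1 D z"
    "Dom1 D (Dom2 D \<sigma>) = Prod P (Cod1 D x) (Prod P (Cod1 D y) (Cod1 D z))" "h \<in> Arr D" "Cod1 D h = Dom1 D x"
  shows "e3 \<sigma> x y z \<lhd> h = e3 \<sigma> (x \<odot> h) (y \<odot> h) (z \<odot> h)"
  using assms by (simp add: e3_def')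

lemma e2_Pr [simp]: "\<sigma> \<in> Cell D \<Longrightarrow> A \<in> Obj D \<Longrightarrow> B \<in> Obj D \<Longrightarrow> Dom1 D (Dom2 D \<sigma>) = Prod P A B \<Longrightarrow> e2 \<sigma> (Pr1 P A B) (Pr2 P A B) = \<sigma>"
  by (simp add: at2_def del: rwhisk_pr)

abbreviation "q1 \<equiv> p1of3 P"
abbreviation "q2 \<equiv> p2of3 D P"
abbreviation "q3 \<equiv> p3of3 D P"

abbreviation "Cube C \<equiv> Prod P C (Prod P C C)"
abbreviation "Hyper C \<equiv> Prod P C (Cube C)"

lemma q_typ [simp]:
  assumes "C \<in> Obj D"
  shows "q1 C \<in> Arr D" "Dom1 D (q1 C) = Cube C" "Cod1 D (q1 C) = C"
    "q2 C \<in> Arr D" "Dom1 D (q2 C) = Cube C" "Cod1 D (q2 C) = C"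
    "q3 C \<in> Arr D" "Dom1 D (q3 C) = Cube C" "Cod1 D (q3 C) = C"
  using assms by (simp_all add: p1of3_def p2of3_def p3of3_def)

lemma q_pr [simp]:
  assumes "x \<in> Arr D" "y \<in> Arr D" "z \<in> Arr D" "Dom1 D x = Dom1 D z" "Dom1 D y = Dom1 D z"
    "Cod1 D x = C" "Cod1 D y = C" "Cod1 D z = C"
  shows "q1 C \<odot> pr x (pr y z) = x" "q2 C \<odot> pr x (pr y z) = y" "q3 C \<odot> pr x (pr y z) = z"
  using assms Cod1_Obj[of z] by (auto simp: p1of3_def p2of3_def p3of3_def simp del: Cod1_Obj)

lemma pr_q [simp]: "C \<in> Obj D \<Longrightarrow> pr (q1 C) (pr (q2 C) (q3 C)) = Id1 D (Cube C)"
  by (simp add: p1of3_def p2of3_def p3of3_def)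

abbreviation "r1 \<equiv> p1of4 P"
abbreviation "r2 \<equiv> p2of4 D P"
abbreviation "r3 \<equiv> p3of4 D P"
abbreviation "r4 \<equiv> p4of4 D P"


lemma r_pr [simp]:
  assumes "x \<in> Arr D" "y \<in> Arr D" "z \<in> Arr D" "w \<in> Arr D" "Dom1 D x = Dom1 D w" "Dom1 D y = Dom1 D w" "Dom1 D z = Dom1 D w"
    "Cod1 D x = C" "Cod1 D y = C" "Cod1 D z = C" "Cod1 D w = C"
  shows "r1 C \<odot> pr x (pr y (pr z w)) = x" "r2 C \<odot> pr x (pr y (pr z w)) = y"
    "r3 C \<odot> pr x (pr y (pr z w)) = z" "r4 C \<odot> pr x (pr y (pr z w)) = w"
  using assms Cod1_Obj[of z] by (auto simp: p1of4_def p2of4_def p3of4_def p4of4_def simp del: Cod1_Obj)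

lemma r_typ [simp]:
  assumes "C \<in> Obj D"
  shows "r1 C \<in> Arr D" "Dom1 D (r1 C) = Hyper C" "Cod1 D (r1 C) = C"
    "r2 C \<in> Arr D" "Dom1 D (r2 C) = Hyper C" "Cod1 D (r2 C) = C"
    "r3 C \<in> Arr D" "Dom1 D (r3 C) = Hyper C" "Cod1 D (r3 C) = C"
    "r4 C \<in> Arr D" "Dom1 D (r4 C) = Hyper C" "Cod1 D (r4 C) = C"
  using assms by (simp_all add: p1of4_def p2of4_def p3of4_def p4of4_def)

lemma ten1_lwhisk [simp]:
  assumes "mon_typ M" "x \<in> Arr D" "y \<in> Arr D" "Dom1 D x = Dom1 D y" "Cod1 D x = ob M" "Cod1 D y = ob M"
    "\<rho> \<in> Cell D" "Cod1 D (Dom2 D \<rho>) = Dom1 D x"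
  shows "ten1 M x y \<rhd> \<rho> = ten2 M (x \<rhd> \<rho>) (y \<rhd> \<rho>)"
  using assms lwhisk_lwhisk[of \<rho> "ten M" "pr x y"] by (simp del: lwhisk_lwhisk)

section \<open>Monoidal objects\<close>

abbreviation is_mon where "is_mon \<equiv> is_monoidal D P"

lemma is_mon_iff:
  "is_mon M \<longleftrightarrow> mon_typ M \<and>
    asc M \<in> Cell D \<and> Dom2 D (asc M) = ten1 M (q1 (ob M)) (ten1 M (q2 (ob M)) (q3 (ob M))) \<and>
    Cod2 D (asc M) = ten1 M (ten1 M (q1 (ob M)) (q2 (ob M))) (q3 (ob M)) \<and>
    lun M \<in> Cell D \<and> Dom2 D (lun M) = ten1 M (un M (ob M)) (Id1 D (ob M)) \<and> Cod2 D (lun M) = Id1 D (ob M) \<and>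
    run M \<in> Cell D \<and> Dom2 D (run M) = ten1 M (Id1 D (ob M)) (un M (ob M)) \<and> Cod2 D (run M) = Id1 D (ob M) \<and>
    invertible2 D (asc M) \<and> invertible2 D (lun M) \<and> invertible2 D (run M) \<and>
    ten2 M (e3 (asc M) (r1 (ob M)) (r2 (ob M)) (r3 (ob M))) (Id2 D (r4 (ob M))) \<bullet>
      e3 (asc M) (r1 (ob M)) (ten1 M (r2 (ob M)) (r3 (ob M))) (r4 (ob M)) \<bullet>
      ten2 M (Id2 D (r1 (ob M))) (e3 (asc M) (r2 (ob M)) (r3 (ob M)) (r4 (ob M)))
      = e3 (asc M) (ten1 M (r1 (ob M)) (r2 (ob M))) (r3 (ob M)) (r4 (ob M)) \<bullet>
        e3 (asc M) (r1 (ob M)) (r2 (ob M)) (ten1 M (r3 (ob M)) (r4 (ob M))) \<and>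
    ten2 M (run M \<lhd> Pr1 P (ob M) (ob M)) (Id2 D (Pr2 P (ob M) (ob M))) \<bullet>
      e3 (asc M) (Pr1 P (ob M) (ob M)) (un M (Prod P (ob M) (ob M))) (Pr2 P (ob M) (ob M))
      = ten2 M (Id2 D (Pr1 P (ob M) (ob M))) (lun M \<lhd> Pr2 P (ob M) (ob M))"
  unfolding is_monoidal_def Let_def mon_typ_def Hom1_def Hom2_def mem_Collect_eq by blast

lemma mon_cells [simp]:
  assumes "is_mon M"
  shows "mon_typ M"
    "asc M \<in> Cell D" "Dom2 D (asc M) = ten1 M (q1 (ob M)) (ten1 M (q2 (ob M)) (q3 (ob M)))"
    "Cod2 D (asc M) = ten1 M (ten1 M (q1 (ob M)) (q2 (ob M))) (q3 (ob M))"
    "lun M \<in> Cell D" "Dom2 D (lun M) = ten1 M (un M (ob M)) (Id1 D (ob M))" "Cod2 D (lun M) = Id1 D (ob M)"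
    "run M \<in> Cell D" "Dom2 D (run M) = ten1 M (Id1 D (ob M)) (un M (ob M))" "Cod2 D (run M) = Id1 D (ob M)"
  using assms unfolding is_mon_iff by blast+

text \<open>The axiom is given at the four projections; whiskering it by the pairing of
  \<open>x\<close>, \<open>y\<close>, \<open>z\<close> and \<open>w\<close> evaluates it at these.
  The triangle, the hexagons and the axioms of oplax morphisms are treated in the same way.\<close>

lemma pentagon:
  assumes M: "is_mon M" and ty: "x \<in> Arr D" "y \<in> Arr D" "z \<in> Arr D" "w \<in> Arr D"
    "Dom1 D x = Dom1 D w" "Dom1 D y = Dom1 D w" "Dom1 D z = Dom1 D w"
    "Cod1 D x = ob M" "Cod1 D y = ob M" "Cod1 D z = ob M" "Cod1 D w = ob M"
  shows "ten2 M (e3 (asc M) x y z) (Id2 D w) \<bullet> e3 (asc M) x (ten1 M y z) w \<bullet> ten2 M (Id2 D x) (e3 (asc M) y z w)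
      = e3 (asc M) (ten1 M x y) z w \<bullet> e3 (asc M) x y (ten1 M z w)"
proof -
  let ?C = "ob M" and ?h = "pr x (pr y (pr z w))"
  have "ten2 M (e3 (asc M) (r1 ?C) (r2 ?C) (r3 ?C)) (Id2 D (r4 ?C)) \<bullet>
      e3 (asc M) (r1 ?C) (ten1 M (r2 ?C) (r3 ?C)) (r4 ?C) \<bullet>
      ten2 M (Id2 D (r1 ?C)) (e3 (asc M) (r2 ?C) (r3 ?C) (r4 ?C))
      = e3 (asc M) (ten1 M (r1 ?C) (r2 ?C)) (r3 ?C) (r4 ?C) \<bullet>
        e3 (asc M) (r1 ?C) (r2 ?C) (ten1 M (r3 ?C) (r4 ?C))"
    using M unfolding is_mon_iff by blast
  from arg_cong[OF this, of "\<lambda>s. s \<lhd> ?h"] show ?thesis using M ty by (simp del: rwhisk_pr)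
qed

lemma triangle:
  assumes M: "is_mon M" and ty: "x \<in> Arr D" "y \<in> Arr D" "Dom1 D x = Z" "Dom1 D y = Z" "Cod1 D x = ob M" "Cod1 D y = ob M"
  shows "ten2 M (run M \<lhd> x) (Id2 D y) \<bullet> e3 (asc M) x (un M Z) y = ten2 M (Id2 D x) (lun M \<lhd> y)"
proof -
  let ?C = "ob M"
  have Z: "Z \<in> Obj D" using ty by auto
  have "ten2 M (run M \<lhd> Pr1 P ?C ?C) (Id2 D (Pr2 P ?C ?C)) \<bullet>
      e3 (asc M) (Pr1 P ?C ?C) (un M (Prod P ?C ?C)) (Pr2 P ?C ?C)
      = ten2 M (Id2 D (Pr1 P ?C ?C)) (lun M \<lhd> Pr2 P ?C ?C)"
    using M unfolding is_mon_iff by blast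
  from arg_cong[OF this, of "\<lambda>s. s \<lhd> pr x y"] show ?thesis using M ty Z by (simp del: rwhisk_pr)
qed

text \<open>Naturality in three variables is one interchange, of the associator with the paired
  2-cell \<open>\<langle>\<sigma>, \<langle>\<tau>, \<upsilon>\<rangle>\<rangle>\<close>.\<close>

lemma asc_natural:
  assumes M: "is_mon M" and ty: "\<sigma> \<in> Cell D" "\<tau> \<in> Cell D" "\<upsilon> \<in> Cell D" "Dom2 D \<sigma> = x" "Dom2 D \<tau> = y" "Dom2 D \<upsilon> = z"
    "Cod2 D \<sigma> = x'" "Cod2 D \<tau> = y'" "Cod2 D \<upsilon> = z'" "Dom1 D x = Dom1 D z" "Dom1 D y = Dom1 D z"
    "Cod1 D x = ob M" "Cod1 D y = ob M" "Cod1 D z = ob M"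
  shows "e3 (asc M) x' y' z' \<bullet> ten2 M \<sigma> (ten2 M \<tau> \<upsilon>) = ten2 M (ten2 M \<sigma> \<tau>) \<upsilon> \<bullet> e3 (asc M) x y z"
proof -
  have t: "x \<in> Arr D" "y \<in> Arr D" "z \<in> Arr D" "x' \<in> Arr D" "y' \<in> Arr D" "z' \<in> Arr D" "Dom1 D x' = Dom1 D z'" "Dom1 D y' = Dom1 D z'"
    "Cod1 D x' = ob M" "Cod1 D y' = ob M" "Cod1 D z' = ob M" "Dom1 D z' = Dom1 D z"
    using ty Dom2_Arr[of \<sigma>] Dom2_Arr[of \<tau>] Dom2_Arr[of \<upsilon>] Cod2_Arr[of \<sigma>] Cod2_Arr[of \<tau>] Cod2_Arr[of \<upsilon>]
      parallel[of \<sigma>] parallel[of \<tau>] parallel[of \<upsilon>] by simp_all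
  let ?C = "ob M" and ?p = "pr2 \<sigma> (pr2 \<tau> \<upsilon>)"
  \<comment> \<open>The second and third projections are composites, so the merging of whiskers is
    undone to expose the inner pairing.\<close>
  have q: "q1 ?C \<rhd> ?p = \<sigma>" "q2 ?C \<rhd> ?p = \<tau>" "q3 ?C \<rhd> ?p = \<upsilon>"
  proof -
    have p: "Pr2 P ?C (Prod P ?C ?C) \<rhd> ?p = pr2 \<tau> \<upsilon>" using M ty t by simp
    have "q2 ?C \<rhd> ?p = Pr1 P ?C ?C \<rhd> pr2 \<tau> \<upsilon>" "q3 ?C \<rhd> ?p = Pr2 P ?C ?C \<rhd> pr2 \<tau> \<upsilon>"
      using lwhisk_lwhisk[of ?p "Pr1 P ?C ?C" "Pr2 P ?C (Prod P ?C ?C)"]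
        lwhisk_lwhisk[of ?p "Pr2 P ?C ?C" "Pr2 P ?C (Prod P ?C ?C)"] M ty t
      by (simp_all add: p p2of3_def p3of3_def del: lwhisk_lwhisk)
    then show "q1 ?C \<rhd> ?p = \<sigma>" "q2 ?C \<rhd> ?p = \<tau>" "q3 ?C \<rhd> ?p = \<upsilon>"
      using M ty t by (simp_all add: p1of3_def)
  qed
  have "(asc M \<lhd> pr x' (pr y' z')) \<bullet> (ten1 M (q1 ?C) (ten1 M (q2 ?C) (q3 ?C)) \<rhd> ?p) =
      (ten1 M (ten1 M (q1 ?C) (q2 ?C)) (q3 ?C) \<rhd> ?p) \<bullet> (asc M \<lhd> pr x (pr y z))"
    by (rule whisk_swap) (use M ty t in \<open>simp_all add: Hom2_def\<close>)
  moreover have "ten1 M (q1 ?C) (ten1 M (q2 ?C) (q3 ?C)) \<rhd> ?p = ten2 M \<sigma> (ten2 M \<tau> \<upsilon>)"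
    "ten1 M (ten1 M (q1 ?C) (q2 ?C)) (q3 ?C) \<rhd> ?p = ten2 M (ten2 M \<sigma> \<tau>) \<upsilon>"
    using M ty t by (simp_all add: q)
  ultimately show ?thesis by (simp add: at3_def)
qed

lemma run_natural:
  assumes M: "is_mon M" and ty: "\<sigma> \<in> Cell D" "Dom2 D \<sigma> = x" "Cod2 D \<sigma> = x'" "Dom1 D x = Z" "Cod1 D x = ob M"
  shows "(run M \<lhd> x') \<bullet> ten2 M \<sigma> (Id2 D (un M Z)) = \<sigma> \<bullet> (run M \<lhd> x)"
    "(lun M \<lhd> x') \<bullet> ten2 M (Id2 D (un M Z)) \<sigma> = \<sigma> \<bullet> (lun M \<lhd> x)"
proof -
  have t: "x \<in> Arr D" "x' \<in> Arr D" "Dom1 D x' = Z" "Cod1 D x' = ob M" "Z \<in> Obj D"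
    using ty Dom2_Arr[of \<sigma>] Cod2_Arr[of \<sigma>] parallel[of \<sigma>] by auto
  \<comment> \<open>The unit factors through the terminal 0-cell, where parallel 2-cells agree;
    whiskering by it therefore gives an identity.\<close>
  have u: "un M (ob M) \<rhd> \<sigma> = Id2 D (un M Z)"
  proof -
    have "bang D P (ob M) \<rhd> \<sigma> = Id2 D (bang D P Z)"
      using One_2[of "bang D P Z" Z "bang D P Z"] M ty t by (auto simp: Hom1_def Hom2_def)
    then have "unt M \<rhd> (bang D P (ob M) \<rhd> \<sigma>) = unt M \<rhd> Id2 D (bang D P Z)" by simp
    then show ?thesis using M ty t by simp
  qed
  have 1: "ten1 M (Id1 D (ob M)) (un M (ob M)) \<rhd> \<sigma> = ten2 M \<sigma> (Id2 D (un M Z))"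
    and 2: "ten1 M (un M (ob M)) (Id1 D (ob M)) \<rhd> \<sigma> = ten2 M (Id2 D (un M Z)) \<sigma>"
    using M ty t u by simp_all
  have "(run M \<lhd> x') \<bullet> (ten1 M (Id1 D (ob M)) (un M (ob M)) \<rhd> \<sigma>) = (Id1 D (ob M) \<rhd> \<sigma>) \<bullet> (run M \<lhd> x)"
    by (rule whisk_swap) (use M ty t in \<open>simp_all add: Hom2_def\<close>)
  then show "(run M \<lhd> x') \<bullet> ten2 M \<sigma> (Id2 D (un M Z)) = \<sigma> \<bullet> (run M \<lhd> x)" using 1 M ty t by simp
  have "(lun M \<lhd> x') \<bullet> (ten1 M (un M (ob M)) (Id1 D (ob M)) \<rhd> \<sigma>) = (Id1 D (ob M) \<rhd> \<sigma>) \<bullet> (lun M \<lhd> x)"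
    by (rule whisk_swap) (use M ty t in \<open>simp_all add: Hom2_def\<close>)
  then show "(lun M \<lhd> x') \<bullet> ten2 M (Id2 D (un M Z)) \<sigma> = \<sigma> \<bullet> (lun M \<lhd> x)" using 2 M ty t by simp
qed

section \<open>Braidings\<close>

abbreviation is_br where "is_br \<equiv> is_braided D P"

lemma is_br_iff:
  "is_br B \<longleftrightarrow> is_mon (mon B) \<and> (let M = mon B; C = ob M; \<alpha> = asc M; \<alpha>' = inv2 D \<alpha>; \<beta> = brd B in
    \<beta> \<in> Cell D \<and> Dom2 D \<beta> = ten M \<and> Cod2 D \<beta> = ten1 M (Pr2 P C C) (Pr1 P C C) \<and> invertible2 D \<beta> \<and>
    e3 \<alpha> (q3 C) (q1 C) (q2 C) \<bullet> e2 \<beta> (ten1 M (q1 C) (q2 C)) (q3 C) \<bullet> e3 \<alpha> (q1 C) (q2 C) (q3 C)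
      = ten2 M (e2 \<beta> (q1 C) (q3 C)) (Id2 D (q2 C)) \<bullet> e3 \<alpha> (q1 C) (q3 C) (q2 C) \<bullet> ten2 M (Id2 D (q1 C)) (e2 \<beta> (q2 C) (q3 C)) \<and>
    e3 \<alpha>' (q2 C) (q3 C) (q1 C) \<bullet> e2 \<beta> (q1 C) (ten1 M (q2 C) (q3 C)) \<bullet> e3 \<alpha>' (q1 C) (q2 C) (q3 C)
      = ten2 M (Id2 D (q2 C)) (e2 \<beta> (q1 C) (q3 C)) \<bullet> e3 \<alpha>' (q2 C) (q1 C) (q3 C) \<bullet> ten2 M (e2 \<beta> (q1 C) (q2 C)) (Id2 D (q3 C)))"
  unfolding is_braided_def Let_def Hom2_def mem_Collect_eq ten_pr by blast

lemma inv_asc [simp]: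
  assumes "is_mon M"
  shows "inv2 D (asc M) \<in> Cell D" "Cod2 D (inv2 D (asc M)) = ten1 M (q1 (ob M)) (ten1 M (q2 (ob M)) (q3 (ob M)))"
    "Dom2 D (inv2 D (asc M)) = ten1 M (ten1 M (q1 (ob M)) (q2 (ob M))) (q3 (ob M))"
proof -
  have "invertible2 D (asc M)" using assms unfolding is_mon_iff by blast
  from inverse2_inv2[OF this] show "inv2 D (asc M) \<in> Cell D" "Cod2 D (inv2 D (asc M)) = ten1 M (q1 (ob M)) (ten1 M (q2 (ob M)) (q3 (ob M)))"
    "Dom2 D (inv2 D (asc M)) = ten1 M (ten1 M (q1 (ob M)) (q2 (ob M))) (q3 (ob M))"
    using assms by (simp_all add: inverse2_def Hom2_def)
qed

lemma brd_cells [simp]: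
  assumes "is_br B"
  shows "is_mon (mon B)" "brd B \<in> Cell D" "Dom2 D (brd B) = ten (mon B)"
    "Cod2 D (brd B) = ten1 (mon B) (Pr2 P (ob (mon B)) (ob (mon B))) (Pr1 P (ob (mon B)) (ob (mon B)))"
  using assms unfolding is_br_iff Let_def by blast+

lemma hexagons:
  assumes B: "is_br B" and M: "M = mon B" and ty: "x \<in> Arr D" "y \<in> Arr D" "z \<in> Arr D" "Dom1 D x = Dom1 D z" "Dom1 D y = Dom1 D z"
    "Cod1 D x = ob M" "Cod1 D y = ob M" "Cod1 D z = ob M"
  shows "e3 (asc M) z x y \<bullet> e2 (brd B) (ten1 M x y) z \<bullet> e3 (asc M) x y z
      = ten2 M (e2 (brd B) x z) (Id2 D y) \<bullet> e3 (asc M) x z y \<bullet> ten2 M (Id2 D x) (e2 (brd B) y z)"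
    "e3 (inv2 D (asc M)) y z x \<bullet> e2 (brd B) x (ten1 M y z) \<bullet> e3 (inv2 D (asc M)) x y z
      = ten2 M (Id2 D y) (e2 (brd B) x z) \<bullet> e3 (inv2 D (asc M)) y x z \<bullet> ten2 M (e2 (brd B) x y) (Id2 D z)"
proof -
  let ?C = "ob M" and ?h = "pr x (pr y z)"
  let ?a = "asc M" and ?b = "brd B" and ?i = "inv2 D (asc M)"
  have 1: "e3 ?a (q3 ?C) (q1 ?C) (q2 ?C) \<bullet> e2 ?b (ten1 M (q1 ?C) (q2 ?C)) (q3 ?C) \<bullet> e3 ?a (q1 ?C) (q2 ?C) (q3 ?C)
      = ten2 M (e2 ?b (q1 ?C) (q3 ?C)) (Id2 D (q2 ?C)) \<bullet> e3 ?a (q1 ?C) (q3 ?C) (q2 ?C) \<bullet> ten2 M (Id2 D (q1 ?C)) (e2 ?b (q2 ?C) (q3 ?C))"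
    and 2: "e3 ?i (q2 ?C) (q3 ?C) (q1 ?C) \<bullet> e2 ?b (q1 ?C) (ten1 M (q2 ?C) (q3 ?C)) \<bullet> e3 ?i (q1 ?C) (q2 ?C) (q3 ?C)
      = ten2 M (Id2 D (q2 ?C)) (e2 ?b (q1 ?C) (q3 ?C)) \<bullet> e3 ?i (q2 ?C) (q1 ?C) (q3 ?C) \<bullet> ten2 M (e2 ?b (q1 ?C) (q2 ?C)) (Id2 D (q3 ?C))"
    using B unfolding is_br_iff Let_def M by blast+
  have mb: "is_mon M" "brd B \<in> Cell D" "Dom2 D (brd B) = ten M" "Cod2 D (brd B) = ten1 M (Pr2 P ?C ?C) (Pr1 P ?C ?C)"
    using B M by simp_all
  show "e3 (asc M) z x y \<bullet> e2 (brd B) (ten1 M x y) z \<bullet> e3 (asc M) x y z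
      = ten2 M (e2 (brd B) x z) (Id2 D y) \<bullet> e3 (asc M) x z y \<bullet> ten2 M (Id2 D x) (e2 (brd B) y z)"
    using arg_cong[OF 1, of "\<lambda>s. s \<lhd> ?h"] mb ty by (simp del: rwhisk_pr)
  show "e3 (inv2 D (asc M)) y z x \<bullet> e2 (brd B) x (ten1 M y z) \<bullet> e3 (inv2 D (asc M)) x y z
      = ten2 M (Id2 D y) (e2 (brd B) x z) \<bullet> e3 (inv2 D (asc M)) y x z \<bullet> ten2 M (e2 (brd B) x y) (Id2 D z)"
    using arg_cong[OF 2, of "\<lambda>s. s \<lhd> ?h"] mb ty by (simp del: rwhisk_pr)
qed

text \<open>Interchange of the braiding with the paired 2-cell; its target is the tensor of the
  swapped projections, whence the exchange of factors.\<close>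

lemma brd_natural:
  assumes B: "is_br B" and M: "M = mon B" and ty: "\<sigma> \<in> Cell D" "\<tau> \<in> Cell D" "Dom2 D \<sigma> = x" "Dom2 D \<tau> = y"
    "Cod2 D \<sigma> = x'" "Cod2 D \<tau> = y'" "Dom1 D x = Dom1 D y" "Cod1 D x = ob M" "Cod1 D y = ob M"
  shows "e2 (brd B) x' y' \<bullet> ten2 M \<sigma> \<tau> = ten2 M \<tau> \<sigma> \<bullet> e2 (brd B) x y"
proof -
  have t: "x \<in> Arr D" "y \<in> Arr D" "x' \<in> Arr D" "y' \<in> Arr D" "Dom1 D x' = Dom1 D y'"
    "Cod1 D x' = ob M" "Cod1 D y' = ob M" "Dom1 D y' = Dom1 D y"
    using ty Dom2_Arr[of \<sigma>] Dom2_Arr[of \<tau>] Cod2_Arr[of \<sigma>] Cod2_Arr[of \<tau>] parallel[of \<sigma>] parallel[of \<tau>] by simp_all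
  let ?C = "ob M" and ?p = "pr2 \<sigma> \<tau>"
  have mb: "is_mon M" "brd B \<in> Cell D" "Dom2 D (brd B) = ten M" "Cod2 D (brd B) = ten1 M (Pr2 P ?C ?C) (Pr1 P ?C ?C)"
    using B M by simp_all
  have "(brd B \<lhd> pr x' y') \<bullet> (ten M \<rhd> ?p) = (ten1 M (Pr2 P ?C ?C) (Pr1 P ?C ?C) \<rhd> ?p) \<bullet> (brd B \<lhd> pr x y)"
    by (rule whisk_swap) (use mb ty t in \<open>simp_all add: Hom2_def\<close>)
  then show ?thesis using mb ty t by simp
qed


lemma e2_push [simp]:
  assumes "\<sigma> \<in> Cell D" "x \<in> Arr D" "y \<in> Arr D" "Dom1 D x = Dom1 D y" "Dom1 D (Dom2 D \<sigma>) = Prod P (Cod1 D x) (Cod1 D y)"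
  shows "\<tau> \<in> Cell D \<Longrightarrow> Cod2 D \<sigma> = Dom2 D \<tau> \<Longrightarrow> e2 (\<tau> \<bullet> \<sigma>) x y = e2 \<tau> x y \<bullet> e2 \<sigma> x y"
    "F \<in> Arr D \<Longrightarrow> Cod1 D (Dom2 D \<sigma>) = Dom1 D F \<Longrightarrow> e2 (F \<rhd> \<sigma>) x y = F \<rhd> e2 \<sigma> x y"
  using assms by (simp_all add: at2_def del: rwhisk_pr)

lemma e2_e2 [simp]:
  assumes "\<sigma> \<in> Cell D" "x \<in> Arr D" "y \<in> Arr D" "Dom1 D x = Dom1 D y" "Dom1 D (Dom2 D \<sigma>) = Prod P (Cod1 D a) (Cod1 D b)"
    "a \<in> Arr D" "b \<in> Arr D" "Dom1 D a = Dom1 D b" "Dom1 D a = Prod P (Cod1 D x) (Cod1 D y)"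
  shows "e2 (e2 \<sigma> a b) x y = e2 \<sigma> (a \<odot> pr x y) (b \<odot> pr x y)"
  using assms by (simp add: at2_def del: rwhisk_pr)

lemma e2_rw [simp]:
  assumes "\<sigma> \<in> Cell D" "f \<in> Arr D" "Cod1 D f = Dom1 D (Dom2 D \<sigma>)" "x \<in> Arr D" "y \<in> Arr D" "Dom1 D x = Dom1 D y" "Dom1 D f = Prod P (Cod1 D x) (Cod1 D y)"
  shows "e2 (\<sigma> \<lhd> f) x y = \<sigma> \<lhd> (f \<odot> pr x y)"
  using assms by (simp add: at2_def del: rwhisk_pr)

lemma e2_Id [simp]:
  assumes "f \<in> Arr D" "x \<in> Arr D" "y \<in> Arr D" "Dom1 D x = Dom1 D y" "Dom1 D f = Prod P (Cod1 D x) (Cod1 D y)"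
  shows "e2 (Id2 D f) x y = Id2 D (f \<odot> pr x y)"
  using assms by (simp add: at2_def del: rwhisk_pr)

lemma e2_ten2 [simp]:
  assumes "mon_typ M" "\<sigma> \<in> Cell D" "\<tau> \<in> Cell D" "Dom1 D (Dom2 D \<sigma>) = Dom1 D (Dom2 D \<tau>)"
    "Cod1 D (Dom2 D \<sigma>) = ob M" "Cod1 D (Dom2 D \<tau>) = ob M" "x \<in> Arr D" "y \<in> Arr D" "Dom1 D x = Dom1 D y" "Dom1 D (Dom2 D \<sigma>) = Prod P (Cod1 D x) (Cod1 D y)"
  shows "e2 (ten2 M \<sigma> \<tau>) x y = ten2 M (e2 \<sigma> x y) (e2 \<tau> x y)"
  using assms by (simp add: at2_def del: rwhisk_pr)

lemma ten2_Id_VComp [simp]: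
  assumes "mon_typ M" "\<sigma> \<in> Cell D" "\<sigma>' \<in> Cell D" "Cod2 D \<sigma> = Dom2 D \<sigma>'" "x \<in> Arr D"
    "Dom1 D (Dom2 D \<sigma>) = Dom1 D x" "Cod1 D (Dom2 D \<sigma>) = ob M" "Cod1 D x = ob M"
  shows "ten2 M (Id2 D x) (\<sigma>' \<bullet> \<sigma>) = ten2 M (Id2 D x) \<sigma>' \<bullet> ten2 M (Id2 D x) \<sigma>"
    "ten2 M (\<sigma>' \<bullet> \<sigma>) (Id2 D x) = ten2 M \<sigma>' (Id2 D x) \<bullet> ten2 M \<sigma> (Id2 D x)"
  using ten2_VComp[of M "Id2 D x" \<sigma> "Id2 D x" \<sigma>'] ten2_VComp[of M \<sigma> "Id2 D x" \<sigma>' "Id2 D x"] assms by simp_all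

text \<open>Bifunctoriality with identities inserted; \<open>unit_alg\<close> uses it to separate an
  action on a generalized element from the action on the unit.\<close>

lemma ten2_split:
  assumes "mon_typ M" "\<sigma> \<in> Cell D" "\<tau> \<in> Cell D" "Dom2 D \<sigma> = x" "Cod2 D \<sigma> = x'" "Dom2 D \<tau> = y" "Cod2 D \<tau> = y'"
    "Dom1 D x = Dom1 D y" "Cod1 D x = ob M" "Cod1 D y = ob M"
  shows "ten2 M \<sigma> (Id2 D y') \<bullet> ten2 M (Id2 D x) \<tau> = ten2 M \<sigma> \<tau>" "ten2 M (Id2 D x') \<tau> \<bullet> ten2 M \<sigma> (Id2 D y) = ten2 M \<sigma> \<tau>"
  using ten2_VComp[of M "Id2 D x" \<tau> \<sigma> "Id2 D y'"] ten2_VComp[of M \<sigma> "Id2 D y" "Id2 D x'" \<tau>] assms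
    Dom2_Arr[of \<sigma>] Dom2_Arr[of \<tau>] Cod2_Arr[of \<sigma>] Cod2_Arr[of \<tau>] by simp_all

text \<open>\<open>oplax_monoidal\<close> together with what it presupposes: the typing of
  \<open>F\<close> and the monoidal laws at both ends.\<close>

definition opl :: "('o, 'a, 'c) monoidal \<Rightarrow> ('o, 'a, 'c) monoidal \<Rightarrow> 'a \<Rightarrow> 'c \<times> 'c \<Rightarrow> bool" where
  "opl M M' F s \<longleftrightarrow> is_mon M \<and> is_mon M' \<and> F \<in> Arr D \<and> Dom1 D F = ob M \<and> Cod1 D F = ob M' \<and> oplax_monoidal D P M M' F s"

lemma opl_iff:
  "opl M M' F s \<longleftrightarrow> is_mon M \<and> is_mon M' \<and> F \<in> Arr D \<and> Dom1 D F = ob M \<and> Cod1 D F = ob M' \<and>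
    (let C = ob M; \<phi> = fst s; \<psi> = snd s; x = q1 C; y = q2 C; z = q3 C in
    \<phi> \<in> Cell D \<and> Dom2 D \<phi> = F \<odot> ten M \<and> Cod2 D \<phi> = ten1 M' (F \<odot> Pr1 P C C) (F \<odot> Pr2 P C C) \<and>
    \<psi> \<in> Cell D \<and> Dom2 D \<psi> = F \<odot> unt M \<and> Cod2 D \<psi> = unt M' \<and>
    e3 (asc M') (F \<odot> x) (F \<odot> y) (F \<odot> z) \<bullet> ten2 M' (Id2 D (F \<odot> x)) (e2 \<phi> y z) \<bullet> e2 \<phi> x (ten1 M y z)
      = ten2 M' (e2 \<phi> x y) (Id2 D (F \<odot> z)) \<bullet> e2 \<phi> (ten1 M x y) z \<bullet> (F \<rhd> asc M) \<and>
    (run M' \<lhd> F) \<bullet> ten2 M' (Id2 D F) (\<psi> \<lhd> bang D P C) \<bullet> e2 \<phi> (Id1 D C) (un M C) = F \<rhd> run M \<and>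
    (lun M' \<lhd> F) \<bullet> ten2 M' (\<psi> \<lhd> bang D P C) (Id2 D F) \<bullet> e2 \<phi> (un M C) (Id1 D C) = F \<rhd> lun M)"
  unfolding opl_def oplax_monoidal_def Let_def Hom2_def mem_Collect_eq by blast

lemma oplD:
  assumes "opl M M' F s"
  shows "is_mon M" "is_mon M'" "F \<in> Arr D" "Dom1 D F = ob M" "Cod1 D F = ob M'" "fst s \<in> Cell D" "Dom2 D (fst s) = F \<odot> ten M"
    "Cod2 D (fst s) = ten1 M' (F \<odot> Pr1 P (ob M) (ob M)) (F \<odot> Pr2 P (ob M) (ob M))"
    "snd s \<in> Cell D" "Dom2 D (snd s) = F \<odot> unt M" "Cod2 D (snd s) = unt M'"
  using assms unfolding opl_iff Let_def by blast+

lemma opl_assoc: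
  assumes s: "opl M M' F s" and ty: "x \<in> Arr D" "y \<in> Arr D" "z \<in> Arr D" "Dom1 D x = Dom1 D z" "Dom1 D y = Dom1 D z"
    "Cod1 D x = ob M" "Cod1 D y = ob M" "Cod1 D z = ob M"
  shows "e3 (asc M') (F \<odot> x) (F \<odot> y) (F \<odot> z) \<bullet> ten2 M' (Id2 D (F \<odot> x)) (e2 (fst s) y z) \<bullet> e2 (fst s) x (ten1 M y z)
      = ten2 M' (e2 (fst s) x y) (Id2 D (F \<odot> z)) \<bullet> e2 (fst s) (ten1 M x y) z \<bullet> (F \<rhd> e3 (asc M) x y z)"
proof -
  note t = oplD[OF s]
  let ?C = "ob M" and ?\<phi> = "fst s"
  have "e3 (asc M') (F \<odot> q1 ?C) (F \<odot> q2 ?C) (F \<odot> q3 ?C) \<bullet> ten2 M' (Id2 D (F \<odot> q1 ?C)) (e2 ?\<phi> (q2 ?C) (q3 ?C)) \<bullet> e2 ?\<phi> (q1 ?C) (ten1 M (q2 ?C) (q3 ?C))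
      = ten2 M' (e2 ?\<phi> (q1 ?C) (q2 ?C)) (Id2 D (F \<odot> q3 ?C)) \<bullet> e2 ?\<phi> (ten1 M (q1 ?C) (q2 ?C)) (q3 ?C) \<bullet> (F \<rhd> asc M)"
    using s unfolding opl_iff Let_def by blast
  from arg_cong[OF this, of "\<lambda>s. s \<lhd> pr x (pr y z)"] show ?thesis
    using ty t by (simp del: rwhisk_pr add: at3_def[of D P "asc M" x y z])
qed

lemma opl_units:
  assumes s: "opl M M' F s" and ty: "x \<in> Arr D" "Dom1 D x = Z" "Cod1 D x = ob M"
  shows "(run M' \<lhd> (F \<odot> x)) \<bullet> ten2 M' (Id2 D (F \<odot> x)) (snd s \<lhd> bang D P Z) \<bullet> e2 (fst s) x (un M Z) = F \<rhd> (run M \<lhd> x)"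
    "(lun M' \<lhd> (F \<odot> x)) \<bullet> ten2 M' (snd s \<lhd> bang D P Z) (Id2 D (F \<odot> x)) \<bullet> e2 (fst s) (un M Z) x = F \<rhd> (lun M \<lhd> x)"
proof -
  note t = oplD[OF s]
  have Z: "Z \<in> Obj D" using ty by auto
  have 1: "(run M' \<lhd> F) \<bullet> ten2 M' (Id2 D F) (snd s \<lhd> bang D P (ob M)) \<bullet> e2 (fst s) (Id1 D (ob M)) (un M (ob M)) = F \<rhd> run M"
    and 2: "(lun M' \<lhd> F) \<bullet> ten2 M' (snd s \<lhd> bang D P (ob M)) (Id2 D F) \<bullet> e2 (fst s) (un M (ob M)) (Id1 D (ob M)) = F \<rhd> lun M"
    using s unfolding opl_iff Let_def by blast+
  show "(run M' \<lhd> (F \<odot> x)) \<bullet> ten2 M' (Id2 D (F \<odot> x)) (snd s \<lhd> bang D P Z) \<bullet> e2 (fst s) x (un M Z) = F \<rhd> (run M \<lhd> x)"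
    using arg_cong[OF 1, of "\<lambda>s. s \<lhd> x"] ty t Z by simp
  show "(lun M' \<lhd> (F \<odot> x)) \<bullet> ten2 M' (snd s \<lhd> bang D P Z) (Id2 D (F \<odot> x)) \<bullet> e2 (fst s) (un M Z) x = F \<rhd> (lun M \<lhd> x)"
    using arg_cong[OF 2, of "\<lambda>s. s \<lhd> x"] ty t Z by simp
qed

text \<open>Again interchange, now of the structure cell of \<open>F\<close> with a pair of
  2-cells.\<close>

lemma opl_natural:
  assumes s: "opl M M' F s" and ty: "\<sigma> \<in> Cell D" "\<tau> \<in> Cell D" "Dom2 D \<sigma> = x" "Dom2 D \<tau> = y" "Cod2 D \<sigma> = x'" "Cod2 D \<tau> = y'"
    "Dom1 D x = Dom1 D y" "Cod1 D x = ob M" "Cod1 D y = ob M"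
  shows "ten2 M' (F \<rhd> \<sigma>) (F \<rhd> \<tau>) \<bullet> e2 (fst s) x y = e2 (fst s) x' y' \<bullet> (F \<rhd> ten2 M \<sigma> \<tau>)"
proof -
  note o = oplD[OF s]
  have t: "x \<in> Arr D" "y \<in> Arr D" "x' \<in> Arr D" "y' \<in> Arr D" "Dom1 D x' = Dom1 D y'"
    "Cod1 D x' = ob M" "Cod1 D y' = ob M" "Dom1 D y' = Dom1 D y"
    using ty Dom2_Arr[of \<sigma>] Dom2_Arr[of \<tau>] Cod2_Arr[of \<sigma>] Cod2_Arr[of \<tau>] parallel[of \<sigma>] parallel[of \<tau>] by simp_all
  let ?C = "ob M"
  have "(fst s \<lhd> pr x' y') \<bullet> ((F \<odot> ten M) \<rhd> pr2 \<sigma> \<tau>) = (ten1 M' (F \<odot> Pr1 P ?C ?C) (F \<odot> Pr2 P ?C ?C) \<rhd> pr2 \<sigma> \<tau>) \<bullet> (fst s \<lhd> pr x y)"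
    by (rule whisk_swap) (use o ty t in \<open>simp_all add: Hom2_def\<close>)
  moreover have "(F \<odot> ten M) \<rhd> pr2 \<sigma> \<tau> = F \<rhd> ten2 M \<sigma> \<tau>"
    using lwhisk_lwhisk[of "pr2 \<sigma> \<tau>" F "ten M"] o ty t by simp
  moreover have "(F \<odot> Pr1 P ?C ?C) \<rhd> pr2 \<sigma> \<tau> = F \<rhd> \<sigma>" "(F \<odot> Pr2 P ?C ?C) \<rhd> pr2 \<sigma> \<tau> = F \<rhd> \<tau>"
    using lwhisk_lwhisk[of "pr2 \<sigma> \<tau>" F "Pr1 P ?C ?C"] lwhisk_lwhisk[of "pr2 \<sigma> \<tau>" F "Pr2 P ?C ?C"] o ty t by simp_all
  ultimately show ?thesis using o ty t by simp
qed

text \<open>\<open>monoidal_comp_str\<close> on bare data, so that the calculations can avoid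
  \<open>Mor\<close> terms.\<close>

definition opl_comp :: "('o, 'a, 'c) monoidal \<Rightarrow> 'a \<Rightarrow> 'a \<Rightarrow> 'c \<times> 'c \<Rightarrow> 'c \<times> 'c \<Rightarrow> 'c \<times> 'c" where
  "opl_comp M G F s' s = (e2 (fst s') (F \<odot> Pr1 P (ob M) (ob M)) (F \<odot> Pr2 P (ob M) (ob M)) \<bullet> (G \<rhd> fst s), snd s' \<bullet> (G \<rhd> snd s))"

lemma opl_comp_cells:
  assumes s: "opl M M' F s" and s': "opl M' M'' G s'"
  shows "fst (opl_comp M G F s' s) \<in> Cell D" "Dom2 D (fst (opl_comp M G F s' s)) = (G \<odot> F) \<odot> ten M"
    "Cod2 D (fst (opl_comp M G F s' s)) = ten1 M'' ((G \<odot> F) \<odot> Pr1 P (ob M) (ob M)) ((G \<odot> F) \<odot> Pr2 P (ob M) (ob M))"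
    "snd (opl_comp M G F s' s) \<in> Cell D" "Dom2 D (snd (opl_comp M G F s' s)) = (G \<odot> F) \<odot> unt M"
    "Cod2 D (snd (opl_comp M G F s' s)) = unt M''"
  using oplD[OF s] oplD[OF s'] by (simp_all add: opl_comp_def)

lemma opl_comp_at:
  assumes s: "opl M M' F s" and s': "opl M' M'' G s'" and ty: "x \<in> Arr D" "y \<in> Arr D" "Dom1 D x = Dom1 D y" "Cod1 D x = ob M" "Cod1 D y = ob M"
  shows "e2 (fst (opl_comp M G F s' s)) x y = e2 (fst s') (F \<odot> x) (F \<odot> y) \<bullet> (G \<rhd> e2 (fst s) x y)"
  using oplD[OF s] oplD[OF s'] ty by (simp add: opl_comp_def)

text \<open>All three axioms follow one pattern: naturality moves the image of the inner structure
  past the outer structure cell, then the axiom of \<open>G\<close> applies, and under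
  \<open>G\<close> the axiom of \<open>F\<close>. Associativity needs naturality once more on the
  way back.\<close>

lemma opl_comp_opl:
  assumes s: "opl M M' F s" and s': "opl M' M'' G s'"
  shows "opl M M'' (G \<odot> F) (opl_comp M G F s' s)"
proof -
  note t = oplD[OF s] oplD[OF s'] and c = opl_comp_at[OF s s'] and cc = opl_comp_cells[OF s s']
  let ?C = "ob M" and ?s = "opl_comp M G F s' s"
  let ?x = "q1 ?C" and ?y = "q2 ?C" and ?z = "q3 ?C" and ?\<phi> = "e2 (fst s)" and ?\<kappa> = "e2 (fst s')"
  let ?X = "F \<odot> ?x" and ?Y = "F \<odot> ?y" and ?Z = "F \<odot> ?z"
  let ?yz = "ten1 M ?y ?z" and ?xy = "ten1 M ?x ?y" and ?YZ = "ten1 M' ?Y ?Z" and ?XY = "ten1 M' ?X ?Y"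
  let ?aG = "e3 (asc M'') (G \<odot> ?X) (G \<odot> ?Y) (G \<odot> ?Z)" and ?aF = "e3 (asc M') ?X ?Y ?Z" and
    ?l = "ten2 M'' (Id2 D (G \<odot> ?X)) (?\<kappa> ?Y ?Z)" and ?r = "ten2 M'' (?\<kappa> ?X ?Y) (Id2 D (G \<odot> ?Z))"
    and ?m = "ten2 M' (Id2 D ?X) (?\<phi> ?y ?z)" and ?n = "ten2 M' (?\<phi> ?x ?y) (Id2 D ?Z)"
  have M: "is_mon M" "is_mon M'" "is_mon M''" using t by simp_all
  have "e3 (asc M'') ((G \<odot> F) \<odot> ?x) ((G \<odot> F) \<odot> ?y) ((G \<odot> F) \<odot> ?z) \<bullet>
      ten2 M'' (Id2 D ((G \<odot> F) \<odot> ?x)) (e2 (fst ?s) ?y ?z) \<bullet> e2 (fst ?s) ?x ?yz =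
      ?aG \<bullet> ?l \<bullet>
      (ten2 M'' (G \<rhd> Id2 D ?X) (G \<rhd> ?\<phi> ?y ?z) \<bullet> ?\<kappa> ?X (F \<odot> ?yz)) \<bullet> (G \<rhd> ?\<phi> ?x ?yz)"
    using t by (simp add: c)
  also have "ten2 M'' (G \<rhd> Id2 D ?X) (G \<rhd> ?\<phi> ?y ?z) \<bullet> ?\<kappa> ?X (F \<odot> ?yz) =
      ?\<kappa> ?X ?YZ \<bullet> (G \<rhd> ?m)"
    by (rule opl_natural[OF s']) (use t in simp_all)
  also have "?aG \<bullet> ?l \<bullet>
      (?\<kappa> ?X ?YZ \<bullet> (G \<rhd> ?m)) \<bullet> (G \<rhd> ?\<phi> ?x ?yz) =
      (?aG \<bullet> ?l \<bullet>
      ?\<kappa> ?X ?YZ) \<bullet> (G \<rhd> (?m \<bullet> ?\<phi> ?x ?yz))"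
    using t by simp
  also have "?aG \<bullet> ?l \<bullet> ?\<kappa> ?X ?YZ =
      ?r \<bullet> ?\<kappa> ?XY ?Z \<bullet> (G \<rhd> ?aF)"
    by (rule opl_assoc[OF s']) (use t in simp_all)
  also have "(?r \<bullet> ?\<kappa> ?XY ?Z \<bullet> (G \<rhd> ?aF))
      \<bullet> (G \<rhd> (?m \<bullet> ?\<phi> ?x ?yz)) =
      (?r \<bullet> ?\<kappa> ?XY ?Z) \<bullet>
      (G \<rhd> (?aF \<bullet> ?m \<bullet> ?\<phi> ?x ?yz))"
    using t by simp
  also have "?aF \<bullet> ?m \<bullet> ?\<phi> ?x ?yz =
      ?n \<bullet> ?\<phi> ?xy ?z \<bullet> (F \<rhd> e3 (asc M) ?x ?y ?z)"
    by (rule opl_assoc[OF s]) (use t in simp_all)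
  also have "(?r \<bullet> ?\<kappa> ?XY ?Z) \<bullet>
      (G \<rhd> (?n \<bullet> ?\<phi> ?xy ?z \<bullet> (F \<rhd> e3 (asc M) ?x ?y ?z))) =
      ?r \<bullet> (?\<kappa> ?XY ?Z \<bullet>
      (G \<rhd> ?n)) \<bullet> (G \<rhd> ?\<phi> ?xy ?z) \<bullet> ((G \<odot> F) \<rhd> asc M)"
    using t by (simp add: at3_def)
  also have "?\<kappa> ?XY ?Z \<bullet> (G \<rhd> ?n) =
      ten2 M'' (G \<rhd> ?\<phi> ?x ?y) (G \<rhd> Id2 D ?Z) \<bullet> ?\<kappa> (F \<odot> ?xy) ?Z"
    by (rule opl_natural[OF s', symmetric]) (use t in simp_all)
  also have "?r \<bullet> (ten2 M'' (G \<rhd> ?\<phi> ?x ?y) (G \<rhd> Id2 D ?Z) \<bullet> ?\<kappa> (F \<odot> ?xy) ?Z)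
      \<bullet> (G \<rhd> ?\<phi> ?xy ?z) \<bullet> ((G \<odot> F) \<rhd> asc M) =
      ten2 M'' (e2 (fst ?s) ?x ?y) (Id2 D ((G \<odot> F) \<odot> ?z)) \<bullet> e2 (fst ?s) ?xy ?z \<bullet> ((G \<odot> F) \<rhd> asc M)"
    using t by (simp add: c)
  finally have 1: "e3 (asc M'') ((G \<odot> F) \<odot> ?x) ((G \<odot> F) \<odot> ?y) ((G \<odot> F) \<odot> ?z) \<bullet>
      ten2 M'' (Id2 D ((G \<odot> F) \<odot> ?x)) (e2 (fst ?s) ?y ?z) \<bullet> e2 (fst ?s) ?x ?yz =
      ten2 M'' (e2 (fst ?s) ?x ?y) (Id2 D ((G \<odot> F) \<odot> ?z)) \<bullet> e2 (fst ?s) ?xy ?z \<bullet> ((G \<odot> F) \<rhd> asc M)" .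
  let ?b = "bang D P ?C" and ?I = "Id1 D ?C" and ?u = "un M ?C"
  have "(run M'' \<lhd> (G \<odot> F)) \<bullet> ten2 M'' (Id2 D (G \<odot> F)) (snd ?s \<lhd> ?b) \<bullet> e2 (fst ?s) ?I ?u =
      (run M'' \<lhd> (G \<odot> F)) \<bullet> ten2 M'' (Id2 D (G \<odot> F)) (snd s' \<lhd> ?b) \<bullet>
       (ten2 M'' (G \<rhd> Id2 D F) (G \<rhd> (snd s \<lhd> ?b)) \<bullet> ?\<kappa> F (F \<odot> ?u)) \<bullet> (G \<rhd> ?\<phi> ?I ?u)"
    \<comment> \<open>Two passes: \<open>c\<close> must evaluate the composite structure as a whole
      before its definition is unfolded for the unit component.\<close>
    using t by (simp add: c) (simp add: opl_comp_def)
  also have "ten2 M'' (G \<rhd> Id2 D F) (G \<rhd> (snd s \<lhd> ?b)) \<bullet> ?\<kappa> F (F \<odot> ?u) = ?\<kappa> F (un M' ?C) \<bullet> (G \<rhd> ten2 M' (Id2 D F) (snd s \<lhd> ?b))"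
    by (rule opl_natural[OF s']) (use t in simp_all)
  also have "(run M'' \<lhd> (G \<odot> F)) \<bullet> ten2 M'' (Id2 D (G \<odot> F)) (snd s' \<lhd> ?b) \<bullet>
      (?\<kappa> F (un M' ?C) \<bullet> (G \<rhd> ten2 M' (Id2 D F) (snd s \<lhd> ?b))) \<bullet> (G \<rhd> ?\<phi> ?I ?u) =
     ((run M'' \<lhd> (G \<odot> F)) \<bullet> ten2 M'' (Id2 D (G \<odot> F)) (snd s' \<lhd> ?b) \<bullet> ?\<kappa> F (un M' ?C)) \<bullet>
      (G \<rhd> (ten2 M' (Id2 D F) (snd s \<lhd> ?b) \<bullet> ?\<phi> ?I ?u))"
    using t by simp
  also have "(run M'' \<lhd> (G \<odot> F)) \<bullet> ten2 M'' (Id2 D (G \<odot> F)) (snd s' \<lhd> ?b) \<bullet> ?\<kappa> F (un M' ?C) = G \<rhd> (run M' \<lhd> F)"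
    by (rule opl_units[OF s']) (use t in simp_all)
  also have "(G \<rhd> (run M' \<lhd> F)) \<bullet> (G \<rhd> (ten2 M' (Id2 D F) (snd s \<lhd> ?b) \<bullet> ?\<phi> ?I ?u)) =
      G \<rhd> ((run M' \<lhd> (F \<odot> ?I)) \<bullet> ten2 M' (Id2 D (F \<odot> ?I)) (snd s \<lhd> ?b) \<bullet> ?\<phi> ?I ?u)"
    using t by simp
  also have "(run M' \<lhd> (F \<odot> ?I)) \<bullet> ten2 M' (Id2 D (F \<odot> ?I)) (snd s \<lhd> ?b) \<bullet> ?\<phi> ?I ?u = F \<rhd> (run M \<lhd> ?I)"
    by (rule opl_units[OF s]) (use t in simp_all)
  finally have 2: "(run M'' \<lhd> (G \<odot> F)) \<bullet> ten2 M'' (Id2 D (G \<odot> F)) (snd ?s \<lhd> ?b) \<bullet> e2 (fst ?s) ?I ?u = (G \<odot> F) \<rhd> run M"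
    using t by simp
  have "(lun M'' \<lhd> (G \<odot> F)) \<bullet> ten2 M'' (snd ?s \<lhd> ?b) (Id2 D (G \<odot> F)) \<bullet> e2 (fst ?s) ?u ?I =
      (lun M'' \<lhd> (G \<odot> F)) \<bullet> ten2 M'' (snd s' \<lhd> ?b) (Id2 D (G \<odot> F)) \<bullet>
       (ten2 M'' (G \<rhd> (snd s \<lhd> ?b)) (G \<rhd> Id2 D F) \<bullet> ?\<kappa> (F \<odot> ?u) F) \<bullet> (G \<rhd> ?\<phi> ?u ?I)"
    using t by (simp add: c) (simp add: opl_comp_def)
  also have "ten2 M'' (G \<rhd> (snd s \<lhd> ?b)) (G \<rhd> Id2 D F) \<bullet> ?\<kappa> (F \<odot> ?u) F = ?\<kappa> (un M' ?C) F \<bullet> (G \<rhd> ten2 M' (snd s \<lhd> ?b) (Id2 D F))"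
    by (rule opl_natural[OF s']) (use t in simp_all)
  also have "(lun M'' \<lhd> (G \<odot> F)) \<bullet> ten2 M'' (snd s' \<lhd> ?b) (Id2 D (G \<odot> F)) \<bullet>
      (?\<kappa> (un M' ?C) F \<bullet> (G \<rhd> ten2 M' (snd s \<lhd> ?b) (Id2 D F))) \<bullet> (G \<rhd> ?\<phi> ?u ?I) =
     ((lun M'' \<lhd> (G \<odot> F)) \<bullet> ten2 M'' (snd s' \<lhd> ?b) (Id2 D (G \<odot> F)) \<bullet> ?\<kappa> (un M' ?C) F) \<bullet>
      (G \<rhd> (ten2 M' (snd s \<lhd> ?b) (Id2 D F) \<bullet> ?\<phi> ?u ?I))"
    using t by simp
  also have "(lun M'' \<lhd> (G \<odot> F)) \<bullet> ten2 M'' (snd s' \<lhd> ?b) (Id2 D (G \<odot> F)) \<bullet> ?\<kappa> (un M' ?C) F = G \<rhd> (lun M' \<lhd> F)"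
    by (rule opl_units[OF s']) (use t in simp_all)
  also have "(G \<rhd> (lun M' \<lhd> F)) \<bullet> (G \<rhd> (ten2 M' (snd s \<lhd> ?b) (Id2 D F) \<bullet> ?\<phi> ?u ?I)) =
      G \<rhd> ((lun M' \<lhd> (F \<odot> ?I)) \<bullet> ten2 M' (snd s \<lhd> ?b) (Id2 D (F \<odot> ?I)) \<bullet> ?\<phi> ?u ?I)"
    using t by simp
  also have "(lun M' \<lhd> (F \<odot> ?I)) \<bullet> ten2 M' (snd s \<lhd> ?b) (Id2 D (F \<odot> ?I)) \<bullet> ?\<phi> ?u ?I = F \<rhd> (lun M \<lhd> ?I)"
    by (rule opl_units[OF s]) (use t in simp_all)
  finally have 3: "(lun M'' \<lhd> (G \<odot> F)) \<bullet> ten2 M'' (snd ?s \<lhd> ?b) (Id2 D (G \<odot> F)) \<bullet> e2 (fst ?s) ?u ?I = (G \<odot> F) \<rhd> lun M"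
    using t by simp
  have "G \<odot> F \<in> Arr D" "Dom1 D (G \<odot> F) = ob M" "Cod1 D (G \<odot> F) = ob M''" using t by simp_all
  then show ?thesis unfolding opl_iff Let_def using 1 2 3 M cc by blast
qed

lemma e3_q [simp]:
  "C \<in> Obj D \<Longrightarrow> \<sigma> \<in> Cell D \<Longrightarrow> Dom1 D (Dom2 D \<sigma>) = Cube C \<Longrightarrow> e3 \<sigma> (q1 C) (q2 C) (q3 C) = \<sigma>"
  by (simp add: at3_def del: rwhisk_pr)

lemma opl_id:
  assumes M: "is_mon M"
  shows "opl M M (Id1 D (ob M)) (Id2 D (ten M), Id2 D (unt M))"
  unfolding opl_iff Let_def using M by simp

end

section \<open>The 2-categories of braided and symmetric monoidal objects\<close>

context finite_products
begin

definition mon_trf :: "('o, 'a, 'c) monoidal \<Rightarrow> ('o, 'a, 'c) monoidal \<Rightarrow> 'c \<times> 'c \<Rightarrow> 'c \<times> 'c \<Rightarrow> 'c \<Rightarrow> bool" where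
  "mon_trf M M' s s' \<sigma> \<longleftrightarrow>
    fst s' \<bullet> (\<sigma> \<lhd> ten M) = ten2 M' (\<sigma> \<lhd> Pr1 P (ob M) (ob M)) (\<sigma> \<lhd> Pr2 P (ob M) (ob M)) \<bullet> fst s \<and>
    snd s' \<bullet> (\<sigma> \<lhd> unt M) = snd s"

lemma mon_trf_at:
  assumes s: "opl M M' F s" and s': "opl M M' F' s'" and \<sigma>: "\<sigma> \<in> Cell D" "Dom2 D \<sigma> = F" "Cod2 D \<sigma> = F'"
    and m: "mon_trf M M' s s' \<sigma>" and ty: "x \<in> Arr D" "y \<in> Arr D" "Dom1 D x = Dom1 D y" "Cod1 D x = ob M" "Cod1 D y = ob M"
  shows "e2 (fst s') x y \<bullet> (\<sigma> \<lhd> ten1 M x y) = ten2 M' (\<sigma> \<lhd> x) (\<sigma> \<lhd> y) \<bullet> e2 (fst s) x y"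
proof -
  note t = oplD[OF s] oplD[OF s']
  have "fst s' \<bullet> (\<sigma> \<lhd> ten M) = ten2 M' (\<sigma> \<lhd> Pr1 P (ob M) (ob M)) (\<sigma> \<lhd> Pr2 P (ob M) (ob M)) \<bullet> fst s"
    using m by (simp add: mon_trf_def)
  from arg_cong[OF this, of "\<lambda>s. s \<lhd> pr x y"] have
    "(fst s' \<lhd> pr x y) \<bullet> (\<sigma> \<lhd> (ten M \<odot> pr x y)) = ten2 M' (\<sigma> \<lhd> (Pr1 P (ob M) (ob M) \<odot> pr x y)) (\<sigma> \<lhd> (Pr2 P (ob M) (ob M) \<odot> pr x y)) \<bullet> (fst s \<lhd> pr x y)"
    using t \<sigma> ty by (simp del: rwhisk_pr ten_pr pr_typ(4,5))
  then show ?thesis using t \<sigma> ty by simp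
qed

lemma mon_trf_unit:
  "mon_trf M M' s s' \<sigma> \<Longrightarrow> snd s' \<bullet> (\<sigma> \<lhd> unt M) = snd s"
  by (simp add: mon_trf_def)

lemma mon_trf_vcomp:
  assumes s: "opl M M' F s" and s': "opl M M' F' s'" and s'': "opl M M' F'' s''"
    and \<sigma>: "\<sigma> \<in> Cell D" "Dom2 D \<sigma> = F" "Cod2 D \<sigma> = F'" and \<tau>: "\<tau> \<in> Cell D" "Dom2 D \<tau> = F'" "Cod2 D \<tau> = F''"
    and m: "mon_trf M M' s s' \<sigma>" and m': "mon_trf M M' s' s'' \<tau>"
  shows "mon_trf M M' s s'' (\<tau> \<bullet> \<sigma>)"
proof -
  note t = oplD[OF s] oplD[OF s'] oplD[OF s''] \<sigma> \<tau>
  let ?p = "Pr1 P (ob M) (ob M)" and ?q = "Pr2 P (ob M) (ob M)"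
  have e: "fst s' \<bullet> (\<sigma> \<lhd> ten M) = ten2 M' (\<sigma> \<lhd> ?p) (\<sigma> \<lhd> ?q) \<bullet> fst s"
    "fst s'' \<bullet> (\<tau> \<lhd> ten M) = ten2 M' (\<tau> \<lhd> ?p) (\<tau> \<lhd> ?q) \<bullet> fst s'"
    "snd s' \<bullet> (\<sigma> \<lhd> unt M) = snd s" "snd s'' \<bullet> (\<tau> \<lhd> unt M) = snd s'"
    using m m' by (simp_all add: mon_trf_def)
  have "fst s'' \<bullet> ((\<tau> \<bullet> \<sigma>) \<lhd> ten M) = (fst s'' \<bullet> (\<tau> \<lhd> ten M)) \<bullet> (\<sigma> \<lhd> ten M)" using t by simp
  also have "\<dots> = ten2 M' (\<tau> \<lhd> ?p) (\<tau> \<lhd> ?q) \<bullet> (fst s' \<bullet> (\<sigma> \<lhd> ten M))" unfolding e(2) using t by simp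
  also have "\<dots> = (ten2 M' (\<tau> \<lhd> ?p) (\<tau> \<lhd> ?q) \<bullet> ten2 M' (\<sigma> \<lhd> ?p) (\<sigma> \<lhd> ?q)) \<bullet> fst s" unfolding e(1) using t by simp
  also have "ten2 M' (\<tau> \<lhd> ?p) (\<tau> \<lhd> ?q) \<bullet> ten2 M' (\<sigma> \<lhd> ?p) (\<sigma> \<lhd> ?q) = ten2 M' ((\<tau> \<bullet> \<sigma>) \<lhd> ?p) ((\<tau> \<bullet> \<sigma>) \<lhd> ?q)"
    using t by (simp add: ten2_VComp)
  finally have 1: "fst s'' \<bullet> ((\<tau> \<bullet> \<sigma>) \<lhd> ten M) = ten2 M' ((\<tau> \<bullet> \<sigma>) \<lhd> ?p) ((\<tau> \<bullet> \<sigma>) \<lhd> ?q) \<bullet> fst s" .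
  have "snd s'' \<bullet> ((\<tau> \<bullet> \<sigma>) \<lhd> unt M) = (snd s'' \<bullet> (\<tau> \<lhd> unt M)) \<bullet> (\<sigma> \<lhd> unt M)" using t by simp
  also have "\<dots> = snd s" unfolding e ..
  finally show ?thesis using 1 by (simp add: mon_trf_def)
qed

text \<open>The condition on \<open>\<sigma>\<close> is used under \<open>G\<close>; naturality of
  the structure of \<open>G\<close> then moves the tensor of the two cells outside.\<close>

lemma mon_trf_lwhisk:
  assumes s: "opl M M' F s" and s': "opl M M' F' s'" and k: "opl M' M'' G k"
    and \<sigma>: "\<sigma> \<in> Cell D" "Dom2 D \<sigma> = F" "Cod2 D \<sigma> = F'" and m: "mon_trf M M' s s' \<sigma>"
  shows "mon_trf M M'' (opl_comp M G F k s) (opl_comp M G F' k s') (G \<rhd> \<sigma>)"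
proof -
  note t = oplD[OF s] oplD[OF s'] oplD[OF k] \<sigma>
  let ?p = "Pr1 P (ob M) (ob M)" and ?q = "Pr2 P (ob M) (ob M)"
  have e: "fst s' \<bullet> (\<sigma> \<lhd> ten M) = ten2 M' (\<sigma> \<lhd> ?p) (\<sigma> \<lhd> ?q) \<bullet> fst s" "snd s' \<bullet> (\<sigma> \<lhd> unt M) = snd s"
    using m by (simp_all add: mon_trf_def)
  have "(e2 (fst k) (F' \<odot> ?p) (F' \<odot> ?q) \<bullet> (G \<rhd> fst s')) \<bullet> ((G \<rhd> \<sigma>) \<lhd> ten M) =
      e2 (fst k) (F' \<odot> ?p) (F' \<odot> ?q) \<bullet> (G \<rhd> (fst s' \<bullet> (\<sigma> \<lhd> ten M)))" using t by simp
  also have "\<dots> = (e2 (fst k) (F' \<odot> ?p) (F' \<odot> ?q) \<bullet> (G \<rhd> ten2 M' (\<sigma> \<lhd> ?p) (\<sigma> \<lhd> ?q))) \<bullet> (G \<rhd> fst s)"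
    unfolding e using t by simp
  also have "e2 (fst k) (F' \<odot> ?p) (F' \<odot> ?q) \<bullet> (G \<rhd> ten2 M' (\<sigma> \<lhd> ?p) (\<sigma> \<lhd> ?q)) =
      ten2 M'' (G \<rhd> (\<sigma> \<lhd> ?p)) (G \<rhd> (\<sigma> \<lhd> ?q)) \<bullet> e2 (fst k) (F \<odot> ?p) (F \<odot> ?q)"
    by (rule opl_natural[OF k, symmetric]) (use t in simp_all)
  finally have 1: "(e2 (fst k) (F' \<odot> ?p) (F' \<odot> ?q) \<bullet> (G \<rhd> fst s')) \<bullet> ((G \<rhd> \<sigma>) \<lhd> ten M) =
    ten2 M'' ((G \<rhd> \<sigma>) \<lhd> ?p) ((G \<rhd> \<sigma>) \<lhd> ?q) \<bullet> e2 (fst k) (F \<odot> ?p) (F \<odot> ?q) \<bullet> (G \<rhd> fst s)" using t by simp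
  have "(snd k \<bullet> (G \<rhd> snd s')) \<bullet> ((G \<rhd> \<sigma>) \<lhd> unt M) = snd k \<bullet> (G \<rhd> (snd s' \<bullet> (\<sigma> \<lhd> unt M)))" using t by simp
  also have "\<dots> = snd k \<bullet> (G \<rhd> snd s)" unfolding e ..
  finally show ?thesis using 1 by (simp add: mon_trf_def opl_comp_def)
qed

text \<open>Interchange carries \<open>\<sigma>\<close> past the structure of \<open>F\<close>; what
  remains is the condition on \<open>\<sigma>\<close> at the elements \<open>F \<odot> ?p\<close>
  and \<open>F \<odot> ?q\<close>, and for the unit the plain condition.\<close>

lemma mon_trf_rwhisk:
  assumes s: "opl M M' F s" and k: "opl M' M'' G k" and k': "opl M' M'' G' k'"
    and \<sigma>: "\<sigma> \<in> Cell D" "Dom2 D \<sigma> = G" "Cod2 D \<sigma> = G'" and m: "mon_trf M' M'' k k' \<sigma>"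
  shows "mon_trf M M'' (opl_comp M G F k s) (opl_comp M G' F k' s) (\<sigma> \<lhd> F)"
proof -
  note t = oplD[OF s] oplD[OF k] oplD[OF k'] \<sigma>
  let ?p = "Pr1 P (ob M) (ob M)" and ?q = "Pr2 P (ob M) (ob M)"
  have sw: "(\<sigma> \<lhd> ten1 M' (F \<odot> ?p) (F \<odot> ?q)) \<bullet> (G \<rhd> fst s) = (G' \<rhd> fst s) \<bullet> (\<sigma> \<lhd> (F \<odot> ten M))"
    by (rule whisk_swap) (use t in \<open>simp_all add: Hom2_def\<close>)
  have su: "(\<sigma> \<lhd> unt M') \<bullet> (G \<rhd> snd s) = (G' \<rhd> snd s) \<bullet> (\<sigma> \<lhd> (F \<odot> unt M))"
    by (rule whisk_swap) (use t in \<open>simp_all add: Hom2_def\<close>)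
  have "(e2 (fst k') (F \<odot> ?p) (F \<odot> ?q) \<bullet> (G' \<rhd> fst s)) \<bullet> ((\<sigma> \<lhd> F) \<lhd> ten M) =
      e2 (fst k') (F \<odot> ?p) (F \<odot> ?q) \<bullet> ((G' \<rhd> fst s) \<bullet> (\<sigma> \<lhd> (F \<odot> ten M)))" using t by simp
  also have "\<dots> = (e2 (fst k') (F \<odot> ?p) (F \<odot> ?q) \<bullet> (\<sigma> \<lhd> ten1 M' (F \<odot> ?p) (F \<odot> ?q))) \<bullet> (G \<rhd> fst s)"
    unfolding sw[symmetric] using t by simp
  also have "e2 (fst k') (F \<odot> ?p) (F \<odot> ?q) \<bullet> (\<sigma> \<lhd> ten1 M' (F \<odot> ?p) (F \<odot> ?q)) =
      ten2 M'' (\<sigma> \<lhd> (F \<odot> ?p)) (\<sigma> \<lhd> (F \<odot> ?q)) \<bullet> e2 (fst k) (F \<odot> ?p) (F \<odot> ?q)"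
    by (rule mon_trf_at[OF k k' \<sigma> m]) (use t in simp_all)
  finally have 1: "(e2 (fst k') (F \<odot> ?p) (F \<odot> ?q) \<bullet> (G' \<rhd> fst s)) \<bullet> ((\<sigma> \<lhd> F) \<lhd> ten M) =
    ten2 M'' ((\<sigma> \<lhd> F) \<lhd> ?p) ((\<sigma> \<lhd> F) \<lhd> ?q) \<bullet> e2 (fst k) (F \<odot> ?p) (F \<odot> ?q) \<bullet> (G \<rhd> fst s)" using t by simp
  have "(snd k' \<bullet> (G' \<rhd> snd s)) \<bullet> ((\<sigma> \<lhd> F) \<lhd> unt M) = snd k' \<bullet> ((G' \<rhd> snd s) \<bullet> (\<sigma> \<lhd> (F \<odot> unt M)))" using t by simp
  also have "\<dots> = (snd k' \<bullet> (\<sigma> \<lhd> unt M')) \<bullet> (G \<rhd> snd s)" unfolding su[symmetric] using t by simp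
  also have "\<dots> = snd k \<bullet> (G \<rhd> snd s)" unfolding mon_trf_unit[OF m] ..
  finally show ?thesis using 1 by (simp add: mon_trf_def opl_comp_def)
qed

lemma opl_comp_unit:
  assumes s: "opl M M' F s"
  shows "opl_comp M F (Id1 D (ob M)) s (Id2 D (ten M), Id2 D (unt M)) = s"
    "opl_comp M (Id1 D (ob M')) F (Id2 D (ten M'), Id2 D (unt M')) s = s"
  using oplD[OF s] by (simp_all add: opl_comp_def)

lemma opl_comp_assoc:
  assumes s: "opl M M' F s" and s': "opl M' M'' G s'" and s'': "opl M'' M''' H s''"
  shows "opl_comp M (H \<odot> G) F (opl_comp M' H G s'' s') s = opl_comp M H (G \<odot> F) s'' (opl_comp M G F s' s)"
  using oplD[OF s] oplD[OF s'] oplD[OF s''] by (simp add: opl_comp_def)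

definition brd_compat :: "('o, 'a, 'c) braided \<Rightarrow> ('o, 'a, 'c) braided \<Rightarrow> 'a \<Rightarrow> 'c \<times> 'c \<Rightarrow> bool" where
  "brd_compat B B' F s \<longleftrightarrow> (let C = ob (mon B); x = Pr1 P C C; y = Pr2 P C C in
     e2 (brd B') (F \<odot> x) (F \<odot> y) \<bullet> fst s = e2 (fst s) y x \<bullet> (F \<rhd> brd B))"

lemma brd_compat_at:
  assumes s: "opl (mon B) (mon B') F s" and B: "is_br B" "is_br B'" and b: "brd_compat B B' F s"
    and ty: "x \<in> Arr D" "y \<in> Arr D" "Dom1 D x = Dom1 D y" "Cod1 D x = ob (mon B)" "Cod1 D y = ob (mon B)"
  shows "e2 (brd B') (F \<odot> x) (F \<odot> y) \<bullet> e2 (fst s) x y = e2 (fst s) y x \<bullet> (F \<rhd> e2 (brd B) x y)"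
  using arg_cong[OF b[unfolded brd_compat_def Let_def], of "\<lambda>s. s \<lhd> pr x y"] oplD[OF s] B ty
  by simp

text \<open>The compatibility of \<open>G\<close> at \<open>F \<odot> ?p\<close> and
  \<open>F \<odot> ?q\<close>, followed by that of \<open>F\<close> under \<open>G\<close>.\<close>

lemma brd_compat_comp:
  assumes s: "opl (mon B) (mon B') F s" and s': "opl (mon B') (mon B'') G s'" and B: "is_br B" "is_br B'" "is_br B''"
    and b: "brd_compat B B' F s" and b': "brd_compat B' B'' G s'"
  shows "brd_compat B B'' (G \<odot> F) (opl_comp (mon B) G F s' s)"
proof -
  note t = oplD[OF s] oplD[OF s'] B
  let ?C = "ob (mon B)"
  let ?p = "Pr1 P ?C ?C" and ?q = "Pr2 P ?C ?C" and ?s = "opl_comp (mon B) G F s' s"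
  have 1: "e2 (brd B') (F \<odot> ?p) (F \<odot> ?q) \<bullet> fst s = e2 (fst s) ?q ?p \<bullet> (F \<rhd> brd B)"
    using b by (simp add: brd_compat_def Let_def)
  have "e2 (brd B'') ((G \<odot> F) \<odot> ?p) ((G \<odot> F) \<odot> ?q) \<bullet> fst ?s =
      (e2 (brd B'') (G \<odot> F \<odot> ?p) (G \<odot> F \<odot> ?q) \<bullet> e2 (fst s') (F \<odot> ?p) (F \<odot> ?q)) \<bullet> (G \<rhd> fst s)"
    using t by (simp add: opl_comp_def)
  also have "e2 (brd B'') (G \<odot> F \<odot> ?p) (G \<odot> F \<odot> ?q) \<bullet> e2 (fst s') (F \<odot> ?p) (F \<odot> ?q) =
      e2 (fst s') (F \<odot> ?q) (F \<odot> ?p) \<bullet> (G \<rhd> e2 (brd B') (F \<odot> ?p) (F \<odot> ?q))"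
    by (rule brd_compat_at[OF s' B(2,3) b']) (use t in simp_all)
  also have "(e2 (fst s') (F \<odot> ?q) (F \<odot> ?p) \<bullet> (G \<rhd> e2 (brd B') (F \<odot> ?p) (F \<odot> ?q))) \<bullet> (G \<rhd> fst s) =
      e2 (fst s') (F \<odot> ?q) (F \<odot> ?p) \<bullet> (G \<rhd> (e2 (brd B') (F \<odot> ?p) (F \<odot> ?q) \<bullet> fst s))"
    using t by simp
  also have "\<dots> = e2 (fst s') (F \<odot> ?q) (F \<odot> ?p) \<bullet> (G \<rhd> (e2 (fst s) ?q ?p \<bullet> (F \<rhd> brd B)))" unfolding 1 ..
  also have "\<dots> = e2 (fst ?s) ?q ?p \<bullet> ((G \<odot> F) \<rhd> brd B)"
    using t opl_comp_at[OF s s', of ?q ?p] by simp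
  finally show ?thesis by (simp add: brd_compat_def Let_def)
qed

lemma braided_mor_iff:
  assumes "is_br (mdom f)" "is_br (mcod f)" "mfun f \<in> Arr D" "Dom1 D (mfun f) = ob (mon (mdom f))" "Cod1 D (mfun f) = ob (mon (mcod f))"
  shows "braided_mor D P f \<longleftrightarrow> opl (mon (mdom f)) (mon (mcod f)) (mfun f) (mstr f) \<and> brd_compat (mdom f) (mcod f) (mfun f) (mstr f)"
  using assms by (auto simp: braided_mor_def opl_def brd_compat_def Let_def)

text \<open>Morphisms and transformations do not see whether a braiding is symmetric, so one
  argument for an arbitrary set of braided objects covers both 2-categories.\<close>

lemma braided_data:
  assumes obs: "\<And>B. B \<in> obs \<Longrightarrow> is_br B"
  shows "structured_data D obs (\<lambda>B. ob (mon B)) (braided_mor D P) (monoidal_trf D P) (monoidal_id_str D) (monoidal_comp_str D P)"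
proof -
  have a: "is_br (mdom f) \<and> is_br (mcod f) \<and> opl (mon (mdom f)) (mon (mcod f)) (mfun f) (mstr f) \<and> brd_compat (mdom f) (mcod f) (mfun f) (mstr f)"
    if "str_arr D obs (\<lambda>B. ob (mon B)) (braided_mor D P) f" for f
    using that obs braided_mor_iff[of f] by (auto simp: str_arr_def)
  have trf: "monoidal_trf D P f f' \<sigma> \<longleftrightarrow> mon_trf (mon (mdom f)) (mon (mcod f)) (mstr f) (mstr f') \<sigma>" for f f' \<sigma>
    by (simp add: monoidal_trf_def mon_trf_def Let_def)
  have cs: "monoidal_comp_str D P g f = opl_comp (mon (mdom f)) (mfun g) (mfun f) (mstr g) (mstr f)" for g f
    by (simp add: monoidal_comp_str_def opl_comp_def Let_def)
  show ?thesis
  proof (unfold_locales, goal_cases)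
    case (1 B) then show ?case using obs by simp
  next
    case (2 B)
    then have B: "is_br B" by (rule obs)
    then have "opl (mon B) (mon B) (Id1 D (ob (mon B))) (monoidal_id_str D B)"
      using opl_id[of "mon B"] by (simp add: monoidal_id_str_def)
    moreover have "brd_compat B B (Id1 D (ob (mon B))) (monoidal_id_str D B)"
      using B by (simp add: brd_compat_def Let_def monoidal_id_str_def)
    ultimately show ?case using B by (subst braided_mor_iff) simp_all
  next
    case (3 f g)
    note f = a[OF 3(1)] and g = a[OF 3(2)]
    have o: "opl (mon (mdom f)) (mon (mcod g)) (mfun g \<odot> mfun f) (monoidal_comp_str D P g f)"
      unfolding cs by (rule opl_comp_opl) (use f g 3 in auto)
    have "brd_compat (mdom f) (mcod g) (mfun g \<odot> mfun f) (monoidal_comp_str D P g f)"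
      unfolding cs by (rule brd_compat_comp[where B' = "mcod f"]) (use f g 3 in auto)
    with o show ?case using f g oplD(3-5)[OF o] by (subst braided_mor_iff) auto
  next
    case (4 f) then show ?case using a[OF 4] opl_comp_unit(1)[of "mon (mdom f)" "mon (mcod f)" "mfun f" "mstr f"] by (simp add: cs monoidal_id_str_def)
  next
    case (5 f) then show ?case using a[OF 5] opl_comp_unit(2)[of "mon (mdom f)" "mon (mcod f)" "mfun f" "mstr f"] by (simp add: cs monoidal_id_str_def)
  next
    case (6 f g h)
    have "opl_comp (mon (mdom f)) (mfun h \<odot> mfun g) (mfun f) (opl_comp (mon (mcod f)) (mfun h) (mfun g) (mstr h) (mstr g)) (mstr f) =
        opl_comp (mon (mdom f)) (mfun h) (mfun g \<odot> mfun f) (mstr h) (opl_comp (mon (mdom f)) (mfun g) (mfun f) (mstr g) (mstr f))"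
      by (rule opl_comp_assoc[where M'' = "mon (mcod g)" and M''' = "mon (mcod h)"]) (use a[OF 6(1)] a[OF 6(2)] a[OF 6(3)] 6(4,5) in auto)
    then show ?case by (simp add: cs 6(4,5))
  next
    case (7 f)
    have o: "opl (mon (mdom f)) (mon (mcod f)) (mfun f) (mstr f)" using a[OF 7] by blast
    show ?case unfolding trf mon_trf_def using oplD[OF o] by simp
  next
    case (8 f g h \<sigma> \<tau>)
    have "opl (mon (mdom f)) (mon (mcod f)) (mfun f) (mstr f)" "opl (mon (mdom f)) (mon (mcod f)) (mfun g) (mstr g)"
      "opl (mon (mdom f)) (mon (mcod f)) (mfun h) (mstr h)" using a[OF 8(1)] a[OF 8(2)] a[OF 8(3)] 8(4-7) by auto
    from mon_trf_vcomp[OF this] show ?case using 8 unfolding trf Hom2_def by simp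
  next
    case (9 f f' g \<sigma>)
    have "opl (mon (mdom f)) (mon (mcod f)) (mfun f) (mstr f)" "opl (mon (mdom f)) (mon (mcod f)) (mfun f') (mstr f')"
      "opl (mon (mcod f)) (mon (mcod g)) (mfun g) (mstr g)" using a[OF 9(1)] a[OF 9(2)] a[OF 9(3)] 9(4-6) by auto
    from mon_trf_lwhisk[OF this] show ?case using 9 unfolding trf Hom2_def cs by simp
  next
    case (10 f g g' \<sigma>)
    have "opl (mon (mdom f)) (mon (mcod f)) (mfun f) (mstr f)" "opl (mon (mcod f)) (mon (mcod g)) (mfun g) (mstr g)"
      "opl (mon (mcod f)) (mon (mcod g)) (mfun g') (mstr g')" using a[OF 10(1)] a[OF 10(2)] a[OF 10(3)] 10(4-6) by auto
    from mon_trf_rwhisk[OF this] show ?case using 10 unfolding trf Hom2_def cs by simp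
  qed
qed

end

section \<open>EM objects of braided monoidal objects\<close>

context em_object
begin

text \<open>The inverse of an invertible morphism of algebras is a morphism of algebras, hence
  lifts: \<open>U\<close> reflects invertibility.\<close>

lemma em_invertible:
  assumes \<rho>: "\<rho> \<in> Cell D" "Cod1 D (Dom2 D \<rho>) = X" and \<kappa>: "inverse2 D (U \<rhd> \<rho>) \<kappa>"
  obtains \<rho>' where "inverse2 D \<rho> \<rho>'" "U \<rhd> \<rho>' = \<kappa>"
proof -
  let ?g = "Dom2 D \<rho>" and ?h = "Cod2 D \<rho>"
  have k: "\<kappa> \<in> Cell D" "Dom2 D \<kappa> = U \<odot> ?h" "Cod2 D \<kappa> = U \<odot> ?g" "\<kappa> \<bullet> (U \<rhd> \<rho>) = Id2 D (U \<odot> ?g)" "(U \<rhd> \<rho>) \<bullet> \<kappa> = Id2 D (U \<odot> ?h)"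
    using \<kappa> \<rho> by (auto simp: inverse2_def Hom2_def)
  \<comment> \<open>Multiplying \<open>chi_natural\<close> for \<open>\<rho>\<close> by
    \<open>\<kappa>\<close> on both sides shows that \<open>\<kappa>\<close> commutes with the
    actions.\<close>
  have "\<kappa> \<bullet> (\<chi> \<lhd> ?h) = \<kappa> \<bullet> ((\<chi> \<lhd> ?h) \<bullet> (T \<rhd> ((U \<rhd> \<rho>) \<bullet> \<kappa>)))" unfolding k(5) using \<rho> k(1-3) by simp
  also have "\<dots> = \<kappa> \<bullet> ((\<chi> \<lhd> ?h) \<bullet> (T \<rhd> (U \<rhd> \<rho>))) \<bullet> (T \<rhd> \<kappa>)" using \<rho> k(1-3) by simp
  also have "\<dots> = \<kappa> \<bullet> ((U \<rhd> \<rho>) \<bullet> (\<chi> \<lhd> ?g)) \<bullet> (T \<rhd> \<kappa>)" unfolding chi_natural[OF \<rho>] ..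
  also have "\<dots> = (\<kappa> \<bullet> (U \<rhd> \<rho>)) \<bullet> (\<chi> \<lhd> ?g) \<bullet> (T \<rhd> \<kappa>)" using \<rho> k(1-3) by simp
  also have "\<dots> = (\<chi> \<lhd> ?g) \<bullet> (T \<rhd> \<kappa>)" unfolding k(4) using \<rho> k(1-3) by simp
  finally have a: "\<kappa> \<bullet> (\<chi> \<lhd> ?h) = (\<chi> \<lhd> ?g) \<bullet> (T \<rhd> \<kappa>)" .
  obtain \<rho>' where r: "\<rho>' \<in> Cell D" "Dom2 D \<rho>' = ?h" "Cod2 D \<rho>' = ?g" "U \<rhd> \<rho>' = \<kappa>"
    by (rule em_lift2[of ?h ?g \<kappa>]) (use \<rho> k(1-3) a in simp_all)
  have "U \<rhd> (\<rho>' \<bullet> \<rho>) = U \<rhd> Id2 D ?g" using \<rho> r k by simp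
  then have 1: "\<rho>' \<bullet> \<rho> = Id2 D ?g" by (rule em_faithful[rotated -1]) (use \<rho> r(1-3) in simp_all)
  have "U \<rhd> (\<rho> \<bullet> \<rho>') = U \<rhd> Id2 D ?h" using \<rho> r k by simp
  then have 2: "\<rho> \<bullet> \<rho>' = Id2 D ?h" by (rule em_faithful[rotated -1]) (use \<rho> r(1-3) in simp_all)
  show ?thesis by (rule that[of \<rho>']) (use 1 2 r \<rho> in \<open>simp_all add: inverse2_def Hom2_def\<close>)
qed

lemma em_inv2:
  assumes "\<rho> \<in> Cell D" "Cod1 D (Dom2 D \<rho>) = X" "inverse2 D (U \<rhd> \<rho>) \<kappa>"
  shows "invertible2 D \<rho>" "U \<rhd> inv2 D \<rho> = \<kappa>"
  using em_invertible[OF assms] inv2_eqI unfolding invertible2_def by blast+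

end

text \<open>A monad on a braided object, seen in \<open>D\<close>: \<open>s\<close> is the oplax
  structure of the endomorphism, and the last two assumptions make unit and multiplication monoidal
  transformations, the pair of identities being the structure of the identity 1-cell.\<close>

locale em_monoidal = finite_products D P + em_object D M X U \<chi>
  for D :: "('o, 'a, 'c) two_cat" (structure) and P and M and X and U and \<chi> +
  fixes B :: "('o, 'a, 'c) braided" and s :: "'c \<times> 'c"
  assumes B: "is_br B" and obB: "ob (mon B) = C" and s: "opl (mon B) (mon B) T s" and bs: "brd_compat B B T s"
    and eta_trf: "mon_trf (mon B) (mon B) (Id2 D (ten (mon B)), Id2 D (unt (mon B))) s \<eta>"
    and mu_trf: "mon_trf (mon B) (mon B) (opl_comp (mon B) T T s s) s \<mu>"
begin

abbreviation "N \<equiv> mon B"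
abbreviation "\<tau> \<equiv> fst s"
abbreviation "\<psi> \<equiv> snd s"

lemmas N_simps [simp] = obB brd_cells[OF B] oplD(6-11)[OF s]

lemma mon_typ_N [simp]: "mon_typ N" by simp

lemma tau_unit:
  assumes "x \<in> Arr D" "y \<in> Arr D" "Dom1 D x = Dom1 D y" "Cod1 D x = C" "Cod1 D y = C"
  shows "e2 \<tau> x y \<bullet> (\<eta> \<lhd> ten1 N x y) = ten2 N (\<eta> \<lhd> x) (\<eta> \<lhd> y)"
  using mon_trf_at[OF opl_id[of N] s _ _ _ eta_trf, of x y] assms by simp

lemma tau_mult:
  assumes "x \<in> Arr D" "y \<in> Arr D" "Dom1 D x = Dom1 D y" "Cod1 D x = C" "Cod1 D y = C"
  shows "e2 \<tau> x y \<bullet> (\<mu> \<lhd> ten1 N x y) = ten2 N (\<mu> \<lhd> x) (\<mu> \<lhd> y) \<bullet> e2 \<tau> (T \<odot> x) (T \<odot> y) \<bullet> (T \<rhd> e2 \<tau> x y)"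
  using mon_trf_at[OF opl_comp_opl[OF s s] s _ _ _ mu_trf, of x y] opl_comp_at[OF s s, of x y] assms by simp

lemma psi_unit: "\<psi> \<bullet> (\<eta> \<lhd> unt N) = Id2 D (unt N)"
  using mon_trf_unit[OF eta_trf] by simp

lemma psi_mult: "\<psi> \<bullet> (\<mu> \<lhd> unt N) = \<psi> \<bullet> (T \<rhd> \<psi>)"
  using mon_trf_unit[OF mu_trf] by (simp add: opl_comp_def)

text \<open>The unit component of \<open>s\<close> is the action; its two laws are the unit
  components of the conditions on \<open>\<eta>\<close> and \<open>\<mu>\<close>.\<close>

lemma alg_unt: "is_alg D M (One P) (unt N) \<psi>"
  using psi_unit psi_mult by (simp add: is_alg_def Hom1_def Hom2_def)

text \<open>The action is \<open>T(f \<otimes> g) -> T f \<otimes> T g -> f \<otimes> g\<close>. Its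
  unit law is \<open>tau_unit\<close>; its multiplication law combines \<open>tau_mult\<close> with
  naturality of \<open>\<tau>\<close> along the actions.\<close>

lemma alg_ten:
  assumes f: "is_alg D M Z f a" and g: "is_alg D M Z g b"
  shows "is_alg D M Z (ten1 N f g) (ten2 N a b \<bullet> e2 \<tau> f g)"
proof -
  have t: "f \<in> Arr D" "Dom1 D f = Z" "Cod1 D f = C" "a \<in> Cell D" "Dom2 D a = T \<odot> f" "Cod2 D a = f"
    "g \<in> Arr D" "Dom1 D g = Z" "Cod1 D g = C" "b \<in> Cell D" "Dom2 D b = T \<odot> g" "Cod2 D b = g"
    using f g by (auto simp: is_alg_def Hom1_def Hom2_def)
  have e: "a \<bullet> (\<eta> \<lhd> f) = Id2 D f" "a \<bullet> (\<mu> \<lhd> f) = a \<bullet> (T \<rhd> a)" "b \<bullet> (\<eta> \<lhd> g) = Id2 D g" "b \<bullet> (\<mu> \<lhd> g) = b \<bullet> (T \<rhd> b)"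
    using f g by (simp_all add: is_alg_def)
  have "(ten2 N a b \<bullet> e2 \<tau> f g) \<bullet> (\<eta> \<lhd> ten1 N f g) = ten2 N a b \<bullet> ten2 N (\<eta> \<lhd> f) (\<eta> \<lhd> g)"
    using t by (simp add: tau_unit)
  also have "\<dots> = ten2 N (a \<bullet> (\<eta> \<lhd> f)) (b \<bullet> (\<eta> \<lhd> g))" by (rule ten2_VComp[symmetric]) (use t in simp_all)
  finally have 1: "(ten2 N a b \<bullet> e2 \<tau> f g) \<bullet> (\<eta> \<lhd> ten1 N f g) = Id2 D (ten1 N f g)" unfolding e using t by simp
  have "(ten2 N a b \<bullet> e2 \<tau> f g) \<bullet> (\<mu> \<lhd> ten1 N f g) =
      (ten2 N a b \<bullet> ten2 N (\<mu> \<lhd> f) (\<mu> \<lhd> g)) \<bullet> e2 \<tau> (T \<odot> f) (T \<odot> g) \<bullet> (T \<rhd> e2 \<tau> f g)"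
    using t by (simp add: tau_mult)
  also have "ten2 N a b \<bullet> ten2 N (\<mu> \<lhd> f) (\<mu> \<lhd> g) = ten2 N (a \<bullet> (\<mu> \<lhd> f)) (b \<bullet> (\<mu> \<lhd> g))"
    by (rule ten2_VComp[symmetric]) (use t in simp_all)
  also have "\<dots> = ten2 N a b \<bullet> ten2 N (T \<rhd> a) (T \<rhd> b)" unfolding e by (rule ten2_VComp) (use t in simp_all)
  also have "(ten2 N a b \<bullet> ten2 N (T \<rhd> a) (T \<rhd> b)) \<bullet> e2 \<tau> (T \<odot> f) (T \<odot> g) \<bullet> (T \<rhd> e2 \<tau> f g) =
      ten2 N a b \<bullet> (ten2 N (T \<rhd> a) (T \<rhd> b) \<bullet> e2 \<tau> (T \<odot> f) (T \<odot> g)) \<bullet> (T \<rhd> e2 \<tau> f g)" using t by simp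
  also have "ten2 N (T \<rhd> a) (T \<rhd> b) \<bullet> e2 \<tau> (T \<odot> f) (T \<odot> g) = e2 \<tau> f g \<bullet> (T \<rhd> ten2 N a b)"
    by (rule opl_natural[OF s]) (use t in simp_all)
  finally have "(ten2 N a b \<bullet> e2 \<tau> f g) \<bullet> (\<mu> \<lhd> ten1 N f g) = (ten2 N a b \<bullet> e2 \<tau> f g) \<bullet> (T \<rhd> (ten2 N a b \<bullet> e2 \<tau> f g))"
    using t by simp
  with 1 show ?thesis using t by (simp add: is_alg_def Hom1_def Hom2_def)
qed

context
  fixes x a Z
  assumes tx [simp]: "x \<in> Arr D" "Dom1 D x = Z" "Cod1 D x = C" "a \<in> Cell D" "Dom2 D a = T \<odot> x" "Cod2 D a = x"
begin

lemma Z_Obj: "Z \<in> Obj D" using Dom1_Obj[of x] tx(1,2) by simp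

text \<open>Naturality of the unitors along \<open>a\<close>, then the unit axioms of
  \<open>T\<close>. It follows that unitors evaluated at an algebra are morphisms of
  algebras.\<close>

lemma unit_alg:
  "(run N \<lhd> x) \<bullet> ten2 N a (\<psi> \<lhd> bang D P Z) \<bullet> e2 \<tau> x (un N Z) = a \<bullet> (T \<rhd> (run N \<lhd> x))"
  "(lun N \<lhd> x) \<bullet> ten2 N (\<psi> \<lhd> bang D P Z) a \<bullet> e2 \<tau> (un N Z) x = a \<bullet> (T \<rhd> (lun N \<lhd> x))"
proof -
  note Z_Obj [simp]
  let ?p = "\<psi> \<lhd> bang D P Z"
  have 1: "ten2 N a ?p = ten2 N a (Id2 D (un N Z)) \<bullet> ten2 N (Id2 D (T \<odot> x)) ?p"
    by (rule ten2_split(1)[symmetric]) simp+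
  have 2: "ten2 N ?p a = ten2 N (Id2 D (un N Z)) a \<bullet> ten2 N ?p (Id2 D (T \<odot> x))"
    by (rule ten2_split(2)[symmetric]) simp+
  have "(run N \<lhd> x) \<bullet> ten2 N a ?p \<bullet> e2 \<tau> x (un N Z) =
      ((run N \<lhd> x) \<bullet> ten2 N a (Id2 D (un N Z))) \<bullet> ten2 N (Id2 D (T \<odot> x)) ?p \<bullet> e2 \<tau> x (un N Z)"
    unfolding 1 by simp
  also have "(run N \<lhd> x) \<bullet> ten2 N a (Id2 D (un N Z)) = a \<bullet> (run N \<lhd> (T \<odot> x))"
    by (rule run_natural) simp_all
  also have "(a \<bullet> (run N \<lhd> (T \<odot> x))) \<bullet> ten2 N (Id2 D (T \<odot> x)) ?p \<bullet> e2 \<tau> x (un N Z) =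
      a \<bullet> ((run N \<lhd> (T \<odot> x)) \<bullet> ten2 N (Id2 D (T \<odot> x)) ?p \<bullet> e2 \<tau> x (un N Z))" by simp
  also have "(run N \<lhd> (T \<odot> x)) \<bullet> ten2 N (Id2 D (T \<odot> x)) ?p \<bullet> e2 \<tau> x (un N Z) = T \<rhd> (run N \<lhd> x)"
    by (rule opl_units[OF s]) simp_all
  finally show "(run N \<lhd> x) \<bullet> ten2 N a ?p \<bullet> e2 \<tau> x (un N Z) = a \<bullet> (T \<rhd> (run N \<lhd> x))" .
  have "(lun N \<lhd> x) \<bullet> ten2 N ?p a \<bullet> e2 \<tau> (un N Z) x =
      ((lun N \<lhd> x) \<bullet> ten2 N (Id2 D (un N Z)) a) \<bullet> ten2 N ?p (Id2 D (T \<odot> x)) \<bullet> e2 \<tau> (un N Z) x"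
    unfolding 2 by simp
  also have "(lun N \<lhd> x) \<bullet> ten2 N (Id2 D (un N Z)) a = a \<bullet> (lun N \<lhd> (T \<odot> x))"
    by (rule run_natural) simp_all
  also have "(a \<bullet> (lun N \<lhd> (T \<odot> x))) \<bullet> ten2 N ?p (Id2 D (T \<odot> x)) \<bullet> e2 \<tau> (un N Z) x =
      a \<bullet> ((lun N \<lhd> (T \<odot> x)) \<bullet> ten2 N ?p (Id2 D (T \<odot> x)) \<bullet> e2 \<tau> (un N Z) x)" by simp
  also have "(lun N \<lhd> (T \<odot> x)) \<bullet> ten2 N ?p (Id2 D (T \<odot> x)) \<bullet> e2 \<tau> (un N Z) x = T \<rhd> (lun N \<lhd> x)"
    by (rule opl_units[OF s]) simp_all
  finally show "(lun N \<lhd> x) \<bullet> ten2 N ?p a \<bullet> e2 \<tau> (un N Z) x = a \<bullet> (T \<rhd> (lun N \<lhd> x))" .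
qed

context
  fixes y b
  assumes ty [simp]: "y \<in> Arr D" "Dom1 D y = Z" "Cod1 D y = C" "b \<in> Cell D" "Dom2 D b = T \<odot> y" "Cod2 D b = y"
begin

text \<open>The same two ingredients for the braiding: naturality, and compatibility of the
  structure of \<open>T\<close> with it.\<close>

lemma brd_alg:
  "e2 (brd B) x y \<bullet> ten2 N a b \<bullet> e2 \<tau> x y = (ten2 N b a \<bullet> e2 \<tau> y x) \<bullet> (T \<rhd> e2 (brd B) x y)"
proof -
  have "e2 (brd B) x y \<bullet> ten2 N a b \<bullet> e2 \<tau> x y = (e2 (brd B) x y \<bullet> ten2 N a b) \<bullet> e2 \<tau> x y" by simp
  also have "e2 (brd B) x y \<bullet> ten2 N a b = ten2 N b a \<bullet> e2 (brd B) (T \<odot> x) (T \<odot> y)"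
    by (rule brd_natural[OF B refl]) simp_all
  also have "(ten2 N b a \<bullet> e2 (brd B) (T \<odot> x) (T \<odot> y)) \<bullet> e2 \<tau> x y = ten2 N b a \<bullet> (e2 (brd B) (T \<odot> x) (T \<odot> y) \<bullet> e2 \<tau> x y)"
    by simp
  also have "e2 (brd B) (T \<odot> x) (T \<odot> y) \<bullet> e2 \<tau> x y = e2 \<tau> y x \<bullet> (T \<rhd> e2 (brd B) x y)"
    by (rule brd_compat_at[OF s B B bs]) simp_all
  finally show ?thesis by simp
qed

context
  fixes z c
  assumes tz [simp]: "z \<in> Arr D" "Dom1 D z = Z" "Cod1 D z = C" "c \<in> Cell D" "Dom2 D c = T \<odot> z" "Cod2 D c = z"
begin

text \<open>The actions on nested tensors are first split so that naturality of the associator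
  applies; the associativity axiom of \<open>T\<close> does the rest.\<close>

lemma asc_alg:
  "e3 (asc N) x y z \<bullet> ten2 N a (ten2 N b c \<bullet> e2 \<tau> y z) \<bullet> e2 \<tau> x (ten1 N y z) =
    (ten2 N (ten2 N a b \<bullet> e2 \<tau> x y) c \<bullet> e2 \<tau> (ten1 N x y) z) \<bullet> (T \<rhd> e3 (asc N) x y z)"
proof -
  have 1: "ten2 N a (ten2 N b c \<bullet> e2 \<tau> y z) = ten2 N a (ten2 N b c) \<bullet> ten2 N (Id2 D (T \<odot> x)) (e2 \<tau> y z)"
    using ten2_VComp[of N "Id2 D (T \<odot> x)" "e2 \<tau> y z" a "ten2 N b c"] by simp
  have 2: "ten2 N (ten2 N a b \<bullet> e2 \<tau> x y) c = ten2 N (ten2 N a b) c \<bullet> ten2 N (e2 \<tau> x y) (Id2 D (T \<odot> z))"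
    using ten2_VComp[of N "e2 \<tau> x y" "Id2 D (T \<odot> z)" "ten2 N a b" c] by simp
  have "e3 (asc N) x y z \<bullet> ten2 N a (ten2 N b c \<bullet> e2 \<tau> y z) \<bullet> e2 \<tau> x (ten1 N y z) =
      (e3 (asc N) x y z \<bullet> ten2 N a (ten2 N b c)) \<bullet> ten2 N (Id2 D (T \<odot> x)) (e2 \<tau> y z) \<bullet> e2 \<tau> x (ten1 N y z)"
    unfolding 1 by simp
  also have "e3 (asc N) x y z \<bullet> ten2 N a (ten2 N b c) = ten2 N (ten2 N a b) c \<bullet> e3 (asc N) (T \<odot> x) (T \<odot> y) (T \<odot> z)"
    by (rule asc_natural) simp_all
  also have "(ten2 N (ten2 N a b) c \<bullet> e3 (asc N) (T \<odot> x) (T \<odot> y) (T \<odot> z)) \<bullet> ten2 N (Id2 D (T \<odot> x)) (e2 \<tau> y z) \<bullet> e2 \<tau> x (ten1 N y z) =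
      ten2 N (ten2 N a b) c \<bullet> (e3 (asc N) (T \<odot> x) (T \<odot> y) (T \<odot> z) \<bullet> ten2 N (Id2 D (T \<odot> x)) (e2 \<tau> y z) \<bullet> e2 \<tau> x (ten1 N y z))"
    by simp
  also have "e3 (asc N) (T \<odot> x) (T \<odot> y) (T \<odot> z) \<bullet> ten2 N (Id2 D (T \<odot> x)) (e2 \<tau> y z) \<bullet> e2 \<tau> x (ten1 N y z) =
      ten2 N (e2 \<tau> x y) (Id2 D (T \<odot> z)) \<bullet> e2 \<tau> (ten1 N x y) z \<bullet> (T \<rhd> e3 (asc N) x y z)"
    by (rule opl_assoc[OF s]) simp_all
  also have "ten2 N (ten2 N a b) c \<bullet> (ten2 N (e2 \<tau> x y) (Id2 D (T \<odot> z)) \<bullet> e2 \<tau> (ten1 N x y) z \<bullet> (T \<rhd> e3 (asc N) x y z)) =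
      (ten2 N (ten2 N a b \<bullet> e2 \<tau> x y) c \<bullet> e2 \<tau> (ten1 N x y) z) \<bullet> (T \<rhd> e3 (asc N) x y z)"
    unfolding 2 by simp
  finally show ?thesis .
qed

end

end

end

end

text \<open>Ties only tensor and unit of \<open>N'\<close> to those of \<open>N\<close>, as
  factorisations of the algebras \<open>alg_ten\<close> and \<open>alg_unt\<close>. The remaining
  components are free, so the locale can be entered before the structure cells have been
  lifted.\<close>

locale em_monoidal_lift = em_monoidal +
  fixes N' :: "('a, 'b, 'c) monoidal"
  assumes N'_typ: "mon_typ N'" and obN' [simp]: "ob N' = X"
    and U_ten0: "U \<odot> ten N' = ten1 N (U \<odot> Pr1 P X X) (U \<odot> Pr2 P X X)"
    and chi_ten0: "\<chi> \<lhd> ten N' = ten2 N (\<chi> \<lhd> Pr1 P X X) (\<chi> \<lhd> Pr2 P X X) \<bullet> e2 \<tau> (U \<odot> Pr1 P X X) (U \<odot> Pr2 P X X)"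
    and U_unt [simp]: "U \<odot> unt N' = unt N" and chi_unt: "\<chi> \<lhd> unt N' = \<psi>"
begin

lemmas N'_simps [simp] = N'_typ mon_typD[OF N'_typ, unfolded obN']

context
  fixes x y
  assumes t [simp]: "x \<in> Arr D" "y \<in> Arr D" "Dom1 D x = Dom1 D y" "Cod1 D x = X" "Cod1 D y = X"
begin

lemma U_ten [simp]: "U \<odot> ten1 N' x y = ten1 N (U \<odot> x) (U \<odot> y)"
proof -
  have "U \<odot> ten1 N' x y = (U \<odot> ten N') \<odot> pr x y" by simp
  then show ?thesis unfolding U_ten0 by simp
qed

lemma chi_ten: "\<chi> \<lhd> ten1 N' x y = ten2 N (\<chi> \<lhd> x) (\<chi> \<lhd> y) \<bullet> e2 \<tau> (U \<odot> x) (U \<odot> y)"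
proof -
  have "\<chi> \<lhd> ten1 N' x y = (\<chi> \<lhd> ten N') \<lhd> pr x y" by (simp del: rwhisk_pr)
  then show ?thesis unfolding chi_ten0 by simp
qed

end

lemma U_ten2 [simp]:
  assumes "\<sigma> \<in> Cell D" "\<rho> \<in> Cell D" "Dom1 D (Dom2 D \<sigma>) = Dom1 D (Dom2 D \<rho>)" "Cod1 D (Dom2 D \<sigma>) = X" "Cod1 D (Dom2 D \<rho>) = X"
  shows "U \<rhd> ten2 N' \<sigma> \<rho> = ten2 N (U \<rhd> \<sigma>) (U \<rhd> \<rho>)"
proof -
  have "U \<rhd> ten2 N' \<sigma> \<rho> = (U \<odot> ten N') \<rhd> pr2 \<sigma> \<rho>"
    using assms lwhisk_lwhisk[of "pr2 \<sigma> \<rho>" U "ten N'"] by simp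
  also have "\<dots> = ten2 N (U \<rhd> (Pr1 P X X \<rhd> pr2 \<sigma> \<rho>)) (U \<rhd> (Pr2 P X X \<rhd> pr2 \<sigma> \<rho>))"
    unfolding U_ten0 using assms by (simp del: pr2_typ(4,5))
  finally show ?thesis using assms by (simp del: lwhisk_lwhisk)
qed

lemma U_un [simp]: "Z \<in> Obj D \<Longrightarrow> U \<odot> un N' Z = un N Z"
  using Comp1_ac[of "bang D P Z" "unt N'" U] by simp

lemma chi_un: "Z \<in> Obj D \<Longrightarrow> \<chi> \<lhd> un N' Z = \<psi> \<lhd> bang D P Z"
  using rwhisk_rwhisk[of \<chi> "unt N'" "bang D P Z"] chi_unt by simp

text \<open>By \<open>asc_alg\<close> the associator at the elements \<open>U \<odot> q1 X\<close>,
  \<open>U \<odot> q2 X\<close>, \<open>U \<odot> q3 X\<close> is a morphism of algebras. The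
  inverse is recorded too, since the second hexagon is stated with \<open>inv2\<close>.\<close>

lemma asc_lift:
  obtains a where "a \<in> Cell D" "Dom2 D a = ten1 N' (q1 X) (ten1 N' (q2 X) (q3 X))"
    "Cod2 D a = ten1 N' (ten1 N' (q1 X) (q2 X)) (q3 X)" "invertible2 D a"
    "U \<rhd> a = e3 (asc N) (U \<odot> q1 X) (U \<odot> q2 X) (U \<odot> q3 X)"
    "U \<rhd> inv2 D a = e3 (inv2 D (asc N)) (U \<odot> q1 X) (U \<odot> q2 X) (U \<odot> q3 X)"
proof -
  let ?u = "e3 (asc N) (U \<odot> q1 X) (U \<odot> q2 X) (U \<odot> q3 X)"
  have "?u \<bullet> ten2 N (\<chi> \<lhd> q1 X) (ten2 N (\<chi> \<lhd> q2 X) (\<chi> \<lhd> q3 X) \<bullet> e2 \<tau> (U \<odot> q2 X) (U \<odot> q3 X)) \<bullet> e2 \<tau> (U \<odot> q1 X) (ten1 N (U \<odot> q2 X) (U \<odot> q3 X)) =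
    (ten2 N (ten2 N (\<chi> \<lhd> q1 X) (\<chi> \<lhd> q2 X) \<bullet> e2 \<tau> (U \<odot> q1 X) (U \<odot> q2 X)) (\<chi> \<lhd> q3 X) \<bullet> e2 \<tau> (ten1 N (U \<odot> q1 X) (U \<odot> q2 X)) (U \<odot> q3 X)) \<bullet> (T \<rhd> ?u)"
    by (rule asc_alg) simp_all
  then have eq: "?u \<bullet> (\<chi> \<lhd> ten1 N' (q1 X) (ten1 N' (q2 X) (q3 X))) = (\<chi> \<lhd> ten1 N' (ten1 N' (q1 X) (q2 X)) (q3 X)) \<bullet> (T \<rhd> ?u)"
    by (simp add: chi_ten)
  obtain a where a: "a \<in> Cell D" "Dom2 D a = ten1 N' (q1 X) (ten1 N' (q2 X) (q3 X))"
    "Cod2 D a = ten1 N' (ten1 N' (q1 X) (q2 X)) (q3 X)" "U \<rhd> a = ?u"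
    by (rule em_lift2[OF _ _ _ _ _ _ _ _ eq]) simp_all
  have "invertible2 D (asc N)" using brd_cells(1)[OF B] unfolding is_mon_iff by blast
  from inverse2_rwhisk[OF inverse2_inv2[OF this], of "pr (U \<odot> q1 X) (pr (U \<odot> q2 X) (U \<odot> q3 X))"]
  have "inverse2 D ?u (e3 (inv2 D (asc N)) (U \<odot> q1 X) (U \<odot> q2 X) (U \<odot> q3 X))" by (simp add: e3_def')
  then show ?thesis using em_inv2[of a] a that by simp
qed

lemma lun_lift:
  obtains a where "a \<in> Cell D" "Dom2 D a = ten1 N' (un N' X) (Id1 D X)" "Cod2 D a = Id1 D X" "invertible2 D a" "U \<rhd> a = lun N \<lhd> U"
proof -
  let ?u = "lun N \<lhd> U"
  have "?u \<bullet> ten2 N (\<psi> \<lhd> bang D P X) \<chi> \<bullet> e2 \<tau> (un N X) U = \<chi> \<bullet> (T \<rhd> ?u)" by (rule unit_alg) simp_all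
  then have eq: "?u \<bullet> (\<chi> \<lhd> ten1 N' (un N' X) (Id1 D X)) = (\<chi> \<lhd> Id1 D X) \<bullet> (T \<rhd> ?u)" by (simp add: chi_ten chi_un)
  obtain a where a: "a \<in> Cell D" "Dom2 D a = ten1 N' (un N' X) (Id1 D X)" "Cod2 D a = Id1 D X" "U \<rhd> a = ?u"
    by (rule em_lift2[OF _ _ _ _ _ _ _ _ eq]) simp_all
  have "invertible2 D (lun N)" using brd_cells(1)[OF B] unfolding is_mon_iff by blast
  from inverse2_rwhisk[OF inverse2_inv2[OF this], of U] show ?thesis using em_inv2[of a] a that by simp
qed

lemma run_lift:
  obtains a where "a \<in> Cell D" "Dom2 D a = ten1 N' (Id1 D X) (un N' X)" "Cod2 D a = Id1 D X" "invertible2 D a" "U \<rhd> a = run N \<lhd> U"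
proof -
  let ?u = "run N \<lhd> U"
  have "?u \<bullet> ten2 N \<chi> (\<psi> \<lhd> bang D P X) \<bullet> e2 \<tau> U (un N X) = \<chi> \<bullet> (T \<rhd> ?u)" by (rule unit_alg) simp_all
  then have eq: "?u \<bullet> (\<chi> \<lhd> ten1 N' (Id1 D X) (un N' X)) = (\<chi> \<lhd> Id1 D X) \<bullet> (T \<rhd> ?u)" by (simp add: chi_ten chi_un)
  obtain a where a: "a \<in> Cell D" "Dom2 D a = ten1 N' (Id1 D X) (un N' X)" "Cod2 D a = Id1 D X" "U \<rhd> a = ?u"
    by (rule em_lift2[OF _ _ _ _ _ _ _ _ eq]) simp_all
  have "invertible2 D (run N)" using brd_cells(1)[OF B] unfolding is_mon_iff by blast
  from inverse2_rwhisk[OF inverse2_inv2[OF this], of U] show ?thesis using em_inv2[of a] a that by simp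
qed

lemma brd_lift:
  obtains a where "a \<in> Cell D" "Dom2 D a = ten N'" "Cod2 D a = ten1 N' (Pr2 P X X) (Pr1 P X X)" "invertible2 D a"
    "U \<rhd> a = e2 (brd B) (U \<odot> Pr1 P X X) (U \<odot> Pr2 P X X)"
proof -
  let ?x = "U \<odot> Pr1 P X X" and ?y = "U \<odot> Pr2 P X X"
  let ?u = "e2 (brd B) ?x ?y"
  have "?u \<bullet> ten2 N (\<chi> \<lhd> Pr1 P X X) (\<chi> \<lhd> Pr2 P X X) \<bullet> e2 \<tau> ?x ?y =
      (ten2 N (\<chi> \<lhd> Pr2 P X X) (\<chi> \<lhd> Pr1 P X X) \<bullet> e2 \<tau> ?y ?x) \<bullet> (T \<rhd> ?u)" by (rule brd_alg) simp_all
  then have eq: "?u \<bullet> (\<chi> \<lhd> ten N') = (\<chi> \<lhd> ten1 N' (Pr2 P X X) (Pr1 P X X)) \<bullet> (T \<rhd> ?u)"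
    by (simp add: chi_ten chi_ten0)
  obtain a where a: "a \<in> Cell D" "Dom2 D a = ten N'" "Cod2 D a = ten1 N' (Pr2 P X X) (Pr1 P X X)" "U \<rhd> a = ?u"
    by (rule em_lift2[OF _ _ _ _ _ _ _ _ eq]) (simp_all add: U_ten0)
  have "invertible2 D (brd B)" using B unfolding is_br_iff Let_def by blast
  from inverse2_rwhisk[OF inverse2_inv2[OF this], of "pr ?x ?y"] show ?thesis using em_inv2[of a] a that by simp
qed

end

text \<open>Now the structure cells are fixed as lifts of the given ones; the coherence laws of
  \<open>N'\<close> and \<open>\<beta>\<close> are consequences.\<close>

locale em_braided = em_monoidal_lift +
  fixes \<beta>
  assumes asc'_typ: "asc N' \<in> Cell D" "Dom2 D (asc N') = ten1 N' (q1 X) (ten1 N' (q2 X) (q3 X))"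
      "Cod2 D (asc N') = ten1 N' (ten1 N' (q1 X) (q2 X)) (q3 X)" "invertible2 D (asc N')"
    and U_asc0: "U \<rhd> asc N' = e3 (asc N) (U \<odot> q1 X) (U \<odot> q2 X) (U \<odot> q3 X)"
      "U \<rhd> inv2 D (asc N') = e3 (inv2 D (asc N)) (U \<odot> q1 X) (U \<odot> q2 X) (U \<odot> q3 X)"
    and lun'_typ: "lun N' \<in> Cell D" "Dom2 D (lun N') = ten1 N' (un N' X) (Id1 D X)" "Cod2 D (lun N') = Id1 D X"
      "invertible2 D (lun N')" and U_lun0: "U \<rhd> lun N' = lun N \<lhd> U"
    and run'_typ: "run N' \<in> Cell D" "Dom2 D (run N') = ten1 N' (Id1 D X) (un N' X)" "Cod2 D (run N') = Id1 D X"
      "invertible2 D (run N')" and U_run0: "U \<rhd> run N' = run N \<lhd> U"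
    and brd'_typ: "\<beta> \<in> Cell D" "Dom2 D \<beta> = ten N'" "Cod2 D \<beta> = ten1 N' (Pr2 P X X) (Pr1 P X X)" "invertible2 D \<beta>"
    and U_brd0: "U \<rhd> \<beta> = e2 (brd B) (U \<odot> Pr1 P X X) (U \<odot> Pr2 P X X)"
begin

lemmas cells' [simp] = asc'_typ(1-3) lun'_typ(1-3) run'_typ(1-3) brd'_typ(1-3)

lemma inv_asc' [simp]:
  "inv2 D (asc N') \<in> Cell D" "Cod2 D (inv2 D (asc N')) = ten1 N' (q1 X) (ten1 N' (q2 X) (q3 X))"
  "Dom2 D (inv2 D (asc N')) = ten1 N' (ten1 N' (q1 X) (q2 X)) (q3 X)"
  using inverse2_inv2[OF asc'_typ(4)] by (simp_all add: inverse2_def Hom2_def)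

lemma U_asc [simp]:
  assumes "x \<in> Arr D" "y \<in> Arr D" "z \<in> Arr D" "Dom1 D x = Dom1 D z" "Dom1 D y = Dom1 D z" "Cod1 D x = X" "Cod1 D y = X" "Cod1 D z = X"
  shows "U \<rhd> e3 (asc N') x y z = e3 (asc N) (U \<odot> x) (U \<odot> y) (U \<odot> z)"
    "U \<rhd> e3 (inv2 D (asc N')) x y z = e3 (inv2 D (asc N)) (U \<odot> x) (U \<odot> y) (U \<odot> z)"
  using arg_cong[OF U_asc0(1), of "\<lambda>s. s \<lhd> pr x (pr y z)"] arg_cong[OF U_asc0(2), of "\<lambda>s. s \<lhd> pr x (pr y z)"] assms
  by (simp_all add: at3_def[of D P "asc N'"] at3_def[of D P "inv2 D (asc N')"] del: rwhisk_pr)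

declare U_asc0 [simp]

lemma U_unitors [simp]:
  assumes "x \<in> Arr D" "Cod1 D x = X"
  shows "U \<rhd> (lun N' \<lhd> x) = lun N \<lhd> (U \<odot> x)" "U \<rhd> (run N' \<lhd> x) = run N \<lhd> (U \<odot> x)"
  using arg_cong[OF U_lun0, of "\<lambda>s. s \<lhd> x"] arg_cong[OF U_run0, of "\<lambda>s. s \<lhd> x"] assms by simp_all

lemma U_brd [simp]:
  assumes "x \<in> Arr D" "y \<in> Arr D" "Dom1 D x = Dom1 D y" "Cod1 D x = X" "Cod1 D y = X"
  shows "U \<rhd> e2 \<beta> x y = e2 (brd B) (U \<odot> x) (U \<odot> y)"
  using arg_cong[OF U_brd0, of "\<lambda>s. s \<lhd> pr x y"] assms by simp

abbreviation "B' \<equiv> Braided N' \<beta>"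

text \<open>The rules for \<open>U\<close> turn the image of each law into the law of
  \<open>N\<close> at elements of the form \<open>U \<odot> x\<close>.\<close>

lemma is_mon_lift: "is_mon N'"
proof -
  let ?x = "r1 X" and ?y = "r2 X" and ?z = "r3 X" and ?w = "r4 X" and ?p = "Pr1 P X X" and ?q = "Pr2 P X X"
  have "ten2 N (e3 (asc N) (U \<odot> ?x) (U \<odot> ?y) (U \<odot> ?z)) (Id2 D (U \<odot> ?w)) \<bullet> e3 (asc N) (U \<odot> ?x) (ten1 N (U \<odot> ?y) (U \<odot> ?z)) (U \<odot> ?w) \<bullet>
      ten2 N (Id2 D (U \<odot> ?x)) (e3 (asc N) (U \<odot> ?y) (U \<odot> ?z) (U \<odot> ?w)) =
      e3 (asc N) (ten1 N (U \<odot> ?x) (U \<odot> ?y)) (U \<odot> ?z) (U \<odot> ?w) \<bullet> e3 (asc N) (U \<odot> ?x) (U \<odot> ?y) (ten1 N (U \<odot> ?z) (U \<odot> ?w))"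
    by (rule pentagon) simp_all
  then have "U \<rhd> (ten2 N' (e3 (asc N') ?x ?y ?z) (Id2 D ?w) \<bullet> e3 (asc N') ?x (ten1 N' ?y ?z) ?w \<bullet> ten2 N' (Id2 D ?x) (e3 (asc N') ?y ?z ?w)) =
      U \<rhd> (e3 (asc N') (ten1 N' ?x ?y) ?z ?w \<bullet> e3 (asc N') ?x ?y (ten1 N' ?z ?w))" by simp
  then have 1: "ten2 N' (e3 (asc N') ?x ?y ?z) (Id2 D ?w) \<bullet> e3 (asc N') ?x (ten1 N' ?y ?z) ?w \<bullet> ten2 N' (Id2 D ?x) (e3 (asc N') ?y ?z ?w) =
      e3 (asc N') (ten1 N' ?x ?y) ?z ?w \<bullet> e3 (asc N') ?x ?y (ten1 N' ?z ?w)"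
    by (rule em_faithful[rotated -1]) simp_all
  have "ten2 N (run N \<lhd> (U \<odot> ?p)) (Id2 D (U \<odot> ?q)) \<bullet> e3 (asc N) (U \<odot> ?p) (un N (Prod P X X)) (U \<odot> ?q) =
      ten2 N (Id2 D (U \<odot> ?p)) (lun N \<lhd> (U \<odot> ?q))"
    by (rule triangle) simp_all
  then have "U \<rhd> (ten2 N' (run N' \<lhd> ?p) (Id2 D ?q) \<bullet> e3 (asc N') ?p (un N' (Prod P X X)) ?q) =
      U \<rhd> ten2 N' (Id2 D ?p) (lun N' \<lhd> ?q)" by simp
  then have 2: "ten2 N' (run N' \<lhd> ?p) (Id2 D ?q) \<bullet> e3 (asc N') ?p (un N' (Prod P X X)) ?q =
      ten2 N' (Id2 D ?p) (lun N' \<lhd> ?q)"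
    by (rule em_faithful[rotated -1]) simp_all
  show ?thesis unfolding is_mon_iff obN' using 1 2 asc'_typ lun'_typ run'_typ N'_typ by blast
qed

lemma is_br_lift: "is_br B'"
proof -
  let ?x = "q1 X" and ?y = "q2 X" and ?z = "q3 X"
  let ?a = "asc N'" and ?i = "inv2 D (asc N')"
  have "e3 (asc N) (U \<odot> ?z) (U \<odot> ?x) (U \<odot> ?y) \<bullet> e2 (brd B) (ten1 N (U \<odot> ?x) (U \<odot> ?y)) (U \<odot> ?z) \<bullet> e3 (asc N) (U \<odot> ?x) (U \<odot> ?y) (U \<odot> ?z)
      = ten2 N (e2 (brd B) (U \<odot> ?x) (U \<odot> ?z)) (Id2 D (U \<odot> ?y)) \<bullet> e3 (asc N) (U \<odot> ?x) (U \<odot> ?z) (U \<odot> ?y) \<bullet> ten2 N (Id2 D (U \<odot> ?x)) (e2 (brd B) (U \<odot> ?y) (U \<odot> ?z))"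
    by (rule hexagons(1)[OF B]) simp_all
  then have "U \<rhd> (e3 ?a ?z ?x ?y \<bullet> e2 \<beta> (ten1 N' ?x ?y) ?z \<bullet> e3 ?a ?x ?y ?z)
      = U \<rhd> (ten2 N' (e2 \<beta> ?x ?z) (Id2 D ?y) \<bullet> e3 ?a ?x ?z ?y \<bullet> ten2 N' (Id2 D ?x) (e2 \<beta> ?y ?z))" by simp
  then have 1: "e3 ?a ?z ?x ?y \<bullet> e2 \<beta> (ten1 N' ?x ?y) ?z \<bullet> e3 ?a ?x ?y ?z
      = ten2 N' (e2 \<beta> ?x ?z) (Id2 D ?y) \<bullet> e3 ?a ?x ?z ?y \<bullet> ten2 N' (Id2 D ?x) (e2 \<beta> ?y ?z)"
    by (rule em_faithful[rotated -1]) simp_all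
  have "e3 (inv2 D (asc N)) (U \<odot> ?y) (U \<odot> ?z) (U \<odot> ?x) \<bullet> e2 (brd B) (U \<odot> ?x) (ten1 N (U \<odot> ?y) (U \<odot> ?z)) \<bullet> e3 (inv2 D (asc N)) (U \<odot> ?x) (U \<odot> ?y) (U \<odot> ?z)
      = ten2 N (Id2 D (U \<odot> ?y)) (e2 (brd B) (U \<odot> ?x) (U \<odot> ?z)) \<bullet> e3 (inv2 D (asc N)) (U \<odot> ?y) (U \<odot> ?x) (U \<odot> ?z) \<bullet> ten2 N (e2 (brd B) (U \<odot> ?x) (U \<odot> ?y)) (Id2 D (U \<odot> ?z))"
    by (rule hexagons(2)[OF B]) simp_all
  then have "U \<rhd> (e3 ?i ?y ?z ?x \<bullet> e2 \<beta> ?x (ten1 N' ?y ?z) \<bullet> e3 ?i ?x ?y ?z)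
      = U \<rhd> (ten2 N' (Id2 D ?y) (e2 \<beta> ?x ?z) \<bullet> e3 ?i ?y ?x ?z \<bullet> ten2 N' (e2 \<beta> ?x ?y) (Id2 D ?z))" by simp
  then have 2: "e3 ?i ?y ?z ?x \<bullet> e2 \<beta> ?x (ten1 N' ?y ?z) \<bullet> e3 ?i ?x ?y ?z
      = ten2 N' (Id2 D ?y) (e2 \<beta> ?x ?z) \<bullet> e3 ?i ?y ?x ?z \<bullet> ten2 N' (e2 \<beta> ?x ?y) (Id2 D ?z)"
    by (rule em_faithful[rotated -1]) simp_all
  show ?thesis unfolding is_br_iff Let_def braided.sel obN' using 1 2 is_mon_lift brd'_typ by blast
qed

text \<open>The double braiding of \<open>X\<close> lies over that of \<open>B\<close> at the two
  elements \<open>U \<odot> ?p\<close> and \<open>U \<odot> ?q\<close>.\<close>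

lemma is_symmetric_lift:
  assumes "is_symmetric D P B"
  shows "is_symmetric D P B'"
proof -
  let ?p = "Pr1 P X X" and ?q = "Pr2 P X X"
  have "e2 (brd B) (Pr2 P C C) (Pr1 P C C) \<bullet> brd B = Id2 D (ten N)"
    using assms by (simp add: is_symmetric_def Let_def)
  from arg_cong[OF this, of "\<lambda>s. s \<lhd> pr (U \<odot> ?p) (U \<odot> ?q)"]
  have "e2 (brd B) (U \<odot> ?q) (U \<odot> ?p) \<bullet> e2 (brd B) (U \<odot> ?p) (U \<odot> ?q) = Id2 D (ten1 N (U \<odot> ?p) (U \<odot> ?q))" by simp
  then have "U \<rhd> (e2 \<beta> ?q ?p \<bullet> \<beta>) = U \<rhd> Id2 D (ten N')" by (simp add: U_brd0 U_ten0)
  then have "e2 \<beta> ?q ?p \<bullet> \<beta> = Id2 D (ten N')" by (rule em_faithful[rotated -1]) simp_all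
  then show ?thesis using is_br_lift by (simp add: is_symmetric_def Let_def)
qed

text \<open>Identities, since \<open>U\<close> preserves tensor and unit strictly.\<close>

abbreviation "sU \<equiv> (Id2 D (U \<odot> ten N'), Id2 D (unt N))"

lemma opl_U: "opl N' N U sU"
  unfolding opl_iff Let_def obN' using is_mon_lift by (simp add: U_ten0 U_lun0 U_run0)

lemma brd_U: "brd_compat B' B U sU"
  by (simp add: brd_compat_def Let_def U_ten0 U_brd0)

end

lemma (in em_monoidal) lift_exists:
  obtains N' \<beta> where "em_braided D P M X U \<chi> B s N' \<beta>"
proof -
  let ?p = "Pr1 P X X" and ?q = "Pr2 P X X"
  have "is_alg D M (Prod P X X) (U \<odot> ?p) (\<chi> \<lhd> ?p)" "is_alg D M (Prod P X X) (U \<odot> ?q) (\<chi> \<lhd> ?q)"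
    by (rule alg_comp[OF em_alg monad]; simp add: Hom1_def)+
  from em_lift[OF alg_ten[OF this]] obtain ten' where ten': "ten' \<in> Arr D" "Dom1 D ten' = Prod P X X" "Cod1 D ten' = X"
    "U \<odot> ten' = ten1 N (U \<odot> ?p) (U \<odot> ?q)" "\<chi> \<lhd> ten' = ten2 N (\<chi> \<lhd> ?p) (\<chi> \<lhd> ?q) \<bullet> e2 \<tau> (U \<odot> ?p) (U \<odot> ?q)" .
  from em_lift[OF alg_unt] obtain unt' where unt': "unt' \<in> Arr D" "Dom1 D unt' = One P" "Cod1 D unt' = X"
    "U \<odot> unt' = unt N" "\<chi> \<lhd> unt' = \<psi>" .
  have L: "em_monoidal_lift D P M X U \<chi> B s (Monoidal X ten' unt' a l r)" for a l r
    by unfold_locales (simp_all add: mon_typ_def ten' unt')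
  \<comment> \<open>The types of the cells to be lifted refer to tensor and unit only, so
    placeholders are harmless while these cells are being obtained.\<close>
  let ?Q = "Monoidal X ten' unt' undefined undefined undefined"
  interpret L: em_monoidal_lift D P M X U \<chi> B s ?Q by (rule L)
  obtain a where a: "a \<in> Cell D" "Dom2 D a = ten1 ?Q (q1 X) (ten1 ?Q (q2 X) (q3 X))"
    "Cod2 D a = ten1 ?Q (ten1 ?Q (q1 X) (q2 X)) (q3 X)" "invertible2 D a"
    "U \<rhd> a = e3 (asc N) (U \<odot> q1 X) (U \<odot> q2 X) (U \<odot> q3 X)"
    "U \<rhd> inv2 D a = e3 (inv2 D (asc N)) (U \<odot> q1 X) (U \<odot> q2 X) (U \<odot> q3 X)"
    by (rule L.asc_lift)
  obtain l where l: "l \<in> Cell D" "Dom2 D l = ten1 ?Q (un ?Q X) (Id1 D X)" "Cod2 D l = Id1 D X" "invertible2 D l" "U \<rhd> l = lun N \<lhd> U"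
    by (rule L.lun_lift)
  obtain r where r: "r \<in> Cell D" "Dom2 D r = ten1 ?Q (Id1 D X) (un ?Q X)" "Cod2 D r = Id1 D X" "invertible2 D r" "U \<rhd> r = run N \<lhd> U"
    by (rule L.run_lift)
  obtain b where b: "b \<in> Cell D" "Dom2 D b = ten'" "Cod2 D b = ten1 ?Q ?q ?p" "invertible2 D b"
    "U \<rhd> b = e2 (brd B) (U \<odot> ?p) (U \<odot> ?q)"
    by (rule L.brd_lift[unfolded monoidal.sel])
  let ?Q' = "Monoidal X ten' unt' a l r"
  \<comment> \<open>Transfers the types found for the placeholder object to the one with the actual
    cells.\<close>
  have e: "ten1 ?Q' = ten1 ?Q" "un ?Q' = un ?Q" by (intro ext, simp add: tensor1_def unit_at_def del: ten_pr unt_bang)+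
  interpret L': em_monoidal_lift D P M X U \<chi> B s ?Q' by (rule L)
  have "em_braided D P M X U \<chi> B s ?Q' b"
    by unfold_locales (use a l r b in \<open>simp_all only: e monoidal.sel\<close>)
  then show ?thesis by (rule that)
qed

context em_braided
begin

text \<open>Composing with the strict morphism \<open>U\<close> merely whiskers both components, so
  the structure of a factorisation can be recovered by faithfulness.\<close>

lemma opl_comp_U:
  assumes t: "opl K N' g t"
  shows "opl_comp K U g sU t = (U \<rhd> fst t, U \<rhd> snd t)"
  using oplD[OF t] by (simp add: opl_comp_def U_ten0)

text \<open>Immediate from the choice of the lifted tensor and unit: the two conditions are
  \<open>chi_ten0\<close> and \<open>chi_unt\<close>.\<close>

lemma chi_trf: "mon_trf N' N (opl_comp N' T U s sU) sU \<chi>"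
  by (simp add: mon_trf_def opl_comp_def U_ten0 chi_ten0 chi_unt)

text \<open>The hypothesis \<open>trf\<close> says that both components of \<open>r\<close> are
  morphisms of algebras, so they lift; each axiom for the lifts becomes the axiom for
  \<open>r\<close> under \<open>U\<close>.\<close>

lemma mor_lift:
  assumes K: "is_br K" and r: "opl (mon K) N f r" and br: "brd_compat K B f r"
    and g: "g \<in> Arr D" "Dom1 D g = ob (mon K)" "Cod1 D g = X" and Ug: "U \<odot> g = f"
    and trf: "mon_trf (mon K) N (opl_comp (mon K) T f s r) r (\<chi> \<lhd> g)"
  obtains t where "opl (mon K) N' g t" "brd_compat K B' g t" "U \<rhd> fst t = fst r" "U \<rhd> snd t = snd r"
proof -
  let ?K = "mon K" and ?C = "ob (mon K)" and ?f = "fst r"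
  let ?p = "Pr1 P ?C ?C" and ?q = "Pr2 P ?C ?C"
  note rt = oplD[OF r]
  have Kt [simp]: "is_mon ?K" "mon_typ ?K" using K by simp_all
  note [simp] = brd_cells[OF K]
  have Ugh: "U \<odot> (g \<odot> h) = f \<odot> h" if "h \<in> Arr D" "Cod1 D h = ?C" for h
    using Comp1_ac[of h g U] that g Ug by simp
  have Ugw: "U \<rhd> (g \<rhd> \<sigma>) = f \<rhd> \<sigma>" if "\<sigma> \<in> Cell D" "Cod1 D (Dom2 D \<sigma>) = ?C" for \<sigma>
    using that g Ug by simp
  have c1: "?f \<bullet> (\<chi> \<lhd> (g \<odot> ten ?K)) = (\<chi> \<lhd> ten1 N' (g \<odot> ?p) (g \<odot> ?q)) \<bullet> (T \<rhd> ?f)"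
    using trf g rt by (simp add: mon_trf_def opl_comp_def chi_ten Ugh)
  have c2: "snd r \<bullet> (\<chi> \<lhd> (g \<odot> unt ?K)) = (\<chi> \<lhd> unt N') \<bullet> (T \<rhd> snd r)"
    using trf g rt by (simp add: mon_trf_def opl_comp_def chi_unt)
  obtain t1 where t1: "t1 \<in> Cell D" "Dom2 D t1 = g \<odot> ten ?K" "Cod2 D t1 = ten1 N' (g \<odot> ?p) (g \<odot> ?q)" "U \<rhd> t1 = ?f"
    by (rule em_lift2[OF _ _ _ _ _ _ _ _ c1]) (use g rt Ugh in simp_all)
  obtain t2 where t2: "t2 \<in> Cell D" "Dom2 D t2 = g \<odot> unt ?K" "Cod2 D t2 = unt N'" "U \<rhd> t2 = snd r"
    by (rule em_lift2[OF _ _ _ _ _ _ _ _ c2]) (use g rt Ugh in simp_all)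
  have Ut1: "U \<rhd> e2 t1 x y = e2 ?f x y"
    if "x \<in> Arr D" "y \<in> Arr D" "Dom1 D x = Dom1 D y" "Cod1 D x = ?C" "Cod1 D y = ?C" for x y
    using e2_push(2)[of t1 x y U] that t1 g by simp
  have Ut2: "U \<rhd> (t2 \<lhd> bang D P Z) = snd r \<lhd> bang D P Z" if "Z \<in> Obj D" for Z
    using lwhisk_rwhisk[of t2 U "bang D P Z"] that t2 g by simp
  \<comment> \<open>\<open>F\<close> evaluates terms under \<open>U\<close>; \<open>G\<close> gives
    just the typing of the lifts, for the side conditions of faithfulness.\<close>
  note F = g Ug Ugh Ut1 Ut2 t1 t2
  note G = g t1(1-3) t2(1-3)
  let ?x = "q1 ?C" and ?y = "q2 ?C" and ?z = "q3 ?C" and ?b = "bang D P ?C" and ?I = "Id1 D ?C" and ?u = "un ?K ?C"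
  have "U \<rhd> (e3 (asc N') (g \<odot> ?x) (g \<odot> ?y) (g \<odot> ?z) \<bullet> ten2 N' (Id2 D (g \<odot> ?x)) (e2 t1 ?y ?z) \<bullet> e2 t1 ?x (ten1 ?K ?y ?z)) =
      e3 (asc N) (f \<odot> ?x) (f \<odot> ?y) (f \<odot> ?z) \<bullet> ten2 N (Id2 D (f \<odot> ?x)) (e2 ?f ?y ?z) \<bullet> e2 ?f ?x (ten1 ?K ?y ?z)"
    by (simp add: F)
  also have "\<dots> = ten2 N (e2 ?f ?x ?y) (Id2 D (f \<odot> ?z)) \<bullet> e2 ?f (ten1 ?K ?x ?y) ?z \<bullet> (f \<rhd> e3 (asc ?K) ?x ?y ?z)"
    by (rule opl_assoc[OF r]) simp_all
  also have "\<dots> = U \<rhd> (ten2 N' (e2 t1 ?x ?y) (Id2 D (g \<odot> ?z)) \<bullet> e2 t1 (ten1 ?K ?x ?y) ?z \<bullet> (g \<rhd> asc ?K))"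
    by (simp add: F)
  finally have 1: "e3 (asc N') (g \<odot> ?x) (g \<odot> ?y) (g \<odot> ?z) \<bullet> ten2 N' (Id2 D (g \<odot> ?x)) (e2 t1 ?y ?z) \<bullet> e2 t1 ?x (ten1 ?K ?y ?z) =
      ten2 N' (e2 t1 ?x ?y) (Id2 D (g \<odot> ?z)) \<bullet> e2 t1 (ten1 ?K ?x ?y) ?z \<bullet> (g \<rhd> asc ?K)"
    by (rule em_faithful[rotated -1]) (simp_all add: G)
  have "U \<rhd> ((run N' \<lhd> g) \<bullet> ten2 N' (Id2 D g) (t2 \<lhd> ?b) \<bullet> e2 t1 ?I ?u) =
      (run N \<lhd> (f \<odot> ?I)) \<bullet> ten2 N (Id2 D (f \<odot> ?I)) (snd r \<lhd> ?b) \<bullet> e2 ?f ?I ?u"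
    using rt by (simp add: F)
  also have "\<dots> = f \<rhd> (run ?K \<lhd> ?I)" by (rule opl_units[OF r]) simp_all
  also have "\<dots> = U \<rhd> (g \<rhd> run ?K)" by (simp add: F)
  finally have 2: "(run N' \<lhd> g) \<bullet> ten2 N' (Id2 D g) (t2 \<lhd> ?b) \<bullet> e2 t1 ?I ?u = g \<rhd> run ?K"
    by (rule em_faithful[rotated -1]) (simp_all add: G)
  have "U \<rhd> ((lun N' \<lhd> g) \<bullet> ten2 N' (t2 \<lhd> ?b) (Id2 D g) \<bullet> e2 t1 ?u ?I) =
      (lun N \<lhd> (f \<odot> ?I)) \<bullet> ten2 N (snd r \<lhd> ?b) (Id2 D (f \<odot> ?I)) \<bullet> e2 ?f ?u ?I"
    using rt by (simp add: F)
  also have "\<dots> = f \<rhd> (lun ?K \<lhd> ?I)" by (rule opl_units[OF r]) simp_all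
  also have "\<dots> = U \<rhd> (g \<rhd> lun ?K)" by (simp add: F)
  finally have 3: "(lun N' \<lhd> g) \<bullet> ten2 N' (t2 \<lhd> ?b) (Id2 D g) \<bullet> e2 t1 ?u ?I = g \<rhd> lun ?K"
    by (rule em_faithful[rotated -1]) (simp_all add: G)
  have "U \<rhd> (e2 \<beta> (g \<odot> ?p) (g \<odot> ?q) \<bullet> t1) = e2 (brd B) (f \<odot> ?p) (f \<odot> ?q) \<bullet> ?f"
    using rt by (simp add: F)
  also have "\<dots> = e2 ?f ?q ?p \<bullet> (f \<rhd> brd K)" using br by (simp add: brd_compat_def Let_def)
  also have "\<dots> = U \<rhd> (e2 t1 ?q ?p \<bullet> (g \<rhd> brd K))" by (simp add: F)
  finally have 4: "e2 \<beta> (g \<odot> ?p) (g \<odot> ?q) \<bullet> t1 = e2 t1 ?q ?p \<bullet> (g \<rhd> brd K)"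
    by (rule em_faithful[rotated -1]) (simp_all add: G)
  have "opl ?K N' g (t1, t2)"
    unfolding opl_iff Let_def fst_conv snd_conv obN' using 1 2 3 G is_mon_lift Kt(1) by blast
  moreover have "brd_compat K B' g (t1, t2)" using 4 by (simp add: brd_compat_def Let_def)
  ultimately show ?thesis using that t1(4) t2(4) by simp
qed

lemma trf_lift:
  assumes g: "opl K N' g t" and h: "opl K N' h t'" and \<rho>: "\<rho> \<in> Cell D" "Dom2 D \<rho> = g" "Cod2 D \<rho> = h"
    and m: "mon_trf K N (opl_comp K U g sU t) (opl_comp K U h sU t') (U \<rhd> \<rho>)"
  shows "mon_trf K N' t t' \<rho>"
proof -
  note G = oplD[OF g] oplD[OF h] \<rho>
  let ?p = "Pr1 P (ob K) (ob K)" and ?q = "Pr2 P (ob K) (ob K)"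
  have e: "(U \<rhd> fst t') \<bullet> ((U \<rhd> \<rho>) \<lhd> ten K) = ten2 N ((U \<rhd> \<rho>) \<lhd> ?p) ((U \<rhd> \<rho>) \<lhd> ?q) \<bullet> (U \<rhd> fst t)"
    "(U \<rhd> snd t') \<bullet> ((U \<rhd> \<rho>) \<lhd> unt K) = U \<rhd> snd t"
    using m unfolding mon_trf_def opl_comp_U[OF g] opl_comp_U[OF h] by simp_all
  have "U \<rhd> (fst t' \<bullet> (\<rho> \<lhd> ten K)) = U \<rhd> (ten2 N' (\<rho> \<lhd> ?p) (\<rho> \<lhd> ?q) \<bullet> fst t)" using e(1) G by simp
  then have 1: "fst t' \<bullet> (\<rho> \<lhd> ten K) = ten2 N' (\<rho> \<lhd> ?p) (\<rho> \<lhd> ?q) \<bullet> fst t"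
    by (rule em_faithful[rotated -1]) (use G in simp_all)
  have "U \<rhd> (snd t' \<bullet> (\<rho> \<lhd> unt K)) = U \<rhd> snd t" using e(2) G by simp
  then have "snd t' \<bullet> (\<rho> \<lhd> unt K) = snd t"
    by (rule em_faithful[rotated -1]) (use G in simp_all)
  with 1 show ?thesis by (simp add: mon_trf_def)
qed

end

section \<open>EM objects for a class of braided monoidal objects\<close>

context finite_products
begin

lemma monoidal_trf_iff:
  "monoidal_trf D P f f' \<sigma> \<longleftrightarrow> mon_trf (mon (mdom f)) (mon (mcod f)) (mstr f) (mstr f') \<sigma>"
  by (simp add: monoidal_trf_def mon_trf_def Let_def)

lemma monoidal_comp_str_eq:
  "monoidal_comp_str D P g f = opl_comp (mon (mdom f)) (mfun g) (mfun f) (mstr g) (mstr f)"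
  by (simp add: monoidal_comp_str_def opl_comp_def Let_def)

text \<open>\<open>lift\<close> is the closure property that brings the constructed object into
  \<open>obs\<close>: for all braided objects it is immediate, for symmetric ones it rests on
  \<open>is_symmetric_lift\<close>.\<close>

lemma braided_standard:
  assumes D: "admits_EM D" and obs: "\<And>B. B \<in> obs \<Longrightarrow> is_br B"
    and lift: "\<And>B B'. \<lbrakk>B \<in> obs; is_br B'; is_symmetric D P B \<Longrightarrow> is_symmetric D P B'\<rbrakk> \<Longrightarrow> B' \<in> obs"
  defines "S \<equiv> structured D obs (\<lambda>B. ob (mon B)) (braided_mor D P) (monoidal_trf D P) (monoidal_id_str D) (monoidal_comp_str D P)"
  shows "admits_EM S \<and> standard_EM S D (forgetful (\<lambda>B. ob (mon B)))"
proof -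
  interpret E: structured_data D obs "\<lambda>B. ob (mon B)" "braided_mor D P" "monoidal_trf D P" "monoidal_id_str D" "monoidal_comp_str D P"
    by (rule braided_data[OF obs])
  have arr: "is_br (mdom f) \<and> is_br (mcod f) \<and> opl (mon (mdom f)) (mon (mcod f)) (mfun f) (mstr f) \<and> brd_compat (mdom f) (mcod f) (mfun f) (mstr f)"
    if "E.arr f" for f
    using that obs braided_mor_iff[of f] by (auto simp: str_arr_def)
  show ?thesis unfolding S_def
  proof (rule E.structured_standard[OF D])
    fix M X U \<chi> assume M: "is_monad E.S M" and M': "is_monad D (E.under M)" and em: "em_universal D (E.under M) X U \<chi>"
    note m = E.S_monadD[OF M]
    let ?B = "mob M" and ?s = "mstr (mend M)"
    have T: "is_br ?B" "opl (mon ?B) (mon ?B) (mfun (mend M)) ?s" "brd_compat ?B ?B (mfun (mend M)) ?s"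
      using arr[OF m(2)] m(3,4) by simp_all
    interpret em_object D "E.under M" X U \<chi> using M' em by unfold_locales
    interpret em_monoidal D P "E.under M" X U \<chi> ?B ?s
      using T m(10,16) unfolding monoidal_trf_iff
      by unfold_locales (simp_all add: m(3,4) monoidal_id_str_def monoidal_comp_str_eq)
    note E.under_sel(1) [simp del] \<comment> \<open>it undoes the rewrite rule \<open>obB\<close>\<close>
    obtain N' \<beta> where "em_braided D P (E.under M) X U \<chi> ?B ?s N' \<beta>" by (rule lift_exists)
    then interpret L: em_braided D P "E.under M" X U \<chi> ?B ?s N' \<beta> .
    have B': "L.B' \<in> obs" by (rule lift[OF m(1) L.is_br_lift L.is_symmetric_lift])
    have U1: "U \<in> Arr D" "Dom1 D U = X" "Cod1 D U = ob (mon ?B)" using em_typ by simp_all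
    show "\<exists>X' U' \<chi>'. em_universal E.S M X' U' \<chi>' \<and>
        em_universal D (E.under M) (ob (mon X')) (mfun U') (tcell \<chi>')"
    proof (rule E.lift_em[OF M _ B'])
      show "em_universal D (E.under M) (ob (mon L.B')) U \<chi>" using em by simp
      show "braided_mor D P (Mor L.B' ?B U L.sU)"
        using L.opl_U L.brd_U L.is_br_lift T(1) U1 by (subst braided_mor_iff) simp_all
      show "monoidal_trf D P (E.cmp (mend M) (Mor L.B' ?B U L.sU)) (Mor L.B' ?B U L.sU) \<chi>"
        using L.chi_trf by (simp add: monoidal_trf_iff monoidal_comp_str_eq m(4))
    next
      fix f g assume f: "E.arr f" "mcod f = ?B" and g: "g \<in> Hom1 D (ob (mon (mdom f))) (ob (mon L.B'))"
        and Ug: "U \<odot> g = mfun f" and trf: "monoidal_trf D P (E.cmp (mend M) f) f (\<chi> \<lhd> g)"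
      have g': "g \<in> Arr D" "Dom1 D g = ob (mon (mdom f))" "Cod1 D g = X" using g by (auto simp: Hom1_def)
      have F: "is_br (mdom f)" "opl (mon (mdom f)) (mon ?B) (mfun f) (mstr f)" "brd_compat (mdom f) ?B (mfun f) (mstr f)"
        using arr[OF f(1)] f(2) by simp_all
      have "mon_trf (mon (mdom f)) (mon ?B) (opl_comp (mon (mdom f)) (mfun (mend M)) (mfun f) ?s (mstr f)) (mstr f) (\<chi> \<lhd> g)"
        using trf by (simp add: monoidal_trf_iff monoidal_comp_str_eq m(4))
      then obtain t where t: "opl (mon (mdom f)) N' g t" "brd_compat (mdom f) L.B' g t" "U \<rhd> fst t = fst (mstr f)" "U \<rhd> snd t = snd (mstr f)"
        using L.mor_lift[OF F g' Ug] by auto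
      have mor: "braided_mor D P (Mor (mdom f) L.B' g t') \<longleftrightarrow> opl (mon (mdom f)) N' g t' \<and> brd_compat (mdom f) L.B' g t'" for t'
        using F L.is_br_lift g' by (subst braided_mor_iff) simp_all
      have cs: "monoidal_comp_str D P (Mor L.B' ?B U L.sU) (Mor (mdom f) L.B' g t') = (U \<rhd> fst t', U \<rhd> snd t')"
        if "opl (mon (mdom f)) N' g t'" for t'
        using L.opl_comp_U[OF that] by (simp add: monoidal_comp_str_eq)
      show "\<exists>!t. braided_mor D P (Mor (mdom f) L.B' g t) \<and>
          monoidal_comp_str D P (Mor L.B' ?B U L.sU) (Mor (mdom f) L.B' g t) = mstr f"
      proof (rule ex1I[of _ t])
        show "braided_mor D P (Mor (mdom f) L.B' g t) \<and>
          monoidal_comp_str D P (Mor L.B' ?B U L.sU) (Mor (mdom f) L.B' g t) = mstr f"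
          using t cs[OF t(1)] mor[of t] by simp
        fix t' assume t': "braided_mor D P (Mor (mdom f) L.B' g t') \<and>
          monoidal_comp_str D P (Mor L.B' ?B U L.sU) (Mor (mdom f) L.B' g t') = mstr f"
        then have o: "opl (mon (mdom f)) N' g t'" using mor[of t'] by simp
        have "mstr f = (U \<rhd> fst t', U \<rhd> snd t')" using cs[OF o] t' by simp
        then have u: "U \<rhd> fst t' = U \<rhd> fst t" "U \<rhd> snd t' = U \<rhd> snd t" using t(3,4) by auto
        note o = oplD[OF o] oplD[OF t(1)]
        have "fst t' = fst t" by (rule em_faithful[rotated -1, OF u(1)]) (simp_all add: o)
        moreover have "snd t' = snd t" by (rule em_faithful[rotated -1, OF u(2)]) (simp_all add: o)
        ultimately show "t' = t" by (simp add: prod_eq_iff)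
      qed
    next
      fix g h \<rho> assume g: "E.arr g" "E.arr h" "mdom g = mdom h" "mcod g = L.B'" "mcod h = L.B'"
        and \<rho>: "\<rho> \<in> Hom2 D (mfun g) (mfun h)"
        and trf: "monoidal_trf D P (E.cmp (Mor L.B' ?B U L.sU) g) (E.cmp (Mor L.B' ?B U L.sU) h) (U \<rhd> \<rho>)"
      have G: "opl (mon (mdom g)) N' (mfun g) (mstr g)" "opl (mon (mdom g)) N' (mfun h) (mstr h)"
        using arr[OF g(1)] arr[OF g(2)] g(3-5) by simp_all
      have r: "\<rho> \<in> Cell D" "Dom2 D \<rho> = mfun g" "Cod2 D \<rho> = mfun h" using \<rho> by (auto simp: Hom2_def)
      have "mon_trf (mon (mdom g)) N' (mstr g) (mstr h) \<rho>"
        by (rule L.trf_lift[OF G r]) (use trf g(3) in \<open>simp add: monoidal_trf_iff monoidal_comp_str_eq\<close>)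
      then show "monoidal_trf D P g h \<rho>" by (simp add: monoidal_trf_iff g(4))
    qed
  qed
qed

lemma BMon_op_standard:
  assumes "admits_EM D"
  shows "admits_EM (BMon_op D P) \<and> standard_EM (BMon_op D P) D (forgetful (\<lambda>B. ob (mon B)))"
  unfolding BMon_op_def by (rule braided_standard[OF assms]) simp_all

lemma SMon_op_standard:
  assumes "admits_EM D"
  shows "admits_EM (SMon_op D P) \<and> standard_EM (SMon_op D P) D (forgetful (\<lambda>B. ob (mon B)))"
  unfolding SMon_op_def by (rule braided_standard[OF assms]) (simp_all add: is_symmetric_def)

end

theorem theorem6p2:
  fixes D :: "('o, 'a, 'c) two_cat"
  assumes "two_category D"
    and "admits_EM D"
  shows "admits_EM (Mnd_op D) \<and> standard_EM (Mnd_op D) D (forgetful mob) \<and>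
    admits_EM (Cmd_op D) \<and> standard_EM (Cmd_op D) D (forgetful cob) \<and>
    (\<forall>P :: ('o, 'a) prods. finite_products D P \<longrightarrow>
      admits_EM (BMon_op D P) \<and>
      standard_EM (BMon_op D P) D (forgetful (\<lambda>B. ob (mon B))) \<and>
      admits_EM (SMon_op D P) \<and>
      standard_EM (SMon_op D P) D (forgetful (\<lambda>B. ob (mon B))))"
  using two_category.Mnd_op_standard[OF assms] two_category.Cmd_op_standard[OF assms]
    finite_products.BMon_op_standard[OF _ assms(2)] finite_products.SMon_op_standard[OF _ assms(2)]
  by blast

end
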